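(* Let $p_+,p_-$ be coprime positive integers and $\mathfrak g=\mathfrak g_{p_+,p_-}$. The center $\mathsf Z$ of $\mathfrak g$ is $\frac12(3p_+-1)(3p_--1)$-dimensional and decomposes into a direct sum of associative algebras as $$\mathsf Z=\mathfrak I^{(1)}_{p_+,p_-}\oplus\mathfrak I^{(1)}_{0,p_-}\oplus\bigoplus_{r=1}^{p_+-1}\mathfrak B^{(3)}_{r,p_-}\oplus\bigoplus_{r'=1}^{p_--1}\mathfrak B^{(3)}_{p_+,r'}\oplus\bigoplus_{(r,r')\in\mathcal I_1}\mathfrak A^{(9)}_{r,r'},$$ where the superscript is the dimension of each algebra. Furthermore: - $\mathfrak I^{(1)}_{p_+,p_-}$ is spanned by a single idempotent $\boldsymbol e(p_+,p_-)$, and $\mathfrak I^{(1)}_{0,p_-}$ by a single idempotent $\boldsymbol e(0,p_-)$; - each $\mathfrak B^{(3)}_{r,p_-}$ is spanned by a primitive idempotent $\boldsymbol e(r,p_-)$ and radical elements $\boldsymbol v^{\uparrow}(r,p_-)$, $\boldsymbol v^{\rightarrow}(r,p_-)$, on all of which $\boldsymbol e(r,p_-)$ acts as identity, the other products vanishing; - each $\mathfrak B^{(3)}_{p_+,r'}$ is spanned by a primitive idempotent $\boldsymbol e(p_+,r')$ and radical elements $\boldsymbol v^{\uparrow}(p_+,r')$, $\boldsymbol v^{\leftarrow}(p_+,r')$, on all of which $\boldsymbol e(p_+,r')$ acts as identity, the other products vanishing; - each $\mathfrak A^{(9)}_{r,r'}$ is spanned by a primitive idempotent $\boldsymbol e(r,r')$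 (acting as identity on $\mathfrak A^{(9)}_{r,r'}$) and eight radical elements $\boldsymbol v^{\nearrow},\boldsymbol v^{\swarrow},\boldsymbol v^{\nwarrow},\boldsymbol v^{\searrow},\boldsymbol w^{\uparrow},\boldsymbol w^{\rightarrow},\boldsymbol w^{\downarrow},\boldsymbol w^{\leftarrow}$ (all depending on $(r,r')$), which have the nonzero products $$\boldsymbol v^{\nearrow}\boldsymbol v^{\nwarrow}=\boldsymbol w^{\uparrow},\quad \boldsymbol v^{\nearrow}\boldsymbol v^{\searrow}=\boldsymbol w^{\rightarrow},\quad \boldsymbol v^{\swarrow}\boldsymbol v^{\nwarrow}=\boldsymbol w^{\leftarrow},\quad \boldsymbol v^{\swarrow}\boldsymbol v^{\searrow}=\boldsymbol w^{\downarrow},$$ all other pairwise products between elements of the radical being zero.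
   Context: $\mathfrak q_\pm=e^{i\pi/p_\pm}$, $Q_+=\mathfrak q_+^{p_-}$, $Q_-=\mathfrak q_-^{p_+}$. $\mathfrak g=\mathfrak g_{p_+,p_-}$ is the associative algebra (in fact a Hopf algebra) over $\mathbb C$ generated by $e_+,f_+,e_-,f_-,K$ with relations $e_\pm^{p_\pm}=f_\pm^{p_\pm}=0$, $K^{2p_+p_-}=1$, $Ke_\pm K^{-1}=\mathfrak q_\pm^2e_\pm$, $Kf_\pm K^{-1}=\mathfrak q_\pm^{-2}f_\pm$, each of $e_+,f_+$ commutes with each of $e_-,f_-$, $[e_+,f_+]=\frac{K^{p_-}-K^{-p_-}}{Q_+-Q_+^{-1}}$, $[e_-,f_-]=\frac{K^{p_+}-K^{-p_+}}{Q_--Q_-^{-1}}$ (if $p_\pm=1$ then $e_\pm=f_\pm=0$ and the corresponding commutator relation is void). $\mathcal I_1=\{(r,r'):1\le r\le p_+-1,\ 1\le r'\le p_--1,\ p_-r+p_+r'\le p_+p_-\}$, a set with $\frac12(p_+-1)(p_--1)$ elements. "Radical" means the radical of the commutative algebra $\mathsf Z$. *)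

theory Defs
  imports
    "HOL-Library.Poly_Mapping"
    "HOL-Algebra.Embedded_Algebras"
    "HOL-Algebra.Algebraic_Closure_Type"
begin

section \<open>The free associative algebra on five generators\<close>

datatype gen = Gen_ep | Gen_fp | Gen_em | Gen_fm | Gen_K

text \<open>The free monoid, written additively because \<^typ>\<open>'a \<Rightarrow>\<^sub>0 'b\<close> (finitely supported
  functions) is a ring under convolution for keys in \<^class>\<open>monoid_add\<close>. With words as keys
  this ring is the free associative unital algebra.\<close>

datatype word = Word (letters: "gen list")

instantiation word :: monoid_add
begin

definition zero_word :: word where "0 = Word []"

definition plus_word :: "word \<Rightarrow> word \<Rightarrow> word" where
  "u + v = Word (letters u @ letters v)"

instance
  by standard (simp_all add: zero_word_def plus_word_def)

end

type_synonym free_alg = "word \<Rightarrow>\<^sub>0 complex"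

definition const :: "complex \<Rightarrow> free_alg" where
  "const c = Poly_Mapping.single 0 c"

definition gen :: "gen \<Rightarrow> free_alg" where
  "gen g = Poly_Mapping.single (Word [g]) 1"

section \<open>The quantum group\<close>

definition qq :: "nat \<Rightarrow> complex" where
  "qq p = exp (\<i> * of_real pi / of_nat p)"

text \<open>In \<open>qg_relations pp pm\<close>, \<open>pp\<close> is $p_+$ and \<open>pm\<close> is $p_-$; an element \<open>x\<close> of the set stands
  for the relation \<open>x = 0\<close>. The inverse of the generator \<open>K\<close> is $K^{2p_+p_--1}$, by
  the relation $K^{2p_+p_-}=1$.\<close>

definition qg_relations :: "nat \<Rightarrow> nat \<Rightarrow> free_alg set" where
  "qg_relations pp pm =
    (let ep = gen Gen_ep; fp = gen Gen_fp; em = gen Gen_em; fm = gen Gen_fm;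
         K = gen Gen_K; Kinv = K ^ (2 * pp * pm - 1);
         Qp = qq pp ^ pm; Qm = qq pm ^ pp
     in {ep ^ pp, fp ^ pp, em ^ pm, fm ^ pm,
         K ^ (2 * pp * pm) - 1,
         K * ep * Kinv - const ((qq pp)\<^sup>2) * ep,
         K * em * Kinv - const ((qq pm)\<^sup>2) * em,
         K * fp * Kinv - const (inverse ((qq pp)\<^sup>2)) * fp,
         K * fm * Kinv - const (inverse ((qq pm)\<^sup>2)) * fm,
         ep * em - em * ep, ep * fm - fm * ep,
         fp * em - em * fp, fp * fm - fm * fp}
        \<union> (if pp = 1 then {}
           else {ep * fp - fp * ep - const (1 / (Qp - inverse Qp)) * (K ^ pm - Kinv ^ pm)})
        \<union> (if pm = 1 then {}
           else {em * fm - fm * em - const (1 / (Qm - inverse Qm)) * (K ^ pp - Kinv ^ pp)}))"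

definition qg_ideal :: "nat \<Rightarrow> nat \<Rightarrow> free_alg set" where
  "qg_ideal pp pm = Idl\<^bsub>ring_of_type_algebra\<^esub> (qg_relations pp pm)"

definition qg :: "nat \<Rightarrow> nat \<Rightarrow> free_alg set ring" where
  "qg pp pm = ring_of_type_algebra Quot (qg_ideal pp pm)"

text \<open>The image of the ground field in the algebra; linear spans and dimensions over the complex
  numbers are those of \<^theory>\<open>HOL-Algebra.Embedded_Algebras\<close> over this subfield.\<close>

definition qg_scalars :: "nat \<Rightarrow> nat \<Rightarrow> free_alg set set" where
  "qg_scalars pp pm = (\<lambda>c. qg_ideal pp pm +>\<^bsub>ring_of_type_algebra\<^esub> const c) ` UNIV"

section \<open>Centers, radicals, idempotents, direct sums\<close>

definition center :: "('a, 'b) ring_scheme \<Rightarrow> 'a set" where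
  "center R = {z \<in> carrier R. \<forall>x \<in> carrier R. z \<otimes>\<^bsub>R\<^esub> x = x \<otimes>\<^bsub>R\<^esub> z}"

definition center_ring :: "'a ring \<Rightarrow> 'a ring" where
  "center_ring R = R\<lparr>carrier := center R\<rparr>"

text \<open>The Jacobson radical, for a commutative ring.\<close>

definition radical :: "('a, 'b) ring_scheme \<Rightarrow> 'a set" where
  "radical R = {x \<in> carrier R. \<forall>M. maximalideal M R \<longrightarrow> x \<in> M}"

definition idempotent :: "('a, 'b) ring_scheme \<Rightarrow> 'a \<Rightarrow> bool" where
  "idempotent R e \<longleftrightarrow> e \<in> carrier R \<and> e \<otimes>\<^bsub>R\<^esub> e = e"

definition primitive_idempotent :: "('a, 'b) ring_scheme \<Rightarrow> 'a \<Rightarrow> bool" where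
  "primitive_idempotent R e \<longleftrightarrow> idempotent R e \<and> e \<noteq> \<zero>\<^bsub>R\<^esub> \<and>
     (\<forall>a b. idempotent R a \<and> idempotent R b \<and> a \<otimes>\<^bsub>R\<^esub> b = \<zero>\<^bsub>R\<^esub> \<and> b \<otimes>\<^bsub>R\<^esub> a = \<zero>\<^bsub>R\<^esub> \<and>
        e = a \<oplus>\<^bsub>R\<^esub> b \<longrightarrow> a = \<zero>\<^bsub>R\<^esub> \<or> b = \<zero>\<^bsub>R\<^esub>)"

text \<open>Internal direct sum of algebras: the summands are two-sided ideals (hence annihilate each
  other), and every element is uniquely a sum of components.\<close>

definition algebra_direct_sum ::
  "('a, 'b) ring_scheme \<Rightarrow> 'i set \<Rightarrow> ('i \<Rightarrow> 'a set) \<Rightarrow> bool" where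
  "algebra_direct_sum R I S \<longleftrightarrow> finite I \<and> (\<forall>i \<in> I. ideal (S i) R) \<and>
     (\<forall>x \<in> carrier R. \<exists>!c. c \<in> (\<Pi>\<^sub>E i \<in> I. S i) \<and> x = finsum R c I)"

section \<open>The index sets and the types of blocks\<close>

definition index_I1 :: "nat \<Rightarrow> nat \<Rightarrow> (nat \<times> nat) set" where
  "index_I1 pp pm = {(r, r'). 1 \<le> r \<and> r \<le> pp - 1 \<and> 1 \<le> r' \<and> r' \<le> pm - 1 \<and>
     pm * r + pp * r' \<le> pp * pm}"

definition block1 :: "'a ring \<Rightarrow> 'a set \<Rightarrow> 'a set \<Rightarrow> 'a \<Rightarrow> bool" where
  "block1 Z F S e \<longleftrightarrow>
     ring.dimension Z 1 F S \<and> S = ring.Span Z F [e] \<and> idempotent Z e"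

definition block3 :: "'a ring \<Rightarrow> 'a set \<Rightarrow> 'a set \<Rightarrow> 'a \<Rightarrow> 'a \<Rightarrow> 'a \<Rightarrow> bool" where
  "block3 Z F S e v v' \<longleftrightarrow>
     ring.dimension Z 3 F S \<and> S = ring.Span Z F [e, v, v'] \<and>
     primitive_idempotent Z e \<and> v \<in> radical Z \<and> v' \<in> radical Z \<and>
     (\<forall>x \<in> {e, v, v'}. e \<otimes>\<^bsub>Z\<^esub> x = x \<and> x \<otimes>\<^bsub>Z\<^esub> e = x) \<and>
     (\<forall>x \<in> {v, v'}. \<forall>y \<in> {v, v'}. x \<otimes>\<^bsub>Z\<^esub> y = \<zero>\<^bsub>Z\<^esub>)"

text \<open>The suffixes are compass directions: \<open>n\<close>, \<open>e\<close>, \<open>s\<close>, \<open>w\<close> are the arrows up, right, down, left.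
  The nine spanning elements are distinct because their span has dimension nine, so the last clause
  does cover all the remaining pairs.\<close>

definition block9 ::
  "'a ring \<Rightarrow> 'a set \<Rightarrow> 'a set \<Rightarrow> 'a \<Rightarrow> 'a \<Rightarrow> 'a \<Rightarrow> 'a \<Rightarrow> 'a \<Rightarrow> 'a \<Rightarrow> 'a \<Rightarrow> 'a \<Rightarrow> 'a \<Rightarrow> bool" where
  "block9 Z F S e v_ne v_sw v_nw v_se w_n w_e w_s w_w \<longleftrightarrow>
     ring.dimension Z 9 F S \<and>
     S = ring.Span Z F [e, v_ne, v_sw, v_nw, v_se, w_n, w_e, w_s, w_w] \<and>
     primitive_idempotent Z e \<and>
     {v_ne, v_sw, v_nw, v_se, w_n, w_e, w_s, w_w} \<subseteq> radical Z \<and>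
     (\<forall>x \<in> S. e \<otimes>\<^bsub>Z\<^esub> x = x \<and> x \<otimes>\<^bsub>Z\<^esub> e = x) \<and>
     v_ne \<otimes>\<^bsub>Z\<^esub> v_nw = w_n \<and> v_nw \<otimes>\<^bsub>Z\<^esub> v_ne = w_n \<and>
     v_ne \<otimes>\<^bsub>Z\<^esub> v_se = w_e \<and> v_se \<otimes>\<^bsub>Z\<^esub> v_ne = w_e \<and>
     v_sw \<otimes>\<^bsub>Z\<^esub> v_nw = w_w \<and> v_nw \<otimes>\<^bsub>Z\<^esub> v_sw = w_w \<and>
     v_sw \<otimes>\<^bsub>Z\<^esub> v_se = w_s \<and> v_se \<otimes>\<^bsub>Z\<^esub> v_sw = w_s \<and>
     (\<forall>x \<in> {v_ne, v_sw, v_nw, v_se, w_n, w_e, w_s, w_w}.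
      \<forall>y \<in> {v_ne, v_sw, v_nw, v_se, w_n, w_e, w_s, w_w}.
        \<not> (x \<in> {v_ne, v_sw} \<and> y \<in> {v_nw, v_se}) \<and>
        \<not> (x \<in> {v_nw, v_se} \<and> y \<in> {v_ne, v_sw}) \<longrightarrow> x \<otimes>\<^bsub>Z\<^esub> y = \<zero>\<^bsub>Z\<^esub>)"

end

theory Submission
  imports Defs
begin

text \<open>Each side of the algebra is a restricted quantum \<open>sl\<^sub>2\<close> with a Casimir element, central and
  with minimal polynomial having at most double roots. On a weight space of \<open>K\<close> the elements
  commuting with \<open>K\<close> are exactly the polynomials in the two Casimirs, because \<open>f\<^sup>i e\<^sup>i\<close> is such
  a polynomial there; linear independence comes from an explicit module on the PBW monomials.
  Writing a central element weight by weight in the resulting basis, commutation with the generators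
  forces each coefficient to be constant along the cycle of weights obtained by multiplying with
  \<open>Q\<^sup>2\<close>, except that the coefficient of a nilpotent vector may jump at the highest weights
  (\<open>walls\<close>) of the corresponding eigenvalue. A double eigenvalue has two walls, which cut the
  cycle into two arcs, so it contributes one idempotent and two nilpotents, and a simple one contributes just an
  idempotent. The blocks of the center are the products of these half-blocks whose cycles lie in a
  common sector; they are matched with the index set of the theorem by counting.\<close>

section \<open>Parameters\<close>

text \<open>Why a coefficient may jump, and only there: if a central element commutes with e, a
  further multiplication by f shows that its coordinates at two neighbouring weights differ by
  something that the Casimir minus one constant annihilates. Only the last nonzero power of the
  nilpotent, at that one eigenvalue, survives this. Conversely, next to a wall the nilpotent is a
  multiple of f^(p-1) e^(p-1), which one more e on the right or f on the left destroys; so its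
  restriction to an arc is still central. Generators and relations alone give only a spanning set,
  and nothing prevents the quotient from collapsing. The explicit module settles this, and by its
  faithfulness all later computation takes place in a ring of operators, with a return to cosets
  only at the end. The counting depends on parity. At least one of p_+ and p_- is odd, and on that
  side each of the two sectors contains exactly one simple eigenvalue, whatever the other side looks
  like. A side with p = 1 is included throughout. There Q^2 = 1 and e = f = 0, the constant
  \<open>om\<close> vanishes, and it is inverted only to the power 0.\<close>

text \<open>The Boolean \<open>s\<close> names the side, \<^term>\<open>True\<close> for $+$ and \<^term>\<open>False\<close> for $-$.\<close>

locale qparam =
  fixes p :: "bool \<Rightarrow> nat"
  assumes p_pos: "p s > 0" and p_coprime: "coprime (p True) (p False)"
begin

text \<open>For an eigenvalue \<open>\<kappa>\<close> of \<open>K\<close>, \<open>wt s \<kappa>\<close> is the eigenvalue of the Cartan element occurring in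
  \<open>[e, f]\<close> on side \<open>s\<close>, and \<open>cas s a\<close> is the value of the Casimir element on a highest
  weight vector with Cartan eigenvalue \<open>a\<close>.\<close>

definition q :: "bool \<Rightarrow> complex" where "q s = qq (p s)"
definition Q :: "bool \<Rightarrow> complex" where "Q s = q s ^ p (\<not> s)"
definition N :: nat where "N = 2 * p True * p False"
definition mu :: "complex set" where "mu = {\<kappa>. \<kappa> ^ N = 1}"
definition wt :: "bool \<Rightarrow> complex \<Rightarrow> complex" where "wt s \<kappa> = \<kappa> ^ p (\<not> s)"
definition cas :: "bool \<Rightarrow> complex \<Rightarrow> complex" where "cas s a = Q s * a + inverse (Q s * a)"
text \<open>Clears denominators: \<open>om s\<close> times f e, plus Cartan terms, is the Casimir,
  and \<open>om s\<close> times the bracket [e, f] acts as a difference of two Casimir values. It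
  vanishes exactly when \<open>p s = 1\<close>.\<close>

definition om :: "bool \<Rightarrow> complex" where "om s = (Q s - inverse (Q s))\<^sup>2"

lemma N_eq: "N = 2 * p s * p (\<not> s)"
  unfolding N_def by (cases s) simp_all

lemma N_pos: "N > 0"
  using p_pos[of True] p_pos[of False] by (simp add: N_def)

lemma p_coprime': "coprime (p s) (p (\<not> s))"
  using p_coprime by (cases s) (simp_all add: coprime_commute)

lemma q_cis: "q s = cis (pi / p s)"
  by (simp add: q_def qq_def cis_conv_exp)

lemma q_nz [simp]: "q s \<noteq> 0" and Q_nz [simp]: "Q s \<noteq> 0"
  by (simp_all add: q_cis Q_def)

lemma q_pow: "q s ^ (2 * p s) = 1"
  using p_pos[of s] by (simp add: q_cis DeMoivre)

lemma Q_pow: "Q s ^ (2 * p s) = 1"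
proof -
  have "Q s ^ (2 * p s) = (q s ^ (2 * p s)) ^ p (\<not> s)"
    unfolding Q_def power_mult[symmetric] by (simp only: mult.commute)
  thus ?thesis by (simp add: q_pow)
qed

lemma q_pow_N: "q s ^ N = 1"
proof -
  have "q s ^ N = (q s ^ (2 * p s)) ^ p (\<not> s)"
    unfolding N_eq[of s] by (rule power_mult)
  thus ?thesis by (simp add: q_pow)
qed

lemma qsq_mu: "(q s)\<^sup>2 \<in> mu"
proof -
  have "((q s)\<^sup>2) ^ N = (q s ^ N)\<^sup>2"
    unfolding power_mult[symmetric] by (simp only: mult.commute)
  thus ?thesis by (simp add: mu_def q_pow_N)
qed

lemma mu_nz: "\<kappa> \<in> mu \<Longrightarrow> \<kappa> \<noteq> 0"
  using N_pos by (auto simp: mu_def power_0_left)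

lemma mu_mult: "\<kappa> \<in> mu \<Longrightarrow> \<kappa>' \<in> mu \<Longrightarrow> \<kappa> * \<kappa>' \<in> mu"
  by (simp add: mu_def power_mult_distrib)

lemma mu_div: "\<kappa> \<in> mu \<Longrightarrow> \<kappa>' \<in> mu \<Longrightarrow> \<kappa> / \<kappa>' \<in> mu"
  by (simp add: mu_def power_divide)

lemma mu_pow: "\<kappa> \<in> mu \<Longrightarrow> \<kappa> ^ n \<in> mu"
proof -
  assume "\<kappa> \<in> mu"
  have "(\<kappa> ^ n) ^ N = (\<kappa> ^ N) ^ n"
    unfolding power_mult[symmetric] by (simp only: mult.commute)
  thus ?thesis using \<open>\<kappa> \<in> mu\<close> by (simp add: mu_def)
qed

lemma finite_mu: "finite mu" and card_mu: "card mu = N"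
  using card_roots_unity_eq[of N] finite_roots_unity[of N] N_pos by (simp_all add: mu_def)

lemma pow_pow_commute: "(x ^ m) ^ n = (x ^ n) ^ (m::nat)" for x :: complex
  unfolding power_mult[symmetric] by (simp only: mult.commute)

lemma wt_shift: "wt s (\<kappa> * (q s)\<^sup>2) = wt s \<kappa> * (Q s)\<^sup>2"
  unfolding wt_def Q_def power_mult_distrib by (subst pow_pow_commute) (rule refl)

lemma wt_shift': "wt (\<not> s) (\<kappa> * (q s)\<^sup>2) = wt (\<not> s) \<kappa>"
  using q_pow[of s] by (simp add: wt_def power_mult_distrib power_mult)

text \<open>Coprimality makes Q^2 = exp(2 pi i p'/p), with p' the parameter of the other side, a
  primitive p-th root of unity: the equation says that p divides p' n.\<close>

lemma Q_sq_eq_1_iff: "Q s ^ (2 * n) = 1 \<longleftrightarrow> p s dvd n"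
proof -
  define x where "x = 2 * pi * (real (p (\<not> s) * n) / real (p s))"
  have "Q s ^ (2 * n) = cis x"
    by (simp add: Q_def q_cis DeMoivre x_def algebra_simps)
  moreover have "cis x = 1 \<longleftrightarrow> cos x = 1"
    using sin_zero_iff[of x] sin_cos_squared_add[of x] by (auto simp: complex_eq_iff power2_eq_square)
  ultimately have "Q s ^ (2 * n) = 1 \<longleftrightarrow> cos x = 1" by simp
  also have "\<dots> \<longleftrightarrow> (\<exists>k::int. x = of_int k * 2 * pi)"
    by (rule cos_one_2pi_int)
  also have "\<dots> \<longleftrightarrow> (\<exists>k::int. real (p (\<not> s) * n) = of_int k * real (p s))"
    using p_pos[of s] by (auto simp: x_def field_simps)
  also have "\<dots> \<longleftrightarrow> (\<exists>k::int. int (p (\<not> s) * n) = k * int (p s))"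
  proof -
    have "real (p (\<not> s) * n) = of_int k * real (p s) \<longleftrightarrow> int (p (\<not> s) * n) = k * int (p s)" for k
      unfolding of_int_of_nat_eq[symmetric, where 'a=real] of_int_mult[symmetric] of_int_eq_iff ..
    thus ?thesis by simp
  qed
  also have "\<dots> \<longleftrightarrow> int (p s) dvd int (p (\<not> s) * n)"
    by (auto simp: dvd_def mult.commute)
  also have "\<dots> \<longleftrightarrow> p s dvd n"
    unfolding int_dvd_int_iff using p_coprime'[of s] by (metis coprime_dvd_mult_right_iff)
  finally show ?thesis .
qed

lemma Q_inj: "i < p s \<Longrightarrow> j < p s \<Longrightarrow> Q s ^ (2 * i) = Q s ^ (2 * j) \<Longrightarrow> i = j"
proof (induction i j rule: linorder_wlog)
  case (le i j)
  have "Q s ^ (2 * j) = Q s ^ (2 * i) * Q s ^ (2 * (j - i))"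
    using le(1) by (simp flip: power_add distrib_left)
  hence "Q s ^ (2 * (j - i)) = 1" using le(4) by simp
  hence "p s dvd j - i" by (simp add: Q_sq_eq_1_iff)
  moreover have "j - i < p s" using le(3) by simp
  ultimately have "j - i = 0" using nat_dvd_not_less by blast
  thus ?case using le(1) by simp
next
  case (sym i j) thus ?case by metis
qed

lemma Q_sq_neq_1: "p s \<ge> 2 \<Longrightarrow> (Q s)\<^sup>2 \<noteq> 1"
  using Q_sq_eq_1_iff[of s 1] by auto

lemma om_nz: "p s \<ge> 2 \<Longrightarrow> om s \<noteq> 0"
proof -
  assume "p s \<ge> 2"
  hence "Q s * Q s \<noteq> 1" using Q_sq_neq_1[of s] by (simp add: power2_eq_square)
  hence "Q s - inverse (Q s) \<noteq> 0" by (auto simp: field_simps)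
  thus ?thesis by (simp add: om_def)
qed

lemma Q_pm_1: "p s = 1 \<Longrightarrow> Q s - inverse (Q s) = 0"
  using Q_sq_eq_1_iff[of s 1] by (auto simp: power2_eq_square field_simps)

text \<open>The power \<open>p (\<not> s)\<close> kills the factor of the other side and turns
  \<open>q s\<close> into \<open>Q s\<close>; the power \<open>p s\<close> does the reverse. This is
  why a PBW monomial commuting with \<open>K\<close> has equal e and f exponents on each
  side.\<close>

lemma q_both_inj:
  assumes "i < p s" "j < p s" "i' < p (\<not> s)" "j' < p (\<not> s)"
    and eq: "q s ^ (2 * i) * q (\<not> s) ^ (2 * i') = q s ^ (2 * j) * q (\<not> s) ^ (2 * j')"
  shows "i = j \<and> i' = j'"
proof -
  have *: "(q s ^ (2 * k) * q (\<not> s) ^ (2 * k')) ^ p (\<not> s) = Q s ^ (2 * k)" for k k'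
  proof -
    have "(q (\<not> s) ^ (2 * k')) ^ p (\<not> s) = (q (\<not> s) ^ (2 * p (\<not> s))) ^ k'"
      unfolding power_mult[symmetric] by (simp only: mult_ac)
    also have "\<dots> = 1" by (simp add: q_pow)
    finally show ?thesis by (simp add: power_mult_distrib Q_def pow_pow_commute)
  qed
  have "Q s ^ (2 * i) = Q s ^ (2 * j)" using *[of i i'] *[of j j'] unfolding eq by simp
  hence "i = j" using Q_inj assms by blast
  moreover have "i' = j'"
  proof -
    have **: "(q s ^ (2 * k) * q (\<not> s) ^ (2 * k')) ^ p s = Q (\<not> s) ^ (2 * k')" for k k'
    proof -
      have "(q s ^ (2 * k)) ^ p s = (q s ^ (2 * p s)) ^ k"
        unfolding power_mult[symmetric] by (simp only: mult_ac)
      also have "\<dots> = 1" by (simp add: q_pow)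
      finally show ?thesis by (simp add: power_mult_distrib Q_def pow_pow_commute)
    qed
    have "Q (\<not> s) ^ (2 * i') = Q (\<not> s) ^ (2 * j')" using **[of i i'] **[of j j'] unfolding eq by simp
    thus ?thesis using Q_inj assms by blast
  qed
  ultimately show ?thesis by simp
qed

text \<open>Neighbouring Casimir values differ by \<open>om s\<close> times the eigenvalue of [e, f]
  (for \<open>p s\<close> at least 2). Sums of such eigenvalues along a string of weights therefore
  telescope.\<close>

lemma cas_diff:
  assumes "a \<noteq> 0"
  shows "cas s a - cas s (a / (Q s)\<^sup>2) = (Q s - inverse (Q s)) * (a - inverse a)"
proof -
  have "Q s * (a / (Q s)\<^sup>2) = a * inverse (Q s)"
    by (simp add: power2_eq_square divide_inverse)
  thus ?thesis by (simp add: cas_def inverse_mult_distrib algebra_simps)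
qed

end

section \<open>Rings with central complex scalars\<close>

text \<open>Scalars given as a central ring map, so that one set of rules serves the free algebra
  (\<open>const\<close>), the operators (\<open>scl\<close>) and the abstract algebra in
  \<open>block_algebra\<close>.\<close>

locale scalar_ring =
  fixes sc :: "complex \<Rightarrow> 'a::ring_1"
  assumes sc_add: "sc (a + b) = sc a + sc b" and sc_mult: "sc (a * b) = sc a * sc b"
    and sc_1 [simp]: "sc 1 = 1" and sc_comm: "sc a * x = x * sc a"
begin

lemma sc_0 [simp]: "sc 0 = 0"
  using sc_add[of 0 0] by simp

lemma sc_minus: "sc (- a) = - sc a"
  using sc_add[of a "- a"] by (simp add: eq_neg_iff_add_eq_0 add.commute)

lemma sc_diff: "sc (a - b) = sc a - sc b"
  using sc_add[of a "- b"] by (simp add: sc_minus)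

lemma sc_left_comm: "x * (sc a * y) = sc a * (x * y)"
  by (metis mult.assoc sc_comm)

lemma sc_sum: "sc (sum f A) = (\<Sum>x\<in>A. sc (f x))"
  by (induction A rule: infinite_finite_induct) (simp_all add: sc_add)

lemma sc_cancel: "a \<noteq> 0 \<Longrightarrow> sc a * x = 0 \<Longrightarrow> x = 0"
  by (metis left_inverse mult.assoc mult_1 mult_zero_right sc_1 sc_mult)

lemma sc_sc: "sc a * (sc b * x) = sc (a * b) * x"
  by (simp add: sc_mult mult.assoc)

lemma skew_pow:
  assumes "k * e = sc a * (e * k)"
  shows "k * e ^ n = sc (a ^ n) * (e ^ n * k)"
proof (induction n)
  case (Suc n)
  have "k * e ^ Suc n = (k * e) * e ^ n" by (simp add: mult.assoc)
  also have "\<dots> = sc a * (e * (k * e ^ n))" by (simp add: assms mult.assoc)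
  also have "\<dots> = sc (a ^ Suc n) * (e ^ Suc n * k)"
    by (simp add: Suc sc_left_comm[of e] sc_mult mult.assoc)
  finally show ?case .
qed simp

text \<open>Moving f through e^(n+1) collects one bracket per factor, and each passage of
  \<open>k\<close> or \<open>ki\<close> across an e contributes a power of \<open>a\<close> or
  \<open>b\<close>. In the application n + 1 = p, the geometric sums run over all p-th roots of
  unity and vanish, so that e^p commutes with f.\<close>

lemma pow_f_commute:
  assumes "e * f = f * e + sc d * (k - ki)" and ke: "k * e = sc a * (e * k)" and kie: "ki * e = sc b * (e * ki)"
  shows "e ^ Suc n * f = f * e ^ Suc n
    + e ^ n * (sc (d * (\<Sum>t\<le>n. a ^ t)) * k - sc (d * (\<Sum>t\<le>n. b ^ t)) * ki)"
proof (induction n)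
  case 0
  show ?case using assms by (simp add: algebra_simps)
next
  case (Suc n)
  let ?A = "\<lambda>n. d * (\<Sum>t\<le>n. a ^ t)" and ?B = "\<lambda>n. d * (\<Sum>t\<le>n. b ^ t)"
  have "e ^ Suc (Suc n) * f = e * (e ^ Suc n * f)" by (simp add: mult.assoc)
  also have "\<dots> = e * f * e ^ Suc n + e ^ Suc n * (sc (?A n) * k - sc (?B n) * ki)"
    unfolding Suc by (simp add: distrib_left mult.assoc)
  also have "e * f * e ^ Suc n = f * e ^ Suc (Suc n) + sc d * (k * e ^ Suc n - ki * e ^ Suc n)"
    using assms by (simp add: distrib_right left_diff_distrib mult.assoc)
  also have "k * e ^ Suc n - ki * e ^ Suc n = e ^ Suc n * (sc (a ^ Suc n) * k - sc (b ^ Suc n) * ki)"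
    by (simp add: skew_pow[OF ke] skew_pow[OF kie] right_diff_distrib sc_left_comm[of "e ^ Suc n"] del: power_Suc)
  also have "sc d * (e ^ Suc n * (sc (a ^ Suc n) * k - sc (b ^ Suc n) * ki))
     = e ^ Suc n * (sc (d * a ^ Suc n) * k - sc (d * b ^ Suc n) * ki)"
    by (simp add: sc_left_comm[of "e ^ Suc n"] right_diff_distrib sc_sc del: power_Suc)
  finally show ?case
    by (simp add: distrib_left sc_add left_diff_distrib right_diff_distrib distrib_right algebra_simps del: power_Suc)
qed

end

section \<open>Representations of the free algebra\<close>

lemma poly_mapping_sum_single: "x = (\<Sum>w\<in>Poly_Mapping.keys x. Poly_Mapping.single w (Poly_Mapping.lookup x w))"
  by (rule poly_mapping_eqI) (auto simp: lookup_sum lookup_single when_def in_keys_iff if_distrib cong: if_cong)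

locale free_alg_rep = scalar_ring sc for sc :: "complex \<Rightarrow> 'a::ring_1" +
  fixes gop :: "gen \<Rightarrow> 'a"
begin

definition wop :: "word \<Rightarrow> 'a" where "wop w = foldr (\<lambda>g T. gop g * T) (letters w) 1"

text \<open>The algebra homomorphism that extends \<open>gop\<close>; by freeness any choice of
  operators for the five generators defines one.\<close>

definition Phi :: "free_alg \<Rightarrow> 'a" where
  "Phi x = (\<Sum>w\<in>Poly_Mapping.keys x. sc (Poly_Mapping.lookup x w) * wop w)"

lemma wop_0 [simp]: "wop 0 = 1"
  by (simp add: wop_def zero_word_def)

lemma wop_add: "wop (u + v) = wop u * wop v"
proof -
  have *: "foldr (\<lambda>g T. gop g * T) l x = foldr (\<lambda>g T. gop g * T) l 1 * x" for l x
    by (induction l) (simp_all add: mult.assoc)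
  show ?thesis unfolding wop_def plus_word_def word.sel foldr_append by (rule *)
qed

lemma Phi_superset:
  assumes "finite S" "Poly_Mapping.keys x \<subseteq> S"
  shows "Phi x = (\<Sum>w\<in>S. sc (Poly_Mapping.lookup x w) * wop w)"
  unfolding Phi_def using assms by (intro sum.mono_neutral_left) (auto simp: in_keys_iff)

lemma Phi_add: "Phi (x + y) = Phi x + Phi y"
proof -
  let ?S = "Poly_Mapping.keys x \<union> Poly_Mapping.keys y"
  have "Poly_Mapping.keys (x + y) \<subseteq> ?S" by (rule keys_add)
  thus ?thesis
    by (simp add: Phi_superset[of ?S] lookup_add sc_add distrib_right sum.distrib)
qed

lemma Phi_0 [simp]: "Phi 0 = 0" by (simp add: Phi_def)

lemma Phi_uminus: "Phi (- x) = - Phi x"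
  using Phi_add[of x "- x"] by (simp add: eq_neg_iff_add_eq_0 add.commute)

lemma Phi_diff: "Phi (x - y) = Phi x - Phi y"
  using Phi_add[of x "- y"] by (simp add: Phi_uminus)

lemma Phi_sum: "Phi (sum f A) = (\<Sum>a\<in>A. Phi (f a))"
  by (induction A rule: infinite_finite_induct) (simp_all add: Phi_add)

lemma Phi_single: "Phi (Poly_Mapping.single w c) = sc c * wop w"
  by (subst Phi_superset[of "{w}"]) auto

lemma Phi_const [simp]: "Phi (const c) = sc c"
  by (simp add: const_def Phi_single)

lemma Phi_gen [simp]: "Phi (gen g) = gop g"
  by (simp add: gen_def Phi_single wop_def)

lemma Phi_1 [simp]: "Phi 1 = 1"
  using Phi_const[of 1] unfolding const_def by simp

lemma Phi_mult: "Phi (x * y) = Phi x * Phi y"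
proof -
  let ?s = "\<lambda>x w. Poly_Mapping.single w (Poly_Mapping.lookup x w)"
  have "x * y = (\<Sum>u\<in>Poly_Mapping.keys x. \<Sum>v\<in>Poly_Mapping.keys y. ?s x u * ?s y v)"
    unfolding sum_product[symmetric] poly_mapping_sum_single[symmetric] ..
  hence "Phi (x * y) = (\<Sum>u\<in>Poly_Mapping.keys x. \<Sum>v\<in>Poly_Mapping.keys y. Phi (?s x u * ?s y v))"
    by (simp add: Phi_sum)
  also have "\<dots> = (\<Sum>u\<in>Poly_Mapping.keys x. \<Sum>v\<in>Poly_Mapping.keys y.
      (sc (Poly_Mapping.lookup x u) * wop u) * (sc (Poly_Mapping.lookup y v) * wop v))"
    by (simp add: mult_single Phi_single wop_add sc_mult mult.assoc sc_left_comm[of "wop _"])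
  finally show ?thesis unfolding Phi_def by (simp add: sum_product)
qed

lemma Phi_pow: "Phi (x ^ n) = Phi x ^ n"
  by (induction n) (simp_all add: Phi_mult)

end

section \<open>A module on PBW monomials\<close>

text \<open>\<open>(\<kappa>, g)\<close> with \<open>g s = (i\<^sub>s, j\<^sub>s)\<close> stands for the product of the \<open>f\<^sub>s\<close> to the powers \<open>i\<^sub>s\<close>, the
  \<open>e\<^sub>s\<close> to the powers \<open>j\<^sub>s\<close>, and the projection to the eigenvalue \<open>\<kappa>\<close> of \<open>K\<close>.\<close>

type_synonym pbw = "complex \<times> (bool \<Rightarrow> nat \<times> nat)"

text \<open>Linear operators as a type of their own, so that they form an instance of
  \<open>ring_1\<close>. They act on all coefficient families, which avoids finiteness conditions;
  the relevant part is supported on the finite set \<open>Dom\<close>.\<close>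

typedef lop = "{T :: (pbw \<Rightarrow> complex) \<Rightarrow> pbw \<Rightarrow> complex.
    \<forall>a u v. T (\<lambda>x. a * u x + v x) = (\<lambda>x. a * T u x + T v x)}"
  morphisms ap Lop
  by (rule exI[of _ id]) simp

setup_lifting type_definition_lop

lemma ap_lin: "ap T (\<lambda>x. a * u x + v x) = (\<lambda>x. a * ap T u x + ap T v x)"
  using ap[of T] by simp

lemma ap_0: "ap T (\<lambda>x. 0) = (\<lambda>x. 0)"
  using ap_lin[of T 1 "\<lambda>x. 0" "\<lambda>x. 0"] by (auto simp: fun_eq_iff)

lemma ap_scale: "ap T (\<lambda>x. a * u x) = (\<lambda>x. a * ap T u x)"
  using ap_lin[of T a u "\<lambda>x. 0"] by (simp add: ap_0)

instantiation lop :: ring_1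
begin
lift_definition zero_lop :: lop is "\<lambda>v x. 0" by simp
lift_definition one_lop :: lop is "\<lambda>v x. v x" by simp
lift_definition plus_lop :: "lop \<Rightarrow> lop \<Rightarrow> lop" is "\<lambda>S T v x. S v x + T v x" by (simp add: algebra_simps)
lift_definition minus_lop :: "lop \<Rightarrow> lop \<Rightarrow> lop" is "\<lambda>S T v x. S v x - T v x" by (simp add: algebra_simps)
lift_definition uminus_lop :: "lop \<Rightarrow> lop" is "\<lambda>S v x. - S v x" by (simp add: algebra_simps)
lift_definition times_lop :: "lop \<Rightarrow> lop \<Rightarrow> lop" is "\<lambda>S T v x. S (T v) x" by simp
instance
proof
  fix a b c :: lop
  show "a * b * c = a * (b * c)" by transfer simp
  show "1 * a = a" by transfer simp
  show "a * 1 = a" by transfer simp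
  show "a + b + c = a + (b + c)" by transfer (simp add: add.assoc)
  show "a + b = b + a" by transfer (simp add: add.commute)
  show "0 + a = a" by transfer simp
  show "- a + a = 0" by transfer simp
  show "a - b = a + - b" by transfer simp
  show "(a + b) * c = a * c + b * c" by transfer simp
  show "a * (b + c) = a * b + a * c"
  proof transfer
    fix a b c :: "(pbw \<Rightarrow> complex) \<Rightarrow> pbw \<Rightarrow> complex"
    assume *: "\<forall>k u v. a (\<lambda>x. k * u x + v x) = (\<lambda>x. k * a u x + a v x)"
    show "(\<lambda>v. a (\<lambda>x. b v x + c v x)) = (\<lambda>v x. a (b v) x + a (c v) x)"
      using *[rule_format, of 1] by simp
  qed
  have "ap 0 (\<lambda>x. 1) undefined \<noteq> ap 1 (\<lambda>x. 1) undefined"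
    by (simp add: zero_lop.rep_eq one_lop.rep_eq)
  thus "(0::lop) \<noteq> 1" by metis
qed
end

lift_definition scl :: "complex \<Rightarrow> lop" is "\<lambda>c v x. c * v x" by (simp add: algebra_simps)

lemma lop_eqI: "(\<And>v x. ap S v x = ap T v x) \<Longrightarrow> S = T"
  by transfer (simp add: fun_eq_iff)

lemmas ap_simps = zero_lop.rep_eq one_lop.rep_eq plus_lop.rep_eq minus_lop.rep_eq uminus_lop.rep_eq
  times_lop.rep_eq scl.rep_eq

interpretation scl: scalar_ring scl
proof
  fix a b :: complex and x :: lop
  show "scl (a + b) = scl a + scl b" by (rule lop_eqI) (simp add: ap_simps algebra_simps)
  show "scl (a * b) = scl a * scl b" by (rule lop_eqI) (simp add: ap_simps algebra_simps)
  show "scl 1 = 1" by (rule lop_eqI) (simp add: ap_simps)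
  show "scl a * x = x * scl a" by (rule lop_eqI) (simp add: ap_simps ap_scale)
qed

section \<open>The generators as operators on the PBW monomials\<close>

context qparam
begin

definition Dom :: "pbw set" where
  "Dom = {(\<kappa>, g). \<kappa> \<in> mu \<and> (\<forall>s. fst (g s) < p s \<and> snd (g s) < p s)}"

definition rat :: "bool \<Rightarrow> (bool \<Rightarrow> nat \<times> nat) \<Rightarrow> complex" where
  "rat s g = q s ^ (2 * snd (g s)) / q s ^ (2 * fst (g s))"

text \<open>The eigenvalue of \<open>K\<close> on the monomial: every e multiplies the eigenvalue at
  the right end by q^2, every f divides it by q^2.\<close>

definition eig :: "pbw \<Rightarrow> complex" where
  "eig x = fst x * rat True (snd x) * rat False (snd x)"

text \<open>The coefficient of f^(i-1) e^j when e is moved across f^i in e f^i e^j. The eigenvalues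
  of [e, f] met on the way are differences of consecutive Casimir values over \<open>om s\<close>,
  and they telescope to this quotient.\<close>

definition coef :: "bool \<Rightarrow> complex \<Rightarrow> nat \<Rightarrow> nat \<Rightarrow> complex" where
  "coef s \<kappa> i j = (cas s (wt s \<kappa> * Q s ^ (2 * j)) - cas s (wt s \<kappa> * Q s ^ (2 * j) / Q s ^ (2 * i))) / om s"

definition upd :: "bool \<Rightarrow> nat \<Rightarrow> nat \<Rightarrow> pbw \<Rightarrow> pbw" where
  "upd s i j x = (fst x, (snd x)(s := (i, j)))"

definition fi :: "bool \<Rightarrow> pbw \<Rightarrow> nat" where "fi s x = fst (snd x s)"
definition ei :: "bool \<Rightarrow> pbw \<Rightarrow> nat" where "ei s x = snd (snd x s)"

lemma upd_simps [simp]: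
  "fst (upd s i j x) = fst x" "fi s (upd s i j x) = i" "ei s (upd s i j x) = j"
  "fi (\<not> s) (upd s i j x) = fi (\<not> s) x" "ei (\<not> s) (upd s i j x) = ei (\<not> s) x"
  "fi s (upd (\<not> s) i j x) = fi s x" "ei s (upd (\<not> s) i j x) = ei s x"
  "upd s i j (upd s i' j' x) = upd s i j x"
  by (cases s; simp add: upd_def fi_def ei_def)+

lemma upd_self: "upd s (fi s x) (ei s x) x = x"
  by (simp add: upd_def fi_def ei_def)

lemma upd_self': "fi s x = i \<Longrightarrow> ei s x = j \<Longrightarrow> upd s i j x = x"
  by (auto simp: upd_self)

lemma upd_comm: "upd s i j (upd (\<not> s) i' j' x) = upd (\<not> s) i' j' (upd s i j x)"
  by (cases s; auto simp: upd_def fun_eq_iff)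

lemma pbw_eqI: "fst x = fst y \<Longrightarrow> (\<And>s. fi s x = fi s y) \<Longrightarrow> (\<And>s. ei s x = ei s y) \<Longrightarrow> x = y"
  by (auto simp: fi_def ei_def prod_eq_iff fun_eq_iff)

lemma Dom_iff: "x \<in> Dom \<longleftrightarrow> fst x \<in> mu \<and> fi s x < p s \<and> ei s x < p s \<and> fi (\<not> s) x < p (\<not> s) \<and> ei (\<not> s) x < p (\<not> s)"
  by (cases x; cases s; auto simp: Dom_def fi_def ei_def all_bool_eq)

lemma finite_Dom: "finite Dom"
proof -
  have "Dom \<subseteq> (\<lambda>(\<kappa>, a, b). (\<kappa>, \<lambda>s. if s then a else b)) ` (mu \<times> ({..<p True} \<times> {..<p True}) \<times> ({..<p False} \<times> {..<p False}))"
  proof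
    fix x assume x: "x \<in> Dom"
    have "x = (\<lambda>(\<kappa>, a, b). (\<kappa>, \<lambda>s. if s then a else b)) (fst x, snd x True, snd x False)"
      by (cases x) (auto simp: fun_eq_iff)
    moreover have "(fst x, snd x True, snd x False) \<in> mu \<times> ({..<p True} \<times> {..<p True}) \<times> ({..<p False} \<times> {..<p False})"
      using x by (auto simp: Dom_def mem_Times_iff)
    ultimately show "x \<in> (\<lambda>(\<kappa>, a, b). (\<kappa>, \<lambda>s. if s then a else b)) ` (mu \<times> ({..<p True} \<times> {..<p True}) \<times> ({..<p False} \<times> {..<p False}))"
      by (rule image_eqI)
  qed
  thus ?thesis by (rule finite_subset) (auto simp: finite_mu)
qed

lemma rat_s: "rat s (snd x) = q s ^ (2 * ei s x) / q s ^ (2 * fi s x)"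
  by (simp add: rat_def fi_def ei_def)

lemma eig_eq: "eig x = fst x * rat s (snd x) * rat (\<not> s) (snd x)"
  by (cases s) (simp_all add: eig_def)

lemma eig_nz: "x \<in> Dom \<Longrightarrow> eig x \<noteq> 0"
  by (auto simp: eig_def rat_def Dom_def mu_nz)

lemma eig_mu: "x \<in> Dom \<Longrightarrow> eig x \<in> mu"
  unfolding eig_eq[of x True] rat_s power_mult
  by (intro mu_mult mu_div mu_pow qsq_mu) (auto simp: Dom_iff[of x True])

lemma wt_eig: "wt s (eig x) = wt s (fst x) * Q s ^ (2 * ei s x) / Q s ^ (2 * fi s x)"
proof -
  have *: "(q (\<not> s) ^ (2 * n)) ^ p (\<not> s) = 1" for n
  proof -
    have "(q (\<not> s) ^ (2 * n)) ^ p (\<not> s) = (q (\<not> s) ^ (2 * p (\<not> s))) ^ n"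
      unfolding power_mult[symmetric] by (simp only: mult_ac)
    thus ?thesis by (simp add: q_pow)
  qed
  have **: "(q s ^ (2 * n)) ^ p (\<not> s) = Q s ^ (2 * n)" for n
    by (simp add: Q_def pow_pow_commute)
  show ?thesis
    unfolding eig_eq[of x s] rat_s wt_def power_mult_distrib power_divide * ** by simp
qed

text \<open>Operators act on coefficient families, so each formula collects the monomials that contribute
  to the one indexed by \<open>x\<close>. Outside \<^term>\<open>Dom\<close> the generators act trivially, with \<open>K\<close> as the
  identity, to keep \<open>K\<close> invertible.\<close>

lift_definition El :: "bool \<Rightarrow> lop" is
  "\<lambda>s v x. if x \<in> Dom then
      (if ei s x > 0 then v (upd s (fi s x) (ei s x - 1) x) else 0)
      + (if Suc (fi s x) < p s then coef s (fst x) (Suc (fi s x)) (ei s x) * v (upd s (Suc (fi s x)) (ei s x) x) else 0)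
    else 0"
  by (auto simp: fun_eq_iff algebra_simps)

lift_definition Fl :: "bool \<Rightarrow> lop" is
  "\<lambda>s v x. if x \<in> Dom \<and> fi s x > 0 then v (upd s (fi s x - 1) (ei s x) x) else 0"
  by (auto simp: fun_eq_iff algebra_simps)

lift_definition Kl :: lop is "\<lambda>v x. if x \<in> Dom then eig x * v x else v x"
  by (auto simp: fun_eq_iff algebra_simps)

lemma ap_K_pow: "ap (Kl ^ n) v x = (if x \<in> Dom then eig x ^ n * v x else v x)"
  by (induction n arbitrary: v) (auto simp: ap_simps Kl.rep_eq)

lemma K_pow_N: "Kl ^ N = 1"
  by (rule lop_eqI) (auto simp: ap_K_pow ap_simps dest: eig_mu simp: mu_def)

definition Ki :: lop where "Ki = Kl ^ (N - 1)"

lemma ap_Kinv: "ap Ki v x = (if x \<in> Dom then inverse (eig x) * v x else v x)"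
proof -
  have "eig x ^ (N - 1) = inverse (eig x)" if "x \<in> Dom"
  proof -
    have "eig x * eig x ^ (N - 1) = eig x ^ N" using N_pos by (metis power_eq_if neq0_conv)
    also have "\<dots> = 1" using eig_mu[OF that] by (simp add: mu_def)
    finally show ?thesis using inverse_unique by metis
  qed
  thus ?thesis by (simp add: ap_K_pow Ki_def del: One_nat_def)
qed

lemma ap_Kinv_pow: "ap (Ki ^ n) v x = (if x \<in> Dom then inverse (eig x) ^ n * v x else v x)"
  by (induction n arbitrary: v) (auto simp: ap_simps ap_Kinv)

lemma eig_upd_Suc_e: "eig (upd s i (Suc j) x) = (q s)\<^sup>2 * eig (upd s i j x)"
  by (simp add: eig_eq[of _ s] rat_s[of s] rat_s[of "\<not> s"] power_add power2_eq_square)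

lemma eig_upd_Suc_f: "eig (upd s (Suc i) j x) = eig (upd s i j x) / (q s)\<^sup>2"
  by (simp add: eig_eq[of _ s] rat_s[of s] rat_s[of "\<not> s"] power_add power2_eq_square)

lemma K_El: "Kl * El s = scl ((q s)\<^sup>2) * (El s * Kl)"
proof (rule lop_eqI)
  fix v x
  have 1: "eig (upd s (fi s x) (ei s x - 1) x) = eig x / (q s)\<^sup>2" if "ei s x > 0"
    using eig_upd_Suc_e[of s "fi s x" "ei s x - 1" x] that by (simp add: upd_self)
  have 2: "eig (upd s (Suc (fi s x)) (ei s x) x) = eig x / (q s)\<^sup>2"
    using eig_upd_Suc_f[of s "fi s x" "ei s x" x] by (simp add: upd_self)
  have 3: "x \<in> Dom \<Longrightarrow> upd s (fi s x) (ei s x - 1) x \<in> Dom"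
    "x \<in> Dom \<Longrightarrow> Suc (fi s x) < p s \<Longrightarrow> upd s (Suc (fi s x)) (ei s x) x \<in> Dom"
    by (auto simp: Dom_iff[of _ s])
  show "ap (Kl * El s) v x = ap (scl ((q s)\<^sup>2) * (El s * Kl)) v x"
    using 1 2 3 by (cases "x \<in> Dom"; cases "ei s x > 0"; cases "Suc (fi s x) < p s")
      (simp_all add: ap_simps Kl.rep_eq El.rep_eq distrib_left)
qed

lemma K_Fl: "Kl * Fl s = scl (inverse ((q s)\<^sup>2)) * (Fl s * Kl)"
proof (rule lop_eqI)
  fix v x
  have 1: "eig (upd s (fi s x - 1) (ei s x) x) = eig x * (q s)\<^sup>2" if "fi s x > 0"
    using eig_upd_Suc_f[of s "fi s x - 1" "ei s x" x] that by (simp add: upd_self)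
  have 3: "x \<in> Dom \<Longrightarrow> upd s (fi s x - 1) (ei s x) x \<in> Dom"
    by (auto simp: Dom_iff[of _ s])
  show "ap (Kl * Fl s) v x = ap (scl (inverse ((q s)\<^sup>2)) * (Fl s * Kl)) v x"
    using 1 3 by (cases "x \<in> Dom"; cases "fi s x > 0") (simp_all add: ap_simps Kl.rep_eq Fl.rep_eq)
qed

lemma Fl_Fl: "Fl s * Fl (\<not> s) = Fl (\<not> s) * Fl s"
  by (rule lop_eqI) (auto simp: ap_simps Fl.rep_eq upd_comm[of s] Dom_iff[of _ s])

lemma El_Fl': "El s * Fl (\<not> s) = Fl (\<not> s) * El s"
  by (rule lop_eqI) (auto simp: ap_simps Fl.rep_eq El.rep_eq upd_comm[of s] Dom_iff[of _ s])

lemma El_El: "El s * El (\<not> s) = El (\<not> s) * El s"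
  by (rule lop_eqI) (auto simp: ap_simps El.rep_eq upd_comm[of s] Dom_iff[of _ s] algebra_simps)

lemma Fl_pow: "Fl s ^ p s = 0"
proof -
  have *: "ap (Fl s ^ n) v x = (if x \<in> Dom \<and> n \<le> fi s x then v (upd s (fi s x - n) (ei s x) x) else 0)"
    if "n > 0" for n v x
    using that
  proof (induction n arbitrary: x)
    case (Suc n)
    show ?case
    proof (cases "n = 0")
      case True thus ?thesis by (auto simp: ap_simps Fl.rep_eq)
    next
      case False
      have 3: "x \<in> Dom \<Longrightarrow> upd s (fi s x - 1) (ei s x) x \<in> Dom" by (auto simp: Dom_iff[of _ s])
      show ?thesis using False 3 by (auto simp: ap_simps Fl.rep_eq Suc.IH)
    qed
  qed simp
  show ?thesis
    by (rule lop_eqI) (use p_pos[of s] in \<open>auto simp: * ap_simps Dom_iff[of _ s]\<close>)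
qed

text \<open>At i = p the two Casimir arguments coincide since Q^(2p) = 1. So the term cut off by the
  truncation f^p = 0 has coefficient zero anyway, and the bracket relation survives at the end of
  the string.\<close>

lemma coef_0: "coef s \<kappa> 0 j = 0" and coef_p: "coef s \<kappa> (p s) j = 0"
  by (simp_all add: coef_def Q_pow)

lemma coef_Suc:
  assumes "\<kappa> \<noteq> 0" "p s \<ge> 2"
  shows "coef s \<kappa> (Suc i) j - coef s \<kappa> i j
    = (wt s \<kappa> * Q s ^ (2 * j) / Q s ^ (2 * i) - inverse (wt s \<kappa> * Q s ^ (2 * j) / Q s ^ (2 * i))) / (Q s - inverse (Q s))"
proof -
  let ?a = "wt s \<kappa> * Q s ^ (2 * j) / Q s ^ (2 * i)"
  have "?a \<noteq> 0" using assms by (simp add: wt_def)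
  have "coef s \<kappa> (Suc i) j - coef s \<kappa> i j = (cas s ?a - cas s (?a / (Q s)\<^sup>2)) / om s"
    by (simp add: coef_def power_add diff_divide_distrib power2_eq_square mult_ac)
  also have "\<dots> = ((Q s - inverse (Q s)) * (?a - inverse ?a)) / om s"
    by (subst cas_diff[OF \<open>?a \<noteq> 0\<close>]) (rule refl)
  also have "\<dots> = (?a - inverse ?a) / (Q s - inverse (Q s))"
    unfolding om_def power2_eq_square by (rule mult_divide_mult_cancel_left) (use om_nz[OF assms(2)] in \<open>simp add: om_def\<close>)
  finally show ?thesis .
qed

text \<open>The diagonal terms of e f and f e are the values of \<open>coef\<close> at i + 1 and at
  i, whose difference is the Cartan eigenvalue by \<open>coef_Suc\<close>; the off-diagonal terms
  cancel.\<close>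

lemma El_Fl:
  assumes "p s \<ge> 2"
  shows "El s * Fl s = Fl s * El s + scl (1 / (Q s - inverse (Q s))) * (Kl ^ p (\<not> s) - Ki ^ p (\<not> s))"
proof (rule lop_eqI)
  fix v x
  let ?h = "scl (1 / (Q s - inverse (Q s))) * (Kl ^ p (\<not> s) - Ki ^ p (\<not> s))"
  show "ap (El s * Fl s) v x = ap (Fl s * El s + ?h) v x"
  proof (cases "x \<in> Dom")
    case False thus ?thesis by (simp add: ap_simps El.rep_eq Fl.rep_eq ap_K_pow ap_Kinv_pow)
  next
    case True
    let ?i = "fi s x" and ?j = "ei s x"
    have D: "?i < p s" "?j < p s" "fst x \<noteq> 0" using True mu_nz by (auto simp: Dom_iff[of _ s])
    have "ap ?h v x = (eig x ^ p (\<not> s) - inverse (eig x ^ p (\<not> s))) / (Q s - inverse (Q s)) * v x"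
      using True by (simp add: ap_simps ap_K_pow ap_Kinv_pow left_diff_distrib diff_divide_distrib power_inverse)
    also have "\<dots> = (coef s (fst x) (Suc ?i) ?j - coef s (fst x) ?i ?j) * v x"
      using coef_Suc[OF D(3) assms] wt_eig[of s x] by (simp add: wt_def)
    finally have h: "ap ?h v x = (coef s (fst x) (Suc ?i) ?j - coef s (fst x) ?i ?j) * v x" .
    have 1: "upd s (?i - 1) ?j x \<in> Dom" "upd s ?i (?j - 1) x \<in> Dom"
      using True by (auto simp: Dom_iff[of _ s])
    have 2: "upd s (Suc ?i) ?j x \<in> Dom" if "Suc ?i < p s"
      using True that by (auto simp: Dom_iff[of _ s])
    have c: "coef s (fst x) (Suc ?i) ?j = 0" if "\<not> Suc ?i < p s"
      using that D coef_p[of s "fst x" ?j] by (metis Suc_lessI)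
    have EF: "ap (El s * Fl s) v x = (if ?i > 0 \<and> ?j > 0 then v (upd s (?i - 1) (?j - 1) x) else 0)
        + coef s (fst x) (Suc ?i) ?j * v x"
    proof (cases "Suc ?i < p s")
      case True
      thus ?thesis using \<open>x \<in> Dom\<close> 1 2 by (auto simp: ap_simps El.rep_eq Fl.rep_eq upd_self')
    next
      case False
      thus ?thesis using \<open>x \<in> Dom\<close> 1 c[OF False] by (auto simp: ap_simps El.rep_eq Fl.rep_eq upd_self')
    qed
    have FE: "ap (Fl s * El s) v x = (if ?i > 0 \<and> ?j > 0 then v (upd s (?i - 1) (?j - 1) x) else 0)
        + coef s (fst x) ?i ?j * v x"
      using True 1 D by (auto simp: ap_simps El.rep_eq Fl.rep_eq upd_self' coef_0)
    show ?thesis unfolding plus_lop.rep_eq EF FE h by (simp add: algebra_simps)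
  qed
qed

lemma Kinv_right: "Kl * Ki = 1"
  unfolding Ki_def using N_pos K_pow_N by (metis power_eq_if neq0_conv)

lemma skew_inv:
  fixes k ki e :: lop
  assumes "k * e = scl a * (e * k)" "ki * k = 1" "k * ki = 1" "a \<noteq> 0"
  shows "ki * e = scl (inverse a) * (e * ki)"
proof -
  have "scl a * (ki * e) = ki * (scl a * (e * k)) * ki"
    using assms by (simp add: scl.sc_left_comm[of ki] mult.assoc)
  also have "\<dots> = (ki * k) * e * ki" unfolding assms(1)[symmetric] by (simp add: mult.assoc)
  also have "\<dots> = e * ki" using assms by simp
  finally have "scl (inverse a) * (scl a * (ki * e)) = scl (inverse a) * (e * ki)" by simp
  thus ?thesis using assms(4) unfolding scl.sc_sc by simp
qed

text \<open>Rests on two facts. First, e^p commutes with f because the geometric sums vanish.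
  Second, at the largest f exponent the bracket term is absent and \<open>El\<close> only shifts the
  e exponent, so p applications give zero there.\<close>

lemma El_pow: "El s ^ p s = 0"
proof (cases "p s = 1")
  case True
  have "El s = 0"
    by (rule lop_eqI) (use True in \<open>auto simp: ap_simps El.rep_eq Dom_iff[of _ s]\<close>)
  thus ?thesis using True by simp
next
  case False
  hence p2: "p s \<ge> 2" using p_pos[of s] by linarith
  let ?k = "Kl ^ p (\<not> s)" and ?ki = "Ki ^ p (\<not> s)"
  have ke: "?k * El s = scl ((Q s)\<^sup>2) * (El s * ?k)"
  proof -
    have "?k * El s = scl (((q s)\<^sup>2) ^ p (\<not> s)) * (El s * ?k)"
    proof -
      have *: "Kl ^ n * El s = scl (((q s)\<^sup>2) ^ n) * (El s * Kl ^ n)" for n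
      proof (induction n)
        case (Suc n)
        have "Kl ^ Suc n * El s = Kl * (Kl ^ n * El s)" by (simp add: mult.assoc)
        also have "\<dots> = scl (((q s)\<^sup>2) ^ n) * ((Kl * El s) * Kl ^ n)" by (simp add: Suc scl.sc_left_comm[of Kl] mult.assoc)
        also have "\<dots> = scl (((q s)\<^sup>2) ^ Suc n) * (El s * Kl ^ Suc n)"
          unfolding K_El by (simp add: scl.sc_sc mult.assoc mult.commute)
        finally show ?case .
      qed simp
      show ?thesis by (rule *)
    qed
    thus ?thesis by (simp add: Q_def pow_pow_commute)
  qed
  have inv: "?ki * ?k = 1" "?k * ?ki = 1"
    by (rule lop_eqI; auto simp: ap_simps ap_Kinv_pow ap_K_pow power_inverse eig_nz)+
  have kie: "?ki * El s = scl (inverse ((Q s)\<^sup>2)) * (El s * ?ki)"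
    by (rule skew_inv[OF ke inv]) simp
  have geo: "(\<Sum>t\<le>p s - 1. a ^ t) = 0" if "a \<noteq> 1" "a ^ p s = 1" for a :: complex
  proof -
    have "(\<Sum>t\<le>p s - 1. a ^ t) = (\<Sum>t<p s. a ^ t)"
      using p_pos[of s] by (intro sum.cong) auto
    also have "\<dots> = (a ^ p s - 1) / (a - 1)" using that by (intro geometric_sum)
    finally show ?thesis using that by simp
  qed
  have Q: "(Q s)\<^sup>2 \<noteq> 1" "((Q s)\<^sup>2) ^ p s = 1" using Q_sq_neq_1[OF p2] Q_pow[of s] by (simp_all add: power_mult)
  have "El s ^ Suc (p s - 1) * Fl s = Fl s * El s ^ Suc (p s - 1)"
    unfolding scl.pow_f_commute[OF El_Fl[OF p2] ke kie] using geo[of "(Q s)\<^sup>2"] geo[of "inverse ((Q s)\<^sup>2)"] Q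
    by (simp add: power_inverse del: power_Suc)
  hence comm: "El s ^ p s * Fl s = Fl s * El s ^ p s" using p_pos[of s] by simp
  have out: "ap (El s ^ n) v x = 0" if "x \<notin> Dom" "n > 0" for n v x
    using that by (cases n) (auto simp: ap_simps El.rep_eq)
  have base: "ap (El s ^ n) v x = (if n \<le> ei s x then v (upd s (fi s x) (ei s x - n) x) else 0)"
    if "x \<in> Dom" "Suc (fi s x) = p s" for n v x
    using that
  proof (induction n arbitrary: x)
    case (Suc n)
    have "upd s (fi s x) (ei s x - 1) x \<in> Dom" using Suc.prems by (auto simp: Dom_iff[of _ s])
    thus ?case using Suc.prems by (auto simp: ap_simps El.rep_eq Suc.IH)
  qed (simp add: ap_simps upd_self)
  have "ap (El s ^ p s) v x = 0" if "x \<in> Dom" for v x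
    using that
  \<comment> \<open>Descending induction on the f exponent: the coefficient of e^p at
    \<open>x\<close> is the coefficient of f e^p = e^p f at the index with one more f.\<close>
  proof (induction "p s - fi s x" arbitrary: x v rule: less_induct)
    case less
    show ?case
    proof (cases "Suc (fi s x) = p s")
      case True
      thus ?thesis using base[OF less.prems] less.prems by (auto simp: Dom_iff[of _ s])
    next
      case False
      hence lt: "Suc (fi s x) < p s" using less.prems by (auto simp: Dom_iff[of _ s])
      let ?y = "upd s (Suc (fi s x)) (ei s x) x"
      have y: "?y \<in> Dom" using lt less.prems by (auto simp: Dom_iff[of _ s])
      have "ap (El s ^ p s) v x = ap (Fl s * El s ^ p s) v ?y"
        using y by (simp add: ap_simps Fl.rep_eq upd_self)
      also have "\<dots> = ap (El s ^ p s) (ap (Fl s) v) ?y"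
        unfolding comm[symmetric] by (simp add: ap_simps)
      also have "\<dots> = 0" using less.hyps[of ?y] y lt by simp
      finally show ?thesis .
    qed
  qed
  hence "ap (El s ^ p s) v x = 0" for v x using out[of x "p s" v] p_pos[of s] by blast
  thus ?thesis by (intro lop_eqI) (simp add: ap_simps)
qed

end

section \<open>The defining ideal is the kernel of the representation\<close>

lemma ring_of_type_ring: "ring (ring_of_type_algebra :: 'a::ring_1 ring)"
proof -
  have "\<exists>y. x + y = 0" for x :: 'a
    using add.right_inverse by blast
  thus ?thesis
    unfolding ring_of_type_algebra_def using add.right_inverse
    by unfold_locales (auto simp: algebra_simps Units_def)
qed

lemma ring_of_type_simps [simp]:
  "carrier ring_of_type_algebra = UNIV" "monoid.mult ring_of_type_algebra x y = x * y"
  "monoid.one ring_of_type_algebra = 1" "ring.zero ring_of_type_algebra = 0"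
  "ring.add ring_of_type_algebra x y = x + y"
  by (simp_all add: ring_of_type_algebra_def)

lemma ring_of_type_ideal_iff:
  fixes J :: "'a::ring_1 set"
  shows "ideal J ring_of_type_algebra \<longleftrightarrow>
    0 \<in> J \<and> (\<forall>x\<in>J. \<forall>y\<in>J. x - y \<in> J) \<and> (\<forall>a. \<forall>x\<in>J. a * x \<in> J \<and> x * a \<in> J)"
proof
  interpret R: ring "ring_of_type_algebra :: 'a ring" by (rule ring_of_type_ring)
  assume J: "ideal J ring_of_type_algebra"
  interpret J: ideal J "ring_of_type_algebra :: 'a ring" by fact
  have m: "(- 1) * y \<in> J" if "y \<in> J" for y using J.I_l_closed[of y "- 1"] that by simp
  have "x - y \<in> J" if "x \<in> J" "y \<in> J" for x y
    using J.a_closed[OF that(1) m[OF that(2)]] by simp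
  thus "0 \<in> J \<and> (\<forall>x\<in>J. \<forall>y\<in>J. x - y \<in> J) \<and> (\<forall>a. \<forall>x\<in>J. a * x \<in> J \<and> x * a \<in> J)"
    using J.zero_closed J.I_l_closed J.I_r_closed by simp
next
  interpret R: ring "ring_of_type_algebra :: 'a ring" by (rule ring_of_type_ring)
  assume *: "0 \<in> J \<and> (\<forall>x\<in>J. \<forall>y\<in>J. x - y \<in> J) \<and> (\<forall>a. \<forall>x\<in>J. a * x \<in> J \<and> x * a \<in> J)"
  have add: "x + y \<in> J" if "x \<in> J" "y \<in> J" for x y
  proof -
    have "0 - y \<in> J" using * that by blast
    hence "x - (0 - y) \<in> J" using * that by blast
    thus ?thesis by simp
  qed
  show "ideal J ring_of_type_algebra"
  proof (rule idealI)
    show "subgroup J (add_monoid ring_of_type_algebra)"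
    proof (rule R.add.subgroupI)
      fix a :: 'a assume "a \<in> J"
      hence "0 - a \<in> J" using * by blast
      moreover have "\<ominus>\<^bsub>ring_of_type_algebra\<^esub> a = - a"
        by (rule R.minus_equality) simp_all
      ultimately show "\<ominus>\<^bsub>ring_of_type_algebra\<^esub> a \<in> J" by simp
    qed (use * add in auto)
  qed (use * ring_of_type_ring in auto)
qed

context qparam
begin

definition genop :: "gen \<Rightarrow> lop" where
  "genop g = (case g of Gen_ep \<Rightarrow> El True | Gen_fp \<Rightarrow> Fl True | Gen_em \<Rightarrow> El False
     | Gen_fm \<Rightarrow> Fl False | Gen_K \<Rightarrow> Kl)"

sublocale rep: free_alg_rep scl genop
  by unfold_locales

abbreviation "Phi \<equiv> rep.Phi"

definition I :: "free_alg set" where "I = qg_ideal (p True) (p False)"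

definition ge :: "bool \<Rightarrow> free_alg" where "ge s = gen (if s then Gen_ep else Gen_em)"
definition gf :: "bool \<Rightarrow> free_alg" where "gf s = gen (if s then Gen_fp else Gen_fm)"
definition gK :: free_alg where "gK = gen Gen_K"
definition gKi :: free_alg where "gKi = gK ^ (N - 1)"

lemma Phi_ge [simp]: "Phi (ge s) = El s" and Phi_gf [simp]: "Phi (gf s) = Fl s" and Phi_gK [simp]: "Phi gK = Kl"
  by (cases s; simp add: ge_def gf_def gK_def genop_def)+

lemma Phi_gKi [simp]: "Phi gKi = Ki"
  by (simp add: gKi_def rep.Phi_pow Ki_def del: One_nat_def)

lemma I_ideal: "ideal I ring_of_type_algebra"
  unfolding I_def qg_ideal_def by (intro ring.genideal_ideal ring_of_type_ring) simp

lemma relations_I: "x \<in> qg_relations (p True) (p False) \<Longrightarrow> x \<in> I"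
  unfolding I_def qg_ideal_def using ring.genideal_self[OF ring_of_type_ring, of "qg_relations (p True) (p False)"]
  by auto

lemma K_inv_conj:
  assumes "Kl * x = scl a * (x * Kl)"
  shows "Kl * x * Ki = scl a * x"
  by (simp add: assms mult.assoc Kinv_right)

definition half_relations :: "bool \<Rightarrow> free_alg set" where
  "half_relations s = {ge s ^ p s, gf s ^ p s,
     gK * ge s * gKi - const ((q s)\<^sup>2) * ge s, gK * gf s * gKi - const (inverse ((q s)\<^sup>2)) * gf s}"

definition ef_relation :: "bool \<Rightarrow> free_alg" where
  "ef_relation s = ge s * gf s - gf s * ge s - const (1 / (Q s - inverse (Q s))) * (gK ^ p (\<not> s) - gKi ^ p (\<not> s))"

text \<open>Sorts the relations by side, so that each later argument can be made once for a Boolean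
  \<open>s\<close>.\<close>

lemma qg_relations_eq:
  "qg_relations (p True) (p False) = half_relations True \<union> half_relations False \<union>
    {gK ^ N - 1, ge True * ge False - ge False * ge True, ge True * gf False - gf False * ge True,
     gf True * ge False - ge False * gf True, gf True * gf False - gf False * gf True} \<union>
    {ef_relation s |s. p s \<noteq> 1}"
proof -
  have G: "gen Gen_ep = ge True" "gen Gen_fp = gf True" "gen Gen_em = ge False" "gen Gen_fm = gf False"
      "gen Gen_K = gK" "gK ^ (N - 1) = gKi" "qq (p True) = q True" "qq (p False) = q False"
      "q True ^ p False = Q True" "q False ^ p True = Q False" "2 * p True * p False = N"
    by (simp_all add: ge_def gf_def gK_def gKi_def q_def Q_def N_def)
  have "{ef_relation s |s. p s \<noteq> 1} = (if p True = 1 then {} else {ef_relation True}) \<union> (if p False = 1 then {} else {ef_relation False})"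
    by (auto simp: ex_bool_eq)
  thus ?thesis
    unfolding qg_relations_def Let_def G half_relations_def ef_relation_def not_True_eq_False not_False_eq_True
    by (elim ssubst) blast
qed

lemma Phi_relations:
  assumes "x \<in> qg_relations (p True) (p False)"
  shows "Phi x = 0"
proof -
  note P = rep.Phi_mult rep.Phi_diff rep.Phi_pow
  have comms: "El True * Fl False = Fl False * El True" "El False * Fl True = Fl True * El False"
    "El True * El False = El False * El True" "Fl True * Fl False = Fl False * Fl True"
    using El_Fl'[of True] El_Fl'[of False] El_El[of True] Fl_Fl[of True] by simp_all
  have h: "Phi x = 0" if "x \<in> half_relations s" for s
    using that unfolding half_relations_def
    by (auto simp: P El_pow Fl_pow K_inv_conj[OF K_El] K_inv_conj[OF K_Fl])
  have ef: "Phi (ef_relation s) = 0" if "p s \<noteq> 1" for s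
    using El_Fl[of s] p_pos[of s] that by (simp add: ef_relation_def P)
  show ?thesis
    using assms h ef unfolding qg_relations_eq by (auto simp: P K_pow_N comms)
qed

lemma Phi_I: assumes "x \<in> I" shows "Phi x = 0"
proof -
  have "ideal {x. Phi x = 0} ring_of_type_algebra"
    unfolding ring_of_type_ideal_iff by (auto simp: rep.Phi_diff rep.Phi_mult)
  hence "I \<subseteq> {x. Phi x = 0}"
    unfolding I_def qg_ideal_def using Phi_relations
    by (intro ring.genideal_minimal[OF ring_of_type_ring]) auto
  thus ?thesis using assms by blast
qed

section \<open>Computation modulo the defining ideal\<close>

definition cg :: "free_alg \<Rightarrow> free_alg \<Rightarrow> bool" (infix "\<approx>" 50) where "x \<approx> y \<longleftrightarrow> x - y \<in> I"

lemma I_diff: "x \<in> I \<Longrightarrow> y \<in> I \<Longrightarrow> x - y \<in> I"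
  and I_mult: "x \<in> I \<Longrightarrow> a * x \<in> I" "x \<in> I \<Longrightarrow> x * a \<in> I" and I_0 [simp]: "0 \<in> I"
  using I_ideal unfolding ring_of_type_ideal_iff by blast+

lemma I_uminus: "x \<in> I \<Longrightarrow> - x \<in> I"
  using I_diff[OF I_0] by simp

lemma I_add: "x \<in> I \<Longrightarrow> y \<in> I \<Longrightarrow> x + y \<in> I"
  using I_diff[OF _ I_uminus] by fastforce

lemma cg_refl [simp]: "x \<approx> x" by (simp add: cg_def)

lemma cg_sym: "x \<approx> y \<Longrightarrow> y \<approx> x"
  unfolding cg_def using I_uminus by fastforce

lemma cg_trans [trans]: "x \<approx> y \<Longrightarrow> y \<approx> z \<Longrightarrow> x \<approx> z"
  unfolding cg_def using I_add by fastforce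

lemma cg_add: "x \<approx> x' \<Longrightarrow> y \<approx> y' \<Longrightarrow> x + y \<approx> x' + y'"
  unfolding cg_def using I_add[of "x - x'" "y - y'"] by (simp add: algebra_simps)

lemma cg_diff: "x \<approx> x' \<Longrightarrow> y \<approx> y' \<Longrightarrow> x - y \<approx> x' - y'"
  unfolding cg_def using I_diff[of "x - x'" "y - y'"] by (simp add: algebra_simps)

lemma cg_multl: "y \<approx> y' \<Longrightarrow> x * y \<approx> x * y'"
  unfolding cg_def right_diff_distrib[symmetric] by (rule I_mult)

lemma cg_multr: "x \<approx> x' \<Longrightarrow> x * y \<approx> x' * y"
  unfolding cg_def left_diff_distrib[symmetric] by (rule I_mult)

lemma cg_Phi: "x \<approx> y \<Longrightarrow> Phi x = Phi y"
  unfolding cg_def using Phi_I[of "x - y"] by (simp add: rep.Phi_diff)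

interpretation cst: scalar_ring const
proof
  fix a b :: complex and x :: free_alg
  show "const (a + b) = const a + const b" "const (a * b) = const a * const b" "const 1 = 1"
    by (simp_all add: const_def single_add mult_single)
  have *: "Poly_Mapping.single 0 a * Poly_Mapping.single w c = Poly_Mapping.single w c * Poly_Mapping.single 0 a"
    for w :: word and c by (simp add: mult_single mult.commute)
  show "const a * x = x * const a"
    unfolding const_def
    by (subst (1 2) poly_mapping_sum_single[of x]) (simp only: sum_distrib_left sum_distrib_right *)
qed

lemma cg_comm_pow: "a * b \<approx> b * a \<Longrightarrow> a * b ^ n \<approx> b ^ n * a"
proof (induction n)
  case (Suc n)
  have "a * b ^ Suc n = a * b * b ^ n" by (simp add: mult.assoc)
  also have "\<dots> \<approx> b * (a * b ^ n)" using cg_multr[OF Suc.prems] by (simp add: mult.assoc)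
  also have "\<dots> \<approx> b ^ Suc n * a" using cg_multl[OF Suc.IH[OF Suc.prems]] by (simp add: mult.assoc)
  finally show ?case .
qed simp

lemma cg_comm_pow2: "a * b \<approx> b * a \<Longrightarrow> a ^ m * b ^ n \<approx> b ^ n * a ^ m"
  by (meson cg_comm_pow cg_sym)

lemma cg_skew_pow: "k * e \<approx> const a * (e * k) \<Longrightarrow> k * e ^ n \<approx> const (a ^ n) * (e ^ n * k)"
proof (induction n)
  case (Suc n)
  have "k * e ^ Suc n = k * e * e ^ n" by (simp add: mult.assoc)
  also have "\<dots> \<approx> const a * (e * (k * e ^ n))" using cg_multr[OF Suc.prems] by (simp add: mult.assoc)
  also have "\<dots> \<approx> const a * (e * (const (a ^ n) * (e ^ n * k)))"
    by (intro cg_multl Suc.IH Suc.prems)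
  also have "\<dots> = const (a ^ Suc n) * (e ^ Suc n * k)"
    by (simp add: cst.sc_left_comm[of e] cst.sc_mult mult.assoc)
  finally show ?case .
qed simp

lemma cg_eig:
  assumes "k * x \<approx> const a * (x * k)" "k * y \<approx> const b * y"
  shows "k * (x * y) \<approx> const (a * b) * (x * y)"
proof -
  have "k * (x * y) \<approx> const a * (x * (k * y))" using cg_multr[OF assms(1)] by (simp add: mult.assoc)
  also have "\<dots> \<approx> const a * (x * (const b * y))" by (intro cg_multl assms)
  also have "\<dots> = const (a * b) * (x * y)" by (simp add: cst.sc_left_comm[of x] cst.sc_mult mult.assoc)
  finally show ?thesis .
qed

lemma cg_relations:
  "ge s ^ p s \<approx> 0" "gf s ^ p s \<approx> 0" "gK ^ N \<approx> 1"
  "gK * ge s * gKi \<approx> const ((q s)\<^sup>2) * ge s" "gK * gf s * gKi \<approx> const (inverse ((q s)\<^sup>2)) * gf s"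
  "ge s * ge (\<not> s) \<approx> ge (\<not> s) * ge s" "gf s * gf (\<not> s) \<approx> gf (\<not> s) * gf s"
  "ge s * gf (\<not> s) \<approx> gf (\<not> s) * ge s"
  "p s \<ge> 2 \<Longrightarrow> ge s * gf s - gf s * ge s \<approx> const (1 / (Q s - inverse (Q s))) * (gK ^ p (\<not> s) - gKi ^ p (\<not> s))"
proof -
  note R = relations_I[unfolded qg_relations_eq]
  have H: "x \<in> I" if "x \<in> half_relations s" for x
    by (rule R) (cases s; use that in simp)
  show "ge s ^ p s \<approx> 0" "gf s ^ p s \<approx> 0"
    "gK * ge s * gKi \<approx> const ((q s)\<^sup>2) * ge s" "gK * gf s * gKi \<approx> const (inverse ((q s)\<^sup>2)) * gf s"
    unfolding cg_def by (rule H; simp add: half_relations_def)+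
  show "gK ^ N \<approx> 1" unfolding cg_def by (rule R) simp
  have "ge True * ge False - ge False * ge True \<in> I" "gf True * gf False - gf False * gf True \<in> I"
    "ge True * gf False - gf False * ge True \<in> I" "gf True * ge False - ge False * gf True \<in> I"
    by (rule R, simp)+
  from this this[THEN I_uminus]
  show "ge s * ge (\<not> s) \<approx> ge (\<not> s) * ge s" "gf s * gf (\<not> s) \<approx> gf (\<not> s) * gf s"
    "ge s * gf (\<not> s) \<approx> gf (\<not> s) * ge s"
    by (cases s; simp add: cg_def)+
  assume "p s \<ge> 2"
  hence "ef_relation s \<in> I" by (intro R UnI2) force
  thus "ge s * gf s - gf s * ge s \<approx> const (1 / (Q s - inverse (Q s))) * (gK ^ p (\<not> s) - gKi ^ p (\<not> s))"
    unfolding cg_def ef_relation_def .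
qed

lemma cg_Ki: "gKi * gK \<approx> 1"
proof -
  have "gKi * gK = gK ^ N" unfolding gKi_def using N_pos by (metis power_eq_if power_commutes neq0_conv)
  thus ?thesis using cg_relations(3) by simp
qed

lemma cg_K_skew:
  assumes "gK * x * gKi \<approx> const a * x"
  shows "gK * x \<approx> const a * (x * gK)"
proof -
  have "gK * x \<approx> gK * x * (gKi * gK)" using cg_multl[OF cg_sym[OF cg_Ki], of "gK * x"] by simp
  also have "\<dots> \<approx> const a * (x * gK)" using cg_multr[OF assms, of gK] by (simp add: mult.assoc)
  finally show ?thesis .
qed

text \<open>Discrete Fourier projection onto an eigenvalue of \<open>K\<close>. It has the expected
  properties only modulo \<open>gK ^ N - 1\<close>.\<close>

definition proj :: "complex \<Rightarrow> free_alg" where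
  "proj \<kappa> = const (1 / of_nat N) * (\<Sum>l<N. const (inverse \<kappa> ^ l) * gK ^ l)"

lemma cg_K_proj:
  assumes "\<kappa> \<in> mu" shows "gK * proj \<kappa> \<approx> const \<kappa> * proj \<kappa>"
proof -
  have k: "\<kappa> \<noteq> 0" using assms mu_nz by blast
  let ?t = "\<lambda>l. const (inverse \<kappa> ^ l) * gK ^ l"
  have "gK * (\<Sum>l<N. ?t l) = (\<Sum>l<N. const \<kappa> * ?t (Suc l))"
    unfolding sum_distrib_left
  proof (intro sum.cong refl)
    fix l
    have "const \<kappa> * ?t (Suc l) = const (\<kappa> * inverse \<kappa> * inverse \<kappa> ^ l) * gK ^ Suc l"
      by (simp add: cst.sc_sc mult.assoc)
    thus "gK * ?t l = const \<kappa> * ?t (Suc l)" using k by (simp add: cst.sc_left_comm[of gK])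
  qed
  \<comment> \<open>Multiplication by \<open>K\<close> shifts the index: the summand at 0 leaves,
    the one at N enters, and the two agree modulo the ideal.\<close>
  also have "\<dots> = const \<kappa> * ((\<Sum>l<N. ?t l) - ?t 0 + ?t N)"
    unfolding sum_distrib_left[symmetric]
    using sum.lessThan_Suc_shift[of ?t N] by (simp add: algebra_simps)
  finally have 1: "gK * (\<Sum>l<N. ?t l) = const \<kappa> * ((\<Sum>l<N. ?t l) - ?t 0 + ?t N)" .
  have "?t N \<approx> const (inverse \<kappa> ^ N) * 1"
    by (intro cg_multl cg_relations(3))
  hence "(\<Sum>l<N. ?t l) - ?t 0 + ?t N \<approx> (\<Sum>l<N. ?t l) - ?t 0 + 1"
    using assms by (intro cg_add cg_refl) (simp add: mu_def power_inverse)
  hence 2: "gK * (\<Sum>l<N. ?t l) \<approx> const \<kappa> * (\<Sum>l<N. ?t l)"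
    unfolding 1 by (intro cg_multl) simp
  have "gK * proj \<kappa> = const (1 / of_nat N) * (gK * (\<Sum>l<N. ?t l))"
    unfolding proj_def by (rule cst.sc_left_comm)
  also have "\<dots> \<approx> const (1 / of_nat N) * (const \<kappa> * (\<Sum>l<N. ?t l))"
    by (intro cg_multl 2)
  also have "\<dots> = const \<kappa> * proj \<kappa>"
    unfolding proj_def by (rule cst.sc_left_comm)
  finally show ?thesis .
qed

text \<open>Orthogonality of characters. For 0 < l < N the equation z^l = 1 has fewer than N roots,
  so some z in \<open>mu\<close> violates it, and the substitution of \<kappa> z for \<kappa>
  multiplies the sum by a factor other than 1.\<close>

lemma proj_sum: "(\<Sum>\<kappa>\<in>mu. proj \<kappa>) = 1"
proof -
  have z: "(\<Sum>\<kappa>\<in>mu. inverse \<kappa> ^ l) = 0" if "0 < l" "l < N" for l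
  proof -
    have "card {z::complex. z ^ l = 1} < card mu"
      using that card_roots_unity_eq[of l] card_mu by simp
    hence "\<not> mu \<subseteq> {z::complex. z ^ l = 1}"
      using card_mono[of "{z::complex. z ^ l = 1}" mu] finite_roots_unity[of l] that by auto
    then obtain z where z: "z \<in> mu" "z ^ l \<noteq> 1" by auto
    have "(\<Sum>\<kappa>\<in>mu. inverse \<kappa> ^ l) = (\<Sum>\<kappa>\<in>mu. inverse (\<kappa> * z) ^ l)"
      by (rule sum.reindex_bij_witness[of _ "\<lambda>\<kappa>. \<kappa> * z" "\<lambda>\<kappa>. \<kappa> / z"]) (use z mu_nz in \<open>auto intro: mu_mult mu_div\<close>)
    also have "\<dots> = (\<Sum>\<kappa>\<in>mu. inverse \<kappa> ^ l) * inverse z ^ l"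
      by (simp add: sum_distrib_right power_mult_distrib inverse_mult_distrib)
    finally have "(\<Sum>\<kappa>\<in>mu. inverse \<kappa> ^ l) * (1 - inverse z ^ l) = 0" by (simp add: algebra_simps)
    moreover have "inverse z ^ l \<noteq> 1" using z by (simp add: power_inverse)
    ultimately show ?thesis by simp
  qed
  have "(\<Sum>\<kappa>\<in>mu. proj \<kappa>) = const (1 / of_nat N) * (\<Sum>l<N. const (\<Sum>\<kappa>\<in>mu. inverse \<kappa> ^ l) * gK ^ l)"
    unfolding proj_def sum_distrib_left[symmetric] cst.sc_sum sum_distrib_right by (subst sum.swap) simp
  also have "(\<Sum>l<N. const (\<Sum>\<kappa>\<in>mu. inverse \<kappa> ^ l) * gK ^ l) = (\<Sum>l<N. if l = 0 then const (of_nat N) else 0)"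
    by (intro sum.cong refl) (use z in \<open>auto simp: card_mu\<close>)
  also have "\<dots> = const (of_nat N)" using N_pos by simp
  finally show ?thesis using N_pos by (simp flip: cst.sc_mult)
qed

definition Mon :: "pbw \<Rightarrow> free_alg" where
  "Mon x = gf True ^ fi True x * (gf False ^ fi False x * (ge True ^ ei True x * (ge False ^ ei False x * proj (fst x))))"

text \<open>The monomial with the factors of side \<open>s\<close> in front. The two sides commute
  modulo the ideal, so a formula for a generator of either side can be proved once.\<close>

definition Mon' :: "bool \<Rightarrow> pbw \<Rightarrow> free_alg" where
  "Mon' s x = gf s ^ fi s x * (gf (\<not> s) ^ fi (\<not> s) x * (ge s ^ ei s x * (ge (\<not> s) ^ ei (\<not> s) x * proj (fst x))))"

lemma Mon_cg: "Mon x \<approx> Mon' s x"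
proof (cases s)
  case True thus ?thesis by (simp add: Mon_def Mon'_def)
next
  case False
  have 1: "gf True ^ m * (gf False ^ n * y) \<approx> gf False ^ n * (gf True ^ m * y)" for m n y
    using cg_multr[OF cg_comm_pow2[OF cg_relations(7)[of True]], of m n y] by (simp add: mult.assoc)
  have 2: "ge True ^ m * (ge False ^ n * y) \<approx> ge False ^ n * (ge True ^ m * y)" for m n y
    using cg_multr[OF cg_comm_pow2[OF cg_relations(6)[of True]], of m n y] by (simp add: mult.assoc)
  show ?thesis using False unfolding Mon_def Mon'_def
    by simp (intro cg_trans[OF 1] cg_multl 2)
qed

lemma eig_mu': "fst x \<in> mu \<Longrightarrow> eig x \<in> mu"
  unfolding eig_eq[of x True] rat_s power_mult by (intro mu_mult mu_div mu_pow qsq_mu) auto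

lemma K_Mon:
  assumes "fst x \<in> mu" shows "gK * Mon x \<approx> const (eig x) * Mon x"
proof -
  note E = cg_skew_pow[OF cg_K_skew[OF cg_relations(4)]] and F = cg_skew_pow[OF cg_K_skew[OF cg_relations(5)]]
  have "gK * Mon x \<approx> const (inverse ((q True)\<^sup>2) ^ fi True x * (inverse ((q False)\<^sup>2) ^ fi False x
     * (((q True)\<^sup>2) ^ ei True x * (((q False)\<^sup>2) ^ ei False x * fst x)))) * Mon x"
    unfolding Mon_def by (intro cg_eig E F cg_K_proj assms)
  also have "inverse ((q True)\<^sup>2) ^ fi True x * (inverse ((q False)\<^sup>2) ^ fi False x
     * (((q True)\<^sup>2) ^ ei True x * (((q False)\<^sup>2) ^ ei False x * fst x))) = eig x"
    by (simp add: eig_eq[of x True] rat_s power_mult divide_inverse power_inverse mult_ac)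
  finally show ?thesis .
qed

lemma eig_pow_cg: "k * y \<approx> const a * y \<Longrightarrow> k ^ n * y \<approx> const (a ^ n) * y"
proof (induction n)
  case (Suc n)
  have "k ^ Suc n * y \<approx> k * (const (a ^ n) * y)"
    using cg_multl[OF Suc.IH[OF Suc.prems], of k] by (simp add: mult.assoc)
  also have "\<dots> = const (a ^ n) * (k * y)" by (rule cst.sc_left_comm)
  also have "\<dots> \<approx> const (a ^ n) * (const a * y)" by (intro cg_multl Suc.prems)
  finally show ?case by (simp add: cst.sc_sc mult.commute)
qed simp

lemma h_Mon:
  assumes "fst x \<in> mu" "p s \<ge> 2"
  shows "const (1 / (Q s - inverse (Q s))) * (gK ^ p (\<not> s) - gKi ^ p (\<not> s)) * Mon x
    \<approx> const (coef s (fst x) (Suc (fi s x)) (ei s x) - coef s (fst x) (fi s x) (ei s x)) * Mon x"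
proof -
  have e: "eig x \<in> mu" using eig_mu'[OF assms(1)] .
  have "eig x * eig x ^ (N - 1) = 1"
    using e N_pos by (simp add: mu_def) (metis power_eq_if neq0_conv One_nat_def)
  hence inv: "eig x ^ (N - 1) = inverse (eig x)" by (rule inverse_unique[symmetric])
  have "gKi * Mon x \<approx> const (inverse (eig x)) * Mon x"
    unfolding gKi_def inv[symmetric] by (intro eig_pow_cg K_Mon assms)
  hence "(gK ^ p (\<not> s) - gKi ^ p (\<not> s)) * Mon x \<approx>
      const (eig x ^ p (\<not> s)) * Mon x - const (inverse (eig x) ^ p (\<not> s)) * Mon x"
    unfolding left_diff_distrib by (intro cg_diff eig_pow_cg K_Mon assms)
  from cg_multl[OF this, of "const (1 / (Q s - inverse (Q s)))"]
  have "const (1 / (Q s - inverse (Q s))) * (gK ^ p (\<not> s) - gKi ^ p (\<not> s)) * Mon x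
    \<approx> const (1 / (Q s - inverse (Q s)) * (eig x ^ p (\<not> s) - inverse (eig x) ^ p (\<not> s))) * Mon x"
    by (simp add: mult.assoc left_diff_distrib[symmetric] cst.sc_diff[symmetric] cst.sc_sc)
  also have "1 / (Q s - inverse (Q s)) * (eig x ^ p (\<not> s) - inverse (eig x) ^ p (\<not> s))
     = coef s (fst x) (Suc (fi s x)) (ei s x) - coef s (fst x) (fi s x) (ei s x)"
    using coef_Suc[of "fst x" s "fi s x" "ei s x"] mu_nz[OF assms(1)] assms(2) wt_eig[of s x]
    by (simp add: wt_def power_inverse)
  finally show ?thesis .
qed

text \<open>Induction on the f exponent, the bracket contributing the increment of
  \<open>coef\<close>. At i = 0 the truncated \<open>i - 1\<close> does no harm because
  \<open>coef\<close> vanishes there. Exponents may leave \<open>Dom\<close>;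
  \<open>span_Mon\<close> deals with such monomials.\<close>

lemma e_Mon':
  assumes "fst x \<in> mu" "p s \<ge> 2"
  shows "ge s * Mon' s (upd s i j x) \<approx> Mon' s (upd s i (Suc j) x) + const (coef s (fst x) i j) * Mon' s (upd s (i - 1) j x)"
proof (induction i)
  case 0
  have "ge s * gf (\<not> s) ^ n \<approx> gf (\<not> s) ^ n * ge s" for n by (intro cg_comm_pow cg_relations)
  from cg_multr[OF this] show ?case by (simp add: Mon'_def coef_0 mult.assoc)
next
  case (Suc i)
  let ?Y = "Mon' s (upd s i j x)" and ?c = "\<lambda>i. coef s (fst x) i j"
  let ?h = "const (1 / (Q s - inverse (Q s))) * (gK ^ p (\<not> s) - gKi ^ p (\<not> s))"
  have f: "Mon' s (upd s (Suc i) j x) = gf s * Mon' s (upd s i j x)" for i j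
    by (simp add: Mon'_def mult.assoc)
  have "ge s * gf s = (ge s * gf s - gf s * ge s) + gf s * ge s" by simp
  also have "\<dots> \<approx> ?h + gf s * ge s" by (intro cg_add cg_relations assms cg_refl)
  finally have "ge s * gf s \<approx> gf s * ge s + ?h" by (simp add: add.commute)
  from cg_multr[OF this, of ?Y]
  have "ge s * Mon' s (upd s (Suc i) j x) \<approx> gf s * (ge s * ?Y) + ?h * ?Y"
    unfolding f by (simp add: distrib_right mult.assoc)
  also have "\<dots> \<approx> gf s * (Mon' s (upd s i (Suc j) x) + const (?c i) * Mon' s (upd s (i - 1) j x))
      + const (?c (Suc i) - ?c i) * ?Y"
  proof (intro cg_add cg_multl Suc.IH)
    have "?h * ?Y \<approx> ?h * Mon (upd s i j x)" by (intro cg_multl cg_sym[OF Mon_cg])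
    also have "\<dots> \<approx> const (?c (Suc i) - ?c i) * Mon (upd s i j x)"
      using h_Mon[of "upd s i j x" s] assms by simp
    also have "\<dots> \<approx> const (?c (Suc i) - ?c i) * ?Y" by (intro cg_multl Mon_cg)
    finally show "?h * ?Y \<approx> const (?c (Suc i) - ?c i) * ?Y" .
  qed
  also have "\<dots> = Mon' s (upd s (Suc i) (Suc j) x) + const (?c (Suc i)) * ?Y"
  proof -
    have "gf s * (const (?c i) * Mon' s (upd s (i - 1) j x)) = const (?c i) * ?Y"
    proof (cases i)
      case 0 thus ?thesis by (simp add: coef_0)
    next
      case (Suc k)
      thus ?thesis by (simp add: f cst.sc_left_comm[of "gf s"])
    qed
    thus ?thesis by (simp add: f distrib_left cst.sc_diff left_diff_distrib)
  qed
  finally show ?case by simp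
qed

section \<open>The PBW monomials span the quotient\<close>

definition pbw_span :: "free_alg set" where
  "pbw_span = {x. \<exists>u. x \<approx> (\<Sum>d\<in>Dom. const (u d) * Mon d)}"

lemma span_cg: "x \<approx> y \<Longrightarrow> y \<in> pbw_span \<Longrightarrow> x \<in> pbw_span"
  unfolding pbw_span_def using cg_trans by blast

lemma pspan_0: "0 \<in> pbw_span"
  unfolding pbw_span_def by (rule CollectI, rule exI[of _ "\<lambda>_. 0"]) simp

lemma pspan_add: assumes "x \<in> pbw_span" "y \<in> pbw_span" shows "x + y \<in> pbw_span"
proof -
  from assms obtain u v where "x \<approx> (\<Sum>d\<in>Dom. const (u d) * Mon d)" "y \<approx> (\<Sum>d\<in>Dom. const (v d) * Mon d)"
    unfolding pbw_span_def by blast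
  from cg_add[OF this] have "x + y \<approx> (\<Sum>d\<in>Dom. const (u d + v d) * Mon d)"
    by (simp add: cst.sc_add distrib_right sum.distrib)
  thus ?thesis unfolding pbw_span_def by (intro CollectI exI)
qed

lemma pspan_scale: assumes "x \<in> pbw_span" shows "const c * x \<in> pbw_span"
proof -
  from assms obtain u where "x \<approx> (\<Sum>d\<in>Dom. const (u d) * Mon d)"
    unfolding pbw_span_def by blast
  from cg_multl[OF this, of "const c"] have "const c * x \<approx> (\<Sum>d\<in>Dom. const (c * u d) * Mon d)"
    by (simp add: sum_distrib_left cst.sc_sc)
  thus ?thesis unfolding pbw_span_def by (intro CollectI exI)
qed

lemma pspan_sum: "(\<And>a. a \<in> A \<Longrightarrow> f a \<in> pbw_span) \<Longrightarrow> sum f A \<in> pbw_span"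
  by (induction A rule: infinite_finite_induct) (auto intro: pspan_add pspan_0)

lemma pow_ge_0: "x ^ m \<approx> 0 \<Longrightarrow> m \<le> n \<Longrightarrow> x ^ n \<approx> 0"
  using cg_multr[of "x ^ m" 0 "x ^ (n - m)"] by (simp flip: power_add)

text \<open>Outside \<open>Dom\<close> some exponent has reached \<open>p s\<close>, and the
  monomial is zero modulo the ideal by e^p = 0 or f^p = 0.\<close>

lemma span_Mon: assumes "fst x \<in> mu" shows "Mon x \<in> pbw_span"
proof (cases "x \<in> Dom")
  case True
  have "(\<Sum>d\<in>Dom. const (if d = x then 1 else 0) * Mon d) = (\<Sum>d\<in>Dom. if d = x then Mon d else 0)"
    by (intro sum.cong) auto
  also have "\<dots> = Mon x" using True finite_Dom by simp
  finally have "Mon x \<approx> (\<Sum>d\<in>Dom. const (if d = x then 1 else 0) * Mon d)" by simp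
  thus ?thesis unfolding pbw_span_def by (intro CollectI exI)
next
  case False
  then obtain s where s: "p s \<le> fi s x \<or> p s \<le> ei s x"
    using assms by (auto simp: Dom_iff[of x True] not_less)
  have "Mon' s x \<approx> 0"
  proof (cases "p s \<le> fi s x")
    case True
    from cg_multr[OF pow_ge_0[OF cg_relations(2) True]] show ?thesis by (simp add: Mon'_def)
  next
    case False
    hence "p s \<le> ei s x" using s by blast
    from cg_multl[OF cg_multl[OF cg_multr[OF pow_ge_0[OF cg_relations(1) this]]]] show ?thesis by (simp add: Mon'_def)
  qed
  thus ?thesis using span_cg[OF cg_trans[OF Mon_cg] pspan_0] by blast
qed

lemma span_left:
  assumes "\<And>d. d \<in> Dom \<Longrightarrow> g * Mon d \<in> pbw_span" "x \<in> pbw_span" shows "g * x \<in> pbw_span"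
proof -
  from assms(2) obtain u where "x \<approx> (\<Sum>d\<in>Dom. const (u d) * Mon d)"
    unfolding pbw_span_def by blast
  from cg_multl[OF this, of g] have "g * x \<approx> (\<Sum>d\<in>Dom. const (u d) * (g * Mon d))"
    by (simp add: sum_distrib_left cst.sc_left_comm[of g])
  thus ?thesis by (rule span_cg) (intro pspan_sum pspan_scale assms)
qed

lemma span_gen:
  assumes "x \<in> pbw_span" shows "gen g * x \<in> pbw_span"
proof -
  have K: "gK * x \<in> pbw_span"
    by (rule span_left[OF _ assms], rule span_cg[OF K_Mon]) (auto intro!: pspan_scale span_Mon simp: Dom_iff[of _ True])
  have F: "gf s * x \<in> pbw_span" for s
  proof (rule span_left[OF _ assms])
    fix d assume d: "d \<in> Dom"
    hence mu: "fst d \<in> mu" by (simp add: Dom_iff[of _ True])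
    have "gf s * Mon d \<approx> gf s * Mon' s d" by (intro cg_multl Mon_cg)
    also have "\<dots> = Mon' s (upd s (Suc (fi s d)) (ei s d) d)" by (simp add: Mon'_def mult.assoc)
    also have "\<dots> \<approx> Mon (upd s (Suc (fi s d)) (ei s d) d)" by (rule cg_sym[OF Mon_cg])
    finally show "gf s * Mon d \<in> pbw_span" by (rule span_cg) (simp add: span_Mon mu)
  qed
  have E: "ge s * x \<in> pbw_span" for s
  proof (cases "p s = 1")
    case True
    hence "ge s \<approx> 0" using cg_relations(1)[of s] by simp
    from cg_multr[OF this, of x] show ?thesis using span_cg pspan_0 by simp
  next
    case False
    hence p2: "p s \<ge> 2" using p_pos[of s] by simp
    show ?thesis
    proof (rule span_left[OF _ assms])
      fix d assume d: "d \<in> Dom"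
      hence mu: "fst d \<in> mu" by (simp add: Dom_iff[of _ True])
      have "ge s * Mon d \<approx> ge s * Mon' s d" by (intro cg_multl Mon_cg)
      also have "\<dots> \<approx> Mon' s (upd s (fi s d) (Suc (ei s d)) d) + const (coef s (fst d) (fi s d) (ei s d)) * Mon' s (upd s (fi s d - 1) (ei s d) d)"
        using e_Mon'[OF mu p2, of "fi s d" "ei s d"] by (simp add: upd_self)
      finally show "ge s * Mon d \<in> pbw_span"
        by (rule span_cg) (intro pspan_add pspan_scale span_cg[OF cg_sym[OF Mon_cg]] span_Mon; simp add: mu)
    qed
  qed
  show ?thesis
    using K E[of True] E[of False] F[of True] F[of False] by (cases g) (simp_all add: ge_def gf_def gK_def)
qed

text \<open>The span contains 1, as the sum of the projections, and is stable under left
  multiplication by generators; so it contains every word.\<close>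

lemma span_UNIV: "x \<in> pbw_span"
proof -
  have one: "1 \<in> pbw_span"
  proof -
    have "Mon (\<kappa>, \<lambda>_. (0, 0)) = proj \<kappa>" for \<kappa> by (simp add: Mon_def fi_def ei_def)
    hence "proj \<kappa> \<in> pbw_span" if "\<kappa> \<in> mu" for \<kappa>
      using span_Mon[of "(\<kappa>, \<lambda>_. (0, 0))"] that by simp
    thus ?thesis using pspan_sum[of mu proj] proj_sum by simp
  qed
  have word: "Poly_Mapping.single (Word l) 1 \<in> pbw_span" for l
  proof (induction l)
    case Nil
    thus ?case using one by (simp flip: zero_word_def)
  next
    case (Cons g l)
    have "Poly_Mapping.single (Word (g # l)) 1 = gen g * Poly_Mapping.single (Word l) 1"
      by (simp add: gen_def mult_single plus_word_def)
    thus ?case using span_gen[OF Cons] by simp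
  qed
  have "Poly_Mapping.single w c \<in> pbw_span" for w c
    using pspan_scale[OF word, of c "letters w"] by (simp add: const_def mult_single)
  thus ?thesis by (subst poly_mapping_sum_single) (rule pspan_sum)
qed

section \<open>Linear independence and faithfulness\<close>

definition delta :: "pbw \<Rightarrow> pbw \<Rightarrow> complex" where "delta d y = (if y = d then 1 else 0)"

text \<open>The sum of all basis vectors without e and f. Having a component at every eigenvalue of
  \<open>K\<close>, it is a cyclic vector: \<open>monl d\<close> sends it to the basis vector
  \<open>delta d\<close>.\<close>

definition vac :: "pbw \<Rightarrow> complex" where "vac y = (if fst y \<in> mu \<and> snd y = (\<lambda>_. (0, 0)) then 1 else 0)"

definition wproj :: "complex \<Rightarrow> lop" where "wproj \<kappa> = Phi (proj \<kappa>)"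

lemma ap_K_vac: "ap (Kl ^ n) vac y = fst y ^ n * vac y"
proof (cases "fst y \<in> mu \<and> snd y = (\<lambda>_. (0, 0))")
  case True
  have "y \<in> Dom" using True p_pos by (simp add: Dom_iff[of _ True] fi_def ei_def)
  moreover have "eig y = fst y" using True by (simp add: eig_def rat_def)
  ultimately show ?thesis by (simp add: ap_K_pow)
qed (auto simp: ap_K_pow vac_def)

lemma ap_sum: "ap (sum f A) v x = (\<Sum>a\<in>A. ap (f a) v x)"
  by (induction A rule: infinite_finite_induct) (simp_all add: ap_simps)

lemma wproj_vac:
  assumes "\<kappa> \<in> mu" shows "ap (wproj \<kappa>) vac = delta (\<kappa>, \<lambda>_. (0, 0))"
proof
  fix y
  have "ap (wproj \<kappa>) vac y = 1 / of_nat N * (\<Sum>l<N. (inverse \<kappa> * fst y) ^ l) * vac y"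
    by (simp add: wproj_def proj_def rep.Phi_mult rep.Phi_sum rep.Phi_pow ap_simps ap_sum ap_K_vac
        sum_distrib_right sum_distrib_left power_mult_distrib mult_ac)
  also have "\<dots> = delta (\<kappa>, \<lambda>_. (0, 0)) y"
  proof (cases "fst y \<in> mu \<and> snd y = (\<lambda>_. (0, 0))")
    case False thus ?thesis using assms by (auto simp: vac_def delta_def)
  next
    case True
    show ?thesis
    proof (cases "fst y = \<kappa>")
      case True
      hence "y = (\<kappa>, \<lambda>_. (0, 0))" using \<open>fst y \<in> mu \<and> _\<close> by (simp add: prod_eq_iff)
      thus ?thesis using assms mu_nz N_pos by (simp add: delta_def vac_def)
    next
      case False
      have "inverse \<kappa> * fst y \<noteq> 1" using False assms mu_nz by (auto simp: field_simps)
      moreover have "(inverse \<kappa> * fst y) ^ N = 1" using assms True by (simp add: mu_def power_mult_distrib power_inverse)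
      ultimately have "(\<Sum>l<N. (inverse \<kappa> * fst y) ^ l) = 0" by (simp add: geometric_sum)
      thus ?thesis using False by (auto simp: delta_def)
    qed
  qed
  finally show "ap (wproj \<kappa>) vac y = delta (\<kappa>, \<lambda>_. (0, 0)) y" .
qed

text \<open>Without f factors the bracket term is absent and e only raises its own exponent. In a
  PBW monomial the e factors act before the f factors, hence on vectors of this kind.\<close>

lemma E_delta:
  assumes "d \<in> Dom" "fi s d = 0" "Suc (ei s d) < p s"
  shows "ap (El s) (delta d) = delta (upd s 0 (Suc (ei s d)) d)"
proof
  fix x
  let ?d = "upd s 0 (Suc (ei s d)) d"
  have dD: "?d \<in> Dom" using assms by (auto simp: Dom_iff[of _ s])
  have 1: "upd s (Suc (fi s x)) (ei s x) x \<noteq> d" using assms(2) by auto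
  have 2: "upd s (fi s x) (ei s x - 1) x = d \<longleftrightarrow> x = ?d" if "ei s x > 0"
  proof
    assume "upd s (fi s x) (ei s x - 1) x = d"
    hence "?d = upd s 0 (Suc (ei s x - 1)) x" "fi s x = 0" using assms(2) by auto
    thus "x = ?d" using that upd_self[of s x] by simp
  next
    assume "x = ?d"
    thus "upd s (fi s x) (ei s x - 1) x = d" using assms(2) upd_self[of s d] by simp
  qed
  define e where "e = ?d"
  have e: "e \<in> Dom" "ei s e > 0" using dD by (simp_all add: e_def)
  have "ap (El s) (delta d) x = delta e x"
    using 1 2[folded e_def] e by (cases "x = e") (auto simp: El.rep_eq delta_def)
  thus "ap (El s) (delta d) x = delta ?d x" by (simp add: e_def)
qed

lemma F_delta:
  assumes "d \<in> Dom" "Suc (fi s d) < p s"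
  shows "ap (Fl s) (delta d) = delta (upd s (Suc (fi s d)) (ei s d) d)"
proof
  fix x
  let ?d = "upd s (Suc (fi s d)) (ei s d) d"
  have dD: "?d \<in> Dom" using assms by (auto simp: Dom_iff[of _ s])
  have 2: "upd s (fi s x - 1) (ei s x) x = d \<longleftrightarrow> x = ?d" if "fi s x > 0"
  proof
    assume "upd s (fi s x - 1) (ei s x) x = d"
    hence "?d = upd s (Suc (fi s x - 1)) (ei s x) x" by auto
    thus "x = ?d" using that upd_self[of s x] by simp
  next
    assume "x = ?d"
    thus "upd s (fi s x - 1) (ei s x) x = d" using upd_self[of s d] by simp
  qed
  define e where "e = ?d"
  have e: "e \<in> Dom" "fi s e > 0" using dD by (simp_all add: e_def)
  have "ap (Fl s) (delta d) x = delta e x"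
    using 2[folded e_def] e by (cases "x = e") (auto simp: Fl.rep_eq delta_def)
  thus "ap (Fl s) (delta d) x = delta ?d x" by (simp add: e_def)
qed

lemma E_pow_delta:
  assumes "d \<in> Dom" "fi s d = 0" "ei s d = 0" "n < p s"
  shows "ap (El s ^ n) (delta d) = delta (upd s 0 n d)"
  using assms(4)
proof (induction n)
  case 0 show ?case using upd_self'[of s d 0 0] assms by (simp add: ap_simps)
next
  case (Suc n)
  have "upd s 0 n d \<in> Dom" using assms(1) Suc.prems by (auto simp: Dom_iff[of _ s])
  thus ?case using Suc E_delta[of "upd s 0 n d" s] by (simp add: ap_simps)
qed

lemma F_pow_delta:
  assumes "d \<in> Dom" "fi s d = 0" "n < p s"
  shows "ap (Fl s ^ n) (delta d) = delta (upd s n (ei s d) d)"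
  using assms(3)
proof (induction n)
  case 0 show ?case using upd_self'[of s d 0 "ei s d"] assms by (simp add: ap_simps)
next
  case (Suc n)
  have "upd s n (ei s d) d \<in> Dom" using assms(1) Suc.prems by (auto simp: Dom_iff[of _ s])
  thus ?case using Suc F_delta[of "upd s n (ei s d) d" s] by (simp add: ap_simps)
qed

definition monl :: "pbw \<Rightarrow> lop" where
  "monl x = Fl True ^ fi True x * (Fl False ^ fi False x * (El True ^ ei True x * (El False ^ ei False x * wproj (fst x))))"

lemma Phi_Mon: "Phi (Mon x) = monl x"
  by (simp add: Mon_def monl_def rep.Phi_mult rep.Phi_pow wproj_def)

lemma monl_vac: assumes "d \<in> Dom" shows "ap (monl d) vac = delta d"
proof -
  have D: "fst d \<in> mu" "fi True d < p True" "fi False d < p False" "ei True d < p True" "ei False d < p False"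
    using assms by (auto simp: Dom_iff[of _ True])
  have u: "fi True (upd False i j x) = fi True x" "ei True (upd False i j x) = ei True x"
    "fi False (upd True i j x) = fi False x" "ei False (upd True i j x) = ei False x" for i j x
    by (simp_all add: upd_def fi_def ei_def)
  let ?d0 = "(fst d, \<lambda>_::bool. (0::nat, 0::nat))"
  have z: "fi s ?d0 = 0" "ei s ?d0 = 0" for s by (simp_all add: fi_def ei_def)
  have d0: "?d0 \<in> Dom" using D p_pos by (simp add: Dom_iff[of _ True] z)
  let ?d1 = "upd False 0 (ei False d) ?d0"
  have d1: "?d1 \<in> Dom" using D d0 by (simp add: Dom_iff[of _ False] z u)
  have s1: "ap (El False ^ ei False d) (delta ?d0) = delta ?d1"
    using E_pow_delta[OF d0] D z by simp
  let ?d2 = "upd True 0 (ei True d) ?d1"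
  have d2: "?d2 \<in> Dom" using D d1 by (simp add: Dom_iff[of _ True] z u)
  have s2: "ap (El True ^ ei True d) (delta ?d1) = delta ?d2"
    using E_pow_delta[OF d1, of True "ei True d"] D z by (simp add: u)
  let ?d3 = "upd False (fi False d) (ei False d) ?d2"
  have d3: "?d3 \<in> Dom" using D d2 by (simp add: Dom_iff[of _ False] z u)
  have s3: "ap (Fl False ^ fi False d) (delta ?d2) = delta ?d3"
    using F_pow_delta[OF d2, of False "fi False d"] D z by (simp add: u)
  have s4: "ap (Fl True ^ fi True d) (delta ?d3) = delta (upd True (fi True d) (ei True d) ?d3)"
    using F_pow_delta[OF d3, of True "fi True d"] D z by (simp add: u)
  have "upd True (fi True d) (ei True d) ?d3 = d"
  proof (rule pbw_eqI)
    fix s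
    show "fi s (upd True (fi True d) (ei True d) ?d3) = fi s d" "ei s (upd True (fi True d) (ei True d) ?d3) = ei s d"
      by (cases s; simp add: u)+
  qed simp
  thus ?thesis unfolding monl_def using D s1 s2 s3 s4 by (simp add: ap_simps wproj_vac)
qed

theorem pbw_independent:
  assumes "(\<Sum>d\<in>Dom. scl (u d) * monl d) = 0" "d \<in> Dom"
  shows "u d = 0"
proof -
  have "ap (\<Sum>d\<in>Dom. scl (u d) * monl d) vac d = (\<Sum>e\<in>Dom. u e * delta e d)"
    unfolding ap_sum by (intro sum.cong) (simp_all add: ap_simps monl_vac)
  also have "\<dots> = u d" using assms(2) finite_Dom by (simp add: delta_def if_distrib cong: if_cong)
  finally show ?thesis using assms by (simp add: ap_simps)
qed

theorem pbw_spanning: "\<exists>u. Phi x = (\<Sum>d\<in>Dom. scl (u d) * monl d)"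
proof -
  obtain u where "x \<approx> (\<Sum>d\<in>Dom. const (u d) * Mon d)" using span_UNIV unfolding pbw_span_def by blast
  from cg_Phi[OF this] show ?thesis by (auto simp: rep.Phi_sum rep.Phi_mult Phi_Mon)
qed

text \<open>Modulo the ideal every element is a combination of PBW monomials, and their images are
  independent, so all coefficients vanish. From here on the quantum group can be replaced by the
  range of \<open>Phi\<close>.\<close>

theorem Phi_eq_0_iff: "Phi x = 0 \<longleftrightarrow> x \<in> I"
proof
  assume 0: "Phi x = 0"
  obtain u where u: "x \<approx> (\<Sum>d\<in>Dom. const (u d) * Mon d)" using span_UNIV unfolding pbw_span_def by blast
  from cg_Phi[OF this] have "(\<Sum>d\<in>Dom. scl (u d) * monl d) = 0"
    using 0 by (simp add: rep.Phi_sum rep.Phi_mult Phi_Mon)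
  from pbw_independent[OF this] have "(\<Sum>d\<in>Dom. const (u d) * Mon d) = 0" by (intro sum.neutral) auto
  thus "x \<in> I" using u by (simp add: cg_def)
qed (rule Phi_I)

end

section \<open>Polynomials in a ring element\<close>

context scalar_ring
begin

definition ev :: "'a \<Rightarrow> complex poly \<Rightarrow> 'a" where
  "ev T h = fold_coeffs (\<lambda>a r. sc a + T * r) h 0"

lemma ev_0 [simp]: "ev T 0 = 0"
  by (simp add: ev_def)

lemma ev_pCons: "ev T (pCons a h) = sc a + T * ev T h"
  by (cases "h = 0 \<and> a = 0") (auto simp: ev_def)

lemma ev_add: "ev T (g + h) = ev T g + ev T h"
  by (induction g h rule: poly_induct2) (simp_all add: ev_pCons sc_add algebra_simps)

lemma ev_smult: "ev T (smult c h) = sc c * ev T h"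
  by (induction h) (simp_all add: ev_pCons sc_mult distrib_left sc_left_comm[of T])

lemma ev_mult: "ev T (g * h) = ev T g * ev T h"
  by (induction g) (simp_all add: ev_pCons ev_add ev_smult distrib_right mult.assoc)

lemma ev_1 [simp]: "ev T 1 = 1"
  by (simp add: one_pCons ev_pCons)

lemma ev_diff: "ev T (g - h) = ev T g - ev T h"
  using ev_add[of T "g - h" h] by simp

lemma ev_sum: "ev T (sum f A) = (\<Sum>a\<in>A. ev T (f a))"
  by (induction A rule: infinite_finite_induct) (simp_all add: ev_add)

lemma ev_linear: "ev T [:- c, 1:] = T - sc c"
  by (simp add: ev_pCons sc_minus)

end

lemma coprime_linear: "a \<noteq> b \<Longrightarrow> coprime [:- a, 1:] [:- b, 1::complex:]"
proof (rule coprimeI)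
  fix d :: "complex poly" assume ab: "a \<noteq> b" and d: "d dvd [:- a, 1:]" "d dvd [:- b, 1:]"
  hence "d dvd [:- b, 1:] - [:- a, 1:]" by (metis dvd_diff)
  hence "d dvd [:a - b:]" by simp
  moreover have "[:a - b:] dvd 1" using ab by (simp add: is_unit_pCons_iff)
  ultimately show "is_unit d" using dvd_trans by blast
qed

lemma coprime_squares: "a \<noteq> b \<Longrightarrow> coprime ([:- a, 1:] ^ 2) ([:- b, 1::complex:] ^ 2)"
  using coprime_linear[of a b] coprime_power_left_iff[of "[:- a, 1:]" 2 "[:- b, 1:] ^ 2"]
    coprime_power_right_iff[of "[:- a, 1:]" "[:- b, 1:]" 2] by simp

lemma squares_dvd:
  fixes h :: "complex poly"
  assumes "finite G" "\<And>a. a \<in> G \<Longrightarrow> [:- a, 1:] ^ 2 dvd h"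
  shows "(\<Prod>a\<in>G. [:- a, 1:] ^ 2) dvd h"
  using assms
proof (induction G rule: finite_induct)
  case (insert a G)
  have "coprime ([:- a, 1:] ^ 2) (\<Prod>a\<in>G. [:- a, 1:] ^ 2)"
    using insert.hyps by (intro prod_coprime_right coprime_squares) auto
  thus ?case using insert by (simp add: divides_mult)
qed simp

text \<open>Chinese remainder theorem for pairwise coprime squares, by a Bezout identity between the
  square at \<open>a\<close> and the product of the others.\<close>

lemma hermite_poly:
  fixes G :: "complex set"
  assumes "finite G" "a \<in> G"
  shows "\<exists>h. [:- a, 1:] ^ 2 dvd h - 1 \<and> (\<forall>b\<in>G - {a}. [:- b, 1:] ^ 2 dvd h)"
proof -
  let ?L = "\<Prod>b\<in>G - {a}. [:- b, 1:] ^ 2"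
  have "coprime ?L ([:- a, 1:] ^ 2)"
    by (intro prod_coprime_left coprime_squares) auto
  then obtain u v where uv: "u * ?L + v * [:- a, 1:] ^ 2 = 1"
    by (metis bezout_coefficients_fst_snd coprime_imp_gcd_eq_1)
  have "u * ?L - 1 = [:- a, 1:] ^ 2 * (- v)" using uv by (simp add: algebra_simps)
  moreover have "[:- b, 1:] ^ 2 dvd u * ?L" if "b \<in> G - {a}" for b
    using assms that by (intro dvd_mult dvd_prodI) auto
  ultimately show ?thesis by (metis dvd_triv_left)
qed

text \<open>Hermite interpolation: evaluated at an element annihilated by the product of all \<open>(X - b)\<^sup>2\<close>, this
  polynomial gives the idempotent of the generalised eigenvalue \<open>a\<close>.\<close>

definition herm :: "complex set \<Rightarrow> complex \<Rightarrow> complex poly" where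
  "herm G a = (SOME h. [:- a, 1:] ^ 2 dvd h - 1 \<and> (\<forall>b\<in>G - {a}. [:- b, 1:] ^ 2 dvd h))"

lemma herm:
  assumes "finite G" "a \<in> G"
  shows "[:- a, 1:] ^ 2 dvd herm G a - 1" "b \<in> G \<Longrightarrow> b \<noteq> a \<Longrightarrow> [:- b, 1:] ^ 2 dvd herm G a"
  using someI_ex[OF hermite_poly[OF assms]] unfolding herm_def by blast+

section \<open>The center acts through two Casimir elements\<close>

context qparam
begin

abbreviation "ev \<equiv> scl.ev"

text \<open>A faithful copy of the quantum group among the operators; the center is computed here
  and transported to cosets at the end.\<close>

definition Al :: "lop set" where "Al = range Phi"
definition Cen :: "lop set" where "Cen = {a \<in> Al. \<forall>b\<in>Al. a * b = b * a}"

lemma Al_intros [intro, simp]: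
  "0 \<in> Al" "1 \<in> Al" "scl c \<in> Al" "El s \<in> Al" "Fl s \<in> Al" "Kl \<in> Al" "Ki \<in> Al" "wproj \<kappa> \<in> Al"
  by (auto simp: Al_def intro: range_eqI[of _ _ 0] range_eqI[of _ _ 1] range_eqI[of _ _ "const c"]
    range_eqI[of _ _ "ge s"] range_eqI[of _ _ "gf s"] range_eqI[of _ _ gK] range_eqI[of _ _ gKi] range_eqI[of _ _ "proj \<kappa>"] simp: wproj_def)

lemma Al_add [intro, simp]: "a \<in> Al \<Longrightarrow> b \<in> Al \<Longrightarrow> a + b \<in> Al"
  by (auto simp: Al_def rep.Phi_add[symmetric])

lemma Al_mult [intro, simp]: "a \<in> Al \<Longrightarrow> b \<in> Al \<Longrightarrow> a * b \<in> Al"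
  by (auto simp: Al_def rep.Phi_mult[symmetric])

lemma Al_pow [intro, simp]: "a \<in> Al \<Longrightarrow> a ^ n \<in> Al"
  by (induction n) auto

lemma Al_sum [intro, simp]: "(\<And>x. x \<in> A \<Longrightarrow> f x \<in> Al) \<Longrightarrow> sum f A \<in> Al"
  by (induction A rule: infinite_finite_induct) auto

lemma Al_ev [intro, simp]: "T \<in> Al \<Longrightarrow> ev T h \<in> Al"
  by (induction h) (simp_all add: scl.ev_pCons)

lemma CenD: "a \<in> Cen \<Longrightarrow> b \<in> Al \<Longrightarrow> a * b = b * a" and Cen_Al: "a \<in> Cen \<Longrightarrow> a \<in> Al"
  by (auto simp: Cen_def)

lemma Cen_scl [simp]: "scl c \<in> Cen" "1 \<in> Cen" "0 \<in> Cen"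
  by (auto simp: Cen_def scl.sc_comm)

lemma Cen_add: "a \<in> Cen \<Longrightarrow> b \<in> Cen \<Longrightarrow> a + b \<in> Cen"
  by (auto simp: Cen_def distrib_left distrib_right)

lemma Cen_mult: "a \<in> Cen \<Longrightarrow> b \<in> Cen \<Longrightarrow> a * b \<in> Cen"
proof -
  assume ab: "a \<in> Cen" "b \<in> Cen"
  have "a * b * c = c * (a * b)" if "c \<in> Al" for c
  proof -
    have "a * b * c = a * (c * b)" using CenD[OF ab(2) that] by (simp add: mult.assoc)
    also have "\<dots> = c * (a * b)" using CenD[OF ab(1) that] by (simp flip: mult.assoc)
    finally show ?thesis .
  qed
  moreover have "a * b \<in> Al" using ab by (intro Al_mult Cen_Al)
  ultimately show ?thesis unfolding Cen_def by blast
qed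

lemma Cen_ev: "T \<in> Cen \<Longrightarrow> ev T h \<in> Cen"
  by (induction h) (auto simp: scl.ev_pCons intro: Cen_add Cen_mult)

lemma Cen_lcomm: "a \<in> Cen \<Longrightarrow> b \<in> Al \<Longrightarrow> b * (a * c) = a * (b * c)"
  using CenD[of a b] by (simp flip: mult.assoc)

lemma Cen_iff_gens:
  assumes "a \<in> Al" "\<And>s. a * El s = El s * a" "\<And>s. a * Fl s = Fl s * a" "a * Kl = Kl * a"
  shows "a \<in> Cen"
proof -
  have g: "a * genop g = genop g * a" for g
    using assms by (cases g) (simp_all add: genop_def)
  have "a * foldr (\<lambda>g T. genop g * T) l 1 = foldr (\<lambda>g T. genop g * T) l 1 * a" for l
    by (induction l) (simp_all add: g mult.assoc flip: mult.assoc[of a])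
  hence "a * rep.wop w = rep.wop w * a" for w by (simp add: rep.wop_def)
  hence "a * Phi x = Phi x * a" for x
    by (simp add: rep.Phi_def sum_distrib_left sum_distrib_right scl.sc_left_comm[of a] mult.assoc)
  thus ?thesis using assms(1) by (auto simp: Cen_def Al_def)
qed

lemma K_wproj: "\<kappa> \<in> mu \<Longrightarrow> Kl * wproj \<kappa> = scl \<kappa> * wproj \<kappa>"
  using cg_Phi[OF cg_K_proj] by (simp add: rep.Phi_mult wproj_def)

lemma wproj_sum: "(\<Sum>\<kappa>\<in>mu. wproj \<kappa>) = 1"
  unfolding wproj_def rep.Phi_sum[symmetric] proj_sum by simp

lemma wproj_formula: "wproj \<kappa> = scl (1 / of_nat N) * (\<Sum>l<N. scl (inverse \<kappa> ^ l) * Kl ^ l)"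
  by (simp add: wproj_def proj_def rep.Phi_mult rep.Phi_sum rep.Phi_pow)

lemma K_pow_wproj: "\<kappa> \<in> mu \<Longrightarrow> Kl ^ n * wproj \<kappa> = scl (\<kappa> ^ n) * wproj \<kappa>"
proof (induction n)
  case (Suc n)
  have "Kl ^ Suc n * wproj \<kappa> = Kl * (Kl ^ n * wproj \<kappa>)" by (simp add: mult.assoc)
  also have "\<dots> = scl (\<kappa> ^ n) * (Kl * wproj \<kappa>)" using Suc by (simp add: scl.sc_left_comm[of Kl])
  finally show ?case using Suc.prems by (simp add: K_wproj scl.sc_sc mult.commute)
qed simp

lemma Ki_pow_wproj: assumes "\<kappa> \<in> mu" shows "Ki ^ n * wproj \<kappa> = scl (inverse (\<kappa> ^ n)) * wproj \<kappa>"
proof -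
  have "\<kappa> * \<kappa> ^ (N - 1) = \<kappa> ^ N" using N_pos by (metis power_eq_if neq0_conv)
  hence "\<kappa> * \<kappa> ^ (N - 1) = 1" using assms unfolding mu_def by simp
  hence "\<kappa> ^ (N - 1) = inverse \<kappa>" by (rule inverse_unique[symmetric])
  moreover have "Ki ^ n * wproj \<kappa> = scl ((\<kappa> ^ (N - 1)) ^ n) * wproj \<kappa>"
    using K_pow_wproj[OF assms, of "(N - 1) * n"] by (simp only: Ki_def power_mult)
  ultimately show ?thesis by (simp add: power_inverse)
qed

lemma wproj_wproj:
  assumes "\<kappa> \<in> mu" "\<kappa>' \<in> mu" shows "wproj \<kappa> * wproj \<kappa>' = (if \<kappa> = \<kappa>' then wproj \<kappa> else 0)"
proof -
  have "wproj \<kappa> * wproj \<kappa>' = scl (1 / of_nat N * (\<Sum>l<N. (inverse \<kappa> * \<kappa>') ^ l)) * wproj \<kappa>'"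
    by (subst wproj_formula) (simp add: sum_distrib_right sum_distrib_left mult.assoc K_pow_wproj assms scl.sc_sc
        scl.sc_sum scl.sc_mult power_mult_distrib)
  also have "\<dots> = (if \<kappa> = \<kappa>' then wproj \<kappa> else 0)"
  proof (cases "\<kappa> = \<kappa>'")
    case True thus ?thesis using assms mu_nz N_pos by simp
  next
    case False
    have "inverse \<kappa> * \<kappa>' \<noteq> 1" using False assms mu_nz by (auto simp: field_simps)
    moreover have "(inverse \<kappa> * \<kappa>') ^ N = 1" using assms by (simp add: mu_def power_mult_distrib power_inverse)
    ultimately have "(\<Sum>l<N. (inverse \<kappa> * \<kappa>') ^ l) = 0" by (simp add: geometric_sum)
    thus ?thesis using False by simp
  qed
  finally show ?thesis .
qed

text \<open>The projections sum to 1, so identities may be checked on one weight space at a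
  time.\<close>

lemma wproj_ext: assumes "\<And>\<kappa>. \<kappa> \<in> mu \<Longrightarrow> a * wproj \<kappa> = b * wproj \<kappa>" shows "a = b"
proof -
  have "a * (\<Sum>\<kappa>\<in>mu. wproj \<kappa>) = b * (\<Sum>\<kappa>\<in>mu. wproj \<kappa>)"
    using assms by (simp add: sum_distrib_left)
  thus ?thesis by (simp add: wproj_sum)
qed

lemma wproj_skew:
  assumes "Kl * x = scl a * (x * Kl)" "a \<noteq> 0"
  shows "wproj (\<kappa> * a) * x = x * wproj \<kappa>"
proof -
  have K: "Kl ^ n * x = scl (a ^ n) * (x * Kl ^ n)" for n
  proof (induction n)
    case (Suc n)
    have "Kl ^ Suc n * x = Kl * (Kl ^ n * x)" by (simp add: mult.assoc)
    also have "\<dots> = scl (a ^ n) * ((Kl * x) * Kl ^ n)" by (simp add: Suc scl.sc_left_comm[of Kl] mult.assoc)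
    also have "\<dots> = scl (a ^ Suc n) * (x * Kl ^ Suc n)"
      unfolding assms(1) by (simp add: scl.sc_sc mult.assoc mult.commute[of a])
    finally show ?case .
  qed simp
  have "scl (inverse (\<kappa> * a) ^ l) * (Kl ^ l * x) = x * (scl (inverse \<kappa> ^ l) * Kl ^ l)" for l
  proof -
    have "inverse (\<kappa> * a) * a = inverse \<kappa>" using assms(2) by simp
    hence "inverse (\<kappa> * a) ^ l * a ^ l = inverse \<kappa> ^ l" by (metis power_mult_distrib)
    thus ?thesis by (simp only: K scl.sc_sc scl.sc_left_comm[of x])
  qed
  thus ?thesis
    unfolding wproj_formula by (simp add: sum_distrib_left sum_distrib_right mult.assoc scl.sc_left_comm[of x])
qed

lemma wproj_El: "wproj (\<kappa> * (q s)\<^sup>2) * El s = El s * wproj \<kappa>"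
  by (rule wproj_skew[OF K_El]) simp

lemma wproj_Fl: "wproj \<kappa> * Fl s = Fl s * wproj (\<kappa> * (q s)\<^sup>2)"
  using wproj_skew[OF K_Fl, of s "\<kappa> * (q s)\<^sup>2"] by (simp add: mult.assoc)

section \<open>Weight shifts and the Casimir elements\<close>

definition sh :: "bool \<Rightarrow> complex \<Rightarrow> complex" where "sh s \<kappa> = \<kappa> * (q s)\<^sup>2"

lemma sh_mu: "\<kappa> \<in> mu \<Longrightarrow> sh s \<kappa> \<in> mu"
  by (simp add: sh_def mu_mult qsq_mu)

lemma sh_surj: "\<kappa> \<in> mu \<Longrightarrow> \<exists>\<kappa>'\<in>mu. \<kappa> = sh s \<kappa>'"
  by (rule bexI[of _ "\<kappa> / (q s)\<^sup>2"]) (auto simp: sh_def mu_div qsq_mu)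

lemma El_wproj: "El s * wproj \<kappa> = wproj (sh s \<kappa>) * El s" and Fl_wproj: "Fl s * wproj (sh s \<kappa>) = wproj \<kappa> * Fl s"
  by (simp_all add: sh_def wproj_El wproj_Fl)

lemma El_prl2: "El s * (wproj \<kappa> * y) = wproj (sh s \<kappa>) * (El s * y)"
  and Fl_prl2: "Fl s * (wproj (sh s \<kappa>) * y) = wproj \<kappa> * (Fl s * y)"
  using El_wproj[of s \<kappa>] Fl_wproj[of s \<kappa>] by (simp_all flip: mult.assoc)

lemma wt_sh: "wt s (sh s \<kappa>) = wt s \<kappa> * (Q s)\<^sup>2" "wt (\<not> s) (sh s \<kappa>) = wt (\<not> s) \<kappa>" "wt s (sh (\<not> s) \<kappa>) = wt s \<kappa>"
  using wt_shift[of s] wt_shift'[of s] wt_shift'[of "\<not> s"] by (simp_all add: sh_def)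

text \<open>The usual quantum Casimir multiplied by \<open>om s\<close>, hence free of denominators.
  For \<open>p s = 1\<close> the f e term drops out and only Cartan terms remain.\<close>

definition casimir :: "bool \<Rightarrow> lop" where
  "casimir s = scl (om s) * (Fl s * El s) + scl (Q s) * Kl ^ p (\<not> s) + scl (inverse (Q s)) * Ki ^ p (\<not> s)"

lemma casimir_Al [simp]: "casimir s \<in> Al" by (simp add: casimir_def)

lemma om_FE:
  assumes "\<kappa> \<in> mu"
  shows "scl (om s) * (Fl s * (El s * wproj \<kappa>)) = (casimir s - scl (cas s (wt s \<kappa>))) * wproj \<kappa>"
  by (simp add: casimir_def distrib_right left_diff_distrib mult.assoc K_pow_wproj[OF assms] Ki_pow_wproj[OF assms]
      scl.sc_sc cas_def wt_def scl.sc_add inverse_mult_distrib)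

text \<open>The linear factor is that of f e at the weight below, since \<open>cas_diff\<close>
  absorbs the bracket into the change of the Casimir value. On vectors where the Casimir takes this
  value, f e and e f vanish on the two sides of the step; this is the origin of the walls.\<close>

lemma om_EF:
  assumes "\<kappa> \<in> mu"
  shows "scl (om s) * (El s * (Fl s * wproj (sh s \<kappa>))) = (casimir s - scl (cas s (wt s \<kappa>))) * wproj (sh s \<kappa>)"
proof -
  let ?\<kappa> = "sh s \<kappa>" and ?w = "wt s (sh s \<kappa>)"
  have m: "?\<kappa> \<in> mu" using assms by (rule sh_mu)
  have w: "?w \<noteq> 0" using mu_nz[OF m] by (simp add: wt_def)
  have cd: "cas s ?w - cas s (wt s \<kappa>) = (Q s - inverse (Q s)) * (?w - inverse ?w)"
    using cas_diff[OF w, of s] by (simp add: wt_sh)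
  have "scl (om s) * (El s * (Fl s * wproj ?\<kappa>)) = scl (om s) * (Fl s * (El s * wproj ?\<kappa>))
     + scl (cas s ?w - cas s (wt s \<kappa>)) * wproj ?\<kappa>"
  proof (cases "p s = 1")
    case True
    thus ?thesis using Q_pm_1[OF True] by (simp add: om_def cd)
  next
    case False
    hence p2: "p s \<ge> 2" using p_pos[of s] by linarith
    have "El s * Fl s * wproj ?\<kappa> = Fl s * El s * wproj ?\<kappa> + scl (1 / (Q s - inverse (Q s)) * (?w - inverse ?w)) * wproj ?\<kappa>"
      unfolding El_Fl[OF p2]
      by (simp add: distrib_right left_diff_distrib right_diff_distrib mult.assoc K_pow_wproj[OF m] Ki_pow_wproj[OF m] wt_def scl.sc_diff scl.sc_sc)
    moreover have "om s * (1 / (Q s - inverse (Q s)) * (?w - inverse ?w)) = cas s ?w - cas s (wt s \<kappa>)"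
      unfolding cd using om_nz[OF p2] by (auto simp: om_def power2_eq_square)
    ultimately show ?thesis by (simp add: mult.assoc distrib_left scl.sc_sc)
  qed
  also have "\<dots> = (casimir s - scl (cas s (wt s \<kappa>))) * wproj ?\<kappa>"
    unfolding om_FE[OF m] by (simp add: left_diff_distrib scl.sc_diff)
  finally show ?thesis .
qed

lemma casimir_wproj: assumes "\<kappa> \<in> mu"
  shows "casimir s * wproj \<kappa> = scl (om s) * (Fl s * (El s * wproj \<kappa>)) + scl (cas s (wt s \<kappa>)) * wproj \<kappa>"
  unfolding om_FE[OF assms] by (simp add: left_diff_distrib)

lemma casimir_prl': assumes "\<kappa> \<in> mu"
  shows "casimir s * wproj (sh s \<kappa>) = scl (om s) * (El s * (Fl s * wproj (sh s \<kappa>))) + scl (cas s (wt s \<kappa>)) * wproj (sh s \<kappa>)"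
  unfolding om_EF[OF assms] by (simp add: left_diff_distrib)

text \<open>On \<kappa> the Casimir is \<open>om s\<close> f e plus a constant, on the shifted
  weight \<open>om s\<close> e f plus the same constant. With the suitable form on each side of e or
  f the two products coincide. Generators of the other side commute with f e and leave the constant
  unchanged.\<close>

lemma casimir_Cen: "casimir s \<in> Cen"
proof (rule Cen_iff_gens)
  have E: "casimir s * El s = El s * casimir s"
  proof (rule wproj_ext)
    fix \<kappa> assume k: "\<kappa> \<in> mu"
    have "casimir s * El s * wproj \<kappa> = (casimir s * wproj (sh s \<kappa>)) * El s" by (simp add: mult.assoc El_wproj)
    also have "\<dots> = scl (om s) * (El s * (Fl s * (El s * wproj \<kappa>))) + scl (cas s (wt s \<kappa>)) * (El s * wproj \<kappa>)"
      unfolding casimir_prl'[OF k] by (simp add: distrib_right mult.assoc El_wproj)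
    also have "\<dots> = El s * (casimir s * wproj \<kappa>)"
      unfolding casimir_wproj[OF k] by (simp add: distrib_left scl.sc_left_comm[of "El s"])
    finally show "casimir s * El s * wproj \<kappa> = El s * casimir s * wproj \<kappa>" by (simp add: mult.assoc)
  qed
  have F: "casimir s * Fl s = Fl s * casimir s"
  proof (rule wproj_ext)
    fix \<kappa>' assume "\<kappa>' \<in> mu"
    then obtain \<kappa> where k: "\<kappa> \<in> mu" "\<kappa>' = sh s \<kappa>" using sh_surj by blast
    have "casimir s * Fl s * wproj \<kappa>' = (casimir s * wproj \<kappa>) * Fl s" by (simp add: mult.assoc Fl_wproj k)
    also have "\<dots> = scl (om s) * (Fl s * (El s * (Fl s * wproj \<kappa>'))) + scl (cas s (wt s \<kappa>)) * (Fl s * wproj \<kappa>')"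
      unfolding casimir_wproj[OF k(1)] by (simp add: distrib_right mult.assoc Fl_wproj k)
    also have "\<dots> = Fl s * (casimir s * wproj \<kappa>')"
      unfolding k(2) casimir_prl'[OF k(1)] by (simp add: distrib_left scl.sc_left_comm[of "Fl s"])
    finally show "casimir s * Fl s * wproj \<kappa>' = Fl s * casimir s * wproj \<kappa>'" by (simp add: mult.assoc)
  qed
  have FE': "Fl s * (El s * El (\<not> s)) = El (\<not> s) * (Fl s * El s)"
    using El_Fl'[of "\<not> s"] El_El[of s] by (simp flip: mult.assoc; simp add: mult.assoc)
  have FF': "Fl s * (El s * Fl (\<not> s)) = Fl (\<not> s) * (Fl s * El s)"
    using El_Fl'[of s] Fl_Fl[of s] by (simp flip: mult.assoc; simp add: mult.assoc)
  have E': "casimir s * El (\<not> s) = El (\<not> s) * casimir s"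
  proof (rule wproj_ext)
    fix \<kappa> assume k: "\<kappa> \<in> mu"
    have "casimir s * El (\<not> s) * wproj \<kappa> = (casimir s * wproj (sh (\<not> s) \<kappa>)) * El (\<not> s)" by (simp add: mult.assoc El_wproj)
    also have "\<dots> = scl (om s) * (Fl s * (El s * El (\<not> s)) * wproj \<kappa>) + scl (cas s (wt s \<kappa>)) * (El (\<not> s) * wproj \<kappa>)"
      unfolding casimir_wproj[OF sh_mu[OF k]] by (simp add: distrib_right mult.assoc El_wproj El_prl2 Fl_wproj Fl_prl2 wt_sh)
    also have "\<dots> = El (\<not> s) * (casimir s * wproj \<kappa>)"
      unfolding casimir_wproj[OF k] FE' by (simp add: distrib_left scl.sc_left_comm[of "El (\<not> s)"] mult.assoc)
    finally show "casimir s * El (\<not> s) * wproj \<kappa> = El (\<not> s) * casimir s * wproj \<kappa>" by (simp add: mult.assoc)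
  qed
  have F': "casimir s * Fl (\<not> s) = Fl (\<not> s) * casimir s"
  proof (rule wproj_ext)
    fix \<kappa>' assume "\<kappa>' \<in> mu"
    then obtain \<kappa> where k: "\<kappa> \<in> mu" "\<kappa>' = sh (\<not> s) \<kappa>" using sh_surj by blast
    have "casimir s * Fl (\<not> s) * wproj \<kappa>' = (casimir s * wproj \<kappa>) * Fl (\<not> s)" by (simp add: mult.assoc Fl_wproj k)
    also have "\<dots> = scl (om s) * (Fl s * (El s * Fl (\<not> s)) * wproj \<kappa>') + scl (cas s (wt s \<kappa>)) * (Fl (\<not> s) * wproj \<kappa>')"
      unfolding casimir_wproj[OF k(1)] by (simp add: distrib_right mult.assoc El_wproj El_prl2 Fl_wproj Fl_prl2 k)
    also have "\<dots> = Fl (\<not> s) * (casimir s * wproj \<kappa>')"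
      unfolding k(2) casimir_wproj[OF sh_mu[OF k(1)]] FF' by (simp add: distrib_left scl.sc_left_comm[of "Fl (\<not> s)"] mult.assoc wt_sh)
    finally show "casimir s * Fl (\<not> s) * wproj \<kappa>' = Fl (\<not> s) * casimir s * wproj \<kappa>'" by (simp add: mult.assoc)
  qed
  show "casimir s \<in> Al" by simp
  show "casimir s * El t = El t * casimir s" for t using E E' by (cases "t = s") auto
  show "casimir s * Fl t = Fl t * casimir s" for t using F F' by (cases "t = s") auto
  show "casimir s * Kl = Kl * casimir s"
  proof (rule wproj_ext)
    fix \<kappa> assume k: "\<kappa> \<in> mu"
    have FE: "Fl s * (El s * wproj \<kappa>) = wproj \<kappa> * (Fl s * El s)"
      unfolding El_wproj by (simp add: Fl_wproj flip: mult.assoc)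
    have XP: "casimir s * wproj \<kappa> = wproj \<kappa> * (scl (om s) * (Fl s * El s) + scl (cas s (wt s \<kappa>)))"
      unfolding casimir_wproj[OF k] FE by (simp add: distrib_left scl.sc_left_comm[of "wproj \<kappa>"] scl.sc_comm[of _ "wproj \<kappa>"])
    have "casimir s * Kl * wproj \<kappa> = scl \<kappa> * (casimir s * wproj \<kappa>)"
      by (simp add: mult.assoc K_wproj[OF k] scl.sc_left_comm[of "casimir s"])
    also have "\<dots> = Kl * (casimir s * wproj \<kappa>)"
      unfolding XP by (simp add: K_wproj[OF k] flip: mult.assoc)
    finally show "casimir s * Kl * wproj \<kappa> = Kl * casimir s * wproj \<kappa>" by (simp add: mult.assoc)
  qed
qed

subsection \<open>Products of linear factors on weight spaces\<close>

text \<open>Casimir value of a highest weight vector t steps above \<kappa>. For t < p these are the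
  roots of a polynomial annihilating the Casimir on the weight space of \<kappa>.\<close>

definition wq :: "bool \<Rightarrow> complex \<Rightarrow> nat \<Rightarrow> complex" where "wq s \<kappa> t = cas s (wt s \<kappa> * Q s ^ (2 * t))"

definition FE :: "bool \<Rightarrow> nat \<Rightarrow> complex \<Rightarrow> lop" where "FE s i \<kappa> = Fl s ^ i * (El s ^ i * wproj \<kappa>)"

lemma sh_pow: "El s ^ i * wproj \<kappa> = wproj ((sh s ^^ i) \<kappa>) * El s ^ i"
proof (induction i)
  case (Suc i)
  have "El s ^ Suc i * wproj \<kappa> = El s * (El s ^ i * wproj \<kappa>)" by (simp add: mult.assoc)
  also have "\<dots> = El s * wproj ((sh s ^^ i) \<kappa>) * El s ^ i" by (simp only: Suc mult.assoc)
  finally show ?case by (simp add: El_wproj mult.assoc)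
qed simp

lemma sh_pow_mu: "\<kappa> \<in> mu \<Longrightarrow> (sh s ^^ i) \<kappa> \<in> mu"
  by (induction i) (auto intro: sh_mu)

lemma wt_sh_pow: "cas s (wt s ((sh s ^^ i) \<kappa>)) = wq s \<kappa> i"
proof -
  have "wt s ((sh s ^^ i) \<kappa>) = wt s \<kappa> * Q s ^ (2 * i)"
    by (induction i) (simp_all add: wt_sh power_add power2_eq_square mult_ac)
  thus ?thesis by (simp add: wq_def)
qed

lemma casimir_FE:
  assumes "\<kappa> \<in> mu"
  shows "casimir s * FE s i \<kappa> = scl (om s) * FE s (Suc i) \<kappa> + scl (wq s \<kappa> i) * FE s i \<kappa>"
proof -
  let ?k = "(sh s ^^ i) \<kappa>"
  have "casimir s * FE s i \<kappa> = Fl s ^ i * ((casimir s * wproj ?k) * El s ^ i)"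
    unfolding FE_def by (subst Cen_lcomm[OF casimir_Cen, symmetric]) (simp_all add: sh_pow mult.assoc)
  also have "\<dots> = scl (om s) * (Fl s ^ i * (Fl s * (El s * (wproj ?k * El s ^ i)))) + scl (wq s \<kappa> i) * (Fl s ^ i * (wproj ?k * El s ^ i))"
    unfolding casimir_wproj[OF sh_pow_mu[OF assms]] wt_sh_pow
    by (simp add: distrib_left distrib_right mult.assoc scl.sc_left_comm[of "Fl s ^ i"])
  also have "Fl s ^ i * (Fl s * (El s * (wproj ?k * El s ^ i))) = FE s (Suc i) \<kappa>"
    unfolding FE_def sh_pow[symmetric] by (simp add: power_commutes flip: mult.assoc)
  finally show ?thesis by (simp add: FE_def sh_pow[symmetric])
qed

text \<open>By \<open>casimir_FE\<close> the Casimir minus \<open>wq s \<kappa> n\<close> sends f^n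
  e^n to \<open>om s\<close> f^(n+1) e^(n+1), with no lower term. At n = p the right-hand side is
  zero, which yields the annihilating polynomial.\<close>

lemma ev_FE:
  assumes "\<kappa> \<in> mu"
  shows "ev (casimir s) (\<Prod>t<n. [:- wq s \<kappa> t, 1:]) * wproj \<kappa> = scl (om s ^ n) * FE s n \<kappa>"
proof (induction n)
  case 0 show ?case by (simp add: FE_def)
next
  case (Suc n)
  have "ev (casimir s) (\<Prod>t<Suc n. [:- wq s \<kappa> t, 1:]) * wproj \<kappa>
    = (casimir s - scl (wq s \<kappa> n)) * (ev (casimir s) (\<Prod>t<n. [:- wq s \<kappa> t, 1:]) * wproj \<kappa>)"
    by (simp only: prod.lessThan_Suc mult.commute[of "prod _ _"] scl.ev_mult scl.ev_linear mult.assoc)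
  also have "\<dots> = scl (om s ^ n) * ((casimir s - scl (wq s \<kappa> n)) * FE s n \<kappa>)"
    unfolding Suc by (rule scl.sc_left_comm)
  also have "(casimir s - scl (wq s \<kappa> n)) * FE s n \<kappa> = scl (om s) * FE s (Suc n) \<kappa>"
    by (simp add: left_diff_distrib casimir_FE[OF assms])
  finally show ?case by (simp add: scl.sc_sc mult.commute)
qed

text \<open>For arbitrary roots lower terms appear, but the leading term in f^n e^n stays the same.
  This is the form used once a root has been left out.\<close>

lemma ev_lead:
  assumes "\<kappa> \<in> mu"
  shows "\<exists>a. ev (casimir s) (\<Prod>t<n. [:- d t, 1:]) * wproj \<kappa> = scl (om s ^ n) * FE s n \<kappa> + (\<Sum>i<n. scl (a i) * FE s i \<kappa>)"
proof (induction n)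
  case 0 show ?case by (simp add: FE_def)
next
  case (Suc n)
  then obtain a where a: "ev (casimir s) (\<Prod>t<n. [:- d t, 1:]) * wproj \<kappa> = scl (om s ^ n) * FE s n \<kappa> + (\<Sum>i<n. scl (a i) * FE s i \<kappa>)" by blast
  \<comment> \<open>Three contributions: the rescaled old leading term, the lower terms raised by
    one step, and the lower terms rescaled by the new factor.\<close>
  define b where "b i = (if i = n then om s ^ n * (wq s \<kappa> n - d n) else 0) + (if i = 0 then 0 else a (i - 1) * om s)
      + (if i < n then a i * (wq s \<kappa> i - d n) else 0)" for i
  have F: "(casimir s - scl c) * FE s i \<kappa> = scl (om s) * FE s (Suc i) \<kappa> + scl (wq s \<kappa> i - c) * FE s i \<kappa>" for i c
    by (simp add: left_diff_distrib casimir_FE[OF assms] scl.sc_diff)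
  have "ev (casimir s) (\<Prod>t<Suc n. [:- d t, 1:]) * wproj \<kappa>
    = (casimir s - scl (d n)) * (ev (casimir s) (\<Prod>t<n. [:- d t, 1:]) * wproj \<kappa>)"
    by (simp only: prod.lessThan_Suc mult.commute[of "prod _ _"] scl.ev_mult scl.ev_linear mult.assoc)
  also have "\<dots> = scl (om s ^ n) * ((casimir s - scl (d n)) * FE s n \<kappa>) + (\<Sum>i<n. scl (a i) * ((casimir s - scl (d n)) * FE s i \<kappa>))"
    unfolding a by (simp add: distrib_left sum_distrib_left scl.sc_left_comm[of "casimir s - scl (d n)"])
  also have "\<dots> = scl (om s ^ Suc n) * FE s (Suc n) \<kappa> + (scl (om s ^ n * (wq s \<kappa> n - d n)) * FE s n \<kappa>
      + (\<Sum>i<n. scl (a i * om s) * FE s (Suc i) \<kappa>) + (\<Sum>i<n. scl (a i * (wq s \<kappa> i - d n)) * FE s i \<kappa>))"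
    unfolding F by (simp add: distrib_left scl.sc_sc sum.distrib mult.commute add.assoc)
  also have "scl (om s ^ n * (wq s \<kappa> n - d n)) * FE s n \<kappa>
      + (\<Sum>i<n. scl (a i * om s) * FE s (Suc i) \<kappa>) + (\<Sum>i<n. scl (a i * (wq s \<kappa> i - d n)) * FE s i \<kappa>)
     = (\<Sum>i<Suc n. scl (b i) * FE s i \<kappa>)"
  proof -
    have 1: "(\<Sum>i<Suc n. scl (if i = n then om s ^ n * (wq s \<kappa> n - d n) else 0) * FE s i \<kappa>) = scl (om s ^ n * (wq s \<kappa> n - d n)) * FE s n \<kappa>"
      by simp
    have 2: "(\<Sum>i<Suc n. scl (if i = 0 then 0 else a (i - 1) * om s) * FE s i \<kappa>) = (\<Sum>i<n. scl (a i * om s) * FE s (Suc i) \<kappa>)"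
      by (subst sum.lessThan_Suc_shift) simp
    have 3: "(\<Sum>i<Suc n. scl (if i < n then a i * (wq s \<kappa> i - d n) else 0) * FE s i \<kappa>) = (\<Sum>i<n. scl (a i * (wq s \<kappa> i - d n)) * FE s i \<kappa>)"
      by simp
    show ?thesis unfolding b_def scl.sc_add distrib_right sum.distrib 1 2 3 ..
  qed
  finally show ?case by blast
qed

definition diag_idx :: "bool \<Rightarrow> complex \<Rightarrow> nat \<Rightarrow> nat \<Rightarrow> pbw" where
  "diag_idx s \<kappa> i j = (\<kappa>, \<lambda>t. if t = s then (i, i) else (j, j))"

lemma diag_idx_simps: "fst (diag_idx s \<kappa> i j) = \<kappa>" "fi s (diag_idx s \<kappa> i j) = i" "ei s (diag_idx s \<kappa> i j) = i"
  "fi (\<not> s) (diag_idx s \<kappa> i j) = j" "ei (\<not> s) (diag_idx s \<kappa> i j) = j"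
  by (simp_all add: diag_idx_def fi_def ei_def)

lemma pow_comm: "a * b = b * a \<Longrightarrow> (a::lop) ^ m * b ^ n = b ^ n * a ^ m"
  by (metis power_commuting_commutes)

lemma monl_sym: "monl x = Fl s ^ fi s x * (Fl (\<not> s) ^ fi (\<not> s) x * (El s ^ ei s x * (El (\<not> s) ^ ei (\<not> s) x * wproj (fst x))))"
proof (cases s)
  case True thus ?thesis by (simp add: monl_def)
next
  case False
  have "Fl True ^ m * (Fl False ^ n * (El True ^ k * (El False ^ l * y))) = Fl False ^ n * (Fl True ^ m * (El False ^ l * (El True ^ k * y)))" for m n k l y
    using pow_comm[OF Fl_Fl[of True], of m n] pow_comm[OF El_El[of True], of k l]
    by (simp flip: mult.assoc; simp add: mult.assoc)
  thus ?thesis using False by (simp add: monl_def)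
qed

lemma FE_monl: "Fl s ^ i * (El s ^ i * FE (\<not> s) j \<kappa>) = monl (diag_idx s \<kappa> i j)"
  unfolding monl_sym[of _ s] diag_idx_simps FE_def
  using pow_comm[OF El_Fl'[of s], of i j] by (simp flip: mult.assoc; simp add: mult.assoc)

lemma FE_indep:
  assumes "\<kappa> \<in> mu" "(\<Sum>i<p s. \<Sum>j<p (\<not> s). scl (b i j) * (Fl s ^ i * (El s ^ i * FE (\<not> s) j \<kappa>))) = 0" "i < p s" "j < p (\<not> s)"
  shows "b i j = 0"
proof -
  let ?S = "(\<lambda>(i, j). diag_idx s \<kappa> i j) ` ({..<p s} \<times> {..<p (\<not> s)})"
  have inj: "inj_on (\<lambda>(i, j). diag_idx s \<kappa> i j) ({..<p s} \<times> {..<p (\<not> s)})"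
    using diag_idx_simps(2,4) by (auto simp: inj_on_def dest: arg_cong[of "diag_idx s \<kappa> _ _" _ "fi s"] arg_cong[of "diag_idx s \<kappa> _ _" _ "fi (\<not> s)"])
  have sub: "?S \<subseteq> Dom" using assms(1) by (auto simp: Dom_iff[of _ s] diag_idx_simps)
  define u where "u d = (if d \<in> ?S then b (fi s d) (fi (\<not> s) d) else 0)" for d
  have "(\<Sum>d\<in>Dom. scl (u d) * monl d) = (\<Sum>d\<in>?S. scl (u d) * monl d)"
    by (rule sum.mono_neutral_right[OF finite_Dom sub]) (simp add: u_def)
  also have "\<dots> = (\<Sum>(i, j)\<in>{..<p s} \<times> {..<p (\<not> s)}. scl (b i j) * monl (diag_idx s \<kappa> i j))"
    by (subst sum.reindex[OF inj]) (auto intro!: sum.cong simp: u_def diag_idx_simps)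
  also have "\<dots> = 0" using assms(2) by (simp add: sum.cartesian_product FE_monl)
  finally have z: "(\<Sum>d\<in>Dom. scl (u d) * monl d) = 0" .
  have S: "diag_idx s \<kappa> i j \<in> ?S" using assms by auto
  hence "diag_idx s \<kappa> i j \<in> Dom" using sub by blast
  from pbw_independent[OF z this] S show ?thesis by (simp add: u_def diag_idx_simps)
qed

text \<open>In the expansion over the independent elements f^i e^i f'^j e'^j, primes marking the
  other side, the coefficient at the largest exponents i = p - 1 and j = p' - 1 is a product of
  powers of the two \<open>om\<close>.\<close>

lemma ev_nonzero:
  assumes "\<kappa> \<in> mu"
  shows "ev (casimir s) (\<Prod>t<p s - 1. [:- d t, 1:]) * (ev (casimir (\<not> s)) (\<Prod>t<p (\<not> s) - 1. [:- d' t, 1:]) * wproj \<kappa>) \<noteq> 0"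
proof
  let ?n = "p s - 1" and ?m = "p (\<not> s) - 1"
  obtain a where a: "ev (casimir s) (\<Prod>t<?n. [:- d t, 1:]) * wproj \<kappa> = scl (om s ^ ?n) * FE s ?n \<kappa> + (\<Sum>i<?n. scl (a i) * FE s i \<kappa>)"
    using ev_lead[OF assms] by blast
  obtain b where b: "ev (casimir (\<not> s)) (\<Prod>t<?m. [:- d' t, 1:]) * wproj \<kappa> = scl (om (\<not> s) ^ ?m) * FE (\<not> s) ?m \<kappa> + (\<Sum>j<?m. scl (b j) * FE (\<not> s) j \<kappa>)"
    using ev_lead[OF assms] by blast
  define a' where "a' i = (if i = ?n then om s ^ ?n else a i)" for i
  define b' where "b' j = (if j = ?m then om (\<not> s) ^ ?m else b j)" for j
  have n: "p s = Suc ?n" "p (\<not> s) = Suc ?m" using p_pos[of s] p_pos[of "\<not> s"] by auto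
  have a2: "ev (casimir s) (\<Prod>t<?n. [:- d t, 1:]) * wproj \<kappa> = (\<Sum>i<p s. scl (a' i) * FE s i \<kappa>)"
  proof -
    have "(\<Sum>i<p s. scl (a' i) * FE s i \<kappa>) = (\<Sum>i<?n. scl (a' i) * FE s i \<kappa>) + scl (a' ?n) * FE s ?n \<kappa>"
      using sum.lessThan_Suc[of "\<lambda>i. scl (a' i) * FE s i \<kappa>" ?n] by (simp only: n(1)[symmetric])
    also have "(\<Sum>i<?n. scl (a' i) * FE s i \<kappa>) = (\<Sum>i<?n. scl (a i) * FE s i \<kappa>)"
      by (intro sum.cong) (auto simp: a'_def)
    finally show ?thesis unfolding a by (simp add: a'_def add.commute)
  qed
  have b2: "ev (casimir (\<not> s)) (\<Prod>t<?m. [:- d' t, 1:]) * wproj \<kappa> = (\<Sum>j<p (\<not> s). scl (b' j) * FE (\<not> s) j \<kappa>)"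
  proof -
    have "(\<Sum>j<p (\<not> s). scl (b' j) * FE (\<not> s) j \<kappa>) = (\<Sum>j<?m. scl (b' j) * FE (\<not> s) j \<kappa>) + scl (b' ?m) * FE (\<not> s) ?m \<kappa>"
      using sum.lessThan_Suc[of "\<lambda>j. scl (b' j) * FE (\<not> s) j \<kappa>" ?m] by (simp only: n(2)[symmetric])
    also have "(\<Sum>j<?m. scl (b' j) * FE (\<not> s) j \<kappa>) = (\<Sum>j<?m. scl (b j) * FE (\<not> s) j \<kappa>)"
      by (intro sum.cong) (auto simp: b'_def)
    finally show ?thesis unfolding b by (simp add: b'_def add.commute)
  qed
  define A where "A = ev (casimir s) (\<Prod>t<?n. [:- d t, 1:])"
  define B where "B = ev (casimir (\<not> s)) (\<Prod>t<?m. [:- d' t, 1:])"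
  have AC: "A \<in> Cen" "B \<in> Cen" unfolding A_def B_def by (intro Cen_ev casimir_Cen)+
  have comm: "B * (scl c * (Fl s ^ i * (El s ^ i * z))) = scl c * (Fl s ^ i * (El s ^ i * (B * z)))" for c i z
    by (simp add: scl.sc_left_comm[of B] Cen_lcomm[OF AC(2), of "Fl s ^ i"] Cen_lcomm[OF AC(2), of "El s ^ i"])
  assume "ev (casimir s) (\<Prod>t<?n. [:- d t, 1:]) * (ev (casimir (\<not> s)) (\<Prod>t<?m. [:- d' t, 1:]) * wproj \<kappa>) = 0"
  hence "0 = A * (B * wproj \<kappa>)" unfolding A_def B_def by (rule sym)
  also have "\<dots> = B * (A * wproj \<kappa>)" by (rule Cen_lcomm[OF AC(2) Cen_Al[OF AC(1)]])
  also have "\<dots> = (\<Sum>i<p s. scl (a' i) * (Fl s ^ i * (El s ^ i * (B * wproj \<kappa>))))"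
    unfolding a2[folded A_def] FE_def sum_distrib_left comm ..
  also have "\<dots> = (\<Sum>i<p s. \<Sum>j<p (\<not> s). scl (a' i * b' j) * (Fl s ^ i * (El s ^ i * FE (\<not> s) j \<kappa>)))"
    unfolding b2[folded B_def] by (simp add: sum_distrib_left scl.sc_left_comm[of "Fl s ^ _"] scl.sc_left_comm[of "El s ^ _"] scl.sc_sc)
  finally have z: "(\<Sum>i<p s. \<Sum>j<p (\<not> s). scl (a' i * b' j) * (Fl s ^ i * (El s ^ i * FE (\<not> s) j \<kappa>))) = 0"
    by (rule sym)
  have "?n < p s" "?m < p (\<not> s)" using p_pos[of s] p_pos[of "\<not> s"] by (auto intro: diff_less)
  from FE_indep[where s = s and b = "\<lambda>i j. a' i * b' j", OF assms z this] have "a' ?n * b' ?m = 0" .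
  \<comment> \<open>For \<open>p t = 1\<close> the number \<open>om t\<close> is zero, but its
    exponent is zero as well.\<close>
  moreover have nz: "om t ^ (p t - 1) \<noteq> 0" for t
    using om_nz[of t] p_pos[of t] by (cases "p t = 1") auto
  ultimately show False using nz[of s] nz[of "\<not> s"] by (simp only: a'_def b'_def if_True refl mult_eq_0_iff) blast
qed

end

context qparam
begin

section \<open>Generalised eigenspaces of the Casimir elements\<close>

definition mu2 :: "bool \<Rightarrow> complex set" where "mu2 s = {a. a ^ (2 * p s) = 1}"
definition cas_ev :: "bool \<Rightarrow> complex set" where "cas_ev s = cas s ` mu2 s"

lemma finite_mu2: "finite (mu2 s)"
  using finite_roots_unity[of "2 * p s"] p_pos[of s] by (simp_all add: mu2_def)

lemma finite_cas_ev: "finite (cas_ev s)"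
  by (simp add: cas_ev_def finite_mu2)

lemma mu2_nz: "a \<in> mu2 s \<Longrightarrow> a \<noteq> 0"
  using p_pos[of s] by (auto simp: mu2_def power_0_left)

lemma wt_mu2: "\<kappa> \<in> mu \<Longrightarrow> wt s \<kappa> \<in> mu2 s"
  by (simp add: wt_def mu2_def mu_def N_eq[of s] mult_ac flip: power_mult)

lemma mu2_Q: "a \<in> mu2 s \<Longrightarrow> a * Q s ^ (2 * t) \<in> mu2 s"
proof -
  assume a: "a \<in> mu2 s"
  have "(Q s ^ (2 * t)) ^ (2 * p s) = (Q s ^ (2 * p s)) ^ (2 * t)" by (rule pow_pow_commute)
  also have "\<dots> = 1" by (simp only: Q_pow power_one)
  finally show ?thesis using a by (simp add: mu2_def power_mult_distrib)
qed

lemma wq_cas_ev: "\<kappa> \<in> mu \<Longrightarrow> wq s \<kappa> t \<in> cas_ev s"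
  unfolding cas_ev_def wq_def by (intro imageI mu2_Q wt_mu2)

lemma joukowski_eq_iff:
  fixes A B :: complex
  assumes "A \<noteq> 0" "B \<noteq> 0"
  shows "A + inverse A = B + inverse B \<longleftrightarrow> B = A \<or> A * B = 1"
proof -
  have i: "A * B * inverse A = B" "A * B * inverse B = A" using assms by simp_all
  have "(A * B) * ((A + inverse A) - (B + inverse B)) = A * B * A + A * B * inverse A - (A * B * B + A * B * inverse B)"
    by (simp only: right_diff_distrib distrib_left)
  also have "\<dots> = (A - B) * (A * B - 1)" unfolding i by (simp add: algebra_simps)
  finally have e: "(A * B) * ((A + inverse A) - (B + inverse B)) = (A - B) * (A * B - 1)" .
  have "A + inverse A = B + inverse B \<longleftrightarrow> (A * B) * ((A + inverse A) - (B + inverse B)) = 0"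
    using assms by simp
  also have "\<dots> \<longleftrightarrow> B = A \<or> A * B = 1" unfolding e by auto
  finally show ?thesis .
qed

lemma cas_eq_iff:
  assumes "a \<noteq> 0" "b \<noteq> 0"
  shows "cas s a = cas s b \<longleftrightarrow> b = a \<or> (Q s)\<^sup>2 * a * b = 1"
proof -
  have e: "Q s * a * (Q s * b) = (Q s)\<^sup>2 * a * b" by (simp add: power2_eq_square mult_ac)
  have nz: "Q s * a \<noteq> 0" "Q s * b \<noteq> 0" using assms by simp_all
  show ?thesis using joukowski_eq_iff[OF nz] unfolding e cas_def by simp
qed

text \<open>The reflection that replaces Q a by its inverse and so preserves \<open>cas\<close>. Its
  fixed points correspond to the simple Casimir eigenvalues.\<close>

definition iot :: "bool \<Rightarrow> complex \<Rightarrow> complex" where "iot s a = inverse ((Q s)\<^sup>2 * a)"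

lemma cas_fibre:
  assumes "a \<in> mu2 s" "b \<in> mu2 s" shows "cas s a = cas s b \<longleftrightarrow> b = a \<or> b = iot s a"
proof -
  have r: "(Q s)\<^sup>2 * a * iot s a = 1"
    using mu2_nz[OF assms(1)] by (simp add: iot_def del: inverse_mult_distrib)
  have "(Q s)\<^sup>2 * a * b = 1 \<longleftrightarrow> b = iot s a"
    using r inverse_unique[of "(Q s)\<^sup>2 * a" b] unfolding iot_def by metis
  thus ?thesis using cas_eq_iff[of a b s] mu2_nz assms by blast
qed

text \<open>The multiplicity of \<open>c\<close> as a root of the annihilating polynomial on the
  weight space; \<open>mult_eq\<close> identifies it with the size of a fibre of \<open>cas\<close>,
  or zero.\<close>

definition mult :: "bool \<Rightarrow> complex \<Rightarrow> complex \<Rightarrow> nat" where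
  "mult s \<kappa> c = card {t. t < p s \<and> wq s \<kappa> t = c}"

lemma pts_inj: "\<kappa> \<in> mu \<Longrightarrow> inj_on (\<lambda>t. wt s \<kappa> * Q s ^ (2 * t)) {..<p s}"
proof (rule inj_onI)
  fix i j assume k: "\<kappa> \<in> mu" and ij: "i \<in> {..<p s}" "j \<in> {..<p s}" "wt s \<kappa> * Q s ^ (2 * i) = wt s \<kappa> * Q s ^ (2 * j)"
  have "Q s ^ (2 * i) = Q s ^ (2 * j)" using ij(3) mu2_nz[OF wt_mu2[OF k]] by (metis mult_cancel_left)
  thus "i = j" using Q_inj ij by blast
qed

text \<open>The Cartan eigenvalues behind the roots are distinct for t < p, and a fibre of
  \<open>cas\<close> consists of a point and its reflection.\<close>

lemma mult_le_2: assumes "\<kappa> \<in> mu" shows "mult s \<kappa> c \<le> 2"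
proof (cases "c \<in> cas_ev s")
  case False
  hence e: "{t. t < p s \<and> wq s \<kappa> t = c} = {}" using wq_cas_ev[OF assms] by auto
  show ?thesis unfolding mult_def e by simp
next
  case True
  then obtain a where a: "a \<in> mu2 s" "c = cas s a" by (auto simp: cas_ev_def)
  have "(\<lambda>t. wt s \<kappa> * Q s ^ (2 * t)) ` {t. t < p s \<and> wq s \<kappa> t = c} \<subseteq> {a, iot s a}"
  proof (rule image_subsetI)
    fix t assume "t \<in> {t. t < p s \<and> wq s \<kappa> t = c}"
    hence "cas s a = cas s (wt s \<kappa> * Q s ^ (2 * t))" using a(2) unfolding wq_def by (metis (mono_tags) mem_Collect_eq)
    thus "wt s \<kappa> * Q s ^ (2 * t) \<in> {a, iot s a}"
      unfolding cas_fibre[OF a(1) mu2_Q[OF wt_mu2[OF assms]]] by blast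
  qed
  moreover have "inj_on (\<lambda>t. wt s \<kappa> * Q s ^ (2 * t)) {t. t < p s \<and> wq s \<kappa> t = c}"
    using pts_inj[OF assms, of s] by (rule inj_on_subset) auto
  ultimately have "mult s \<kappa> c \<le> card {a, iot s a}"
    unfolding mult_def using card_inj_on_le[of _ _ "{a, iot s a}"] by blast
  also have "\<dots> \<le> 2" by (simp add: card_insert_if)
  finally show ?thesis .
qed

definition root_poly :: "bool \<Rightarrow> complex \<Rightarrow> nat set \<Rightarrow> complex poly" where
  "root_poly s \<kappa> S = (\<Prod>t\<in>S. [:- wq s \<kappa> t, 1:])"

lemma root_poly_remove: "finite S \<Longrightarrow> t \<in> S \<Longrightarrow> root_poly s \<kappa> S = [:- wq s \<kappa> t, 1:] * root_poly s \<kappa> (S - {t})"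
  unfolding root_poly_def by (rule prod.remove)

lemma root_poly_root: "finite S \<Longrightarrow> poly (root_poly s \<kappa> S) c = 0 \<longleftrightarrow> (\<exists>t\<in>S. wq s \<kappa> t = c)"
  by (auto simp: root_poly_def poly_prod)

lemma root_poly_wproj: assumes "\<kappa> \<in> mu" shows "ev (casimir s) (root_poly s \<kappa> {..<p s}) * wproj \<kappa> = 0"
  unfolding root_poly_def ev_FE[OF assms] by (simp add: FE_def El_pow)

lemma root_poly_dvd: assumes "\<kappa> \<in> mu" shows "root_poly s \<kappa> {..<p s} dvd (\<Prod>c\<in>cas_ev s. [:- c, 1:] ^ 2)"
proof -
  have "root_poly s \<kappa> {..<p s} = (\<Prod>c\<in>cas_ev s. \<Prod>t\<in>{t\<in>{..<p s}. wq s \<kappa> t = c}. [:- wq s \<kappa> t, 1:])"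
    unfolding root_poly_def using wq_cas_ev[OF assms] by (intro prod.group[symmetric] finite_cas_ev) auto
  also have "\<dots> = (\<Prod>c\<in>cas_ev s. [:- c, 1:] ^ mult s \<kappa> c)"
  proof (intro prod.cong refl)
    fix c
    have "(\<Prod>t\<in>{t\<in>{..<p s}. wq s \<kappa> t = c}. [:- wq s \<kappa> t, 1:]) = (\<Prod>t\<in>{t\<in>{..<p s}. wq s \<kappa> t = c}. [:- c, 1:])"
      by (intro prod.cong) auto
    thus "(\<Prod>t\<in>{t\<in>{..<p s}. wq s \<kappa> t = c}. [:- wq s \<kappa> t, 1:]) = [:- c, 1:] ^ mult s \<kappa> c"
      by (simp add: mult_def)
  qed
  also have "\<dots> dvd (\<Prod>c\<in>cas_ev s. [:- c, 1:] ^ 2)"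
    by (intro prod_dvd_prod le_imp_power_dvd mult_le_2 assms)
  finally show ?thesis .
qed

text \<open>Multiplicities being at most 2, the product of all squares is divisible by the
  annihilating polynomial of every weight space. Identities between polynomials in the Casimir can
  thus be checked modulo each square.\<close>

lemma ev_eq_0:
  assumes "\<And>c. c \<in> cas_ev s \<Longrightarrow> [:- c, 1:] ^ 2 dvd h" shows "ev (casimir s) h = 0"
proof (rule wproj_ext)
  fix \<kappa> assume k: "\<kappa> \<in> mu"
  have "root_poly s \<kappa> {..<p s} dvd h"
    using root_poly_dvd[OF k] squares_dvd[OF finite_cas_ev assms] dvd_trans by blast
  then obtain g where "h = g * root_poly s \<kappa> {..<p s}" by (metis dvdE mult.commute)
  thus "ev (casimir s) h * wproj \<kappa> = 0 * wproj \<kappa>" using root_poly_wproj[OF k, of s] by (simp add: scl.ev_mult mult.assoc)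
qed

lemma ev_cong:
  assumes "\<And>c. c \<in> cas_ev s \<Longrightarrow> [:- c, 1:] ^ 2 dvd g - h" shows "ev (casimir s) g = ev (casimir s) h"
  using ev_eq_0[OF assms] by (simp add: scl.ev_diff)

text \<open>For \<open>c\<close> in \<open>cas_ev s\<close>: at j = 0 the projection onto the
  generalised eigenspace, at j = 1 the nilpotent part of the Casimir there, and zero from j = 2
  on.\<close>

definition gen_eig :: "bool \<Rightarrow> complex \<Rightarrow> nat \<Rightarrow> lop" where
  "gen_eig s c j = ev (casimir s) ([:- c, 1:] ^ j * herm (cas_ev s) c)"

lemma gen_eig_Cen [simp]: "gen_eig s c j \<in> Cen"
  unfolding gen_eig_def by (intro Cen_ev casimir_Cen)

lemma gen_eig_Al [simp]: "gen_eig s c j \<in> Al"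
  by (rule Cen_Al) simp

lemma herm_idem_dvd:
  assumes "c \<in> cas_ev s" "b \<in> cas_ev s"
  shows "[:- b, 1:] ^ 2 dvd herm (cas_ev s) c * (herm (cas_ev s) c - 1)"
  using herm[OF finite_cas_ev assms(1)] assms(2) by (cases "b = c") (auto intro: dvd_mult dvd_mult2)

lemma gen_eig_sum: "(\<Sum>c\<in>cas_ev s. gen_eig s c 0) = 1"
proof -
  have "ev (casimir s) (\<Sum>c\<in>cas_ev s. herm (cas_ev s) c) = ev (casimir s) 1"
  proof (rule ev_cong)
    fix b assume b: "b \<in> cas_ev s"
    have "(\<Sum>c\<in>cas_ev s. herm (cas_ev s) c) - 1 = (herm (cas_ev s) b - 1) + (\<Sum>c\<in>cas_ev s - {b}. herm (cas_ev s) c)"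
      using sum.remove[OF finite_cas_ev b, of "herm (cas_ev s)"] by simp
    moreover have "[:- b, 1:] ^ 2 dvd herm (cas_ev s) b - 1" by (rule herm[OF finite_cas_ev b])
    moreover have "[:- b, 1:] ^ 2 dvd (\<Sum>c\<in>cas_ev s - {b}. herm (cas_ev s) c)"
      by (rule dvd_sum) (use herm(2)[OF finite_cas_ev _ b] in auto)
    ultimately show "[:- b, 1:] ^ 2 dvd (\<Sum>c\<in>cas_ev s. herm (cas_ev s) c) - 1" by (metis dvd_add)
  qed
  thus ?thesis by (simp add: gen_eig_def scl.ev_sum)
qed

lemma gen_eig_mult:
  assumes "c \<in> cas_ev s" shows "gen_eig s c i * gen_eig s c j = gen_eig s c (i + j)"
  unfolding gen_eig_def scl.ev_mult[symmetric]
proof (rule ev_cong)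
  fix b assume b: "b \<in> cas_ev s"
  have e: "([:- c, 1:] ^ i * herm (cas_ev s) c) * ([:- c, 1:] ^ j * herm (cas_ev s) c) - [:- c, 1:] ^ (i + j) * herm (cas_ev s) c
    = [:- c, 1:] ^ (i + j) * (herm (cas_ev s) c * (herm (cas_ev s) c - 1))"
  proof -
    have "(x ^ i * h) * (x ^ j * h) - x ^ (i + j) * h = x ^ (i + j) * (h * (h - 1))" for x h :: "complex poly"
      by (simp add: power_add algebra_simps)
    thus ?thesis .
  qed
  show "[:- b, 1:] ^ 2 dvd ([:- c, 1:] ^ i * herm (cas_ev s) c) * ([:- c, 1:] ^ j * herm (cas_ev s) c) - [:- c, 1:] ^ (i + j) * herm (cas_ev s) c"
    unfolding e by (intro dvd_mult herm_idem_dvd assms b)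
qed

lemma gen_eig_orth:
  assumes "c \<in> cas_ev s" "d \<in> cas_ev s" "c \<noteq> d" shows "gen_eig s c i * gen_eig s d j = 0"
  unfolding gen_eig_def scl.ev_mult[symmetric]
proof (rule ev_eq_0)
  fix b assume b: "b \<in> cas_ev s"
  have "[:- b, 1:] ^ 2 dvd herm (cas_ev s) c \<or> [:- b, 1:] ^ 2 dvd herm (cas_ev s) d"
    using herm(2)[OF finite_cas_ev _ b] assms by (cases "b = c") auto
  thus "[:- b, 1:] ^ 2 dvd ([:- c, 1:] ^ i * herm (cas_ev s) c) * ([:- d, 1:] ^ j * herm (cas_ev s) d)"
    by (meson dvd_mult dvd_mult2)
qed

lemma gen_eig_ge_2:
  assumes "c \<in> cas_ev s" "j \<ge> 2" shows "gen_eig s c j = 0"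
  unfolding gen_eig_def
proof (rule ev_eq_0)
  fix b assume b: "b \<in> cas_ev s"
  show "[:- b, 1:] ^ 2 dvd [:- c, 1:] ^ j * herm (cas_ev s) c"
  proof (cases "b = c")
    case True show ?thesis unfolding True by (rule dvd_mult2, rule le_imp_power_dvd, rule assms(2))
  next
    case False thus ?thesis by (intro dvd_mult herm(2)[OF finite_cas_ev assms(1) b])
  qed
qed

lemma ev_gen_eig_Suc:
  assumes "c \<in> cas_ev s" "h = [:- c, 1:] * h1" shows "ev (casimir s) h * gen_eig s c j = ev (casimir s) h1 * gen_eig s c (Suc j)"
  unfolding gen_eig_def scl.ev_mult[symmetric] assms(2) by (simp only: power_Suc mult_ac)

lemma ev_gen_eig_pos:
  assumes "c \<in> cas_ev s" "j > 0" shows "ev (casimir s) h * gen_eig s c j = scl (poly h c) * gen_eig s c j"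
proof -
  have "[:- c, 1:] dvd h - [:poly h c:]" by (simp add: dvd_iff_poly_eq_0)
  then obtain g where g: "h - [:poly h c:] = [:- c, 1:] * g" by (elim dvdE)
  have "ev (casimir s) (h - [:poly h c:]) * gen_eig s c j = 0"
    unfolding ev_gen_eig_Suc[OF assms(1) g] using gen_eig_ge_2[OF assms(1), of "Suc j"] assms(2) by simp
  thus ?thesis by (simp add: scl.ev_diff scl.ev_pCons left_diff_distrib)
qed

lemma ev_gen_eig_0:
  assumes "c \<in> cas_ev s" shows "\<exists>d. ev (casimir s) h * gen_eig s c 0 = scl (poly h c) * gen_eig s c 0 + scl d * gen_eig s c 1"
proof -
  have "[:- c, 1:] dvd h - [:poly h c:]" by (simp add: dvd_iff_poly_eq_0)
  then obtain g where g: "h - [:poly h c:] = [:- c, 1:] * g" by (elim dvdE)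
  have "ev (casimir s) (h - [:poly h c:]) * gen_eig s c 0 = scl (poly g c) * gen_eig s c 1"
    unfolding ev_gen_eig_Suc[OF assms(1) g] using ev_gen_eig_pos[OF assms(1), of 1 g] by simp
  hence "ev (casimir s) h * gen_eig s c 0 = scl (poly h c) * gen_eig s c 0 + scl (poly g c) * gen_eig s c 1"
    by (simp add: scl.ev_diff scl.ev_pCons left_diff_distrib algebra_simps)
  thus ?thesis by blast
qed

text \<open>The annihilating polynomial has a nonzero value at \<open>c\<close>, so on the
  generalised eigenspace it acts as a nonzero scalar plus a nilpotent. First the nilpotent part is
  seen to vanish on the weight space, then the projection.\<close>

lemma gen_eig_wproj_0:
  assumes "\<kappa> \<in> mu" "c \<in> cas_ev s" "\<And>t. t < p s \<Longrightarrow> wq s \<kappa> t \<noteq> c" shows "gen_eig s c j * wproj \<kappa> = 0"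
proof -
  let ?P = "root_poly s \<kappa> {..<p s}"
  have nz: "poly ?P c \<noteq> 0" using assms(3) by (auto simp: root_poly_root)
  have z: "ev (casimir s) ?P * gen_eig s c i * wproj \<kappa> = 0" for i
    using CenD[OF gen_eig_Cen[of s c i], of "ev (casimir s) ?P"] root_poly_wproj[OF assms(1), of s]
    by (simp add: mult.assoc Al_ev) (metis mult.assoc mult_zero_right)
  have 1: "gen_eig s c 1 * wproj \<kappa> = 0"
    using z[of 1] scl.sc_cancel[OF nz] unfolding ev_gen_eig_pos[OF assms(2) zero_less_one] by (simp add: mult.assoc)
  obtain d where d: "ev (casimir s) ?P * gen_eig s c 0 = scl (poly ?P c) * gen_eig s c 0 + scl d * gen_eig s c 1"
    using ev_gen_eig_0[OF assms(2)] by blast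
  have 0: "gen_eig s c 0 * wproj \<kappa> = 0"
    using z[of 0] 1 scl.sc_cancel[OF nz] unfolding d by (simp add: mult.assoc distrib_right)
  consider "j = 0" | "j = 1" | "j \<ge> 2" by linarith
  thus ?thesis using 0 1 gen_eig_ge_2[OF assms(2)] by cases auto
qed

text \<open>The root is simple, so the annihilating polynomial acts on the projection as a nonzero
  multiple of the nilpotent part.\<close>

lemma gen_eig_wproj_1:
  assumes "\<kappa> \<in> mu" "c \<in> cas_ev s" "t < p s" "wq s \<kappa> t = c" "\<And>t'. t' < p s \<Longrightarrow> wq s \<kappa> t' = c \<Longrightarrow> t' = t"
  shows "gen_eig s c 1 * wproj \<kappa> = 0"
proof -
  let ?P = "root_poly s \<kappa> {..<p s}" and ?R = "root_poly s \<kappa> ({..<p s} - {t})"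
  have P: "?P = [:- c, 1:] * ?R" using root_poly_remove[of "{..<p s}" t] assms(3,4) by simp
  have nz: "poly ?R c \<noteq> 0" using assms(5) by (auto simp: root_poly_root)
  have "ev (casimir s) ?P * gen_eig s c 0 * wproj \<kappa> = gen_eig s c 0 * (ev (casimir s) ?P * wproj \<kappa>)"
    using CenD[OF gen_eig_Cen[of s c 0], of "ev (casimir s) ?P"] by (simp add: mult.assoc[symmetric] Al_ev)
  hence "ev (casimir s) ?P * gen_eig s c 0 * wproj \<kappa> = 0" using root_poly_wproj[OF assms(1), of s] by simp
  hence "scl (poly ?R c) * gen_eig s c 1 * wproj \<kappa> = 0"
    unfolding ev_gen_eig_Suc[OF assms(2) P] using ev_gen_eig_pos[OF assms(2), of 1 ?R] by simp
  thus ?thesis using scl.sc_cancel[OF nz] by (simp add: mult.assoc)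
qed

lemma mult_pos: "mult s \<kappa> c > 0 \<longleftrightarrow> (\<exists>t<p s. wq s \<kappa> t = c)"
  unfolding mult_def by (auto simp: card_gt_0_iff)

lemma gen_eig_wproj_mult:
  assumes "\<kappa> \<in> mu" "c \<in> cas_ev s" "j \<ge> mult s \<kappa> c" shows "gen_eig s c j * wproj \<kappa> = 0"
proof -
  consider "j \<ge> 2" | "mult s \<kappa> c = 0" | "j = 1" "mult s \<kappa> c = 1" using assms(3) by linarith
  thus ?thesis
  proof cases
    case 1 thus ?thesis using gen_eig_ge_2[OF assms(2)] by simp
  next
    case 2 thus ?thesis using mult_pos[of s \<kappa> c] by (intro gen_eig_wproj_0 assms) auto
  next
    case 3
    then obtain t where "{t. t < p s \<and> wq s \<kappa> t = c} = {t}" unfolding mult_def by (metis card_1_singletonE)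
    thus ?thesis unfolding \<open>j = 1\<close> by (intro gen_eig_wproj_1[of \<kappa> c s t] assms(1,2)) auto
  qed
qed

lemma mult_card2:
  assumes "t < p s" "wq s \<kappa> t = c" "mult s \<kappa> c = 2"
  shows "\<exists>t'<p s. t' \<noteq> t \<and> wq s \<kappa> t' = c"
proof (rule ccontr)
  assume "\<not> ?thesis"
  hence "{t. t < p s \<and> wq s \<kappa> t = c} = {t}" using assms by auto
  thus False using assms(3) by (simp add: mult_def)
qed

text \<open>With one root at \<open>c\<close> removed, the polynomial still annihilates the part of
  the weight space in every other generalised eigenspace, and on that of \<open>c\<close> it leaves
  only the last nonzero power of the nilpotent. This links the socle to
  \<open>ev_nonzero\<close>.\<close>

lemma root_poly_gen_eig_wproj:
  assumes "\<kappa> \<in> mu" "t < p s" "c = wq s \<kappa> t"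
  shows "\<exists>a. ev (casimir s) (root_poly s \<kappa> ({..<p s} - {t})) * wproj \<kappa> = scl a * (gen_eig s c (mult s \<kappa> c - 1) * wproj \<kappa>)"
proof -
  let ?R = "root_poly s \<kappa> ({..<p s} - {t})" and ?m = "mult s \<kappa>"
  have cG: "c \<in> cas_ev s" using assms wq_cas_ev by simp
  have other: "ev (casimir s) ?R * gen_eig s b 0 * wproj \<kappa> = 0" if b: "b \<in> cas_ev s" "b \<noteq> c" for b
  proof (cases "?m b = 0")
    case True thus ?thesis using gen_eig_wproj_mult[OF assms(1) b(1), of 0] by (simp add: mult.assoc)
  next
    case False
    then obtain t' where t': "t' < p s" "wq s \<kappa> t' = b" using mult_pos[of s \<kappa> b] by auto
    let ?R1 = "root_poly s \<kappa> ({..<p s} - {t} - {t'})"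
    have R: "?R = [:- b, 1:] * ?R1"
      using root_poly_remove[of "{..<p s} - {t}" t' s \<kappa>] t' b assms by auto
    have e: "ev (casimir s) ?R * gen_eig s b 0 = scl (poly ?R1 b) * gen_eig s b 1"
      unfolding ev_gen_eig_Suc[OF b(1) R] using ev_gen_eig_pos[OF b(1), of 1 ?R1] by simp
    show ?thesis
    proof (cases "?m b = 1")
      case True thus ?thesis unfolding e using gen_eig_wproj_mult[OF assms(1) b(1), of 1] by (simp add: mult.assoc)
    next
      case F: False
      hence "?m b = 2" using False mult_le_2[OF assms(1), of s b] by linarith
      from mult_card2[OF t' this] obtain t'' where "t'' < p s" "t'' \<noteq> t'" "wq s \<kappa> t'' = b" by blast
      hence "poly ?R1 b = 0" using b assms by (auto simp: root_poly_root)
      thus ?thesis unfolding e by simp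
    qed
  qed
  have "ev (casimir s) ?R * wproj \<kappa> = (\<Sum>b\<in>cas_ev s. ev (casimir s) ?R * gen_eig s b 0 * wproj \<kappa>)"
    unfolding sum_distrib_right[symmetric] sum_distrib_left[symmetric] gen_eig_sum by simp
  also have "\<dots> = ev (casimir s) ?R * gen_eig s c 0 * wproj \<kappa>"
    using sum.remove[OF finite_cas_ev cG, of "\<lambda>b. ev (casimir s) ?R * gen_eig s b 0 * wproj \<kappa>"] other by simp
  finally have e: "ev (casimir s) ?R * wproj \<kappa> = ev (casimir s) ?R * gen_eig s c 0 * wproj \<kappa>" .
  have mp: "?m c > 0" using assms mult_pos by blast
  show ?thesis
  proof (cases "?m c = 1")
    case True
    obtain d where d: "ev (casimir s) ?R * gen_eig s c 0 = scl (poly ?R c) * gen_eig s c 0 + scl d * gen_eig s c 1"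
      using ev_gen_eig_0[OF cG] by blast
    show ?thesis unfolding e d using gen_eig_wproj_mult[OF assms(1) cG, of 1] True
      by (intro exI[of _ "poly ?R c"]) (simp add: distrib_right mult.assoc)
  next
    case False
    hence m2: "?m c = 2" using mp mult_le_2[OF assms(1), of s c] by linarith
    obtain t' where t': "t' < p s" "t' \<noteq> t" "wq s \<kappa> t' = c" using mult_card2[OF assms(2) _ m2] assms(3) by blast
    let ?R1 = "root_poly s \<kappa> ({..<p s} - {t} - {t'})"
    have R: "?R = [:- c, 1:] * ?R1"
      using root_poly_remove[of "{..<p s} - {t}" t' s \<kappa>] t' by auto
    have "ev (casimir s) ?R * gen_eig s c 0 = scl (poly ?R1 c) * gen_eig s c 1"
      unfolding ev_gen_eig_Suc[OF cG R] using ev_gen_eig_pos[OF cG, of 1 ?R1] by simp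
    thus ?thesis unfolding e m2 by (intro exI[of _ "poly ?R1 c"]) (simp add: mult.assoc)
  qed
qed

lemma prod_reindex_card:
  assumes "finite S" shows "\<exists>d. (\<Prod>t\<in>S. [:- f t, 1:]) = (\<Prod>t<card S. [:- d t, 1::complex:])"
proof -
  obtain h where h: "bij_betw h {0..<card S} S" using ex_bij_betw_nat_finite[OF assms] by blast
  have "(\<Prod>t\<in>S. [:- f t, 1:]) = (\<Prod>t<card S. [:- f (h t), 1:])"
    using prod.reindex_bij_betw[OF h, of "\<lambda>t. [:- f t, 1:]"] by (simp add: atLeast0LessThan)
  thus ?thesis by (intro exI[of _ "\<lambda>t. f (h t)"]) simp
qed

text \<open>The two polynomials with one root removed multiply to a scalar multiple of this element,
  and by \<open>ev_nonzero\<close> their product is not zero.\<close>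

lemma socle_nonzero:
  assumes "\<kappa> \<in> mu" "mult s \<kappa> c > 0" "mult (\<not> s) \<kappa> d > 0"
  shows "gen_eig s c (mult s \<kappa> c - 1) * (gen_eig (\<not> s) d (mult (\<not> s) \<kappa> d - 1) * wproj \<kappa>) \<noteq> 0"
proof
  let ?n = "gen_eig s c (mult s \<kappa> c - 1)" and ?n' = "gen_eig (\<not> s) d (mult (\<not> s) \<kappa> d - 1)"
  assume 0: "?n * (?n' * wproj \<kappa>) = 0"
  obtain t where t: "t < p s" "wq s \<kappa> t = c" using assms mult_pos by blast
  obtain t' where t': "t' < p (\<not> s)" "wq (\<not> s) \<kappa> t' = d" using assms mult_pos by blast
  let ?R = "root_poly s \<kappa> ({..<p s} - {t})" and ?R' = "root_poly (\<not> s) \<kappa> ({..<p (\<not> s)} - {t'})"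
  obtain a where a: "ev (casimir s) ?R * wproj \<kappa> = scl a * (?n * wproj \<kappa>)" using root_poly_gen_eig_wproj[OF assms(1) t(1)] t(2) by blast
  obtain a' where a': "ev (casimir (\<not> s)) ?R' * wproj \<kappa> = scl a' * (?n' * wproj \<kappa>)" using root_poly_gen_eig_wproj[OF assms(1) t'(1)] t'(2) by blast
  have RC: "ev (casimir s) ?R \<in> Cen" by (intro Cen_ev casimir_Cen)
  have "ev (casimir s) ?R * (ev (casimir (\<not> s)) ?R' * wproj \<kappa>) = scl a' * (?n' * (ev (casimir s) ?R * wproj \<kappa>))"
    unfolding a' scl.sc_left_comm[of "ev (casimir s) ?R"] using Cen_lcomm[OF RC, of ?n'] by simp
  also have "\<dots> = scl a' * (scl a * (?n' * (?n * wproj \<kappa>)))"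
    unfolding a by (simp only: scl.sc_left_comm[of ?n'])
  also have "?n' * (?n * wproj \<kappa>) = ?n * (?n' * wproj \<kappa>)" by (rule Cen_lcomm) simp_all
  finally have z: "ev (casimir s) ?R * (ev (casimir (\<not> s)) ?R' * wproj \<kappa>) = 0" using 0 by simp
  have c: "card ({..<p s} - {t}) = p s - 1" "card ({..<p (\<not> s)} - {t'}) = p (\<not> s) - 1"
    using t t' by (simp_all add: card_Diff_singleton)
  obtain d where d: "?R = (\<Prod>t<p s - 1. [:- d t, 1:])"
    using prod_reindex_card[of "{..<p s} - {t}" "wq s \<kappa>"] unfolding c root_poly_def by auto
  obtain d' where d': "?R' = (\<Prod>t<p (\<not> s) - 1. [:- d' t, 1:])"
    using prod_reindex_card[of "{..<p (\<not> s)} - {t'}" "wq (\<not> s) \<kappa>"] unfolding c root_poly_def by auto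
  show False using z ev_nonzero[OF assms(1), of s d d'] unfolding d d' by blast
qed

section \<open>A basis of the elements commuting with K, on each weight space\<close>

definition adm :: "bool \<Rightarrow> complex \<Rightarrow> (complex \<times> nat) set" where
  "adm s \<kappa> = {(c, j). c \<in> cas_ev s \<and> j < mult s \<kappa> c}"

definition gen_eig_pair :: "bool \<Rightarrow> complex \<times> nat \<Rightarrow> lop" where "gen_eig_pair s x = gen_eig s (fst x) (snd x)"

lemma gen_eig_pair_Cen [simp]: "gen_eig_pair s x \<in> Cen" and gen_eig_pair_Al [simp]: "gen_eig_pair s x \<in> Al"
  by (simp_all add: gen_eig_pair_def)

lemma finite_adm: "\<kappa> \<in> mu \<Longrightarrow> finite (adm s \<kappa>)"
proof -
  assume "\<kappa> \<in> mu"
  hence "adm s \<kappa> \<subseteq> cas_ev s \<times> {..<2}" using mult_le_2[of \<kappa> s] by (auto simp: adm_def intro: less_le_trans)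
  thus ?thesis by (rule finite_subset) (simp add: finite_cas_ev)
qed

text \<open>Induction on the total power of the two nilpotents. Multiplication by the complementary
  powers lifts the term at \<open>x\<close>, \<open>y\<close> to the nonzero socle and kills terms
  with another eigenvalue or a higher power on either side; the terms left over have coefficient
  zero by induction.\<close>

lemma adm_indep:
  assumes k: "\<kappa> \<in> mu"
    and z: "(\<Sum>x\<in>adm s \<kappa>. \<Sum>y\<in>adm (\<not> s) \<kappa>. scl (h x y) * (gen_eig_pair s x * (gen_eig_pair (\<not> s) y * wproj \<kappa>))) = 0"
    and "x \<in> adm s \<kappa>" "y \<in> adm (\<not> s) \<kappa>"
  shows "h x y = 0"
  using assms(3,4)
proof (induction "snd x + snd y" arbitrary: x y rule: less_induct)
  case less
  obtain c j where x: "x = (c, j)" by (cases x)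
  obtain d i where y: "y = (d, i)" by (cases y)
  let ?m = "mult s \<kappa> c" and ?n = "mult (\<not> s) \<kappa> d"
  have j: "c \<in> cas_ev s" "j < ?m" and i: "d \<in> cas_ev (\<not> s)" "i < ?n"
    using less.prems by (auto simp: x y adm_def)
  let ?u = "gen_eig s c (?m - 1 - j)" and ?v = "gen_eig (\<not> s) d (?n - 1 - i)"
  have tm: "?u * (?v * (scl (h x' y') * (gen_eig_pair s x' * (gen_eig_pair (\<not> s) y' * wproj \<kappa>)))) =
      (if x' = x \<and> y' = y then scl (h x y) * (gen_eig s c (?m - 1) * (gen_eig (\<not> s) d (?n - 1) * wproj \<kappa>)) else 0)"
    if x': "x' \<in> adm s \<kappa>" and y': "y' \<in> adm (\<not> s) \<kappa>" for x' y'
  proof -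
    obtain c' j' where xx: "x' = (c', j')" by (cases x')
    obtain d' i' where yy: "y' = (d', i')" by (cases y')
    have G: "c' \<in> cas_ev s" "d' \<in> cas_ev (\<not> s)" using x' y' by (auto simp: xx yy adm_def)
    let ?A = "?u * gen_eig s c' j'" and ?B = "?v * gen_eig (\<not> s) d' i'"
    have e: "?u * (?v * (scl (h x' y') * (gen_eig_pair s x' * (gen_eig_pair (\<not> s) y' * wproj \<kappa>)))) = scl (h x' y') * (?A * (?B * wproj \<kappa>))"
      by (simp only: gen_eig_pair_def xx yy fst_conv snd_conv scl.sc_left_comm[of ?u] scl.sc_left_comm[of ?v]
          Cen_lcomm[of "gen_eig s c' j'" ?v, OF gen_eig_Cen gen_eig_Al] mult.assoc)
    have swap: "?A * (?B * wproj \<kappa>) = ?B * (?A * wproj \<kappa>)"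
      by (rule Cen_lcomm) (intro Cen_mult Al_mult gen_eig_Cen gen_eig_Al)+
    have B0: "?B * wproj \<kappa> = 0" if "d' \<noteq> d \<or> i' > i"
    proof (cases "d' = d")
      case False thus ?thesis using gen_eig_orth[OF i(1) G(2)] by simp
    next
      case True
      hence "?n \<le> ?n - 1 - i + i'" using that i(2) by linarith
      thus ?thesis using gen_eig_wproj_mult[OF k i(1)] True by (simp add: gen_eig_mult[OF i(1)])
    qed
    have A0: "?A * wproj \<kappa> = 0" if "c' \<noteq> c \<or> j' > j"
    proof (cases "c' = c")
      case False thus ?thesis using gen_eig_orth[OF j(1) G(1)] by simp
    next
      case True
      hence "?m \<le> ?m - 1 - j + j'" using that j(2) by linarith
      thus ?thesis using gen_eig_wproj_mult[OF k j(1)] True by (simp add: gen_eig_mult[OF j(1)])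
    qed
    show ?thesis
    proof (cases "x' = x \<and> y' = y")
      case True
      hence "?A = gen_eig s c (?m - 1)" "?B = gen_eig (\<not> s) d (?n - 1)"
        using gen_eig_mult[OF j(1), of "?m - 1 - j" j] gen_eig_mult[OF i(1), of "?n - 1 - i" i] j(2) i(2) by (auto simp: x y xx yy)
      thus ?thesis unfolding e using True by simp
    next
      case False
      have "h x' y' = 0 \<or> ?A * (?B * wproj \<kappa>) = 0"
      proof (cases "(d' \<noteq> d \<or> i' > i) \<or> (c' \<noteq> c \<or> j' > j)")
        case True thus ?thesis using A0 B0 swap by (metis mult_zero_right)
      next
        case F: False
        hence "j' + i' < j + i" using False by (auto simp: x y xx yy)
        thus ?thesis using less.hyps[OF _ x' y'] by (simp add: x y xx yy)
      qed
      thus ?thesis unfolding e using False by auto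
    qed
  qed
  have "0 = ?u * (?v * (\<Sum>x'\<in>adm s \<kappa>. \<Sum>y'\<in>adm (\<not> s) \<kappa>. scl (h x' y') * (gen_eig_pair s x' * (gen_eig_pair (\<not> s) y' * wproj \<kappa>))))"
    unfolding z by simp
  also have "\<dots> = (\<Sum>x'\<in>adm s \<kappa>. \<Sum>y'\<in>adm (\<not> s) \<kappa>. ?u * (?v * (scl (h x' y') * (gen_eig_pair s x' * (gen_eig_pair (\<not> s) y' * wproj \<kappa>)))))"
    by (simp only: sum_distrib_left)
  also have "\<dots> = (\<Sum>x'\<in>adm s \<kappa>. \<Sum>y'\<in>adm (\<not> s) \<kappa>. if x' = x \<and> y' = y then scl (h x y) * (gen_eig s c (?m - 1) * (gen_eig (\<not> s) d (?n - 1) * wproj \<kappa>)) else 0)"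
    by (intro sum.cong refl tm)
  also have "\<dots> = (\<Sum>x'\<in>adm s \<kappa>. if x' = x then scl (h x y) * (gen_eig s c (?m - 1) * (gen_eig (\<not> s) d (?n - 1) * wproj \<kappa>)) else 0)"
    using less.prems(2) finite_adm[OF k] by (intro sum.cong refl) (auto simp: sum.delta)
  also have "\<dots> = scl (h x y) * (gen_eig s c (?m - 1) * (gen_eig (\<not> s) d (?n - 1) * wproj \<kappa>))"
    using less.prems(1) finite_adm[OF k] by (simp add: sum.delta)
  finally show ?case
    using socle_nonzero[OF k, of s c d] j(2) i(2) scl.sc_cancel by fastforce
qed

definition wspan :: "bool \<Rightarrow> complex \<Rightarrow> lop set" where
  "wspan s \<kappa> = {z. \<exists>h. z = (\<Sum>x\<in>adm s \<kappa>. \<Sum>y\<in>adm (\<not> s) \<kappa>. scl (h x y) * (gen_eig_pair s x * (gen_eig_pair (\<not> s) y * wproj \<kappa>)))}"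

lemma wspan_0: "0 \<in> wspan s \<kappa>"
  unfolding wspan_def by (intro CollectI exI[of _ "\<lambda>_ _. 0"]) simp

lemma wspan_add: assumes "x \<in> wspan s \<kappa>" "y \<in> wspan s \<kappa>" shows "x + y \<in> wspan s \<kappa>"
proof -
  obtain g h where "x = (\<Sum>x\<in>adm s \<kappa>. \<Sum>y\<in>adm (\<not> s) \<kappa>. scl (g x y) * (gen_eig_pair s x * (gen_eig_pair (\<not> s) y * wproj \<kappa>)))"
    "y = (\<Sum>x\<in>adm s \<kappa>. \<Sum>y\<in>adm (\<not> s) \<kappa>. scl (h x y) * (gen_eig_pair s x * (gen_eig_pair (\<not> s) y * wproj \<kappa>)))"
    using assms unfolding wspan_def by blast
  hence "x + y = (\<Sum>x\<in>adm s \<kappa>. \<Sum>y\<in>adm (\<not> s) \<kappa>. scl (g x y + h x y) * (gen_eig_pair s x * (gen_eig_pair (\<not> s) y * wproj \<kappa>)))"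
    by (simp add: scl.sc_add distrib_right sum.distrib)
  thus ?thesis unfolding wspan_def by (intro CollectI exI)
qed

lemma wspan_scale: assumes "x \<in> wspan s \<kappa>" shows "scl c * x \<in> wspan s \<kappa>"
proof -
  obtain g where "x = (\<Sum>x\<in>adm s \<kappa>. \<Sum>y\<in>adm (\<not> s) \<kappa>. scl (g x y) * (gen_eig_pair s x * (gen_eig_pair (\<not> s) y * wproj \<kappa>)))"
    using assms unfolding wspan_def by blast
  hence "scl c * x = (\<Sum>x\<in>adm s \<kappa>. \<Sum>y\<in>adm (\<not> s) \<kappa>. scl (c * g x y) * (gen_eig_pair s x * (gen_eig_pair (\<not> s) y * wproj \<kappa>)))"
    by (simp add: sum_distrib_left scl.sc_sc)
  thus ?thesis unfolding wspan_def by (intro CollectI exI)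
qed

lemma wspan_sum: "(\<And>a. a \<in> A \<Longrightarrow> f a \<in> wspan s \<kappa>) \<Longrightarrow> sum f A \<in> wspan s \<kappa>"
  by (induction A rule: infinite_finite_induct) (auto intro: wspan_add wspan_0)

lemma wspan_gen_eig:
  assumes k: "\<kappa> \<in> mu" and c: "c \<in> cas_ev s" and d: "d \<in> cas_ev (\<not> s)"
  shows "gen_eig s c i * (gen_eig (\<not> s) d j * wproj \<kappa>) \<in> wspan s \<kappa>"
proof (cases "i < mult s \<kappa> c \<and> j < mult (\<not> s) \<kappa> d")
  case False
  have sw: "gen_eig s c i * (gen_eig (\<not> s) d j * wproj \<kappa>) = gen_eig (\<not> s) d j * (gen_eig s c i * wproj \<kappa>)"
    by (rule Cen_lcomm) simp_all
  have "gen_eig s c i * (gen_eig (\<not> s) d j * wproj \<kappa>) = 0"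
  proof (cases "i < mult s \<kappa> c")
    case True
    hence "gen_eig (\<not> s) d j * wproj \<kappa> = 0" using gen_eig_wproj_mult[OF k d] False by simp
    thus ?thesis by simp
  next
    case F: False
    hence "gen_eig s c i * wproj \<kappa> = 0" using gen_eig_wproj_mult[OF k c] by simp
    thus ?thesis unfolding sw by simp
  qed
  thus ?thesis using wspan_0 by simp
next
  case True
  let ?x = "(c, i)" and ?y = "(d, j)"
  have xy: "?x \<in> adm s \<kappa>" "?y \<in> adm (\<not> s) \<kappa>" using True c d by (auto simp: adm_def)
  define T where "T x y = gen_eig_pair s x * (gen_eig_pair (\<not> s) y * wproj \<kappa>)" for x y
  have "(\<Sum>x\<in>adm s \<kappa>. \<Sum>y\<in>adm (\<not> s) \<kappa>. scl (if x = ?x \<and> y = ?y then 1 else 0) * T x y)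
    = (\<Sum>x\<in>adm s \<kappa>. \<Sum>y\<in>adm (\<not> s) \<kappa>. if y = ?y then (if x = ?x then T ?x ?y else 0) else 0)"
    by (intro sum.cong refl) auto
  also have "\<dots> = T ?x ?y" using xy finite_adm[OF k] by (simp add: sum.delta)
  finally have "gen_eig s c i * (gen_eig (\<not> s) d j * wproj \<kappa>) =
      (\<Sum>x\<in>adm s \<kappa>. \<Sum>y\<in>adm (\<not> s) \<kappa>. scl (if x = ?x \<and> y = ?y then 1 else 0) * (gen_eig_pair s x * (gen_eig_pair (\<not> s) y * wproj \<kappa>)))"
    unfolding T_def by (simp only: gen_eig_pair_def fst_conv snd_conv)
  thus ?thesis unfolding wspan_def by (intro CollectI exI)
qed

lemma ev_expand: "\<exists>a b. ev (casimir s) h = (\<Sum>c\<in>cas_ev s. scl (a c) * gen_eig s c 0 + scl (b c) * gen_eig s c 1)"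
proof -
  have "\<forall>c\<in>cas_ev s. \<exists>d. ev (casimir s) h * gen_eig s c 0 = scl (poly h c) * gen_eig s c 0 + scl d * gen_eig s c 1"
    using ev_gen_eig_0 by blast
  then obtain b where b: "\<forall>c\<in>cas_ev s. ev (casimir s) h * gen_eig s c 0 = scl (poly h c) * gen_eig s c 0 + scl (b c) * gen_eig s c 1"
    by metis
  have "ev (casimir s) h = (\<Sum>c\<in>cas_ev s. ev (casimir s) h * gen_eig s c 0)"
    unfolding sum_distrib_left[symmetric] gen_eig_sum by simp
  also have "\<dots> = (\<Sum>c\<in>cas_ev s. scl (poly h c) * gen_eig s c 0 + scl (b c) * gen_eig s c 1)"
    using b by (intro sum.cong) auto
  finally show ?thesis by blast
qed

lemma wspan_ev:
  assumes k: "\<kappa> \<in> mu"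
  shows "ev (casimir s) g * (ev (casimir (\<not> s)) h * wproj \<kappa>) \<in> wspan s \<kappa>"
proof -
  obtain a b where g: "ev (casimir s) g = (\<Sum>c\<in>cas_ev s. scl (a c) * gen_eig s c 0 + scl (b c) * gen_eig s c 1)" using ev_expand by blast
  obtain a' b' where h: "ev (casimir (\<not> s)) h = (\<Sum>c\<in>cas_ev (\<not> s). scl (a' c) * gen_eig (\<not> s) c 0 + scl (b' c) * gen_eig (\<not> s) c 1)" using ev_expand by blast
  have "(scl (a c) * gen_eig s c 0 + scl (b c) * gen_eig s c 1) * ((scl (a' d) * gen_eig (\<not> s) d 0 + scl (b' d) * gen_eig (\<not> s) d 1) * wproj \<kappa>) \<in> wspan s \<kappa>"
    if "c \<in> cas_ev s" "d \<in> cas_ev (\<not> s)" for c d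
    using that
    by (auto simp: distrib_left distrib_right mult.assoc scl.sc_left_comm[of "gen_eig s c _"] intro!: wspan_add wspan_scale wspan_gen_eig k)
  thus ?thesis unfolding g h sum_distrib_right sum_distrib_left by (intro wspan_sum)
qed

lemma om_pow_nz: "i < p s \<Longrightarrow> om s ^ i \<noteq> 0"
  using om_nz[of s] by (cases "i = 0") auto

text \<open>By \<open>ev_FE\<close> on both sides the monomial is a polynomial in the Casimirs up to
  powers of the two \<open>om\<close>. These are invertible since i < p and j < p', so that a
  vanishing \<open>om\<close> occurs only to the power 0.\<close>

lemma wspan_monl:
  assumes k: "\<kappa> \<in> mu" and "i < p s" "j < p (\<not> s)" shows "monl (diag_idx s \<kappa> i j) \<in> wspan s \<kappa>"
proof -
  let ?g = "\<Prod>t<i. [:- wq s \<kappa> t, 1:]" and ?h = "\<Prod>t<j. [:- wq (\<not> s) \<kappa> t, 1:]"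
  have gC: "ev (casimir s) ?g \<in> Cen" by (intro Cen_ev casimir_Cen)
  have "ev (casimir s) ?g * (ev (casimir (\<not> s)) ?h * wproj \<kappa>) = scl (om (\<not> s) ^ j) * (Fl (\<not> s) ^ j * (El (\<not> s) ^ j * (ev (casimir s) ?g * wproj \<kappa>)))"
    unfolding ev_FE[where s = "\<not> s", OF k] FE_def[of "\<not> s"] scl.sc_left_comm[of "ev (casimir s) ?g"]
    by (simp only: Cen_lcomm[OF gC, of "Fl (\<not> s) ^ j"] Cen_lcomm[OF gC, of "El (\<not> s) ^ j"] Al_pow Al_intros)
  also have "\<dots> = scl (om (\<not> s) ^ j * om s ^ i) * (Fl (\<not> s) ^ j * (El (\<not> s) ^ j * FE s i \<kappa>))"
    unfolding ev_FE[OF k] by (simp only: scl.sc_left_comm[of "El (\<not> s) ^ j"] scl.sc_left_comm[of "Fl (\<not> s) ^ j"] scl.sc_sc)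
  also have "Fl (\<not> s) ^ j * (El (\<not> s) ^ j * FE s i \<kappa>) = monl (diag_idx (\<not> s) \<kappa> j i)"
    using FE_monl[of "\<not> s" j i \<kappa>] by simp
  also have "diag_idx (\<not> s) \<kappa> j i = diag_idx s \<kappa> i j" by (auto simp: diag_idx_def fun_eq_iff)
  finally have e: "scl (om (\<not> s) ^ j * om s ^ i) * monl (diag_idx s \<kappa> i j) \<in> wspan s \<kappa>" using wspan_ev[OF k] by metis
  have "om (\<not> s) ^ j * om s ^ i \<noteq> 0" using om_pow_nz assms by simp
  hence "inverse (om (\<not> s) ^ j * om s ^ i) * (om (\<not> s) ^ j * om s ^ i) = 1" by (rule left_inverse)
  with wspan_scale[OF e, of "inverse (om (\<not> s) ^ j * om s ^ i)"] show ?thesis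
    unfolding scl.sc_sc by (simp only: scl.sc_1 mult_1)
qed

lemma K_monl: "fst d \<in> mu \<Longrightarrow> Kl * monl d = scl (eig d) * monl d"
  using cg_Phi[OF K_Mon] by (simp add: rep.Phi_mult Phi_Mon)

lemma wproj_K: "\<kappa> \<in> mu \<Longrightarrow> wproj \<kappa> * Kl = scl \<kappa> * wproj \<kappa>"
proof -
  have "wproj \<kappa> * Kl = Kl * wproj \<kappa>"
    unfolding wproj_formula
    by (simp add: sum_distrib_left sum_distrib_right mult.assoc scl.sc_left_comm[of Kl] power_commutes)
  thus "\<kappa> \<in> mu \<Longrightarrow> wproj \<kappa> * Kl = scl \<kappa> * wproj \<kappa>" by (simp add: K_wproj)
qed

lemma monl_K: "fst d \<in> mu \<Longrightarrow> monl d * Kl = scl (fst d) * monl d"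
  unfolding monl_def
  by (simp add: mult.assoc wproj_K scl.sc_left_comm[of "El _ ^ _"] scl.sc_left_comm[of "Fl _ ^ _"])

lemma monl_wproj: "fst d \<in> mu \<Longrightarrow> \<kappa> \<in> mu \<Longrightarrow> monl d * wproj \<kappa> = (if fst d = \<kappa> then monl d else 0)"
  unfolding monl_def by (auto simp: mult.assoc wproj_wproj)

text \<open>In PBW coordinates, commutation with \<open>K\<close> leaves only monomials with the
  same \<open>K\<close> eigenvalue at both ends. By \<open>q_both_inj\<close> these have equal e and
  f exponents on each side, and \<open>wspan_monl\<close> applies.\<close>

lemma weight_zero_span:
  assumes z: "z \<in> Al" "z * Kl = Kl * z" and k: "\<kappa> \<in> mu"
  shows "z * wproj \<kappa> \<in> wspan s \<kappa>"
proof -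
  obtain u where u: "z = (\<Sum>d\<in>Dom. scl (u d) * monl d)" using pbw_spanning z(1) by (auto simp: Al_def)
  have D: "fst d \<in> mu" if "d \<in> Dom" for d using that by (simp add: Dom_iff[of _ True])
  have "(\<Sum>d\<in>Dom. scl (u d * (fst d - eig d)) * monl d) = z * Kl - Kl * z"
    unfolding u sum_distrib_left sum_distrib_right sum_subtractf[symmetric]
    by (intro sum.cong refl)
      (simp add: D mult.assoc monl_K K_monl scl.sc_left_comm[of Kl] scl.sc_sc right_diff_distrib scl.sc_diff left_diff_distrib)
  hence "(\<Sum>d\<in>Dom. scl (u d * (fst d - eig d)) * monl d) = 0" using z(2) by simp
  hence u0: "u d = 0 \<or> eig d = fst d" if "d \<in> Dom" for d using pbw_independent[OF _ that] by fastforce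
  have diag: "d = diag_idx s (fst d) (fi s d) (fi (\<not> s) d)" if d: "d \<in> Dom" "eig d = fst d" for d
  proof -
    have "rat s (snd d) * rat (\<not> s) (snd d) = 1"
      using d mu_nz[OF D[OF d(1)]] by (simp add: eig_eq[of d s] mult.assoc)
    hence "q s ^ (2 * ei s d) * q (\<not> s) ^ (2 * ei (\<not> s) d) = q s ^ (2 * fi s d) * q (\<not> s) ^ (2 * fi (\<not> s) d)"
      by (simp add: rat_s)
    hence "ei s d = fi s d \<and> ei (\<not> s) d = fi (\<not> s) d"
      using d(1) by (intro q_both_inj) (auto simp: Dom_iff[of _ s])
    thus ?thesis by (intro pbw_eqI) (auto simp: diag_idx_def fi_def ei_def prod_eq_iff)
  qed
  have "z * wproj \<kappa> = (\<Sum>d\<in>Dom. scl (u d) * (monl d * wproj \<kappa>))"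
    unfolding u by (simp add: sum_distrib_right mult.assoc)
  also have "\<dots> \<in> wspan s \<kappa>"
  proof (rule wspan_sum)
    fix d assume d: "d \<in> Dom"
    consider "u d = 0" | "fst d \<noteq> \<kappa>" | "eig d = fst d" "fst d = \<kappa>" using u0[OF d] by blast
    thus "scl (u d) * (monl d * wproj \<kappa>) \<in> wspan s \<kappa>"
    proof cases
      case 1 thus ?thesis by (simp add: wspan_0)
    next
      case 2 thus ?thesis by (simp add: monl_wproj D d k wspan_0)
    next
      case 3
      have "monl (diag_idx s \<kappa> (fi s d) (fi (\<not> s) d)) \<in> wspan s \<kappa>"
        using d by (intro wspan_monl k) (auto simp: Dom_iff[of _ s])
      thus ?thesis using diag[OF d 3(1)] 3(2) by (simp add: monl_wproj D d k wspan_scale)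
    qed
  qed
  finally show ?thesis .
qed

end

context qparam
begin

section \<open>Sectors and arcs\<close>

text \<open>On a weight space the Casimir value \<open>c\<close> can only occur if the Cartan eigenvalue \<open>a\<close> satisfies
  \<open>a\<^sup>p = sect s c\<close>; the choice in the definition is
  immaterial, as the fibre is \<open>{a, Q\<^sup>-\<^sup>2 a\<^sup>-\<^sup>1}\<close> with \<open>a\<^sup>2\<^sup>p = 1\<close>.\<close>

definition fib :: "bool \<Rightarrow> complex \<Rightarrow> complex set" where "fib s c = {a \<in> mu2 s. cas s a = c}"
definition sect :: "bool \<Rightarrow> complex \<Rightarrow> complex" where "sect s c = (SOME a. a \<in> fib s c) ^ p s"

lemma pow_double: "x ^ (2 * n) = (x ^ n)\<^sup>2" for x :: complex
  by (simp only: mult.commute[of 2] power_mult)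

lemma iot_mu2: assumes "a \<in> mu2 s" shows "iot s a \<in> mu2 s" "iot s a ^ p s = a ^ p s"
proof -
  have "(a ^ p s)\<^sup>2 = 1" using assms by (simp only: mu2_def mem_Collect_eq pow_double)
  hence i: "inverse (a ^ p s) = a ^ p s" by (intro inverse_unique) (simp add: power2_eq_square)
  have "((Q s)\<^sup>2) ^ p s = 1" using Q_pow[of s] by (simp add: power_mult)
  thus e: "iot s a ^ p s = a ^ p s"
    unfolding iot_def power_inverse power_mult_distrib using i by simp
  show "iot s a \<in> mu2 s" using \<open>(a ^ p s)\<^sup>2 = 1\<close> unfolding mu2_def mem_Collect_eq pow_double e .
qed

lemma fib_eq: assumes "a \<in> mu2 s" shows "fib s (cas s a) = {a, iot s a}"
proof (intro equalityI subsetI)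
  fix b assume "b \<in> fib s (cas s a)"
  hence "b \<in> mu2 s" "cas s a = cas s b" by (simp_all add: fib_def)
  thus "b \<in> {a, iot s a}" using cas_fibre[OF assms] by blast
next
  fix b assume b: "b \<in> {a, iot s a}"
  hence m: "b \<in> mu2 s" using iot_mu2(1)[OF assms] assms by blast
  hence "cas s a = cas s b" using cas_fibre[OF assms m] b by blast
  thus "b \<in> fib s (cas s a)" using m by (simp add: fib_def)
qed

lemma sect_eq: assumes "a \<in> mu2 s" shows "sect s (cas s a) = a ^ p s"
proof -
  have "(SOME x. x \<in> fib s (cas s a)) \<in> {a, iot s a}"
    unfolding fib_eq[OF assms] by (rule someI[of _ a]) simp
  thus ?thesis unfolding sect_def using iot_mu2[OF assms] by auto
qed

lemma card_fib: "c \<in> cas_ev s \<Longrightarrow> card (fib s c) = 1 \<or> card (fib s c) = 2"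
proof -
  assume "c \<in> cas_ev s"
  then obtain a where a: "a \<in> mu2 s" "c = cas s a" by (auto simp: cas_ev_def)
  show ?thesis unfolding a(2) fib_eq[OF a(1)] by (cases "a = iot s a") auto
qed

text \<open>The p points are distinct solutions of b^p = a^p, an equation with exactly p
  roots.\<close>

lemma orbit:
  assumes "a \<in> mu2 s" shows "(\<lambda>t. a * Q s ^ (2 * t)) ` {..<p s} = {b. b ^ p s = a ^ p s}"
    and "inj_on (\<lambda>t. a * Q s ^ (2 * t)) {..<p s}"
proof -
  have nz: "a \<noteq> 0" by (rule mu2_nz[OF assms])
  show inj: "inj_on (\<lambda>t. a * Q s ^ (2 * t)) {..<p s}"
  proof (rule inj_onI)
    fix i j assume ij: "i \<in> {..<p s}" "j \<in> {..<p s}" "a * Q s ^ (2 * i) = a * Q s ^ (2 * j)"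
    have "Q s ^ (2 * i) = Q s ^ (2 * j)" using ij(3) nz by (metis mult_cancel_left)
    thus "i = j" using Q_inj ij by blast
  qed
  show "(\<lambda>t. a * Q s ^ (2 * t)) ` {..<p s} = {b. b ^ p s = a ^ p s}"
  proof (rule card_subset_eq)
    show "finite {b. b ^ p s = a ^ p s}" using p_pos[of s] by (rule finite_nth_roots)
    show "(\<lambda>t. a * Q s ^ (2 * t)) ` {..<p s} \<subseteq> {b. b ^ p s = a ^ p s}"
    proof (rule image_subsetI)
      fix t
      have "(Q s ^ (2 * t)) ^ p s = (Q s ^ (2 * p s)) ^ t" unfolding power_mult[symmetric] by (simp only: mult_ac)
      thus "a * Q s ^ (2 * t) \<in> {b. b ^ p s = a ^ p s}" by (simp add: power_mult_distrib Q_pow)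
    qed
    show "card ((\<lambda>t. a * Q s ^ (2 * t)) ` {..<p s}) = card {b. b ^ p s = a ^ p s}"
      using card_image[OF inj] card_nth_roots[of "a ^ p s" "p s"] nz p_pos[of s] by simp
  qed
qed

lemma sector_mu2: assumes "a \<in> mu2 s" "b ^ p s = a ^ p s" shows "b \<in> mu2 s"
proof -
  show ?thesis using assms(1) unfolding mu2_def mem_Collect_eq pow_double assms(2) .
qed

text \<open>The orbit of the Cartan eigenvalue is a full sector, and the reflection preserves
  sectors. So the fibre of \<open>c\<close> lies in the orbit entirely or not at all.\<close>

lemma mult_eq:
  assumes k: "\<kappa> \<in> mu" and c: "c \<in> cas_ev s"
  shows "mult s \<kappa> c = (if wt s \<kappa> ^ p s = sect s c then card (fib s c) else 0)"
proof -
  let ?w = "wt s \<kappa>"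
  have w: "?w \<in> mu2 s" by (rule wt_mu2[OF k])
  have img: "(\<lambda>t. ?w * Q s ^ (2 * t)) ` {t. t < p s \<and> wq s \<kappa> t = c} = {b \<in> fib s c. b ^ p s = ?w ^ p s}"
  proof (intro equalityI subsetI)
    fix b assume "b \<in> (\<lambda>t. ?w * Q s ^ (2 * t)) ` {t. t < p s \<and> wq s \<kappa> t = c}"
    then obtain t where t: "t < p s" "wq s \<kappa> t = c" "b = ?w * Q s ^ (2 * t)" by blast
    have "b ^ p s = ?w ^ p s" using orbit(1)[OF w] t by blast
    thus "b \<in> {b \<in> fib s c. b ^ p s = ?w ^ p s}" using t sector_mu2[OF w] by (simp add: fib_def wq_def)
  next
    fix b assume b: "b \<in> {b \<in> fib s c. b ^ p s = ?w ^ p s}"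
    hence "b \<in> (\<lambda>t. ?w * Q s ^ (2 * t)) ` {..<p s}" unfolding orbit(1)[OF w] by simp
    then obtain t where "t < p s" "b = ?w * Q s ^ (2 * t)" by auto
    thus "b \<in> (\<lambda>t. ?w * Q s ^ (2 * t)) ` {t. t < p s \<and> wq s \<kappa> t = c}" using b by (auto simp: fib_def wq_def)
  qed
  have inj: "inj_on (\<lambda>t. ?w * Q s ^ (2 * t)) {t. t < p s \<and> wq s \<kappa> t = c}"
    by (rule inj_on_subset[OF orbit(2)[OF w]]) auto
  have m: "mult s \<kappa> c = card {b \<in> fib s c. b ^ p s = ?w ^ p s}"
    unfolding mult_def img[symmetric] by (rule card_image[OF inj, symmetric])
  have "b ^ p s = sect s c" if "b \<in> fib s c" for b using that sect_eq[of b s] by (auto simp: fib_def)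
  hence e: "{b \<in> fib s c. b ^ p s = ?w ^ p s} = {b \<in> fib s c. sect s c = ?w ^ p s}" by (intro Collect_cong) auto
  show ?thesis unfolding m e by (cases "?w ^ p s = sect s c") simp_all
qed

lemma adm_iff: "\<kappa> \<in> mu \<Longrightarrow> (c, j) \<in> adm s \<kappa> \<longleftrightarrow> c \<in> cas_ev s \<and> wt s \<kappa> ^ p s = sect s c \<and> j < card (fib s c)"
  by (auto simp: adm_def mult_eq split: if_splits)

lemma wt_pow_sh: "wt s (sh s \<kappa>) ^ p s = wt s \<kappa> ^ p s"
  using Q_pow[of s] by (simp add: wt_sh power_mult_distrib power_mult)

lemma adm_sh: "\<kappa> \<in> mu \<Longrightarrow> adm s (sh s \<kappa>) = adm s \<kappa>" "\<kappa> \<in> mu \<Longrightarrow> adm (\<not> s) (sh s \<kappa>) = adm (\<not> s) \<kappa>"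
  by (auto simp: adm_iff sh_mu wt_pow_sh wt_sh(2))

text \<open>Only the coefficient of the last nonzero power is unconstrained at a fibre point; lower
  powers have no walls. A simple eigenvalue thus has one wall, for its idempotent.\<close>

definition walls :: "bool \<Rightarrow> complex \<Rightarrow> nat \<Rightarrow> complex set" where
  "walls s c j = (if Suc j < card (fib s c) then {} else fib s c)"

lemma orbit_const:
  fixes g :: "complex \<Rightarrow> complex"
  assumes a: "a \<in> mu2 s" and le: "m \<le> n" and g: "\<And>t. m \<le> t \<Longrightarrow> t < n \<Longrightarrow> g (a * Q s ^ (2 * Suc t)) = g (a * Q s ^ (2 * t))"
  shows "g (a * Q s ^ (2 * n)) = g (a * Q s ^ (2 * m))"
  using le g by (induction n rule: dec_induct) auto

text \<open>The exponents run from 1 to p instead of 0 to p - 1, so that a path along the cycle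
  starts just behind the wall \<open>a\<close> and ends at it.\<close>

lemma orbit1:
  assumes a: "a \<in> mu2 s" and b: "b ^ p s = a ^ p s"
  obtains t where "1 \<le> t" "t \<le> p s" "b = a * Q s ^ (2 * t)"
proof -
  have "b \<in> (\<lambda>t. a * Q s ^ (2 * t)) ` {..<p s}" unfolding orbit(1)[OF a] using b by simp
  then obtain t where t: "t < p s" "b = a * Q s ^ (2 * t)" by auto
  show ?thesis
  proof (cases "t = 0")
    case True
    thus ?thesis using that[of "p s"] t p_pos[of s] Q_pow[of s] by simp
  next
    case False thus ?thesis using that[of t] t by simp
  qed
qed

lemma orbit1_inj:
  assumes a: "a \<in> mu2 s" and t: "1 \<le> t" "t \<le> p s" "1 \<le> t'" "t' \<le> p s" "a * Q s ^ (2 * t) = a * Q s ^ (2 * t')"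
  shows "t = t'"
proof -
  have "a * Q s ^ (2 * Suc (t - 1)) = a * Q s ^ (2 * Suc (t' - 1))" using t by simp
  hence "Q s ^ (2 * (t - 1)) = Q s ^ (2 * (t' - 1))" using mu2_nz[OF a] by simp
  hence "t - 1 = t' - 1" using t by (intro Q_inj) auto
  thus ?thesis using t by simp
qed

lemma orbit_pow: "a \<in> mu2 s \<Longrightarrow> (a * Q s ^ (2 * t)) ^ p s = a ^ p s"
proof -
  have "(Q s ^ (2 * t)) ^ p s = (Q s ^ (2 * p s)) ^ t" unfolding power_mult[symmetric] by (simp only: mult_ac)
  thus ?thesis by (simp add: power_mult_distrib Q_pow)
qed

lemma Q_Suc: "a * Q s ^ (2 * Suc t) = a * Q s ^ (2 * t) * (Q s)\<^sup>2"
  by (simp add: power2_eq_square mult_ac)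

text \<open>A single cut does not disconnect a cycle: every point is reached from a Q^2 without
  taking the step that leaves \<open>a\<close>.\<close>

lemma one_wall_const:
  fixes g :: "complex \<Rightarrow> complex"
  assumes a: "a \<in> mu2 s" and b: "b ^ p s = a ^ p s" and b': "b' ^ p s = a ^ p s"
    and g: "\<And>b. b \<in> mu2 s \<Longrightarrow> b ^ p s = a ^ p s \<Longrightarrow> b \<noteq> a \<Longrightarrow> g (b * (Q s)\<^sup>2) = g b"
  shows "g b = g b'"
proof -
  have st: "g (a * Q s ^ (2 * Suc t)) = g (a * Q s ^ (2 * t))" if "1 \<le> t" "t < p s" for t
  proof -
    have "a * Q s ^ (2 * t) \<noteq> a"
    proof
      assume "a * Q s ^ (2 * t) = a"
      hence "a * Q s ^ (2 * t) = a * Q s ^ (2 * p s)" by (simp only: Q_pow mult_1_right)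
      from orbit1_inj[OF a _ _ _ _ this] that show False by simp
    qed
    thus ?thesis unfolding Q_Suc by (intro g mu2_Q a orbit_pow)
  qed
  have *: "g x = g (a * Q s ^ (2 * 1))" if x: "x ^ p s = a ^ p s" for x
  proof -
    obtain t where t: "1 \<le> t" "t \<le> p s" "x = a * Q s ^ (2 * t)" using orbit1[OF a x] .
    show ?thesis unfolding t(3)
    proof (rule orbit_const[where g = g, OF a t(1)])
      fix i assume "1 \<le> i" "i < t"
      hence "1 \<le> i" "i < p s" using t(2) by linarith+
      thus "g (a * Q s ^ (2 * Suc i)) = g (a * Q s ^ (2 * i))" by (rule st)
    qed
  qed
  show ?thesis using *[OF b] *[OF b'] by (rule trans[OF _ sym])
qed

text \<open>\<open>D\<close> is one of the two arcs into which the two points of \<^term>\<open>fib s c\<close> cut the cycle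
  \<open>a \<mapsto> a Q\<^sup>2\<close>; \<open>r\<close> and \<open>r'\<close> represent it and the complementary arc.\<close>

definition arc_spec :: "bool \<Rightarrow> complex \<Rightarrow> complex set \<times> complex \<times> complex \<Rightarrow> bool" where
  "arc_spec s c = (\<lambda>(D, r, r'). r \<in> D \<and> r' \<notin> D \<and> r ^ p s = sect s c \<and> r' ^ p s = sect s c \<and>
     (\<forall>a\<in>mu2 s. a ^ p s = sect s c \<and> a \<notin> fib s c \<longrightarrow> (a \<in> D \<longleftrightarrow> a * (Q s)\<^sup>2 \<in> D)) \<and>
     (\<forall>g::complex \<Rightarrow> complex. (\<forall>a\<in>mu2 s. a ^ p s = sect s c \<and> a \<notin> fib s c \<longrightarrow> g (a * (Q s)\<^sup>2) = g a) \<longrightarrow>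
        (\<forall>a\<in>mu2 s. a ^ p s = sect s c \<longrightarrow> g a = (if a \<in> D then g r else g r'))))"

text \<open>Along a Q^(2t) with t from 1 to p, the two walls sit at t = d and t = p. The arcs are
  1..d and d + 1..p: each ends with its wall, because the jump happens on the step that leaves the
  wall.\<close>

lemma two_arcs:
  assumes c: "c \<in> cas_ev s" and 2: "card (fib s c) = 2"
  shows "\<exists>x. arc_spec s c x"
proof -
  obtain a where a: "a \<in> mu2 s" "c = cas s a" using c by (auto simp: cas_ev_def)
  have fib: "fib s c = {a, iot s a}" using fib_eq[OF a(1)] a(2) by simp
  hence ne: "iot s a \<noteq> a" using 2 by (auto simp: card_insert_if split: if_splits)
  have sc: "sect s c = a ^ p s" using sect_eq[OF a(1)] a(2) by simp
  obtain d where d: "1 \<le> d" "d \<le> p s" "iot s a = a * Q s ^ (2 * d)" using orbit1[OF a(1) iot_mu2(2)[OF a(1)]] .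
  have dp: "d < p s" using d ne Q_pow[of s] by (metis le_neq_implies_less mult_1_right)
  define D where "D = (\<lambda>t. a * Q s ^ (2 * t)) ` {1..d}"
  define r where "r = a * Q s ^ (2 * 1)"
  define r' where "r' = a * Q s ^ (2 * Suc d)"
  have D: "a * Q s ^ (2 * t) \<in> D \<longleftrightarrow> t \<le> d" if t: "1 \<le> t" "t \<le> p s" for t
  proof
    assume "a * Q s ^ (2 * t) \<in> D"
    then obtain t' where t': "t' \<in> {1..d}" "a * Q s ^ (2 * t) = a * Q s ^ (2 * t')" unfolding D_def by blast
    have "t = t'" by (rule orbit1_inj[OF a(1) t _ _ t'(2)]) (use t' d in auto)
    thus "t \<le> d" using t' by simp
  qed (use t in \<open>auto simp: D_def\<close>)
  have nf: "a * Q s ^ (2 * t) \<notin> fib s c \<longleftrightarrow> t \<noteq> d \<and> t \<noteq> p s" if t: "1 \<le> t" "t \<le> p s" for t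
  proof -
    have "a * Q s ^ (2 * t) = a \<longleftrightarrow> t = p s"
    proof
      assume "a * Q s ^ (2 * t) = a"
      hence e: "a * Q s ^ (2 * t) = a * Q s ^ (2 * p s)" by (simp only: Q_pow mult_1_right)
      show "t = p s" by (rule orbit1_inj[OF a(1) t _ _ e]) (use p_pos[of s] in auto)
    qed (simp add: Q_pow)
    moreover have "a * Q s ^ (2 * t) = iot s a \<longleftrightarrow> t = d"
      unfolding d(3) using orbit1_inj[OF a(1) t d(1,2)] by blast
    ultimately show ?thesis unfolding fib by blast
  qed
  have "arc_spec s c (D, r, r')"
    unfolding arc_spec_def case_prod_conv sc
  proof (intro conjI ballI allI impI)
    show "r \<in> D" "r' \<notin> D" using D[of 1] D[of "Suc d"] d dp by (auto simp: r_def r'_def simp del: power_Suc mult_Suc_right)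
    show "r ^ p s = a ^ p s" "r' ^ p s = a ^ p s" unfolding r_def r'_def by (intro orbit_pow a)+
    fix b assume b: "b \<in> mu2 s"
    { assume bn: "b ^ p s = a ^ p s \<and> b \<notin> fib s c"
      obtain t where t: "1 \<le> t" "t \<le> p s" "b = a * Q s ^ (2 * t)" using orbit1[OF a(1)] bn by blast
      have "t \<noteq> d" "t \<noteq> p s" using nf[OF t(1,2)] bn t(3) by auto
      hence "t \<le> d \<longleftrightarrow> Suc t \<le> d" "Suc t \<le> p s" using t by auto
      thus "b \<in> D \<longleftrightarrow> b * (Q s)\<^sup>2 \<in> D"
        unfolding t(3) Q_Suc[symmetric] using D[of t] D[of "Suc t"] t by simp }
    { fix g :: "complex \<Rightarrow> complex"
      assume g: "\<forall>b\<in>mu2 s. b ^ p s = a ^ p s \<and> b \<notin> fib s c \<longrightarrow> g (b * (Q s)\<^sup>2) = g b" and bp: "b ^ p s = a ^ p s"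
      have st: "g (a * Q s ^ (2 * Suc t)) = g (a * Q s ^ (2 * t))" if "1 \<le> t" "t < p s" "t \<noteq> d" for t
      proof -
        have "a * Q s ^ (2 * t) \<notin> fib s c" using nf[of t] that by simp
        thus ?thesis unfolding Q_Suc using g mu2_Q[OF a(1)] orbit_pow[OF a(1)] by blast
      qed
      obtain t where t: "1 \<le> t" "t \<le> p s" "b = a * Q s ^ (2 * t)" using orbit1[OF a(1) bp] .
      show "g b = (if b \<in> D then g r else g r')"
      proof (cases "t \<le> d")
        case True
        have "g b = g r" unfolding t(3) r_def 
        proof (rule orbit_const[where g = g, OF a(1) t(1)])
          fix i assume "1 \<le> i" "i < t"
          hence "1 \<le> i" "i < p s" "i \<noteq> d" using t(2) True by linarith+
          thus "g (a * Q s ^ (2 * Suc i)) = g (a * Q s ^ (2 * i))" by (rule st)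
        qed
        thus ?thesis using D[OF t(1,2)] True t(3) by simp
      next
        case False
        have "g b = g r'" unfolding t(3) r'_def
        proof (rule orbit_const[where g = g, OF a(1)])
          show "Suc d \<le> t" using False by simp
          fix i assume "Suc d \<le> i" "i < t"
          hence "1 \<le> i" "i < p s" "i \<noteq> d" using t(2) by linarith+
          thus "g (a * Q s ^ (2 * Suc i)) = g (a * Q s ^ (2 * i))" by (rule st)
        qed
        thus ?thesis using D[OF t(1,2)] False t(3) by simp
      qed }
  qed
  thus ?thesis by blast
qed

definition arc_data :: "bool \<Rightarrow> complex \<Rightarrow> complex set \<times> complex \<times> complex" where
  "arc_data s c = (SOME x. arc_spec s c x)"

text \<open>The power of the nilpotent in a slot: slots 1 and 2 carry the same power and differ only
  by their arc.\<close>

definition lev :: "nat \<Rightarrow> nat" where "lev n = (if n = 0 then 0 else 1)"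

text \<open>Slot 2 takes the full complement of the first arc, points of other sectors included. At
  such weights the nilpotent is zero, so they contribute nothing.\<close>

definition arc :: "bool \<Rightarrow> complex \<Rightarrow> nat \<Rightarrow> complex set" where
  "arc s c n = (if n = 0 then UNIV else if n = 1 then fst (arc_data s c) else - fst (arc_data s c))"

definition arep :: "bool \<Rightarrow> complex \<Rightarrow> nat \<Rightarrow> complex" where
  "arep s c n = (if n = 0 then (SOME a. a \<in> fib s c) else if n = 1 then fst (snd (arc_data s c)) else snd (snd (arc_data s c)))"

text \<open>The half-block of \<open>c\<close> has the idempotent in slot 0 and, for a double eigenvalue, the nilpotents
  supported on the two arcs in slots 1 and 2.\<close>

definition slots :: "bool \<Rightarrow> complex \<Rightarrow> nat set" where
  "slots s c = (if card (fib s c) = 1 then {0} else {0, 1, 2})"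

lemma arc_data: assumes "c \<in> cas_ev s" "card (fib s c) = 2" shows "arc_spec s c (arc_data s c)"
  unfolding arc_data_def by (rule someI_ex[OF two_arcs[OF assms]])

lemma fib_ex: assumes "c \<in> cas_ev s" shows "(SOME a. a \<in> fib s c) \<in> fib s c"
  using card_fib[OF assms] by (intro some_in_eq[THEN iffD2]) auto

lemma fib_pow: "a \<in> fib s c \<Longrightarrow> a ^ p s = sect s c"
  using sect_eq[of a s] by (auto simp: fib_def)

lemma arep:
  assumes c: "c \<in> cas_ev s" and n: "n \<in> slots s c"
  shows "arep s c n \<in> mu2 s" "arep s c n ^ p s = sect s c" "arep s c n \<in> arc s c n"
proof -
  have f: "(SOME a. a \<in> fib s c) \<in> mu2 s" "(SOME a. a \<in> fib s c) ^ p s = sect s c"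
    using fib_ex[OF c] fib_pow[OF fib_ex[OF c]] by (auto simp: fib_def)
  have "arep s c n ^ p s = sect s c \<and> arep s c n \<in> arc s c n"
  proof (cases "n = 0")
    case True thus ?thesis using f by (simp add: arep_def arc_def)
  next
    case False
    hence "card (fib s c) = 2" using n card_fib[OF c] by (auto simp: slots_def)
    from arc_data[OF c this] False show ?thesis by (auto simp: arc_spec_def arep_def arc_def case_prod_beta)
  qed
  thus "arep s c n ^ p s = sect s c" "arep s c n \<in> arc s c n" by auto
  thus "arep s c n \<in> mu2 s" using sector_mu2[OF f(1)] f(2) by simp
qed

text \<open>Slot 0 has at most one wall, so \<open>one_wall_const\<close> applies. The other slots
  have both fibre points as walls, and \<open>arc_spec\<close> gives constancy on each arc.\<close>

lemma arc_const:
  fixes g :: "complex \<Rightarrow> complex"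
  assumes c: "c \<in> cas_ev s" and n: "n \<in> slots s c"
    and g: "\<And>a. a \<in> mu2 s \<Longrightarrow> a ^ p s = sect s c \<Longrightarrow> a \<notin> walls s c (lev n) \<Longrightarrow> g (a * (Q s)\<^sup>2) = g a"
    and a: "a ^ p s = sect s c" "a \<in> arc s c n"
  shows "g a = g (arep s c n)"
proof -
  define f where "f = (SOME a. a \<in> fib s c)"
  have f: "f \<in> fib s c" "f \<in> mu2 s" "f ^ p s = sect s c"
    using fib_ex[OF c] fib_pow[OF fib_ex[OF c]] by (auto simp: fib_def f_def)
  have am: "a \<in> mu2 s" using sector_mu2[OF f(2)] a f(3) by simp
  show ?thesis
  proof (cases "n = 0")
    case True
    have w: "walls s c 0 \<subseteq> {f}"
    proof (cases "card (fib s c) = 1")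
      case True
      then obtain x where "fib s c = {x}" by (metis card_1_singletonE)
      thus ?thesis using f by (auto simp: walls_def)
    next
      case False thus ?thesis using card_fib[OF c] by (simp add: walls_def)
    qed
    show ?thesis
      by (rule one_wall_const[OF f(2)]) (use a f arep[OF c n] w g True in \<open>auto simp: lev_def\<close>)
  next
    case False
    hence 2: "card (fib s c) = 2" using n card_fib[OF c] by (auto simp: slots_def)
    have l: "walls s c (lev n) = fib s c" using False 2 by (simp add: lev_def walls_def)
    obtain D r r' where x: "arc_data s c = (D, r, r')" by (cases "arc_data s c") auto
    have "arc_spec s c (D, r, r')" using arc_data[OF c 2] x by simp
    hence "g a = (if a \<in> D then g r else g r')"
      unfolding arc_spec_def case_prod_conv using g[unfolded l] am a by blast
    thus ?thesis using a(2) False by (auto simp: arc_def arep_def x split: if_splits)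
  qed
qed

text \<open>Chinese remaindering for roots of unity: with p' x = p y + 1 the quotient a^x / b^y has
  p'-th power a and p-th power b. The sectors have to agree, both being the power p p' of the
  weight.\<close>

lemma ex_kappa:
  assumes a: "a \<in> mu2 s" and b: "b \<in> mu2 (\<not> s)" and ab: "a ^ p s = b ^ p (\<not> s)"
  shows "\<exists>\<kappa>\<in>mu. wt s \<kappa> = a \<and> wt (\<not> s) \<kappa> = b"
proof -
  let ?P = "p s" and ?P' = "p (\<not> s)"
  obtain x y where xy: "?P' * x = ?P * y + 1"
    using bezout_nat[of ?P' ?P] p_pos[of "\<not> s"] p_coprime'[of s] by (auto simp: coprime_iff_gcd_eq_1 gcd.commute)
  have nz: "a \<noteq> 0" "b \<noteq> 0" using a b mu2_nz by auto
  define \<kappa> where "\<kappa> = a ^ x / b ^ y"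
  have "(a ^ x) ^ ?P' = a ^ (?P * y + 1)" by (simp only: xy[symmetric] power_mult[symmetric] mult.commute[of x])
  also have "\<dots> = a * (a ^ ?P) ^ y" by (simp add: power_mult)
  finally have 1: "(a ^ x) ^ ?P' = a * (a ^ ?P) ^ y" .
  have 2: "(b ^ y) ^ ?P' = (b ^ ?P') ^ y" by (rule pow_pow_commute)
  have ka: "\<kappa> ^ ?P' = a" unfolding \<kappa>_def power_divide 1 2 ab using nz by simp
  have "(a ^ x) ^ ?P = (b ^ ?P') ^ x" unfolding ab[symmetric] by (rule pow_pow_commute)
  also have "\<dots> = b ^ (?P * y + 1)" by (simp only: xy[symmetric] power_mult[symmetric])
  also have "\<dots> = b * (b ^ y) ^ ?P" by (simp add: power_mult[symmetric] mult.commute)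
  finally have kb: "\<kappa> ^ ?P = b" unfolding \<kappa>_def power_divide using nz by simp
  have "\<kappa> ^ N = (\<kappa> ^ ?P') ^ (2 * ?P)" unfolding N_eq[of s] power_mult[symmetric] by (simp only: mult_ac)
  hence "\<kappa> \<in> mu" using a unfolding ka by (simp add: mu_def mu2_def)
  thus ?thesis using ka kb by (auto simp: wt_def)
qed

lemma kappa_unique:
  assumes "\<kappa> \<in> mu" "\<kappa>' \<in> mu" "wt s \<kappa> = wt s \<kappa>'" "wt (\<not> s) \<kappa> = wt (\<not> s) \<kappa>'"
  shows "\<kappa> = \<kappa>'"
proof -
  let ?P = "p s" and ?P' = "p (\<not> s)"
  obtain x y where xy: "?P' * x = ?P * y + 1"
    using bezout_nat[of ?P' ?P] p_pos[of "\<not> s"] p_coprime'[of s] by (auto simp: coprime_iff_gcd_eq_1 gcd.commute)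
  define r where "r = \<kappa> / \<kappa>'"
  have "r ^ ?P' = 1" "r ^ ?P = 1" using assms mu_nz by (simp_all add: r_def wt_def power_divide)
  moreover have "(r ^ ?P') ^ x = (r ^ ?P) ^ y * r"
    unfolding power_mult[symmetric] xy by simp
  ultimately have "r = 1" by simp
  thus ?thesis using assms mu_nz by (simp add: r_def)
qed

definition joint_ev :: "bool \<Rightarrow> complex \<Rightarrow> complex \<Rightarrow> complex" where
  "joint_ev s a b = (SOME \<kappa>. \<kappa> \<in> mu \<and> wt s \<kappa> = a \<and> wt (\<not> s) \<kappa> = b)"

lemma joint_ev:
  assumes "a \<in> mu2 s" "b \<in> mu2 (\<not> s)" "a ^ p s = b ^ p (\<not> s)"
  shows "joint_ev s a b \<in> mu" "wt s (joint_ev s a b) = a" "wt (\<not> s) (joint_ev s a b) = b"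
proof -
  have "\<exists>\<kappa>. \<kappa> \<in> mu \<and> wt s \<kappa> = a \<and> wt (\<not> s) \<kappa> = b" using ex_kappa[OF assms] by blast
  from someI_ex[OF this] show "joint_ev s a b \<in> mu" "wt s (joint_ev s a b) = a" "wt (\<not> s) (joint_ev s a b) = b"
    unfolding joint_ev_def by auto
qed

lemma joint_ev_wt: assumes "\<kappa> \<in> mu" shows "joint_ev s (wt s \<kappa>) (wt (\<not> s) \<kappa>) = \<kappa>"
proof -
  have "\<exists>\<kappa>'. \<kappa>' \<in> mu \<and> wt s \<kappa>' = wt s \<kappa> \<and> wt (\<not> s) \<kappa>' = wt (\<not> s) \<kappa>" using assms by blast
  from someI_ex[OF this] have "joint_ev s (wt s \<kappa>) (wt (\<not> s) \<kappa>) \<in> mu"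
    "wt s (joint_ev s (wt s \<kappa>) (wt (\<not> s) \<kappa>)) = wt s \<kappa>" "wt (\<not> s) (joint_ev s (wt s \<kappa>) (wt (\<not> s) \<kappa>)) = wt (\<not> s) \<kappa>"
    unfolding joint_ev_def by blast+
  from kappa_unique[OF this(1) assms this(2,3)] show ?thesis .
qed

lemma wt_sector: "wt s \<kappa> ^ p s = wt (\<not> s) \<kappa> ^ p (\<not> s)"
  unfolding wt_def not_not by (rule pow_pow_commute)

lemma joint_ev_sh:
  assumes "a \<in> mu2 s" "b \<in> mu2 (\<not> s)" "a ^ p s = b ^ p (\<not> s)"
  shows "joint_ev s (a * (Q s)\<^sup>2) b = sh s (joint_ev s a b)"
proof -
  have k: "sh s (joint_ev s a b) \<in> mu" by (intro sh_mu joint_ev assms)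
  have w: "wt s (sh s (joint_ev s a b)) = a * (Q s)\<^sup>2" "wt (\<not> s) (sh s (joint_ev s a b)) = b"
    unfolding wt_sh joint_ev[OF assms] by (rule refl)+
  show ?thesis using joint_ev_wt[OF k, of s] unfolding w .
qed

lemma joint_ev_swap:
  assumes "a \<in> mu2 s" "b \<in> mu2 (\<not> s)" "a ^ p s = b ^ p (\<not> s)"
  shows "joint_ev (\<not> s) b a = joint_ev s a b"
proof -
  have "joint_ev (\<not> s) b a \<in> mu" "wt (\<not> s) (joint_ev (\<not> s) b a) = b" "wt s (joint_ev (\<not> s) b a) = a"
    using joint_ev[of b "\<not> s" a] assms by simp_all
  thus ?thesis using joint_ev[OF assms] kappa_unique[of "joint_ev (\<not> s) b a" "joint_ev s a b" s] by simp
qed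

section \<open>The central basis\<close>

definition wsum :: "bool \<Rightarrow> complex set \<Rightarrow> lop" where "wsum s D = (\<Sum>\<kappa>\<in>{\<kappa> \<in> mu. wt s \<kappa> \<in> D}. wproj \<kappa>)"

lemma wsum_Al [simp]: "wsum s D \<in> Al" by (simp add: wsum_def)

lemma wsum_wproj: assumes "\<kappa> \<in> mu" shows "wsum s D * wproj \<kappa> = (if wt s \<kappa> \<in> D then wproj \<kappa> else 0)"
proof -
  have "wsum s D * wproj \<kappa> = (\<Sum>\<kappa>'\<in>{\<kappa> \<in> mu. wt s \<kappa> \<in> D}. if \<kappa>' = \<kappa> then wproj \<kappa> else 0)"
    unfolding wsum_def sum_distrib_right by (intro sum.cong refl) (auto simp: wproj_wproj assms)
  thus ?thesis using assms finite_mu by (simp add: sum.delta)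
qed

lemma wsum_UNIV: "wsum s UNIV = 1" by (simp add: wsum_def wproj_sum)

text \<open>From the weight just above a wall, p - 1 further steps lead back to the wall, so the
  last root of the annihilating polynomial is \<open>c\<close>. The other p - 1 factors multiply to
  f^(p-1) e^(p-1) up to a scalar; they still contain the second root \<open>c\<close> and so act on
  the eigenspace as a nonzero multiple of the nilpotent.\<close>

lemma nb1_wall:
  assumes k: "\<kappa> \<in> mu" and c: "c \<in> cas_ev s" "card (fib s c) = 2" "wt s \<kappa> \<in> fib s c"
  shows "\<exists>a. gen_eig s c 1 * wproj (sh s \<kappa>) = scl a * (gen_eig s c 0 * FE s (p s - 1) (sh s \<kappa>))"
proof -
  let ?k = "sh s \<kappa>" and ?n = "p s - 1"
  have km: "?k \<in> mu" by (rule sh_mu[OF k])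
  have cw: "cas s (wt s \<kappa>) = c" using c(3) by (simp add: fib_def)
  have pw: "wt s ?k ^ p s = sect s c" using fib_pow[OF c(3)] by (simp add: wt_pow_sh)
  have m2: "mult s ?k c = 2" using mult_eq[OF km c(1)] pw c(2) by simp
  have "wt s ?k * Q s ^ (2 * ?n) = wt s \<kappa> * Q s ^ (2 * Suc ?n)" unfolding Q_Suc by (simp add: wt_sh mult_ac)
  also have "\<dots> = wt s \<kappa>" using p_pos[of s] Q_pow[of s] by simp
  finally have last: "wq s ?k ?n = c" using cw by (simp add: wq_def)
  obtain t where t: "t < p s" "t \<noteq> ?n" "wq s ?k t = c" using mult_card2[OF _ last m2] p_pos[of s] by auto
  let ?R = "root_poly s ?k {..<?n}" and ?R1 = "root_poly s ?k ({..<?n} - {t})"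
  have R: "?R = [:- c, 1:] * ?R1" using root_poly_remove[of "{..<?n}" t s ?k] t by simp
  \<comment> \<open>A further root equal to \<open>c\<close> would make the multiplicity 3.\<close>
  have nz: "poly ?R1 c \<noteq> 0"
  proof
    assume "poly ?R1 c = 0"
    then obtain t' where t': "t' < ?n" "t' \<noteq> t" "wq s ?k t' = c" by (auto simp: root_poly_root)
    have "{t, t', ?n} \<subseteq> {t. t < p s \<and> wq s ?k t = c}" using t t' last p_pos[of s] by auto
    hence "card {t, t', ?n} \<le> 2" unfolding m2[symmetric] mult_def by (intro card_mono) auto
    thus False using t t' by (simp add: card_insert_if)
  qed
  have "scl (poly ?R1 c) * (gen_eig s c 1 * wproj ?k) = ev (casimir s) ?R * gen_eig s c 0 * wproj ?k"
    unfolding ev_gen_eig_Suc[OF c(1) R] using ev_gen_eig_pos[OF c(1), of 1 ?R1] by (simp add: mult.assoc)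
  also have "\<dots> = gen_eig s c 0 * (ev (casimir s) ?R * wproj ?k)"
    using CenD[OF gen_eig_Cen[of s c 0], of "ev (casimir s) ?R"] by (simp add: mult.assoc[symmetric] Al_ev)
  also have "\<dots> = scl (om s ^ ?n) * (gen_eig s c 0 * FE s ?n ?k)"
    unfolding root_poly_def ev_FE[OF km] by (simp only: scl.sc_left_comm[of "gen_eig s c 0"])
  finally have e: "scl (poly ?R1 c) * (gen_eig s c 1 * wproj ?k) = scl (om s ^ ?n) * (gen_eig s c 0 * FE s ?n ?k)" .
  have "gen_eig s c 1 * wproj ?k = scl (inverse (poly ?R1 c)) * (scl (poly ?R1 c) * (gen_eig s c 1 * wproj ?k))"
    using nz by (simp add: scl.sc_sc)
  also have "\<dots> = scl (inverse (poly ?R1 c) * om s ^ ?n) * (gen_eig s c 0 * FE s ?n ?k)"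
    unfolding e by (simp add: scl.sc_sc)
  finally show ?thesis by blast
qed

text \<open>Next to the wall the nilpotent is a multiple of f^(p-1) e^(p-1), which vanishes with one
  more e on the right or f on the left. So no generator of this side carries the nilpotent across
  the wall.\<close>

lemma nb1_wall_El:
  assumes "\<kappa> \<in> mu" "c \<in> cas_ev s" "card (fib s c) = 2" "wt s \<kappa> \<in> fib s c"
  shows "gen_eig s c 1 * (El s * wproj \<kappa>) = 0" and "gen_eig s c 1 * (Fl s * wproj (sh s \<kappa>)) = 0"
proof -
  let ?n = "p s - 1"
  obtain a where a: "gen_eig s c 1 * wproj (sh s \<kappa>) = scl a * (gen_eig s c 0 * FE s ?n (sh s \<kappa>))" using nb1_wall[OF assms] by blast
  have "FE s ?n (sh s \<kappa>) * El s = Fl s ^ ?n * (El s ^ Suc ?n * wproj \<kappa>)"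
    unfolding FE_def by (simp add: mult.assoc El_wproj[symmetric] power_commutes) (simp add: power_commutes flip: mult.assoc)
  also have "\<dots> = 0" using p_pos[of s] El_pow[of s] by simp
  finally have z: "FE s ?n (sh s \<kappa>) * El s = 0" .
  have "gen_eig s c 1 * (El s * wproj \<kappa>) = gen_eig s c 1 * wproj (sh s \<kappa>) * El s" by (simp add: El_wproj mult.assoc)
  also have "\<dots> = scl a * (gen_eig s c 0 * (FE s ?n (sh s \<kappa>) * El s))" unfolding a by (simp add: mult.assoc)
  finally show "gen_eig s c 1 * (El s * wproj \<kappa>) = 0" using z by simp
  have "Fl s * FE s ?n (sh s \<kappa>) = Fl s ^ Suc ?n * (El s ^ ?n * wproj (sh s \<kappa>))"
    unfolding FE_def by (simp add: mult.assoc)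
  also have "\<dots> = 0" using p_pos[of s] Fl_pow[of s] by simp
  finally have z': "Fl s * FE s ?n (sh s \<kappa>) = 0" .
  have "gen_eig s c 1 * (Fl s * wproj (sh s \<kappa>)) = Fl s * (gen_eig s c 1 * wproj (sh s \<kappa>))"
    by (rule Cen_lcomm[symmetric]) simp_all
  also have "\<dots> = scl a * (gen_eig s c 0 * (Fl s * FE s ?n (sh s \<kappa>)))"
    unfolding a scl.sc_left_comm[of "Fl s"] by (subst Cen_lcomm) simp_all
  finally show "gen_eig s c 1 * (Fl s * wproj (sh s \<kappa>)) = 0" using z' by simp
qed

definition half_basis :: "bool \<Rightarrow> complex \<times> nat \<Rightarrow> lop" where
  "half_basis s u = gen_eig s (fst u) (lev (snd u)) * wsum s (arc s (fst u) (snd u))"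

definition half_index :: "bool \<Rightarrow> (complex \<times> nat) set" where "half_index s = {(c, n). c \<in> cas_ev s \<and> n \<in> slots s c}"

text \<open>Under e and f of side \<open>s\<close> the indicator of \<open>D\<close> changes only
  across a wall, where \<open>nb1_wall_El\<close> kills the nilpotent. Generators of the other side
  leave unchanged the Cartan eigenvalue on which the indicator depends.\<close>

lemma gen_eig_wsum_Cen:
  assumes c: "c \<in> cas_ev s" "card (fib s c) = 2"
    and D: "\<And>a. a \<in> mu2 s \<Longrightarrow> a ^ p s = sect s c \<Longrightarrow> a \<notin> fib s c \<Longrightarrow> a \<in> D \<longleftrightarrow> a * (Q s)\<^sup>2 \<in> D"
  shows "gen_eig s c 1 * wsum s D \<in> Cen"
proof (rule Cen_iff_gens)
  let ?n = "gen_eig s c 1"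
  define \<delta> where "\<delta> \<kappa> = (if wt s \<kappa> \<in> D then 1 else 0 :: lop)" for \<kappa>
  have P: "wsum s D * wproj \<kappa> = \<delta> \<kappa> * wproj \<kappa>" if "\<kappa> \<in> mu" for \<kappa> by (simp add: wsum_wproj that \<delta>_def)
  have d: "\<delta> (sh s \<kappa>) = \<delta> \<kappa> \<or> ?n * (El s * wproj \<kappa>) = 0 \<and> ?n * (Fl s * wproj (sh s \<kappa>)) = 0" if k: "\<kappa> \<in> mu" for \<kappa>
  proof (cases "wt s \<kappa> ^ p s = sect s c")
    case False
    have "?n * wproj \<kappa> = 0" by (rule gen_eig_wproj_mult[OF k c(1)]) (simp add: mult_eq[OF k c(1)] False)
    moreover have "?n * wproj (sh s \<kappa>) = 0"
      by (rule gen_eig_wproj_mult[OF sh_mu[OF k] c(1)]) (simp add: mult_eq[OF sh_mu[OF k] c(1)] False wt_pow_sh)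
    moreover have "?n * (El s * wproj \<kappa>) = El s * (?n * wproj \<kappa>)" "?n * (Fl s * wproj (sh s \<kappa>)) = Fl s * (?n * wproj (sh s \<kappa>))"
      by (rule Cen_lcomm[symmetric]; simp)+
    ultimately show ?thesis by simp
  next
    case True
    show ?thesis
    proof (cases "wt s \<kappa> \<in> fib s c")
      case True thus ?thesis using nb1_wall_El[OF k c] by blast
    next
      case False
      hence "wt s \<kappa> \<in> D \<longleftrightarrow> wt s (sh s \<kappa>) \<in> D" using D[OF wt_mu2[OF k] True] by (simp add: wt_sh)
      thus ?thesis by (simp add: \<delta>_def)
    qed
  qed
  have \<delta>_comm: "\<delta> \<kappa> * x = x * \<delta> \<kappa>" for \<kappa> x by (simp add: \<delta>_def)
  have lc: "x * (?n * y) = ?n * (x * y)" if "x \<in> Al" for x y using that by (intro Cen_lcomm) simp_all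
  have E: "?n * wsum s D * El s = El s * (?n * wsum s D)"
  proof (rule wproj_ext)
    fix \<kappa> assume k: "\<kappa> \<in> mu"
    have "?n * wsum s D * El s * wproj \<kappa> = ?n * ((wsum s D * wproj (sh s \<kappa>)) * El s)" by (simp add: mult.assoc El_wproj)
    also have "\<dots> = \<delta> (sh s \<kappa>) * (?n * (El s * wproj \<kappa>))"
      unfolding P[OF sh_mu[OF k]] by (simp add: mult.assoc El_wproj \<delta>_def)
    also have "\<dots> = \<delta> \<kappa> * (?n * (El s * wproj \<kappa>))" using d[OF k] by auto
    also have "\<dots> = El s * (?n * (wsum s D * wproj \<kappa>))" unfolding P[OF k] lc[OF Al_intros(4)] by (simp add: \<delta>_def)
    finally show "?n * wsum s D * El s * wproj \<kappa> = El s * (?n * wsum s D) * wproj \<kappa>" by (simp add: mult.assoc)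
  qed
  have F: "?n * wsum s D * Fl s = Fl s * (?n * wsum s D)"
  proof (rule wproj_ext)
    fix \<kappa>' assume "\<kappa>' \<in> mu"
    then obtain \<kappa> where k: "\<kappa> \<in> mu" "\<kappa>' = sh s \<kappa>" using sh_surj by blast
    have "?n * wsum s D * Fl s * wproj \<kappa>' = ?n * ((wsum s D * wproj \<kappa>) * Fl s)" by (simp add: mult.assoc Fl_wproj k)
    also have "\<dots> = \<delta> \<kappa> * (?n * (Fl s * wproj \<kappa>'))"
      unfolding P[OF k(1)] by (simp add: mult.assoc Fl_wproj k \<delta>_def)
    also have "\<dots> = \<delta> \<kappa>' * (?n * (Fl s * wproj \<kappa>'))" using d[OF k(1)] k(2) by auto
    also have "\<dots> = Fl s * (?n * (wsum s D * wproj \<kappa>'))"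
      using k sh_mu unfolding k(2) P[OF sh_mu[OF k(1)]] lc[OF Al_intros(5)] by (simp add: \<delta>_def)
    finally show "?n * wsum s D * Fl s * wproj \<kappa>' = Fl s * (?n * wsum s D) * wproj \<kappa>'" by (simp add: mult.assoc)
  qed
  have E': "?n * wsum s D * El (\<not> s) = El (\<not> s) * (?n * wsum s D)"
  proof (rule wproj_ext)
    fix \<kappa> assume k: "\<kappa> \<in> mu"
    have \<delta>': "\<delta> (sh (\<not> s) \<kappa>) = \<delta> \<kappa>" by (simp add: \<delta>_def wt_sh)
    have "?n * wsum s D * El (\<not> s) * wproj \<kappa> = ?n * ((wsum s D * wproj (sh (\<not> s) \<kappa>)) * El (\<not> s))" by (simp add: mult.assoc El_wproj)
    also have "\<dots> = \<delta> \<kappa> * (?n * (El (\<not> s) * wproj \<kappa>))"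
      unfolding P[OF sh_mu[OF k]] \<delta>' by (simp add: mult.assoc El_wproj \<delta>_def)
    also have "\<dots> = El (\<not> s) * (?n * (wsum s D * wproj \<kappa>))" unfolding P[OF k] lc[OF Al_intros(4)] by (simp add: \<delta>_def)
    finally show "?n * wsum s D * El (\<not> s) * wproj \<kappa> = El (\<not> s) * (?n * wsum s D) * wproj \<kappa>" by (simp add: mult.assoc)
  qed
  have F': "?n * wsum s D * Fl (\<not> s) = Fl (\<not> s) * (?n * wsum s D)"
  proof (rule wproj_ext)
    fix \<kappa>' assume "\<kappa>' \<in> mu"
    then obtain \<kappa> where k: "\<kappa> \<in> mu" "\<kappa>' = sh (\<not> s) \<kappa>" using sh_surj by blast
    have \<delta>': "\<delta> (sh (\<not> s) \<kappa>) = \<delta> \<kappa>" by (simp add: \<delta>_def wt_sh)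
    have "?n * wsum s D * Fl (\<not> s) * wproj \<kappa>' = ?n * ((wsum s D * wproj \<kappa>) * Fl (\<not> s))" by (simp add: mult.assoc Fl_wproj k)
    also have "\<dots> = \<delta> \<kappa> * (?n * (Fl (\<not> s) * wproj \<kappa>'))"
      unfolding P[OF k(1)] by (simp add: mult.assoc Fl_wproj k \<delta>_def)
    also have "\<dots> = Fl (\<not> s) * (?n * (wsum s D * wproj \<kappa>'))"
      unfolding k(2) P[OF sh_mu[OF k(1)]] \<delta>' lc[OF Al_intros(5)] by (simp add: \<delta>_def)
    finally show "?n * wsum s D * Fl (\<not> s) * wproj \<kappa>' = Fl (\<not> s) * (?n * wsum s D) * wproj \<kappa>'" by (simp add: mult.assoc)
  qed
  show "?n * wsum s D \<in> Al" by simp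
  show "?n * wsum s D * El t = El t * (?n * wsum s D)" for t using E E' by (cases "t = s") auto
  show "?n * wsum s D * Fl t = Fl t * (?n * wsum s D)" for t using F F' by (cases "t = s") auto
  show "?n * wsum s D * Kl = Kl * (?n * wsum s D)"
  proof -
    have "wsum s D * Kl = Kl * wsum s D"
      unfolding wsum_def sum_distrib_left sum_distrib_right by (intro sum.cong refl) (simp add: wproj_K K_wproj)
    thus ?thesis using lc[of Kl "wsum s D"] by (simp add: mult.assoc)
  qed
qed

lemma half_basis_Cen: assumes "u \<in> half_index s" shows "half_basis s u \<in> Cen"
proof -
  obtain c n where u: "u = (c, n)" by (cases u)
  have c: "c \<in> cas_ev s" and n: "n \<in> slots s c" using assms by (auto simp: half_index_def u)
  show ?thesis
  proof (cases "n = 0")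
    case True thus ?thesis by (simp add: half_basis_def u lev_def arc_def wsum_UNIV)
  next
    case False
    hence 2: "card (fib s c) = 2" using n card_fib[OF c] by (auto simp: slots_def)
    have "half_basis s u = gen_eig s c 1 * wsum s (arc s c n)" using False by (simp add: half_basis_def u lev_def)
    also have "\<dots> \<in> Cen"
    proof (rule gen_eig_wsum_Cen[OF c 2])
      fix a assume "a \<in> mu2 s" "a ^ p s = sect s c" "a \<notin> fib s c"
      thus "a \<in> arc s c n \<longleftrightarrow> a * (Q s)\<^sup>2 \<in> arc s c n"
        using arc_data[OF c 2] False unfolding arc_spec_def arc_def case_prod_beta by auto
    qed
    finally show ?thesis .
  qed
qed

lemma half_basis_wproj:
  assumes "\<kappa> \<in> mu"
  shows "half_basis s (c, n) * wproj \<kappa> = (if wt s \<kappa> \<in> arc s c n then gen_eig s c (lev n) * wproj \<kappa> else 0)"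
  by (simp add: half_basis_def mult.assoc wsum_wproj assms)

lemma half_basis_orth:
  assumes "u \<in> half_index s" "v \<in> half_index s" "fst u \<noteq> fst v" shows "half_basis s u * half_basis s v = 0"
proof -
  obtain c n where u: "u = (c, n)" by (cases u)
  obtain d m where v: "v = (d, m)" by (cases v)
  have "half_basis s u * half_basis s v = gen_eig s c (lev n) * (gen_eig s d (lev m) * (wsum s (arc s c n) * wsum s (arc s d m)))"
    unfolding half_basis_def u v fst_conv snd_conv mult.assoc by (subst Cen_lcomm[of "gen_eig s d (lev m)" "wsum s (arc s c n)"]) simp_all
  also have "\<dots> = 0"
    using gen_eig_orth[of c s d] assms by (simp add: u v half_index_def flip: mult.assoc)
  finally show ?thesis .
qed

lemma half_basis_0: assumes "(c, n) \<in> half_index s" shows "half_basis s (c, 0) * half_basis s (c, n) = half_basis s (c, n)"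
  using assms gen_eig_mult[of c s 0 "lev n"] by (simp add: half_basis_def lev_def arc_def wsum_UNIV half_index_def flip: mult.assoc)

lemma half_basis_rad:
  assumes "(c, n) \<in> half_index s" "(c, m) \<in> half_index s" "n \<noteq> 0" "m \<noteq> 0" shows "half_basis s (c, n) * half_basis s (c, m) = 0"
proof -
  have c: "c \<in> cas_ev s" using assms by (simp add: half_index_def)
  have "half_basis s (c, n) * half_basis s (c, m) = gen_eig s c 1 * (gen_eig s c 1 * (wsum s (arc s c n) * wsum s (arc s c m)))"
    using assms unfolding half_basis_def fst_conv snd_conv mult.assoc
    by (subst Cen_lcomm[of "gen_eig s c (lev m)" "wsum s (arc s c n)"]) (simp_all add: lev_def)
  also have "\<dots> = 0"
    using gen_eig_mult[OF c, of 1 1] gen_eig_ge_2[OF c, of 2] by (simp add: numeral_2_eq_2 flip: mult.assoc)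
  finally show ?thesis .
qed

subsection \<open>Coordinates of central elements\<close>

definition repr :: "bool \<Rightarrow> complex \<Rightarrow> (complex \<times> nat \<Rightarrow> complex \<times> nat \<Rightarrow> complex) \<Rightarrow> lop \<Rightarrow> bool" where
  "repr s \<kappa> h z \<longleftrightarrow> z * wproj \<kappa> = (\<Sum>x\<in>adm s \<kappa>. \<Sum>y\<in>adm (\<not> s) \<kappa>. scl (h x y) * (gen_eig_pair s x * (gen_eig_pair (\<not> s) y * wproj \<kappa>)))"

lemma gen_eig_pair_swap: "gen_eig_pair s x * (gen_eig_pair t y * z) = gen_eig_pair t y * (gen_eig_pair s x * z)"
  by (rule Cen_lcomm) simp_all

lemma repr_swap: "repr s \<kappa> h z \<Longrightarrow> repr (\<not> s) \<kappa> (\<lambda>y x. h x y) z"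
  unfolding repr_def not_not
  by (subst sum.swap) (simp only: gen_eig_pair_swap[of s _ "\<not> s"])

lemma X_gen_eig: "c \<in> cas_ev s \<Longrightarrow> (casimir s - scl a) * gen_eig s c j = scl (c - a) * gen_eig s c j + gen_eig s c (Suc j)"
proof -
  assume c: "c \<in> cas_ev s"
  have "(casimir s - scl c) * gen_eig s c j = gen_eig s c (Suc j)"
    using ev_gen_eig_Suc[OF c, of "[:- c, 1:]" 1 j] by (simp add: scl.ev_linear)
  thus ?thesis by (simp add: left_diff_distrib scl.sc_diff algebra_simps)
qed

lemma adm_Sigma: "adm s \<kappa> = Sigma (cas_ev s) (\<lambda>c. {..<mult s \<kappa> c})"
  by (auto simp: adm_def)

text \<open>Commutation with e equates the images under e of both coordinate families; multiplied by
  \<open>om s\<close> f, it says that the Casimir minus its value a at \<kappa> kills their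
  difference d. In coordinates (c - a) d_j + d_(j-1) = 0 below the multiplicity. If \<open>c\<close>
  differs from a, all d_j vanish; if it equals a, all but the last.\<close>

lemma shift_coords:
  assumes k: "\<kappa> \<in> mu" and z: "z \<in> Cen" and h: "repr s \<kappa> h z" and h': "repr s (sh s \<kappa>) h' z"
    and x: "(c, j) \<in> adm s \<kappa>" and y: "y \<in> adm (\<not> s) \<kappa>"
    and w: "cas s (wt s \<kappa>) \<noteq> c \<or> Suc j < mult s \<kappa> c"
  shows "h' (c, j) y = h (c, j) y"
proof -
  let ?a = "cas s (wt s \<kappa>)"
  define \<Delta> where "\<Delta> x y = h' x y - h x y" for x y
  define T where "T c j y = gen_eig s c j * (gen_eig_pair (\<not> s) y * wproj \<kappa>)" for c j y
  \<comment> \<open>Coordinates of the Casimir minus \<open>?a\<close> applied to the difference;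
    the second summand is the shift by one power of the nilpotent.\<close>
  define g where "g x y = (fst x - ?a) * \<Delta> x y + (if snd x = 0 then 0 else \<Delta> (fst x, snd x - 1) y)" for x y
  have com: "gen_eig_pair s x * (gen_eig_pair (\<not> s) y * (Fl s * v)) = Fl s * (gen_eig_pair s x * (gen_eig_pair (\<not> s) y * v))" for x y v
    by (simp add: Cen_lcomm[of "gen_eig_pair s x" "Fl s"] Cen_lcomm[of "gen_eig_pair (\<not> s) y" "Fl s"])
  have comE: "gen_eig_pair s x * (gen_eig_pair (\<not> s) y * (El s * v)) = El s * (gen_eig_pair s x * (gen_eig_pair (\<not> s) y * v))" for x y v
    by (simp add: Cen_lcomm[of "gen_eig_pair s x" "El s"] Cen_lcomm[of "gen_eig_pair (\<not> s) y" "El s"])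
  have "scl (om s) * (Fl s * ((z * wproj (sh s \<kappa>)) * El s)) = scl (om s) * (Fl s * (El s * (z * wproj \<kappa>)))"
    using Cen_lcomm[OF z, of "El s"] by (simp add: mult.assoc El_wproj)
  also have "(z * wproj (sh s \<kappa>)) * El s = (\<Sum>x\<in>adm s \<kappa>. \<Sum>y\<in>adm (\<not> s) \<kappa>. scl (h' x y) * (gen_eig_pair s x * (gen_eig_pair (\<not> s) y * (El s * wproj \<kappa>))))"
    unfolding h'[unfolded repr_def] adm_sh[OF k] by (simp add: sum_distrib_right mult.assoc El_wproj)
  also have "El s * (z * wproj \<kappa>) = (\<Sum>x\<in>adm s \<kappa>. \<Sum>y\<in>adm (\<not> s) \<kappa>. scl (h x y) * (gen_eig_pair s x * (gen_eig_pair (\<not> s) y * (El s * wproj \<kappa>))))"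
    unfolding h[unfolded repr_def] by (simp only: sum_distrib_left comE scl.sc_left_comm[of "El s"])
  finally have e0: "scl (om s) * (Fl s * (\<Sum>x\<in>adm s \<kappa>. \<Sum>y\<in>adm (\<not> s) \<kappa>. scl (\<Delta> x y) * (gen_eig_pair s x * (gen_eig_pair (\<not> s) y * (El s * wproj \<kappa>))))) = 0"
    by (simp add: \<Delta>_def scl.sc_diff left_diff_distrib sum_subtractf right_diff_distrib)
  have "(\<Sum>x\<in>adm s \<kappa>. \<Sum>y\<in>adm (\<not> s) \<kappa>. scl (\<Delta> x y) * (gen_eig_pair s x * (gen_eig_pair (\<not> s) y * (scl (om s) * (Fl s * (El s * wproj \<kappa>)))))) = 0"
    using e0 by (simp only: sum_distrib_left com[symmetric] scl.sc_left_comm[of "Fl s"] scl.sc_left_comm[of "gen_eig_pair s _"]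
        scl.sc_left_comm[of "gen_eig_pair (\<not> s) _"] scl.sc_left_comm[of "scl (om s)"])
  hence e1: "(\<Sum>x\<in>adm s \<kappa>. \<Sum>y\<in>adm (\<not> s) \<kappa>. scl (\<Delta> x y) * (gen_eig_pair s x * (gen_eig_pair (\<not> s) y * ((casimir s - scl ?a) * wproj \<kappa>)))) = 0"
    unfolding om_FE[OF k] .
  have XC: "casimir s - scl ?a \<in> Cen" using Cen_ev[OF casimir_Cen[of s], of "[:- ?a, 1:]"] by (simp add: scl.ev_linear)
  have tX: "gen_eig_pair s (c, j) * (gen_eig_pair (\<not> s) y * ((casimir s - scl ?a) * wproj \<kappa>)) = scl (c - ?a) * T c j y + T c (Suc j) y"
    if "c \<in> cas_ev s" for c j y
  proof -
    have "gen_eig_pair s (c, j) * (gen_eig_pair (\<not> s) y * ((casimir s - scl ?a) * wproj \<kappa>)) = ((casimir s - scl ?a) * gen_eig s c j) * (gen_eig_pair (\<not> s) y * wproj \<kappa>)"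
      unfolding Cen_lcomm[OF XC gen_eig_pair_Al] by (simp only: gen_eig_pair_def fst_conv snd_conv mult.assoc)
    thus ?thesis unfolding X_gen_eig[OF that] by (simp add: T_def distrib_right mult.assoc)
  qed
  \<comment> \<open>The power equal to the multiplicity vanishes, so the shifted sum has no boundary
    term.\<close>
  have Tm: "T c (mult s \<kappa> c) y = 0" if "c \<in> cas_ev s" for c y
  proof -
    have "T c (mult s \<kappa> c) y = gen_eig_pair (\<not> s) y * (gen_eig s c (mult s \<kappa> c) * wproj \<kappa>)"
      unfolding T_def by (rule Cen_lcomm) simp_all
    thus ?thesis using gen_eig_wproj_mult[OF k that, of "mult s \<kappa> c"] by simp
  qed
  have sh: "(\<Sum>j<mult s \<kappa> c. scl (\<Delta> (c, j) y) * T c (Suc j) y) =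
      (\<Sum>j<mult s \<kappa> c. scl (if j = 0 then 0 else \<Delta> (c, j - 1) y) * T c j y)" if "c \<in> cas_ev s" for c y
  proof -
    let ?G = "\<lambda>j. scl (if j = 0 then 0 else \<Delta> (c, j - 1) y) * T c j y"
    have "(\<Sum>j<mult s \<kappa> c. scl (\<Delta> (c, j) y) * T c (Suc j) y) = (\<Sum>j<Suc (mult s \<kappa> c). ?G j)"
      unfolding sum.lessThan_Suc_shift by simp
    also have "\<dots> = (\<Sum>j<mult s \<kappa> c. ?G j)" using Tm[OF that] by simp
    finally show ?thesis .
  qed
  have fin: "finite (cas_ev s)" "finite (adm (\<not> s) \<kappa>)" by (simp_all add: finite_cas_ev finite_adm k)
  have S: "(\<Sum>x\<in>adm s \<kappa>. f x) = (\<Sum>c\<in>cas_ev s. \<Sum>j<mult s \<kappa> c. f (c, j))" for f :: "complex \<times> nat \<Rightarrow> lop"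
    unfolding adm_Sigma by (subst sum.Sigma) (simp_all add: finite_cas_ev)
  have "0 = (\<Sum>y\<in>adm (\<not> s) \<kappa>. \<Sum>x\<in>adm s \<kappa>. scl (\<Delta> x y) * (gen_eig_pair s x * (gen_eig_pair (\<not> s) y * ((casimir s - scl ?a) * wproj \<kappa>))))"
    unfolding e1[symmetric] by (rule sum.swap)
  also have "\<dots> = (\<Sum>y\<in>adm (\<not> s) \<kappa>. \<Sum>c\<in>cas_ev s. \<Sum>j<mult s \<kappa> c. scl (\<Delta> (c, j) y) * (scl (c - ?a) * T c j y + T c (Suc j) y))"
    unfolding S by (intro sum.cong refl) (simp only: tX)
  also have "\<dots> = (\<Sum>y\<in>adm (\<not> s) \<kappa>. \<Sum>c\<in>cas_ev s. \<Sum>j<mult s \<kappa> c. scl (g (c, j) y) * T c j y)"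
  proof (rule sum.cong[OF refl], rule sum.cong[OF refl])
    fix y c assume c: "c \<in> cas_ev s"
    have "(\<Sum>j<mult s \<kappa> c. scl (\<Delta> (c, j) y) * (scl (c - ?a) * T c j y + T c (Suc j) y)) =
      (\<Sum>j<mult s \<kappa> c. scl ((c - ?a) * \<Delta> (c, j) y) * T c j y) + (\<Sum>j<mult s \<kappa> c. scl (\<Delta> (c, j) y) * T c (Suc j) y)"
      by (simp add: distrib_left sum.distrib scl.sc_sc mult.commute)
    also have "\<dots> = (\<Sum>j<mult s \<kappa> c. scl (g (c, j) y) * T c j y)"
      unfolding sh[OF c] g_def fst_conv snd_conv by (simp add: scl.sc_add distrib_right sum.distrib)
    finally show "(\<Sum>j<mult s \<kappa> c. scl (\<Delta> (c, j) y) * (scl (c - ?a) * T c j y + T c (Suc j) y)) = (\<Sum>j<mult s \<kappa> c. scl (g (c, j) y) * T c j y)" .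
  qed
  also have "\<dots> = (\<Sum>y\<in>adm (\<not> s) \<kappa>. \<Sum>x\<in>adm s \<kappa>. scl (g x y) * (gen_eig_pair s x * (gen_eig_pair (\<not> s) y * wproj \<kappa>)))"
    unfolding S by (simp add: T_def gen_eig_pair_def)
  also have "\<dots> = (\<Sum>x\<in>adm s \<kappa>. \<Sum>y\<in>adm (\<not> s) \<kappa>. scl (g x y) * (gen_eig_pair s x * (gen_eig_pair (\<not> s) y * wproj \<kappa>)))"
    by (rule sum.swap)
  finally have e2: "(\<Sum>x\<in>adm s \<kappa>. \<Sum>y\<in>adm (\<not> s) \<kappa>. scl (g x y) * (gen_eig_pair s x * (gen_eig_pair (\<not> s) y * wproj \<kappa>))) = 0" by (rule sym)
  have g0: "g (c, i) y = 0" if "i < mult s \<kappa> c" for i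
    using adm_indep[OF k e2 _ y, of "(c, i)"] x that by (simp add: adm_def)
  have jm: "j < mult s \<kappa> c" using x by (simp add: adm_def)
  have "\<Delta> (c, j) y = 0"
  proof (cases "?a = c")
    case True
    hence "Suc j < mult s \<kappa> c" using w by simp
    from g0[OF this] True show ?thesis by (simp add: g_def)
  next
    case False
    have "\<Delta> (c, i) y = 0" if "i < mult s \<kappa> c" for i
      using that
    proof (induction i)
      case 0 thus ?case using g0[of 0] False by (simp add: g_def)
    next
      case (Suc i) thus ?case using g0[of "Suc i"] False by (simp add: g_def)
    qed
    thus ?thesis using jm by blast
  qed
  thus ?thesis by (simp add: \<Delta>_def)
qed

end

section \<open>From coordinates on weight spaces to a basis of the center\<close>

context qparam
begin

text \<open>Indices of those half-basis elements that do not vanish on the weight space.\<close>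

definition wt_index :: "bool \<Rightarrow> complex \<Rightarrow> (complex \<times> nat) set" where
  "wt_index s \<kappa> = {(c, n). (c, n) \<in> half_index s \<and> wt s \<kappa> ^ p s = sect s c \<and> wt s \<kappa> \<in> arc s c n}"

definition phi :: "complex \<times> nat \<Rightarrow> complex \<times> nat" where "phi u = (fst u, lev (snd u))"

lemma slots_cases:
  assumes "c \<in> cas_ev s" "n \<in> slots s c"
  obtains "n = 0" | "n = 1" "card (fib s c) = 2" | "n = 2" "card (fib s c) = 2"
  using assms card_fib[of c s] by (auto simp: slots_def split: if_splits)

lemma lev_less: "c \<in> cas_ev s \<Longrightarrow> n \<in> slots s c \<Longrightarrow> lev n < card (fib s c)"
  using card_fib[of c s] by (auto simp: slots_def lev_def split: if_splits)

text \<open>A double eigenvalue has two slots of power 1, but the weight lies in exactly one of the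
  two arcs, so forgetting the arc loses nothing.\<close>

lemma phi_bij: assumes k: "\<kappa> \<in> mu" shows "bij_betw phi (wt_index s \<kappa>) (adm s \<kappa>)"
proof (rule bij_betw_imageI)
  show "inj_on phi (wt_index s \<kappa>)"
  proof (rule inj_onI)
    fix u v assume u: "u \<in> wt_index s \<kappa>" and v: "v \<in> wt_index s \<kappa>" and e: "phi u = phi v"
    obtain c n where un: "u = (c, n)" by (cases u)
    obtain m where vm: "v = (c, m)" and l: "lev n = lev m" using e by (cases v) (auto simp: phi_def un)
    have T: "c \<in> cas_ev s" "n \<in> slots s c" "m \<in> slots s c" "wt s \<kappa> \<in> arc s c n" "wt s \<kappa> \<in> arc s c m"
      using u v by (auto simp: wt_index_def un vm half_index_def)
    have "n = m"
      by (rule slots_cases[OF T(1,2)]; rule slots_cases[OF T(1,3)]) (use T(4,5) l in \<open>auto simp: arc_def lev_def\<close>)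
    thus "u = v" by (simp add: un vm)
  qed
  show "phi ` wt_index s \<kappa> = adm s \<kappa>"
  proof (intro equalityI subsetI)
    fix x assume "x \<in> phi ` wt_index s \<kappa>"
    thus "x \<in> adm s \<kappa>" by (auto simp: wt_index_def phi_def half_index_def adm_iff[OF k] intro: lev_less)
  next
    fix x assume x: "x \<in> adm s \<kappa>"
    obtain c j where cj: "x = (c, j)" by (cases x)
    have a: "c \<in> cas_ev s" "wt s \<kappa> ^ p s = sect s c" "j < card (fib s c)" using x by (auto simp: cj adm_iff[OF k])
    show "x \<in> phi ` wt_index s \<kappa>"
    proof (cases "j = 0")
      case True
      have "(c, 0) \<in> wt_index s \<kappa>" using a by (auto simp: wt_index_def half_index_def slots_def arc_def)
      thus ?thesis by (rule rev_image_eqI) (simp add: cj True phi_def lev_def)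
    next
      case False
      hence j: "j = 1" "card (fib s c) = 2" using a card_fib[OF a(1)] by auto
      let ?n = "if wt s \<kappa> \<in> arc s c 1 then 1 else 2 :: nat"
      have "(c, ?n) \<in> wt_index s \<kappa>" using a j by (auto simp: wt_index_def half_index_def slots_def arc_def)
      thus ?thesis by (rule rev_image_eqI) (simp add: cj j phi_def lev_def)
    qed
  qed
qed

lemma half_basis_wproj_wt_index:
  assumes k: "\<kappa> \<in> mu" and u: "u \<in> half_index s"
  shows "half_basis s u * wproj \<kappa> = (if u \<in> wt_index s \<kappa> then gen_eig_pair s (phi u) * wproj \<kappa> else 0)"
proof -
  obtain c n where cn: "u = (c, n)" by (cases u)
  have c: "c \<in> cas_ev s" using u by (simp add: cn half_index_def)
  show ?thesis
  proof (cases "wt s \<kappa> ^ p s = sect s c")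
    case True
    thus ?thesis using u by (simp add: cn half_basis_wproj[OF k] wt_index_def gen_eig_pair_def phi_def)
  next
    case False
    have "gen_eig s c (lev n) * wproj \<kappa> = 0" by (rule gen_eig_wproj_mult[OF k c]) (simp add: mult_eq[OF k c] False)
    thus ?thesis using False by (simp add: cn half_basis_wproj[OF k] wt_index_def)
  qed
qed

definition cbasis_index :: "((complex \<times> nat) \<times> (complex \<times> nat)) set" where
  "cbasis_index = {(u, v). u \<in> half_index True \<and> v \<in> half_index False \<and> sect True (fst u) = sect False (fst v)}"

definition cbasis :: "(complex \<times> nat) \<times> (complex \<times> nat) \<Rightarrow> lop" where
  "cbasis t = half_basis True (fst t) * half_basis False (snd t)"

lemma finite_slots [simp]: "finite (slots s c)" by (simp add: slots_def)

lemma finite_half_index: "finite (half_index s)"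
proof -
  have "half_index s = Sigma (cas_ev s) (slots s)" by (auto simp: half_index_def)
  thus ?thesis by (simp add: finite_cas_ev)
qed

lemma finite_cbasis_index: "finite cbasis_index"
  by (rule finite_subset[of _ "half_index True \<times> half_index False"]) (auto simp: cbasis_index_def finite_half_index)

lemma wt_index_cbasis_index: "wt_index True \<kappa> \<times> wt_index False \<kappa> \<subseteq> cbasis_index"
  using wt_sector[of True \<kappa>] by (auto simp: wt_index_def cbasis_index_def)

lemma cbasis_wproj:
  assumes k: "\<kappa> \<in> mu" and t: "t \<in> cbasis_index"
  shows "cbasis t * wproj \<kappa> = (if t \<in> wt_index True \<kappa> \<times> wt_index False \<kappa>
    then gen_eig_pair True (phi (fst t)) * (gen_eig_pair False (phi (snd t)) * wproj \<kappa>) else 0)"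
proof -
  obtain u v where uv: "t = (u, v)" by (cases t)
  have T: "u \<in> half_index True" "v \<in> half_index False" using t by (auto simp: cbasis_index_def uv)
  have "cbasis t * wproj \<kappa> = half_basis True u * (half_basis False v * wproj \<kappa>)" by (simp add: cbasis_def uv mult.assoc)
  also have "\<dots> = (if v \<in> wt_index False \<kappa> then gen_eig_pair False (phi v) * (half_basis True u * wproj \<kappa>) else 0)"
    unfolding half_basis_wproj_wt_index[OF k T(2)] using Cen_lcomm[OF gen_eig_pair_Cen, of "half_basis True u" False "phi v" "wproj \<kappa>"] half_basis_Cen[OF T(1)]
    by (simp add: Cen_Al)
  also have "\<dots> = (if t \<in> wt_index True \<kappa> \<times> wt_index False \<kappa>
    then gen_eig_pair True (phi (fst t)) * (gen_eig_pair False (phi (snd t)) * wproj \<kappa>) else 0)"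
    unfolding half_basis_wproj_wt_index[OF k T(1)] by (simp add: uv gen_eig_pair_swap)
  finally show ?thesis .
qed

lemma cbasis_index_sum_wproj:
  assumes k: "\<kappa> \<in> mu"
  shows "(\<Sum>t\<in>cbasis_index. scl (C t) * cbasis t) * wproj \<kappa> =
    (\<Sum>u\<in>wt_index True \<kappa>. \<Sum>v\<in>wt_index False \<kappa>. scl (C (u, v)) * (gen_eig_pair True (phi u) * (gen_eig_pair False (phi v) * wproj \<kappa>)))"
proof -
  have "(\<Sum>t\<in>cbasis_index. scl (C t) * cbasis t) * wproj \<kappa> = (\<Sum>t\<in>cbasis_index. scl (C t) * (cbasis t * wproj \<kappa>))"
    by (simp add: sum_distrib_right mult.assoc)
  also have "\<dots> = (\<Sum>t\<in>wt_index True \<kappa> \<times> wt_index False \<kappa>. scl (C t) * (cbasis t * wproj \<kappa>))"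
    by (rule sum.mono_neutral_right[OF finite_cbasis_index wt_index_cbasis_index]) (auto simp: cbasis_wproj[OF k])
  also have "\<dots> = (\<Sum>t\<in>wt_index True \<kappa> \<times> wt_index False \<kappa>. scl (C t) * (gen_eig_pair True (phi (fst t)) * (gen_eig_pair False (phi (snd t)) * wproj \<kappa>)))"
  proof (rule sum.cong[OF refl])
    fix t assume t: "t \<in> wt_index True \<kappa> \<times> wt_index False \<kappa>"
    show "scl (C t) * (cbasis t * wproj \<kappa>) = scl (C t) * (gen_eig_pair True (phi (fst t)) * (gen_eig_pair False (phi (snd t)) * wproj \<kappa>))"
      unfolding cbasis_wproj[OF k subsetD[OF wt_index_cbasis_index t]] using t by simp
  qed
  also have "\<dots> = (\<Sum>u\<in>wt_index True \<kappa>. \<Sum>v\<in>wt_index False \<kappa>. scl (C (u, v)) * (gen_eig_pair True (phi u) * (gen_eig_pair False (phi v) * wproj \<kappa>)))"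
    by (simp add: sum.cartesian_product case_prod_beta)
  finally show ?thesis .
qed

lemma adm_sum_wt_index:
  assumes k: "\<kappa> \<in> mu"
  shows "(\<Sum>x\<in>adm True \<kappa>. \<Sum>y\<in>adm False \<kappa>. f x y) = (\<Sum>u\<in>wt_index True \<kappa>. \<Sum>v\<in>wt_index False \<kappa>. f (phi u) (phi v) :: lop)"
proof -
  have "(\<Sum>x\<in>adm True \<kappa>. \<Sum>y\<in>adm False \<kappa>. f x y) = (\<Sum>u\<in>wt_index True \<kappa>. \<Sum>y\<in>adm False \<kappa>. f (phi u) y)"
    by (rule sum.reindex_bij_betw[OF phi_bij[OF k], symmetric])
  also have "\<dots> = (\<Sum>u\<in>wt_index True \<kappa>. \<Sum>v\<in>wt_index False \<kappa>. f (phi u) (phi v))"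
    by (intro sum.cong refl sum.reindex_bij_betw[OF phi_bij[OF k], symmetric])
  finally show ?thesis .
qed

text \<open>At a weight whose two Cartan eigenvalues are the representatives of the arcs of
  \<open>t\<close>, the basis elements that survive are independent by \<open>adm_indep\<close>, and
  \<open>t\<close> is among them.\<close>

theorem center_indep:
  assumes z: "(\<Sum>t\<in>cbasis_index. scl (C t) * cbasis t) = 0" and t: "t \<in> cbasis_index" shows "C t = 0"
proof -
  obtain c n d m where tt: "t = ((c, n), (d, m))" by (metis surj_pair)
  have c: "c \<in> cas_ev True" "n \<in> slots True c" and d: "d \<in> cas_ev False" "m \<in> slots False d" and cd: "sect True c = sect False d"
    using t by (auto simp: tt cbasis_index_def half_index_def)
  let ?a = "arep True c n" and ?b = "arep False d m"
  have ab: "?a \<in> mu2 True" "?b \<in> mu2 (\<not> True)" "?a ^ p True = ?b ^ p (\<not> True)"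
    using arep[OF c] arep[OF d] cd by simp_all
  define \<kappa> where "\<kappa> = joint_ev True ?a ?b"
  have k: "\<kappa> \<in> mu" "wt True \<kappa> = ?a" "wt False \<kappa> = ?b" using joint_ev[OF ab] by (simp_all add: \<kappa>_def)
  have uv: "(c, n) \<in> wt_index True \<kappa>" "(d, m) \<in> wt_index False \<kappa>"
    using arep[OF c] arep[OF d] c d by (auto simp: wt_index_def k half_index_def)
  let ?\<psi> = "\<lambda>s. the_inv_into (wt_index s \<kappa>) phi"
  have inv: "?\<psi> s (phi u) = u" if "u \<in> wt_index s \<kappa>" for s u
    using phi_bij[OF k(1), of s] that by (simp add: bij_betw_def the_inv_into_f_f)
  have "(\<Sum>x\<in>adm True \<kappa>. \<Sum>y\<in>adm (\<not> True) \<kappa>. scl (C (?\<psi> True x, ?\<psi> False y)) * (gen_eig_pair True x * (gen_eig_pair (\<not> True) y * wproj \<kappa>)))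
    = (\<Sum>u\<in>wt_index True \<kappa>. \<Sum>v\<in>wt_index False \<kappa>. scl (C (u, v)) * (gen_eig_pair True (phi u) * (gen_eig_pair False (phi v) * wproj \<kappa>)))"
    unfolding not_True_eq_False adm_sum_wt_index[OF k(1)] by (intro sum.cong refl) (simp add: inv)
  also have "\<dots> = 0" using cbasis_index_sum_wproj[OF k(1), of C] z by simp
  finally have e: "(\<Sum>x\<in>adm True \<kappa>. \<Sum>y\<in>adm (\<not> True) \<kappa>. scl (C (?\<psi> True x, ?\<psi> False y)) * (gen_eig_pair True x * (gen_eig_pair (\<not> True) y * wproj \<kappa>))) = 0" .
  have "C (?\<psi> True (phi (c, n)), ?\<psi> False (phi (d, m))) = 0"
    by (rule adm_indep[OF k(1) e]) (use phi_bij[OF k(1), of True] phi_bij[OF k(1), of False] uv in \<open>auto simp: bij_betw_def\<close>)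
  thus ?thesis using uv by (simp add: inv tt)
qed

text \<open>With the other Cartan eigenvalue held fixed, the coordinate is a function of the one on
  side \<open>s\<close>. By \<open>shift_coords\<close> every step that leaves no wall preserves it,
  so it is constant on the arc.\<close>

lemma coords_step:
  assumes z: "z \<in> Cen" and H: "\<And>\<kappa>. \<kappa> \<in> mu \<Longrightarrow> repr s \<kappa> (h \<kappa>) z"
    and k: "\<kappa> \<in> mu" and u: "(c, n) \<in> wt_index s \<kappa>" and y: "y \<in> adm (\<not> s) \<kappa>"
  shows "h \<kappa> (phi (c, n)) y = h (joint_ev s (arep s c n) (wt (\<not> s) \<kappa>)) (phi (c, n)) y"
proof -
  let ?b = "wt (\<not> s) \<kappa>"
  define g where "g a = h (joint_ev s a ?b) (phi (c, n)) y" for a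
  have c: "c \<in> cas_ev s" "n \<in> slots s c" "wt s \<kappa> ^ p s = sect s c" "wt s \<kappa> \<in> arc s c n"
    using u by (auto simp: wt_index_def half_index_def)
  have bm: "?b \<in> mu2 (\<not> s)" by (rule wt_mu2[OF k])
  have sb: "?b ^ p (\<not> s) = sect s c" using c(3) wt_sector[of s \<kappa>] by simp
  obtain d i where yd: "y = (d, i)" by (cases y)
  have "g (wt s \<kappa>) = g (arep s c n)"
  proof (rule arc_const[OF c(1,2) _ c(3,4)])
    fix a assume a: "a \<in> mu2 s" "a ^ p s = sect s c" "a \<notin> walls s c (lev n)"
    have ab: "a ^ p s = ?b ^ p (\<not> s)" using a sb by simp
    let ?k = "joint_ev s a ?b"
    note K = joint_ev[OF a(1) bm ab]
    have x: "(c, lev n) \<in> adm s ?k" using a c K by (simp add: adm_iff lev_less)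
    have y': "y \<in> adm (\<not> s) ?k" using y k K by (simp add: adm_iff yd)
    have w: "cas s (wt s ?k) \<noteq> c \<or> Suc (lev n) < mult s ?k c"
      unfolding K(2) using a K c by (auto simp: mult_eq walls_def fib_def split: if_splits)
    show "g (a * (Q s)\<^sup>2) = g a"
      unfolding g_def joint_ev_sh[OF a(1) bm ab] phi_def fst_conv snd_conv
      by (rule shift_coords[OF K(1) z H[OF K(1)] H[OF sh_mu[OF K(1)]] x y' w])
  qed
  thus ?thesis unfolding g_def joint_ev_wt[OF k] .
qed

text \<open>Each coordinate is carried to the chosen representative, on one side and then on the
  other; so it depends only on the index of the basis element and can serve as its
  coefficient.\<close>

theorem center_span:
  assumes z: "z \<in> Cen" shows "\<exists>C. z = (\<Sum>t\<in>cbasis_index. scl (C t) * cbasis t)"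
proof -
  have "\<exists>h. repr True \<kappa> h z" if "\<kappa> \<in> mu" for \<kappa>
    using weight_zero_span[OF Cen_Al[OF z] CenD[OF z] that, of True] unfolding wspan_def repr_def by auto
  then obtain h where h: "\<And>\<kappa>. \<kappa> \<in> mu \<Longrightarrow> repr True \<kappa> (h \<kappa>) z" by metis
  define C where "C t = h (joint_ev True (arep True (fst (fst t)) (snd (fst t))) (arep False (fst (snd t)) (snd (snd t))))
     (phi (fst t)) (phi (snd t))" for t
  have "z = (\<Sum>t\<in>cbasis_index. scl (C t) * cbasis t)"
  proof (rule wproj_ext)
    fix \<kappa> assume k: "\<kappa> \<in> mu"
    have e: "h \<kappa> (phi u) (phi v) = C (u, v)" if u: "u \<in> wt_index True \<kappa>" and v: "v \<in> wt_index False \<kappa>" for u v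
    proof -
      obtain c n where cn: "u = (c, n)" by (cases u)
      obtain d m where dm: "v = (d, m)" by (cases v)
      have cS: "c \<in> cas_ev True" "n \<in> slots True c" "wt True \<kappa> ^ p True = sect True c"
        using u by (auto simp: wt_index_def half_index_def cn)
      have dS: "d \<in> cas_ev False" "m \<in> slots False d" "wt False \<kappa> ^ p False = sect False d"
        using v by (auto simp: wt_index_def half_index_def dm)
      have y: "phi v \<in> adm False \<kappa>" and x: "phi u \<in> adm True \<kappa>"
        using phi_bij[OF k, of True] phi_bij[OF k, of False] u v by (auto simp: bij_betw_def)
      have se: "sect True c = sect False d" using wt_sector[of True \<kappa>] cS dS by simp
      have bm: "wt False \<kappa> \<in> mu2 False" by (rule wt_mu2[OF k])
      let ?k1 = "joint_ev True (arep True c n) (wt False \<kappa>)"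
      have K1: "?k1 \<in> mu" "wt True ?k1 = arep True c n" "wt False ?k1 = wt False \<kappa>"
        using joint_ev[of "arep True c n" True "wt False \<kappa>"] arep[OF cS(1,2)] bm se dS by simp_all
      have 1: "h \<kappa> (phi u) (phi v) = h ?k1 (phi u) (phi v)"
        using coords_step[OF z h k u[unfolded cn], of "phi v"] y by (simp add: cn)
      have H': "repr False \<kappa>' (\<lambda>y x. h \<kappa>' x y) z" if "\<kappa>' \<in> mu" for \<kappa>'
        using repr_swap[OF h[OF that]] by simp
      have v1: "(d, m) \<in> wt_index False ?k1" using v K1 by (simp add: wt_index_def dm)
      have u1: "(c, n) \<in> wt_index True ?k1" using K1 cS arep[OF cS(1,2)] by (simp add: wt_index_def half_index_def)
      have x1: "phi u \<in> adm (\<not> False) ?k1" using phi_bij[OF K1(1), of True] u1 by (auto simp: bij_betw_def cn)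
      have 2: "h ?k1 (phi u) (phi v) = h (joint_ev False (arep False d m) (wt True ?k1)) (phi u) (phi v)"
        using coords_step[where h = "\<lambda>\<kappa> y x. h \<kappa> x y", OF z H' K1(1) v1 x1] by (simp add: dm)
      have 3: "joint_ev False (arep False d m) (arep True c n) = joint_ev True (arep True c n) (arep False d m)"
        using joint_ev_swap[of "arep True c n" True "arep False d m"] arep[OF cS(1,2)] arep[OF dS(1,2)] se by simp
      show ?thesis unfolding 1 2 K1(2) 3 by (simp add: C_def cn dm)
    qed
    have "z * wproj \<kappa> = (\<Sum>x\<in>adm True \<kappa>. \<Sum>y\<in>adm False \<kappa>. scl (h \<kappa> x y) * (gen_eig_pair True x * (gen_eig_pair False y * wproj \<kappa>)))"
      using h[OF k] by (simp add: repr_def)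
    also have "\<dots> = (\<Sum>t\<in>cbasis_index. scl (C t) * cbasis t) * wproj \<kappa>"
      unfolding adm_sum_wt_index[OF k] cbasis_index_sum_wproj[OF k] by (intro sum.cong refl) (simp add: e)
    finally show "z * wproj \<kappa> = (\<Sum>t\<in>cbasis_index. scl (C t) * cbasis t) * wproj \<kappa>" .
  qed
  thus ?thesis by blast
qed

lemma cbasis_Cen: "t \<in> cbasis_index \<Longrightarrow> cbasis t \<in> Cen"
  unfolding cbasis_def by (intro Cen_mult half_basis_Cen) (auto simp: cbasis_index_def)

text \<open>Slots may be added because in every nonzero product one of them is 0, the unit of the
  half-block.\<close>

lemma half_basis_mult:
  assumes "(c, n) \<in> half_index s" "(d, m) \<in> half_index s"
  shows "half_basis s (c, n) * half_basis s (d, m) = (if c = d \<and> (n = 0 \<or> m = 0) then half_basis s (c, n + m) else 0)"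
proof -
  have T0: "(c, 0) \<in> half_index s" using assms by (auto simp: half_index_def slots_def)
  have "half_basis s (c, n) * half_basis s (c, 0) = half_basis s (c, 0) * half_basis s (c, n)"
    using CenD[OF half_basis_Cen[OF T0] Cen_Al[OF half_basis_Cen[OF assms(1)]]] by simp
  thus ?thesis
    using half_basis_orth[OF assms] half_basis_0[of c m s] half_basis_0[of c n s] half_basis_rad[of c n s m] assms by auto
qed

lemma cbasis_mult:
  assumes "((c, n), (d, m)) \<in> cbasis_index" "((c', n'), (d', m')) \<in> cbasis_index"
  shows "cbasis ((c, n), (d, m)) * cbasis ((c', n'), (d', m')) =
    (if c = c' \<and> d = d' \<and> (n = 0 \<or> n' = 0) \<and> (m = 0 \<or> m' = 0) then cbasis ((c, n + n'), (d, m + m')) else 0)"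
proof -
  have T: "(c, n) \<in> half_index True" "(d, m) \<in> half_index False" "(c', n') \<in> half_index True" "(d', m') \<in> half_index False"
    using assms by (auto simp: cbasis_index_def)
  have "cbasis ((c, n), (d, m)) * cbasis ((c', n'), (d', m')) = half_basis True (c, n) * (half_basis False (d, m) * (half_basis True (c', n') * half_basis False (d', m')))"
    by (simp add: cbasis_def mult.assoc)
  also have "\<dots> = (half_basis True (c, n) * half_basis True (c', n')) * (half_basis False (d, m) * half_basis False (d', m'))"
    using Cen_lcomm[OF half_basis_Cen[OF T(3)], of "half_basis False (d, m)" "half_basis False (d', m')"] Cen_Al[OF half_basis_Cen[OF T(2)]] by (simp add: mult.assoc)
  also have "\<dots> = (if c = c' \<and> d = d' \<and> (n = 0 \<or> n' = 0) \<and> (m = 0 \<or> m' = 0) then cbasis ((c, n + n'), (d, m + m')) else 0)"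
    unfolding half_basis_mult[OF T(1,3)] half_basis_mult[OF T(2,4)] by (auto simp: cbasis_def)
  finally show ?thesis .
qed

section \<open>Counting the blocks\<close>

definition ev_of_mult :: "bool \<Rightarrow> nat \<Rightarrow> complex \<Rightarrow> complex set" where
  "ev_of_mult s k e = {c \<in> cas_ev s. card (fib s c) = k \<and> sect s c = e}"

lemma sect_pm: "c \<in> cas_ev s \<Longrightarrow> sect s c = 1 \<or> sect s c = -1"
proof -
  assume "c \<in> cas_ev s"
  then obtain a where a: "a \<in> mu2 s" "c = cas s a" by (auto simp: cas_ev_def)
  have "(a ^ p s)\<^sup>2 = 1" using a(1) unfolding mu2_def mem_Collect_eq pow_double .
  thus ?thesis unfolding a(2) sect_eq[OF a(1)] by (simp add: power2_eq_1_iff)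
qed

lemma finite_ev_of_mult: "finite (ev_of_mult s k e)" by (simp add: ev_of_mult_def finite_cas_ev)

text \<open>The p points with a^p = e split into the fibres of the Casimir eigenvalues of the
  sector.\<close>

lemma sector_count:
  assumes "e\<^sup>2 = 1" shows "card (ev_of_mult s 1 e) + 2 * card (ev_of_mult s 2 e) = p s"
proof -
  let ?C = "{c \<in> cas_ev s. sect s c = e}" and ?A = "{a. a ^ p s = e}"
  have e0: "e \<noteq> 0" using assms by auto
  have A: "a \<in> mu2 s" if "a \<in> ?A" for a using that assms unfolding mu2_def mem_Collect_eq pow_double by simp
  have fin: "finite ?A" using p_pos[of s] by (rule finite_nth_roots)
  have "card ?A = (\<Sum>a\<in>?A. 1)" by simp
  also have "\<dots> = (\<Sum>c\<in>?C. \<Sum>a\<in>{a \<in> ?A. cas s a = c}. 1)"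
  proof (rule sum.group[symmetric])
    show "finite ?A" by (rule fin)
    show "finite ?C" by (simp add: finite_cas_ev)
    show "cas s ` ?A \<subseteq> ?C" using A sect_eq by (auto simp: cas_ev_def)
  qed
  also have "\<dots> = (\<Sum>c\<in>?C. card (fib s c))"
  proof (intro sum.cong refl)
    fix c assume c: "c \<in> ?C"
    have "{a \<in> ?A. cas s a = c} = fib s c" using c A fib_pow by (auto simp: fib_def)
    thus "(\<Sum>a\<in>{a \<in> ?A. cas s a = c}. 1) = card (fib s c)" by simp
  qed
  also have "?C = ev_of_mult s 1 e \<union> ev_of_mult s 2 e" using card_fib by (auto simp: ev_of_mult_def)
  also have "(\<Sum>c\<in>ev_of_mult s 1 e \<union> ev_of_mult s 2 e. card (fib s c)) = (\<Sum>c\<in>ev_of_mult s 1 e. card (fib s c)) + (\<Sum>c\<in>ev_of_mult s 2 e. card (fib s c))"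
    by (rule sum.union_disjoint) (simp_all add: finite_ev_of_mult, auto simp: ev_of_mult_def)
  also have "(\<Sum>c\<in>ev_of_mult s 1 e. card (fib s c)) = card (ev_of_mult s 1 e)" by (simp add: ev_of_mult_def)
  also have "(\<Sum>c\<in>ev_of_mult s 2 e. card (fib s c)) = 2 * card (ev_of_mult s 2 e)" by (simp add: ev_of_mult_def)
  finally show ?thesis using card_nth_roots[OF e0, of "p s"] p_pos[of s] by simp
qed

text \<open>Simple eigenvalues come from the fixed points of the reflection, that is from (Q a)^2 =
  1: the points 1/Q and -1/Q, in whichever sectors these lie.\<close>

lemma singles_count: "card (ev_of_mult s 1 1) + card (ev_of_mult s 1 (-1)) = 2"
proof -
  let ?C = "{c \<in> cas_ev s. card (fib s c) = 1}"
  have m: "inverse (Q s) \<in> mu2 s" "- inverse (Q s) \<in> mu2 s"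
    using Q_pow[of s] by (simp_all add: mu2_def power_inverse)
  have fx: "iot s a = a \<longleftrightarrow> a = inverse (Q s) \<or> a = - inverse (Q s)" if a: "a \<in> mu2 s" for a
  proof -
    have nz: "(Q s)\<^sup>2 * a \<noteq> 0" using mu2_nz[OF a] by simp
    have "iot s a = a \<longleftrightarrow> (Q s)\<^sup>2 * a * a = 1"
    proof
      assume "iot s a = a"
      moreover have "(Q s)\<^sup>2 * a * iot s a = 1" unfolding iot_def by (rule right_inverse[OF nz])
      ultimately show "(Q s)\<^sup>2 * a * a = 1" by simp
    next
      assume "(Q s)\<^sup>2 * a * a = 1"
      thus "iot s a = a" unfolding iot_def by (rule inverse_unique)
    qed
    also have "(Q s)\<^sup>2 * a * a = (Q s * a)\<^sup>2" by (simp add: power2_eq_square mult_ac)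
    also have "(Q s * a)\<^sup>2 = 1 \<longleftrightarrow> Q s * a = 1 \<or> Q s * a = -1" by (rule power2_eq_1_iff)
    also have "Q s * a = 1 \<longleftrightarrow> a = inverse (Q s)" using inverse_unique[of "Q s" a] by auto
    also have "Q s * a = -1 \<longleftrightarrow> a = - inverse (Q s)"
    proof
      assume "Q s * a = -1"
      hence "inverse (Q s) = - a" by (intro inverse_unique) simp
      thus "a = - inverse (Q s)" by simp
    qed simp
    finally show ?thesis .
  qed
  have ne: "inverse (Q s) \<noteq> - inverse (Q s)" by (simp add: eq_neg_iff_add_eq_0)
  have cf: "card (fib s (cas s a)) = 1 \<longleftrightarrow> iot s a = a" if "a \<in> mu2 s" for a
    unfolding fib_eq[OF that] by (cases "iot s a = a") auto
  have "?C = cas s ` {inverse (Q s), - inverse (Q s)}"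
  proof (intro equalityI subsetI)
    fix c assume "c \<in> ?C"
    then obtain a where a: "a \<in> mu2 s" "c = cas s a" "card (fib s (cas s a)) = 1" by (auto simp: cas_ev_def)
    hence "a = inverse (Q s) \<or> a = - inverse (Q s)" using cf fx by blast
    thus "c \<in> cas s ` {inverse (Q s), - inverse (Q s)}" using a by auto
  next
    fix c assume "c \<in> cas s ` {inverse (Q s), - inverse (Q s)}"
    then obtain a where a: "a = inverse (Q s) \<or> a = - inverse (Q s)" "c = cas s a" by auto
    hence "a \<in> mu2 s" using m by auto
    moreover have "iot s a = a" using fx[OF calculation] a by blast
    ultimately show "c \<in> ?C" using cf a(2) by (simp add: cas_ev_def)
  qed
  moreover have "cas s (inverse (Q s)) \<noteq> cas s (- inverse (Q s))"
    using cas_fibre[OF m] fx[OF m(1)] ne by auto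
  ultimately have "card ?C = 2" by simp
  moreover have "?C = ev_of_mult s 1 1 \<union> ev_of_mult s 1 (-1)" using sect_pm by (auto simp: ev_of_mult_def)
  moreover have "card (ev_of_mult s 1 1 \<union> ev_of_mult s 1 (-1)) = card (ev_of_mult s 1 1) + card (ev_of_mult s 1 (-1))"
    by (rule card_Un_disjoint) (simp_all add: finite_ev_of_mult, auto simp: ev_of_mult_def)
  ultimately show ?thesis by simp
qed

definition ev_pairs :: "nat \<Rightarrow> nat \<Rightarrow> (complex \<times> complex) set" where
  "ev_pairs k l = {(c, d). c \<in> cas_ev True \<and> d \<in> cas_ev False \<and> sect True c = sect False d \<and> card (fib True c) = k \<and> card (fib False d) = l}"

lemma finite_ev_pairs: "finite (ev_pairs k l)"
  by (rule finite_subset[of _ "cas_ev True \<times> cas_ev False"]) (auto simp: ev_pairs_def finite_cas_ev)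

lemma card_ev_pairs: "card (ev_pairs k l) = card (ev_of_mult True k 1) * card (ev_of_mult False l 1) + card (ev_of_mult True k (-1)) * card (ev_of_mult False l (-1))"
proof -
  have "ev_pairs k l = ev_of_mult True k 1 \<times> ev_of_mult False l 1 \<union> ev_of_mult True k (-1) \<times> ev_of_mult False l (-1)"
  proof (rule Set.set_eqI)
    fix x :: "complex \<times> complex"
    obtain c d where x: "x = (c, d)" by (cases x)
    show "x \<in> ev_pairs k l \<longleftrightarrow> x \<in> ev_of_mult True k 1 \<times> ev_of_mult False l 1 \<union> ev_of_mult True k (-1) \<times> ev_of_mult False l (-1)"
      using sect_pm[of c True] unfolding x ev_pairs_def ev_of_mult_def mem_Collect_eq Un_iff mem_Sigma_iff case_prod_conv by metis
  qed
  moreover have "card (ev_of_mult True k 1 \<times> ev_of_mult False l 1 \<union> ev_of_mult True k (-1) \<times> ev_of_mult False l (-1))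
     = card (ev_of_mult True k 1 \<times> ev_of_mult False l 1) + card (ev_of_mult True k (-1) \<times> ev_of_mult False l (-1))"
    by (rule card_Un_disjoint) (simp_all add: finite_ev_of_mult, auto simp: ev_of_mult_def)
  ultimately show ?thesis by (simp add: card_cartesian_product)
qed

text \<open>Here a, a' count the simple and b, b' the double eigenvalues in the two sectors of one
  side; x, x' and y, y' do so for the other. If m is odd, a and a' are odd with sum 2, so both are 1
  and b = b'. The sums over the sectors then depend only on the totals of the other side.\<close>

lemma block_arith:
  fixes a b a' b' x y x' y' :: nat
  assumes "a + 2 * b = m" "a' + 2 * b' = m" "a + a' = 2" "x + 2 * y = n" "x' + 2 * y' = n" "x + x' = 2" "odd m"
  shows "a * x + a' * x' = 2" "b * x + b' * x' = m - 1" "a * y + a' * y' = n - 1" "2 * (b * y + b' * y') = (m - 1) * (n - 1)"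
proof -
  have "odd a" "odd a'" using assms by (metis even_add even_mult_iff even_numeral)+
  hence a: "a = 1" "a' = 1" using assms(3) by (cases a; cases a'; auto)+
  hence b: "b = b'" "m - 1 = 2 * b" using assms by auto
  have xy: "2 * (y + y') = 2 * (n - 1)" using assms(4-6) by auto
  show "a * x + a' * x' = 2" using a assms by simp
  have "b * x + b' * x' = b * (x + x')" unfolding b(1)[symmetric] by (simp add: distrib_left)
  thus "b * x + b' * x' = m - 1" using b assms(6) by simp
  show "a * y + a' * y' = n - 1" using a xy by simp
  have "2 * (b * y + b' * y') = b * (2 * (y + y'))" unfolding b(1)[symmetric] by (simp add: distrib_left)
  thus "2 * (b * y + b' * y') = (m - 1) * (n - 1)" using xy b(2) by simp
qed

lemma card_ev_pairs_all:
  "card (ev_pairs 1 1) = 2" "card (ev_pairs 2 1) = p True - 1" "card (ev_pairs 1 2) = p False - 1"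
  "2 * card (ev_pairs 2 2) = (p True - 1) * (p False - 1)"
proof -
  note S = sector_count[of 1 True] sector_count[of "-1" True] singles_count[of True]
    and S' = sector_count[of 1 False] sector_count[of "-1" False] singles_count[of False]
  have T: "card (ev_of_mult True 1 1) + 2 * card (ev_of_mult True 2 1) = p True" "card (ev_of_mult True 1 (-1)) + 2 * card (ev_of_mult True 2 (-1)) = p True"
    "card (ev_of_mult True 1 1) + card (ev_of_mult True 1 (-1)) = 2" using S by simp_all
  have F: "card (ev_of_mult False 1 1) + 2 * card (ev_of_mult False 2 1) = p False" "card (ev_of_mult False 1 (-1)) + 2 * card (ev_of_mult False 2 (-1)) = p False"
    "card (ev_of_mult False 1 1) + card (ev_of_mult False 1 (-1)) = 2" using S' by simp_all
  have "odd (p True) \<or> odd (p False)" using p_coprime coprime_common_divisor[of "p True" "p False" 2] by auto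
  hence "card (ev_pairs 1 1) = 2 \<and> card (ev_pairs 2 1) = p True - 1 \<and> card (ev_pairs 1 2) = p False - 1 \<and>
    2 * card (ev_pairs 2 2) = (p True - 1) * (p False - 1)"
  proof
    assume "odd (p True)"
    from block_arith[OF T F this] show ?thesis unfolding card_ev_pairs by blast
  next
    assume "odd (p False)"
    from block_arith[OF F T this] show ?thesis unfolding card_ev_pairs by (simp add: mult.commute)
  qed
  thus "card (ev_pairs 1 1) = 2" "card (ev_pairs 2 1) = p True - 1" "card (ev_pairs 1 2) = p False - 1"
    "2 * card (ev_pairs 2 2) = (p True - 1) * (p False - 1)" by blast+
qed

text \<open>The map from (r, r') to (p_+ - r, p_- - r') exchanges the index set with its complement
  in the rectangle. Equality in the defining inequality cannot occur, as p_+ would divide r by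
  coprimality.\<close>

lemma index_I1_card: "2 * card (index_I1 (p True) (p False)) = (p True - 1) * (p False - 1)"
proof -
  let ?P = "p True" and ?M = "p False"
  let ?G = "{1..?P - 1} \<times> {1..?M - 1}" and ?I = "index_I1 ?P ?M"
  let ?f = "\<lambda>(r, r'). (?P - r, ?M - r')"
  have sub: "?I \<subseteq> ?G" by (auto simp: index_I1_def)
  have fin: "finite ?I" by (rule finite_subset[OF sub]) simp
  have img: "?f ` ?I = ?G - ?I"
  proof (intro equalityI subsetI)
    fix x assume "x \<in> ?f ` ?I"
    then obtain r r' where r: "(r, r') \<in> ?I" "x = (?P - r, ?M - r')" by auto
    have b: "1 \<le> r" "r \<le> ?P - 1" "1 \<le> r'" "r' \<le> ?M - 1" "?M * r + ?P * r' \<le> ?P * ?M" using r by (auto simp: index_I1_def)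
    have "?M * r + ?P * r' \<noteq> ?P * ?M"
    proof
      assume "?M * r + ?P * r' = ?P * ?M"
      hence "?P dvd ?M * r" by (metis dvd_add_left_iff dvd_triv_left)
      hence "?P dvd r" using p_coprime by (metis coprime_dvd_mult_right_iff)
      thus False using b by (auto dest: dvd_imp_le)
    qed
    hence lt: "?M * r + ?P * r' < ?P * ?M" using b by simp
    have "int ?M * (int ?P - int r) + int ?P * (int ?M - int r') > int ?P * int ?M"
    proof -
      have "int (?M * r + ?P * r') < int (?P * ?M)" using lt by (simp only: of_nat_less_iff)
      thus ?thesis by (simp add: algebra_simps)
    qed
    moreover have "int (?P - r) = int ?P - int r" "int (?M - r') = int ?M - int r'" using b by auto
    ultimately have "int (?M * (?P - r) + ?P * (?M - r')) > int (?P * ?M)" by simp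
    hence "?M * (?P - r) + ?P * (?M - r') > ?P * ?M" by (simp only: of_nat_less_iff)
    thus "x \<in> ?G - ?I" using b r(2) by (auto simp: index_I1_def)
  next
    fix x assume x: "x \<in> ?G - ?I"
    obtain r r' where r: "x = (r, r')" by (cases x)
    have b: "1 \<le> r" "r \<le> ?P - 1" "1 \<le> r'" "r' \<le> ?M - 1" "?M * r + ?P * r' > ?P * ?M" using x by (auto simp: index_I1_def r)
    have "int (?M * r + ?P * r') > int (?P * ?M)" using b(5) by (simp only: of_nat_less_iff)
    hence "int ?M * (int ?P - int r) + int ?P * (int ?M - int r') < int ?P * int ?M" by (simp add: algebra_simps)
    moreover have "int (?P - r) = int ?P - int r" "int (?M - r') = int ?M - int r'" using b by auto
    ultimately have "int (?M * (?P - r) + ?P * (?M - r')) < int (?P * ?M)" by simp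
    hence "?M * (?P - r) + ?P * (?M - r') < ?P * ?M" by (simp only: of_nat_less_iff)
    hence "(?P - r, ?M - r') \<in> ?I" using b by (auto simp: index_I1_def)
    moreover have "x = ?f (?P - r, ?M - r')" using b r by auto
    ultimately show "x \<in> ?f ` ?I" by (rule rev_image_eqI)
  qed
  have "inj_on ?f ?I" using sub by (auto simp: inj_on_def index_I1_def)
  hence "card ?I = card (?G - ?I)" unfolding img[symmetric] by (simp add: card_image)
  also have "\<dots> = card ?G - card ?I" by (rule card_Diff_subset[OF fin sub])
  finally have "card ?I = card ?G - card ?I" .
  moreover have "card ?I \<le> card ?G" by (rule card_mono[OF _ sub]) simp
  ultimately have "2 * card ?I = card ?G" by linarith
  thus ?thesis by (simp add: card_cartesian_product)
qed

end

section \<open>Block decompositions from a multiplicative basis\<close>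

text \<open>\<open>G\<close> identifies the commutative algebra \<open>A\<close>, presented by a multiplicative basis, with the ring
  \<open>Z\<close> given by its carrier.\<close>

locale block_algebra = scalar_ring sc for sc :: "complex \<Rightarrow> 'a::ring_1" +
  fixes Z :: "'b ring" and G :: "'a \<Rightarrow> 'b" and A :: "'a set"
    and IX :: "'i set" and SA SB :: "'i \<Rightarrow> nat set" and b :: "'i \<times> nat \<times> nat \<Rightarrow> 'a"
  assumes carrier_Z: "carrier Z = G ` A" and G_inj: "inj_on G A"
    and G_mult: "\<And>x y. x \<in> A \<Longrightarrow> y \<in> A \<Longrightarrow> G x \<otimes>\<^bsub>Z\<^esub> G y = G (x * y)"
    and G_add: "\<And>x y. x \<in> A \<Longrightarrow> y \<in> A \<Longrightarrow> G x \<oplus>\<^bsub>Z\<^esub> G y = G (x + y)"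
    and G_one: "\<one>\<^bsub>Z\<^esub> = G 1" and G_zero: "\<zero>\<^bsub>Z\<^esub> = G 0"
    and A_sc: "\<And>c. sc c \<in> A" and A_add: "\<And>x y. x \<in> A \<Longrightarrow> y \<in> A \<Longrightarrow> x + y \<in> A"
    and A_mult: "\<And>x y. x \<in> A \<Longrightarrow> y \<in> A \<Longrightarrow> x * y \<in> A"
    and A_comm: "\<And>x y. x \<in> A \<Longrightarrow> y \<in> A \<Longrightarrow> x * y = y * x"
    and fin_IX: "finite IX" and fin_SA: "\<And>i. finite (SA i)" and fin_SB: "\<And>i. finite (SB i)"
    and zero_SA: "\<And>i. 0 \<in> SA i" and zero_SB: "\<And>i. 0 \<in> SB i"
    and b_A: "\<And>i m n. i \<in> IX \<Longrightarrow> m \<in> SA i \<Longrightarrow> n \<in> SB i \<Longrightarrow> b (i, m, n) \<in> A"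
    and b_span: "\<And>z. z \<in> A \<Longrightarrow> \<exists>c. z = (\<Sum>w\<in>(SIGMA i:IX. SA i \<times> SB i). sc (c w) * b w)"
    and b_indep: "\<And>c w. (\<Sum>w\<in>(SIGMA i:IX. SA i \<times> SB i). sc (c w) * b w) = 0 \<Longrightarrow> w \<in> (SIGMA i:IX. SA i \<times> SB i) \<Longrightarrow> c w = 0"
    and b_mult: "\<And>i m n i' m' n'. i \<in> IX \<Longrightarrow> m \<in> SA i \<Longrightarrow> n \<in> SB i \<Longrightarrow> i' \<in> IX \<Longrightarrow> m' \<in> SA i' \<Longrightarrow> n' \<in> SB i' \<Longrightarrow>
      b (i, m, n) * b (i', m', n') = (if i = i' \<and> (m = 0 \<or> m' = 0) \<and> (n = 0 \<or> n' = 0) then b (i, m + m', n + n') else 0)"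
begin

abbreviation "W \<equiv> (SIGMA i:IX. SA i \<times> SB i)"
definition FF :: "'b set" where "FF = G ` range sc"
definition Vs :: "('i \<times> nat \<times> nat) set \<Rightarrow> 'a set" where "Vs S = {\<Sum>w\<in>S. sc (c w) * b w |c. True}"
definition blk :: "'i \<Rightarrow> ('i \<times> nat \<times> nat) set" where "blk i = {i} \<times> SA i \<times> SB i"

lemma A_0: "0 \<in> A" using A_sc[of 0] by simp
lemma A_1: "1 \<in> A" using A_sc[of 1] by simp
lemma A_sum: "(\<And>x. x \<in> S \<Longrightarrow> f x \<in> A) \<Longrightarrow> sum f S \<in> A"
  by (induction S rule: infinite_finite_induct) (auto intro: A_0 A_add)
lemma A_neg: "x \<in> A \<Longrightarrow> - x \<in> A"
  using A_mult[OF A_sc[of "- 1"], of x] by (simp add: sc_minus)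

lemma finite_W: "finite W"
  by (intro finite_SigmaI fin_IX finite_cartesian_product fin_SA fin_SB)

lemma b_W: "w \<in> W \<Longrightarrow> b w \<in> A" by (auto intro: b_A)

lemma Vs_A: assumes "S \<subseteq> W" "x \<in> Vs S" shows "x \<in> A"
  using assms unfolding Vs_def by (auto intro!: A_sum A_mult A_sc b_W)

lemma Vs_0: "0 \<in> Vs S"
  unfolding Vs_def by (intro CollectI exI[of _ "\<lambda>_. 0"]) simp

lemma Vs_add: assumes "x \<in> Vs S" "y \<in> Vs S" shows "x + y \<in> Vs S"
proof -
  obtain c d where "x = (\<Sum>w\<in>S. sc (c w) * b w)" "y = (\<Sum>w\<in>S. sc (d w) * b w)" using assms unfolding Vs_def by blast
  hence "x + y = (\<Sum>w\<in>S. sc (c w + d w) * b w)" by (simp add: sc_add distrib_right sum.distrib)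
  thus ?thesis unfolding Vs_def by (intro CollectI exI conjI TrueI)
qed

lemma Vs_scale: assumes "x \<in> Vs S" shows "sc a * x \<in> Vs S"
proof -
  obtain c where "x = (\<Sum>w\<in>S. sc (c w) * b w)" using assms unfolding Vs_def by blast
  hence "sc a * x = (\<Sum>w\<in>S. sc (a * c w) * b w)" by (simp add: sum_distrib_left sc_sc)
  thus ?thesis unfolding Vs_def by (intro CollectI exI conjI TrueI)
qed

lemma Vs_neg: "x \<in> Vs S \<Longrightarrow> - x \<in> Vs S"
  using Vs_scale[of x S "- 1"] by (simp add: sc_minus)

lemma Vs_sum: "(\<And>a. a \<in> T \<Longrightarrow> f a \<in> Vs S) \<Longrightarrow> sum f T \<in> Vs S"
  by (induction T rule: infinite_finite_induct) (auto intro: Vs_add Vs_0)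

lemma Vs_b: assumes "finite S" "w \<in> S" shows "b w \<in> Vs S"
proof -
  have "(\<Sum>v\<in>S. sc (if v = w then 1 else 0) * b v) = (\<Sum>v\<in>S. if v = w then b v else 0)"
    by (intro sum.cong) auto
  also have "\<dots> = b w" using assms by simp
  finally have "b w = (\<Sum>v\<in>S. sc (if v = w then 1 else 0) * b v)" by simp
  thus ?thesis unfolding Vs_def by (intro CollectI exI conjI TrueI)
qed

lemma Vs_insert:
  assumes "finite S" "w \<notin> S"
  shows "Vs (insert w S) = {sc a * b w + y |a y. y \<in> Vs S}"
proof (intro equalityI subsetI)
  fix x assume "x \<in> Vs (insert w S)"
  then obtain c where "x = (\<Sum>v\<in>insert w S. sc (c v) * b v)" unfolding Vs_def by blast
  hence "x = sc (c w) * b w + (\<Sum>v\<in>S. sc (c v) * b v)" using assms by simp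
  thus "x \<in> {sc a * b w + y |a y. y \<in> Vs S}" unfolding Vs_def by blast
next
  fix x assume "x \<in> {sc a * b w + y |a y. y \<in> Vs S}"
  then obtain a c where x: "x = sc a * b w + (\<Sum>v\<in>S. sc (c v) * b v)" unfolding Vs_def by blast
  have "(\<Sum>v\<in>S. sc (c v) * b v) = (\<Sum>v\<in>S. sc ((c(w := a)) v) * b v)"
    using assms by (intro sum.cong) auto
  hence "x = (\<Sum>v\<in>insert w S. sc ((c(w := a)) v) * b v)" using assms x by simp
  thus "x \<in> Vs (insert w S)" unfolding Vs_def by (intro CollectI exI conjI TrueI)
qed

lemma indep_sub:
  assumes "S \<subseteq> W" "(\<Sum>w\<in>S. sc (c w) * b w) = 0" "w \<in> S" shows "c w = 0"
proof -
  define d where "d v = (if v \<in> S then c v else 0)" for v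
  have "(\<Sum>w\<in>W. sc (d w) * b w) = (\<Sum>w\<in>S. sc (d w) * b w)"
    by (rule sum.mono_neutral_right[OF finite_W assms(1)]) (simp add: d_def)
  also have "\<dots> = (\<Sum>w\<in>S. sc (c w) * b w)" by (intro sum.cong) (auto simp: d_def)
  finally have "d w = 0" using b_indep[of d w] assms by auto
  thus ?thesis using assms(3) by (simp add: d_def)
qed

lemma b_notin: assumes "S \<subseteq> W" "w \<in> W" "w \<notin> S" shows "b w \<notin> Vs S"
proof
  assume "b w \<in> Vs S"
  then obtain c where c: "b w = (\<Sum>v\<in>S. sc (c v) * b v)" unfolding Vs_def by blast
  have fin: "finite S" using finite_subset[OF assms(1) finite_W] .
  have "(\<Sum>v\<in>S. sc ((c(w := - 1)) v) * b v) = (\<Sum>v\<in>S. sc (c v) * b v)"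
    using assms(3) by (intro sum.cong) auto
  hence "(\<Sum>v\<in>insert w S. sc ((c(w := - 1)) v) * b v) = 0"
    using assms fin c by (simp add: sc_minus)
  from indep_sub[OF _ this, of w] assms show False by auto
qed

lemma b_nz: "w \<in> W \<Longrightarrow> b w \<noteq> 0"
  using b_notin[of "{}" w] by (simp add: Vs_def)

lemma Z_cases: assumes "x \<in> carrier Z" obtains y where "y \<in> A" "x = G y"
  using assms carrier_Z by auto

lemma G_in: "x \<in> A \<Longrightarrow> G x \<in> carrier Z" by (simp add: carrier_Z)

lemma G_eq: "x \<in> A \<Longrightarrow> y \<in> A \<Longrightarrow> G x = G y \<longleftrightarrow> x = y"
  using G_inj by (auto simp: inj_on_def)

lemma cring_Z: "cring Z"
proof (rule cringI)
  show "abelian_group Z"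
  proof (rule abelian_groupI)
    fix x assume "x \<in> carrier Z"
    then obtain u where u: "u \<in> A" "x = G u" by (rule Z_cases)
    show "\<exists>y\<in>carrier Z. y \<oplus>\<^bsub>Z\<^esub> x = \<zero>\<^bsub>Z\<^esub>"
      by (rule bexI[of _ "G (- u)"]) (simp_all add: u A_neg G_in G_add G_zero)
  qed (auto simp: carrier_Z G_add A_add G_zero A_0 add_ac)
  show "comm_monoid Z"
  proof (rule comm_monoidI)
    fix x y assume "x \<in> carrier Z" "y \<in> carrier Z"
    thus "x \<otimes>\<^bsub>Z\<^esub> y = y \<otimes>\<^bsub>Z\<^esub> x"
      by (auto simp: carrier_Z G_mult intro!: arg_cong[where f = G] A_comm)
  qed (auto simp: carrier_Z G_mult A_mult G_one A_1 mult.assoc)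
  fix x y z assume "x \<in> carrier Z" "y \<in> carrier Z" "z \<in> carrier Z"
  thus "(x \<oplus>\<^bsub>Z\<^esub> y) \<otimes>\<^bsub>Z\<^esub> z = x \<otimes>\<^bsub>Z\<^esub> z \<oplus>\<^bsub>Z\<^esub> y \<otimes>\<^bsub>Z\<^esub> z"
    by (auto simp: carrier_Z G_mult A_mult G_add A_add distrib_right)
qed

sublocale Z: cring Z by (rule cring_Z)

lemma span_dim:
  assumes "distinct ws" "set ws \<subseteq> W"
  shows "Z.Span FF (map (\<lambda>w. G (b w)) ws) = G ` Vs (set ws) \<and> Z.dimension (length ws) FF (G ` Vs (set ws))"
  using assms
proof (induction ws)
  case Nil
  have "Vs {} = {0}" by (auto simp: Vs_def)
  thus ?case by (simp add: G_zero[symmetric])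
next
  case (Cons w ws)
  let ?S = "set ws"
  have S: "?S \<subseteq> W" "w \<in> W" "w \<notin> ?S" using Cons.prems by auto
  have IH: "Z.Span FF (map (\<lambda>w. G (b w)) ws) = G ` Vs ?S" "Z.dimension (length ws) FF (G ` Vs ?S)"
    using Cons by auto
  have ext: "Z.line_extension FF (G (b w)) (G ` Vs ?S) = G ` Vs (set (w # ws))"
  proof (intro equalityI subsetI)
    fix x assume "x \<in> Z.line_extension FF (G (b w)) (G ` Vs ?S)"
    then obtain a y where "y \<in> Vs ?S" "x = G (sc a) \<otimes>\<^bsub>Z\<^esub> G (b w) \<oplus>\<^bsub>Z\<^esub> G y"
      unfolding Z.line_extension_mem_iff FF_def by blast
    moreover from this have "x = G (sc a * b w + y)"
      using S Vs_A by (simp add: G_mult G_add A_sc b_W A_mult)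
    moreover have "sc a * b w + y \<in> Vs (set (w # ws))" using \<open>y \<in> Vs ?S\<close> Vs_insert[of ?S w] S by auto
    ultimately show "x \<in> G ` Vs (set (w # ws))" by blast
  next
    fix x assume "x \<in> G ` Vs (set (w # ws))"
    then obtain a y where y: "y \<in> Vs ?S" "x = G (sc a * b w + y)" using Vs_insert[of ?S w] S by auto
    hence "x = G (sc a) \<otimes>\<^bsub>Z\<^esub> G (b w) \<oplus>\<^bsub>Z\<^esub> G y"
      using S Vs_A by (simp add: G_mult G_add A_sc b_W A_mult)
    thus "x \<in> Z.line_extension FF (G (b w)) (G ` Vs ?S)"
      unfolding Z.line_extension_mem_iff FF_def using y by blast
  qed
  have "G (b w) \<notin> G ` Vs ?S"
  proof
    assume "G (b w) \<in> G ` Vs ?S"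
    then obtain y where "y \<in> Vs ?S" "G (b w) = G y" by blast
    hence "b w \<in> Vs ?S" using G_eq[OF b_W[OF S(2)]] Vs_A[OF S(1)] by simp
    thus False using b_notin[OF S] by simp
  qed
  from Z.Suc_dim[OF G_in[OF b_W[OF S(2)]] this IH(2)] show ?case using IH(1) ext by simp
qed

lemma Vs_W: "Vs W = A"
proof (intro equalityI subsetI)
  fix z assume "z \<in> A"
  from b_span[OF this] show "z \<in> Vs W" unfolding Vs_def by blast
qed (rule Vs_A[OF subset_refl])

lemma dim_Z: "Z.dimension (card W) FF (carrier Z)"
proof -
  obtain ws where ws: "set ws = W" "distinct ws" using finite_distinct_list[OF finite_W] by blast
  from span_dim[OF ws(2)] ws(1) have "Z.dimension (length ws) FF (G ` Vs W)" by simp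
  thus ?thesis using distinct_card[OF ws(2)] ws(1) by (simp add: Vs_W carrier_Z)
qed

lemma blk_W: "i \<in> IX \<Longrightarrow> blk i \<subseteq> W" by (auto simp: blk_def)
lemma finite_blk: "finite (blk i)" by (simp add: blk_def fin_SA fin_SB)

lemma Vs_mult:
  assumes i: "i \<in> IX" and z: "z \<in> A" and x: "x \<in> Vs (blk i)" shows "z * x \<in> Vs (blk i)"
proof -
  obtain c where c: "z = (\<Sum>w\<in>W. sc (c w) * b w)" using b_span[OF z] by blast
  obtain d where d: "x = (\<Sum>v\<in>blk i. sc (d v) * b v)" using x unfolding Vs_def by blast
  have bb: "b w * b v \<in> Vs (blk i)" if w: "w \<in> W" and v: "v \<in> blk i" for w v
  proof -
    obtain j m n where wj: "w = (j, m, n)" by (metis prod_cases3)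
    obtain m' n' where vi: "v = (i, m', n')" using v by (auto simp: blk_def)
    have "b w * b v = (if j = i \<and> (m = 0 \<or> m' = 0) \<and> (n = 0 \<or> n' = 0) then b (j, m + m', n + n') else 0)"
      unfolding wj vi by (rule b_mult) (use w v i in \<open>auto simp: wj vi blk_def\<close>)
    moreover have "b (i, m + m', n + n') \<in> Vs (blk i)" if "j = i" "m = 0 \<or> m' = 0" "n = 0 \<or> n' = 0"
      using that w v by (intro Vs_b finite_blk) (auto simp: wj vi blk_def)
    ultimately show ?thesis using Vs_0 by auto
  qed
  have "z * x = (\<Sum>w\<in>W. \<Sum>v\<in>blk i. sc (c w) * (sc (d v) * (b w * b v)))"
    unfolding c d by (simp add: sum_product mult.assoc sc_left_comm[of "b _"])
  thus ?thesis using bb by (auto intro!: Vs_sum Vs_scale)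
qed

definition ee :: "'i \<Rightarrow> 'a" where "ee i = b (i, 0, 0)"

lemma ee_W: "i \<in> IX \<Longrightarrow> (i, 0, 0) \<in> W" by (simp add: zero_SA zero_SB)
lemma ee_A: "i \<in> IX \<Longrightarrow> ee i \<in> A" unfolding ee_def by (rule b_W[OF ee_W])

lemma ee_Vs:
  assumes "i \<in> IX" "j \<in> IX" "x \<in> Vs (blk j)" shows "ee i * x = (if i = j then x else 0)"
proof -
  obtain d where d: "x = (\<Sum>v\<in>blk j. sc (d v) * b v)" using assms unfolding Vs_def by blast
  have "ee i * b v = (if i = j then b v else 0)" if vj: "v \<in> blk j" for v
  proof -
    obtain m n where v: "v = (j, m, n)" using vj by (auto simp: blk_def)
    show ?thesis unfolding ee_def v using b_mult[of i 0 0 j m n] assms vj zero_SA zero_SB by (auto simp: v blk_def)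
  qed
  thus ?thesis unfolding d by (auto simp: sum_distrib_left sc_left_comm[of "ee i"])
qed

definition SS :: "'i \<Rightarrow> 'b set" where "SS i = G ` Vs (blk i)"

lemma SS_ideal: assumes i: "i \<in> IX" shows "ideal (SS i) Z"
proof (rule idealI)
  note VA = Vs_A[OF blk_W[OF i]]
  show "ring Z" by (rule Z.ring_axioms)
  show "subgroup (SS i) (add_monoid Z)"
  proof (rule Z.add.subgroupI)
    show "SS i \<subseteq> carrier Z" using VA G_in by (auto simp: SS_def)
    show "SS i \<noteq> {}" using Vs_0 by (auto simp: SS_def)
    fix x assume "x \<in> SS i"
    then obtain u where u: "u \<in> Vs (blk i)" "x = G u" by (auto simp: SS_def)
    have "\<ominus>\<^bsub>Z\<^esub> x = G (- u)"
      unfolding u(2) by (rule Z.minus_equality) (use VA[OF u(1)] in \<open>simp_all add: G_add A_neg G_zero G_in\<close>)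
    thus "\<ominus>\<^bsub>Z\<^esub> x \<in> SS i" using Vs_neg[OF u(1)] by (auto simp: SS_def)
    fix y assume "y \<in> SS i"
    then obtain v where v: "v \<in> Vs (blk i)" "y = G v" by (auto simp: SS_def)
    show "x \<oplus>\<^bsub>Z\<^esub> y \<in> SS i" using u v VA Vs_add[OF u(1) v(1)] by (auto simp: SS_def G_add)
  qed
  fix a x assume "a \<in> SS i" "x \<in> carrier Z"
  then obtain u z where u: "u \<in> Vs (blk i)" "a = G u" and z: "z \<in> A" "x = G z" by (auto simp: SS_def carrier_Z)
  have "x \<otimes>\<^bsub>Z\<^esub> a = G (z * u)" "a \<otimes>\<^bsub>Z\<^esub> x = G (z * u)"
    using u z VA A_comm by (simp_all add: G_mult)
  thus "x \<otimes>\<^bsub>Z\<^esub> a \<in> SS i" "a \<otimes>\<^bsub>Z\<^esub> x \<in> SS i" using Vs_mult[OF i z(1) u(1)] by (auto simp: SS_def)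
qed

lemma finsum_G:
  assumes "finite T" "\<And>i. i \<in> T \<Longrightarrow> f i \<in> A" shows "finsum Z (\<lambda>i. G (f i)) T = G (sum f T)"
  using assms
proof (induction T rule: finite_induct)
  case empty thus ?case by (simp add: G_zero)
next
  case (insert i T)
  have "finsum Z (\<lambda>i. G (f i)) (insert i T) = G (f i) \<oplus>\<^bsub>Z\<^esub> finsum Z (\<lambda>i. G (f i)) T"
    using insert by (intro Z.finsum_insert) (auto intro: G_in)
  thus ?case using insert by (simp add: G_add A_sum)
qed

lemma finsum_SS:
  assumes "c \<in> (\<Pi>\<^sub>E i\<in>IX. SS i)"
  shows "\<exists>y. (\<forall>i\<in>IX. y i \<in> Vs (blk i) \<and> c i = G (y i)) \<and> finsum Z c IX = G (sum y IX)"
proof -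
  have "\<forall>i\<in>IX. \<exists>y. y \<in> Vs (blk i) \<and> c i = G y" using assms by (auto simp: SS_def dest: PiE_mem)
  then obtain y where y: "\<forall>i\<in>IX. y i \<in> Vs (blk i) \<and> c i = G (y i)" by metis
  hence yA: "y i \<in> A" if "i \<in> IX" for i using Vs_A[OF blk_W[OF that]] that by blast
  have "finsum Z c IX = finsum Z (\<lambda>i. G (y i)) IX"
    using y yA by (intro Z.finsum_cong') (auto intro: G_in)
  thus ?thesis using y finsum_G[OF fin_IX yA] by auto
qed

text \<open>Existence collects the basis coordinates block by block. For uniqueness, multiplication
  by the idempotent of a block extracts the component in that block.\<close>

lemma direct_sum: "algebra_direct_sum Z IX SS"
  unfolding algebra_direct_sum_def
proof (intro conjI ballI)
  show "finite IX" by (rule fin_IX)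
  show "ideal (SS i) Z" if "i \<in> IX" for i using SS_ideal[OF that] .
  fix x assume "x \<in> carrier Z"
  then obtain z where z: "z \<in> A" "x = G z" by (rule Z_cases)
  obtain d where d: "z = (\<Sum>w\<in>W. sc (d w) * b w)" using b_span[OF z(1)] by blast
  define y where "y i = (\<Sum>w\<in>blk i. sc (d w) * b w)" for i
  have yV: "y i \<in> Vs (blk i)" for i unfolding y_def Vs_def by blast
  have yA: "y i \<in> A" if "i \<in> IX" for i using Vs_A[OF blk_W[OF that] yV] .
  have zy: "z = sum y IX"
  proof -
    have "z = (\<Sum>i\<in>IX. \<Sum>x\<in>SA i \<times> SB i. sc (d (i, x)) * b (i, x))"
      unfolding d by (subst sum.Sigma) (auto simp: fin_IX fin_SA fin_SB)
    also have "\<dots> = sum y IX"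
    proof (rule sum.cong[OF refl])
      fix i
      show "(\<Sum>x\<in>SA i \<times> SB i. sc (d (i, x)) * b (i, x)) = y i"
        unfolding y_def blk_def
        by (rule sum.reindex_bij_witness[of _ snd "\<lambda>x. (i, x)"]) auto
    qed
    finally show ?thesis .
  qed
  define c where "c = restrict (\<lambda>i. G (y i)) IX"
  have cE: "c \<in> (\<Pi>\<^sub>E i\<in>IX. SS i)" using yV by (auto simp: c_def SS_def)
  have "finsum Z c IX = finsum Z (\<lambda>i. G (y i)) IX"
    using yA by (intro Z.finsum_cong') (auto intro: G_in simp: c_def)
  hence cx: "x = finsum Z c IX" using finsum_G[OF fin_IX yA] zy z by simp
  show "\<exists>!c. c \<in> (\<Pi>\<^sub>E i\<in>IX. SS i) \<and> x = finsum Z c IX"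
  proof (rule ex1I[of _ c])
    show "c \<in> (\<Pi>\<^sub>E i\<in>IX. SS i) \<and> x = finsum Z c IX" using cE cx by blast
    fix c' assume c': "c' \<in> (\<Pi>\<^sub>E i\<in>IX. SS i) \<and> x = finsum Z c' IX"
    then obtain y' where y': "\<forall>i\<in>IX. y' i \<in> Vs (blk i) \<and> c' i = G (y' i)" and f: "finsum Z c' IX = G (sum y' IX)"
      using finsum_SS by blast
    have y'A: "y' i \<in> A" if "i \<in> IX" for i using Vs_A[OF blk_W[OF that]] y' that by blast
    have e: "sum y' IX = sum y IX" using c' f z zy G_eq[of "sum y' IX" "sum y IX"] A_sum y'A yA by metis
    have pick: "ee j * sum u IX = u j" if "j \<in> IX" "\<forall>i\<in>IX. u i \<in> Vs (blk i)" for u j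
    proof -
      have "ee j * sum u IX = (\<Sum>i\<in>IX. if j = i then u i else 0)"
        unfolding sum_distrib_left using that by (intro sum.cong) (auto simp: ee_Vs)
      thus ?thesis using that(1) fin_IX by simp
    qed
    have "y' j = y j" if "j \<in> IX" for j
      using pick[OF that, of y'] pick[OF that, of y] e y' yV by simp
    hence "c' j = c j" if "j \<in> IX" for j using y' that by (simp add: c_def)
    thus "c' = c" using c' cE by (intro PiE_ext) auto
  qed
qed

text \<open>The element has square zero, so it lies in every prime ideal and therefore in every
  maximal one.\<close>

lemma nil_rad:
  assumes i: "i \<in> IX" "m \<in> SA i" "n \<in> SB i" and ne: "m \<noteq> 0 \<or> n \<noteq> 0"
  shows "G (b (i, m, n)) \<in> radical Z"
  unfolding radical_def
proof (intro CollectI conjI allI impI)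
  have bA: "b (i, m, n) \<in> A" by (rule b_A[OF i])
  show "G (b (i, m, n)) \<in> carrier Z" by (rule G_in[OF bA])
  fix M assume "maximalideal M Z"
  hence P: "primeideal M Z" by (rule Z.maximalideal_prime)
  have "b (i, m, n) * b (i, m, n) = 0" using b_mult[OF i i] ne by auto
  hence "G (b (i, m, n)) \<otimes>\<^bsub>Z\<^esub> G (b (i, m, n)) = \<zero>\<^bsub>Z\<^esub>" using bA by (simp add: G_mult G_zero)
  moreover have "\<zero>\<^bsub>Z\<^esub> \<in> M" using P by (simp add: primeideal_def ideal_def additive_subgroup.zero_closed)
  ultimately show "G (b (i, m, n)) \<in> M"
    using primeideal.I_prime[OF P G_in[OF bA] G_in[OF bA]] by auto
qed

lemma ee_idem: "i \<in> IX \<Longrightarrow> ee i * ee i = ee i"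
  unfolding ee_def using b_mult[of i 0 0 i 0 0] zero_SA zero_SB by simp

lemma idempotent_ee: "i \<in> IX \<Longrightarrow> idempotent Z (G (ee i))"
  by (simp add: idempotent_def G_in ee_A G_mult ee_idem)

definition nblk :: "'i \<Rightarrow> ('i \<times> nat \<times> nat) set" where "nblk i = blk i - {(i, 0, 0)}"

text \<open>A product of radical basis elements survives only if on each side at most one factor has
  a nonzero slot. There are two sides and every factor occupies at least one, so three factors
  always collide.\<close>

lemma nblk_cube:
  assumes i: "i \<in> IX" and x: "x \<in> Vs (nblk i)" shows "x * (x * x) = 0"
proof -
  obtain d where d: "x = (\<Sum>v\<in>nblk i. sc (d v) * b v)" using x unfolding Vs_def by blast
  have bbb: "b u * (b v * b w) = 0" if uvw: "u \<in> nblk i" "v \<in> nblk i" "w \<in> nblk i" for u v w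
  proof -
    obtain m n where u: "u = (i, m, n)" "m \<in> SA i" "n \<in> SB i" "\<not> (m = 0 \<and> n = 0)"
      using uvw(1) unfolding nblk_def blk_def by blast
    obtain m' n' where v: "v = (i, m', n')" "m' \<in> SA i" "n' \<in> SB i" "\<not> (m' = 0 \<and> n' = 0)"
      using uvw(2) unfolding nblk_def blk_def by blast
    obtain m'' n'' where w: "w = (i, m'', n'')" "m'' \<in> SA i" "n'' \<in> SB i" "\<not> (m'' = 0 \<and> n'' = 0)"
      using uvw(3) unfolding nblk_def blk_def by blast
    have vw: "b v * b w = (if (m' = 0 \<or> m'' = 0) \<and> (n' = 0 \<or> n'' = 0) then b (i, m' + m'', n' + n'') else 0)"
      unfolding v(1) w(1) using b_mult[OF i v(2,3) i w(2,3)] by simp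
    show ?thesis
    proof (cases "(m' = 0 \<or> m'' = 0) \<and> (n' = 0 \<or> n'' = 0)")
      case True
      have "m' + m'' \<in> SA i" "n' + n'' \<in> SB i" using True v w by auto
      from b_mult[OF i u(2,3) i this] show ?thesis unfolding vw u(1) using True u v w by auto
    next
      case False thus ?thesis unfolding vw by auto
    qed
  qed
  have 1: "x * y = (\<Sum>u\<in>nblk i. sc (d u) * (b u * y))" for y
    unfolding d by (simp only: sum_distrib_right mult.assoc)
  have z: "b u * (b v * x) = 0" if uv: "u \<in> nblk i" "v \<in> nblk i" for u v
    unfolding d by (simp add: sum_distrib_left sc_left_comm[of "b u"] sc_left_comm[of "b v"] bbb uv)
  have "b u * (x * x) = 0" if u: "u \<in> nblk i" for u
    unfolding 1[of x] by (simp add: sum_distrib_left sc_left_comm[of "b u"] z u)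
  thus ?thesis unfolding 1[of "x * x"] by simp
qed

text \<open>Blocks are local: \<open>a\<close> is a scalar c times the unit plus a nilpotent. If c =
  0, the idempotent \<open>a\<close> is nilpotent, hence zero. Otherwise \<open>a * u = 0\<close>
  can be solved to u = m u with m nilpotent, and iteration gives \<open>u = 0\<close>.\<close>

lemma idempotent_zero:
  assumes i: "i \<in> IX" and a: "a \<in> Vs (blk i)" and u: "u \<in> Vs (blk i)"
    and aa: "a * a = a" and uu: "u * u = u" and au: "a * u = 0" and e: "ee i = a + u"
  shows "a = 0 \<or> u = 0"
proof -
  have blk: "blk i = insert (i, 0, 0) (nblk i)" "(i, 0, 0) \<notin> nblk i" "finite (nblk i)"
    using zero_SA zero_SB finite_blk by (auto simp: nblk_def blk_def)
  obtain c n where n: "n \<in> Vs (nblk i)" "a = sc c * ee i + n"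
    using a unfolding blk(1) Vs_insert[OF blk(3,2)] ee_def by blast
  show ?thesis
  proof (cases "c = 0")
    case True
    have "a = a * (a * a)" by (simp add: aa)
    also have "\<dots> = 0" using nblk_cube[OF i n(1)] n(2) True by simp
    finally show ?thesis by simp
  next
    case False
    define m where "m = sc (- inverse c) * n"
    have "ee i * u = u" using ee_Vs[OF i i u] by simp
    hence "sc c * u + n * u = 0" using au unfolding n(2) by (simp add: distrib_right mult.assoc)
    hence "sc (inverse c) * (sc c * u + n * u) = 0" by simp
    hence "u = m * u" using False
      by (simp add: distrib_left sc_sc m_def sc_minus mult.assoc eq_neg_iff_add_eq_0)
    hence "u = m * (m * (m * u))" by metis
    also have "\<dots> = (m * (m * m)) * u" by (simp add: mult.assoc)
    also have "m * (m * m) = 0" by (rule nblk_cube[OF i]) (simp add: m_def Vs_scale n)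
    finally show ?thesis by simp
  qed
qed

lemma primitive_ee: assumes i: "i \<in> IX" shows "primitive_idempotent Z (G (ee i))"
  unfolding primitive_idempotent_def
proof (intro conjI allI impI)
  show "idempotent Z (G (ee i))" by (rule idempotent_ee[OF i])
  show "G (ee i) \<noteq> \<zero>\<^bsub>Z\<^esub>" using b_nz[OF ee_W[OF i]] G_eq[OF ee_A[OF i] A_0] by (simp add: G_zero ee_def)
  fix x y
  assume *: "idempotent Z x \<and> idempotent Z y \<and> x \<otimes>\<^bsub>Z\<^esub> y = \<zero>\<^bsub>Z\<^esub> \<and> y \<otimes>\<^bsub>Z\<^esub> x = \<zero>\<^bsub>Z\<^esub> \<and> G (ee i) = x \<oplus>\<^bsub>Z\<^esub> y"
  obtain a where a: "a \<in> A" "x = G a" using * Z_cases unfolding idempotent_def by metis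
  obtain u where u: "u \<in> A" "y = G u" using * Z_cases unfolding idempotent_def by metis
  have aa: "a * a = a" and uu: "u * u = u" and au: "a * u = 0" and e: "ee i = a + u"
    using * a u G_eq A_mult A_add A_0 ee_A[OF i] by (auto simp: idempotent_def G_mult G_add G_zero)
  have ua: "u * a = 0" using A_comm[OF u(1) a(1)] au by simp
  \<comment> \<open>Orthogonality puts both summands below the unit of the block, hence into the
    block itself.\<close>
  have "a * ee i = a" "u * ee i = u" unfolding e by (simp_all add: distrib_left aa uu au ua)
  moreover have "a * ee i \<in> Vs (blk i)" "u * ee i \<in> Vs (blk i)"
    using Vs_mult[OF i] a u Vs_b[OF finite_blk, of "(i, 0, 0)" i] zero_SA zero_SB by (simp_all add: ee_def blk_def)
  ultimately have "a = 0 \<or> u = 0" using idempotent_zero[OF i _ _ aa uu au e] by simp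
  thus "x = \<zero>\<^bsub>Z\<^esub> \<or> y = \<zero>\<^bsub>Z\<^esub>" using a u by (auto simp: G_zero)
qed

definition gb :: "'i \<Rightarrow> nat \<Rightarrow> nat \<Rightarrow> 'b" where "gb i m n = G (b (i, m, n))"

lemma gb_mult:
  assumes "i \<in> IX" "m \<in> SA i" "n \<in> SB i" "m' \<in> SA i" "n' \<in> SB i"
  shows "gb i m n \<otimes>\<^bsub>Z\<^esub> gb i m' n' = (if (m = 0 \<or> m' = 0) \<and> (n = 0 \<or> n' = 0) then gb i (m + m') (n + n') else \<zero>\<^bsub>Z\<^esub>)"
  unfolding gb_def using b_mult[OF assms(1-3) assms(1,4,5)] G_mult[OF b_A[OF assms(1-3)] b_A[OF assms(1,4,5)]] by (simp add: G_zero)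

lemma block_span_dim:
  assumes i: "i \<in> IX" and ws: "distinct ws" "set ws = SA i \<times> SB i"
  shows "Z.dimension (length ws) FF (SS i)" "SS i = Z.Span FF (map (\<lambda>(m, n). gb i m n) ws)"
proof -
  have "distinct (map (Pair i) ws)" "set (map (Pair i) ws) = blk i"
    using ws by (auto simp: distinct_map inj_on_def blk_def)
  from span_dim[OF this(1)] this(2) blk_W[OF i]
  have "Z.Span FF (map (\<lambda>w. G (b w)) (map (Pair i) ws)) = G ` Vs (blk i) \<and> Z.dimension (length (map (Pair i) ws)) FF (G ` Vs (blk i))"
    by simp
  moreover have "map (\<lambda>w. G (b w)) (map (Pair i) ws) = map (\<lambda>(m, n). gb i m n) ws"
    by (auto simp: gb_def)
  ultimately have "Z.Span FF (map (\<lambda>(m, n). gb i m n) ws) = SS i \<and> Z.dimension (length ws) FF (SS i)"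
    unfolding SS_def by (simp only: length_map)
  thus "Z.dimension (length ws) FF (SS i)" "SS i = Z.Span FF (map (\<lambda>(m, n). gb i m n) ws)"
    by (simp_all only:)
qed

lemma is_block1:
  assumes i: "i \<in> IX" and S: "SA i = {0}" "SB i = {0}"
  shows "block1 Z FF (SS i) (gb i 0 0)"
  using block_span_dim[OF i, of "[(0, 0)]"] S idempotent_ee[OF i] by (simp add: block1_def gb_def ee_def)

lemma is_block3A:
  assumes i: "i \<in> IX" and S: "SA i = {0, 1, 2}" "SB i = {0}"
  shows "block3 Z FF (SS i) (gb i 0 0) (gb i 1 0) (gb i 2 0)"
proof -
  have "Z.dimension 3 FF (SS i)" "SS i = Z.Span FF [gb i 0 0, gb i 1 0, gb i 2 0]"
    using block_span_dim[OF i, of "[(0, 0), (1, 0), (2, 0)]"] S by (auto simp: numeral_3_eq_3)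
  thus ?thesis
    unfolding block3_def using primitive_ee[OF i] nil_rad[OF i, of 1 0] nil_rad[OF i, of 2 0] gb_mult[OF i] S
    by (simp add: gb_def[symmetric] ee_def numeral_2_eq_2)
qed

lemma is_block3B:
  assumes i: "i \<in> IX" and S: "SA i = {0}" "SB i = {0, 1, 2}"
  shows "block3 Z FF (SS i) (gb i 0 0) (gb i 0 1) (gb i 0 2)"
proof -
  have "Z.dimension 3 FF (SS i)" "SS i = Z.Span FF [gb i 0 0, gb i 0 1, gb i 0 2]"
    using block_span_dim[OF i, of "[(0, 0), (0, 1), (0, 2)]"] S by (auto simp: numeral_3_eq_3)
  thus ?thesis
    unfolding block3_def using primitive_ee[OF i] nil_rad[OF i, of 0 1] nil_rad[OF i, of 0 2] gb_mult[OF i] S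
    by (simp add: gb_def[symmetric] ee_def numeral_2_eq_2)
qed

text \<open>The dictionary: first index 1, 2 stands for the arrows NE, SW and second index 1, 2 for
  NW, SE. A w has both indices nonzero and is the product of the two corresponding v.\<close>

lemma is_block9:
  assumes i: "i \<in> IX" and S: "SA i = {0, 1, 2}" "SB i = {0, 1, 2}"
  shows "block9 Z FF (SS i) (gb i 0 0) (gb i 1 0) (gb i 2 0) (gb i 0 1) (gb i 0 2)
    (gb i 1 1) (gb i 1 2) (gb i 2 2) (gb i 2 1)"
proof -
  let ?L = "[(0, 0), (1, 0), (2, 0), (0, 1), (0, 2), (1, 1), (1, 2), (2, 2), (2, 1)] :: (nat \<times> nat) list"
  have L: "distinct ?L" "set ?L = SA i \<times> SB i" "length ?L = 9" unfolding S by auto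
  have mp: "map (\<lambda>(m, n). gb i m n) ?L = [gb i 0 0, gb i 1 0, gb i 2 0, gb i 0 1, gb i 0 2, gb i 1 1, gb i 1 2, gb i 2 2, gb i 2 1]"
    by simp
  have D: "Z.dimension 9 FF (SS i)" "SS i = Z.Span FF [gb i 0 0, gb i 1 0, gb i 2 0, gb i 0 1, gb i 0 2, gb i 1 1, gb i 1 2, gb i 2 2, gb i 2 1]"
    using block_span_dim[OF i L(1,2)] unfolding L(3) mp by blast+
  have R: "gb i m n \<in> radical Z" if "m \<in> {0, 1, 2}" "n \<in> {0, 1, 2}" "m \<noteq> 0 \<or> n \<noteq> 0" for m n
    unfolding gb_def by (rule nil_rad[OF i]) (use that S in auto)
  have M: "gb i m n \<otimes>\<^bsub>Z\<^esub> gb i m' n' = (if (m = 0 \<or> m' = 0) \<and> (n = 0 \<or> n' = 0) then gb i (m + m') (n + n') else \<zero>\<^bsub>Z\<^esub>)"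
    if "m \<in> {0, 1, 2}" "n \<in> {0, 1, 2}" "m' \<in> {0, 1, 2}" "n' \<in> {0, 1, 2}" for m n m' n'
    by (rule gb_mult[OF i]) (use that S in auto)
  have E: "gb i 0 0 \<otimes>\<^bsub>Z\<^esub> x = x \<and> x \<otimes>\<^bsub>Z\<^esub> gb i 0 0 = x" if "x \<in> SS i" for x
  proof -
    obtain u where u: "u \<in> Vs (blk i)" "x = G u" using \<open>x \<in> SS i\<close> by (auto simp: SS_def)
    have uA: "u \<in> A" by (rule Vs_A[OF blk_W[OF i] u(1)])
    have "ee i * u = u" "u * ee i = u" using ee_Vs[OF i i u(1)] A_comm[OF uA ee_A[OF i]] by simp_all
    thus ?thesis using G_mult[OF uA ee_A[OF i]] G_mult[OF ee_A[OF i] uA] by (simp add: u gb_def ee_def)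
  qed
  show ?thesis
    unfolding block9_def
  proof (intro conjI)
    show "primitive_idempotent Z (gb i 0 0)" using primitive_ee[OF i] by (simp add: gb_def ee_def)
    show "{gb i 1 0, gb i 2 0, gb i 0 1, gb i 0 2, gb i 1 1, gb i 1 2, gb i 2 2, gb i 2 1} \<subseteq> radical Z"
      using R by auto
    show "\<forall>x\<in>SS i. gb i 0 0 \<otimes>\<^bsub>Z\<^esub> x = x \<and> x \<otimes>\<^bsub>Z\<^esub> gb i 0 0 = x" using E by blast
    show "\<forall>x\<in>{gb i 1 0, gb i 2 0, gb i 0 1, gb i 0 2, gb i 1 1, gb i 1 2, gb i 2 2, gb i 2 1}.
      \<forall>y\<in>{gb i 1 0, gb i 2 0, gb i 0 1, gb i 0 2, gb i 1 1, gb i 1 2, gb i 2 2, gb i 2 1}.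
        \<not> (x \<in> {gb i 1 0, gb i 2 0} \<and> y \<in> {gb i 0 1, gb i 0 2}) \<and>
        \<not> (x \<in> {gb i 0 1, gb i 0 2} \<and> y \<in> {gb i 1 0, gb i 2 0}) \<longrightarrow> x \<otimes>\<^bsub>Z\<^esub> y = \<zero>\<^bsub>Z\<^esub>"
      by (simp add: M)
  qed (use D in \<open>simp_all add: M numeral_2_eq_2\<close>)
qed

end

section \<open>The center of the quantum group\<close>

context qparam
begin

abbreviation "qgr \<equiv> qg (p True) (p False)"

definition cls :: "free_alg \<Rightarrow> free_alg set" where "cls x = I +>\<^bsub>ring_of_type_algebra\<^esub> x"

lemma cls_alt: "cls x = (\<lambda>i. i + x) ` I"
  by (auto simp: cls_def a_r_coset_def')

lemma cls_eq_iff: "cls x = cls y \<longleftrightarrow> Phi x = Phi y"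
proof
  assume "cls x = cls y"
  moreover have "x \<in> cls x" unfolding cls_alt by (rule image_eqI[of _ _ 0]) simp_all
  ultimately obtain i where "i \<in> I" "x = i + y" unfolding cls_alt by auto
  thus "Phi x = Phi y" by (simp add: rep.Phi_add Phi_I)
next
  have sub: "cls x \<subseteq> cls y" if "Phi x = Phi y" for x y
  proof
    fix z assume "z \<in> cls x"
    then obtain i where i: "i \<in> I" "z = i + x" unfolding cls_alt by auto
    have "x - y \<in> I" using that by (simp add: rep.Phi_diff flip: Phi_eq_0_iff)
    hence "i + (x - y) \<in> I" using i(1) I_add by blast
    thus "z \<in> cls y" unfolding cls_alt i(2) by (rule rev_image_eqI) simp
  qed
  assume "Phi x = Phi y"
  thus "cls x = cls y" using sub[of x y] sub[of y x] by auto
qed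

lemma qgr_eq: "qgr = ring_of_type_algebra Quot I"
  by (simp add: qg_def I_def)

lemma carrier_qgr: "carrier qgr = range cls"
proof -
  have "carrier qgr = {I +>\<^bsub>ring_of_type_algebra\<^esub> x |x. x \<in> carrier ring_of_type_algebra}"
    unfolding qgr_eq FactRing_def A_RCOSETS_def' a_r_coset_def' by (auto simp del: ring_of_type_algebra_def)
  thus ?thesis by (auto simp: cls_def)
qed

lemmas cls_hom = ideal.rcos_ring_hom[OF I_ideal]

lemma cls_mult: "cls x \<otimes>\<^bsub>qgr\<^esub> cls y = cls (x * y)"
  using ring_hom_mult[OF cls_hom, of x y] by (simp add: qgr_eq cls_def)

lemma cls_add: "cls x \<oplus>\<^bsub>qgr\<^esub> cls y = cls (x + y)"
  using ring_hom_add[OF cls_hom, of x y] by (simp add: qgr_eq cls_def)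

lemma cls_one: "\<one>\<^bsub>qgr\<^esub> = cls 1"
  using ring_hom_one[OF cls_hom] by (simp add: qgr_eq cls_def)

lemma cls_zero: "\<zero>\<^bsub>qgr\<^esub> = cls 0"
  unfolding cls_alt by (simp add: qgr_eq FactRing_def)

text \<open>The inverse of \<open>Phi\<close> followed by the passage to cosets. The choice of
  preimage is immaterial because the kernel of \<open>Phi\<close> is the defining ideal.\<close>

definition Gq :: "lop \<Rightarrow> free_alg set" where "Gq z = cls (SOME x. Phi x = z)"

lemma Gq_Phi: "Gq (Phi x) = cls x"
proof -
  have "Phi (SOME y. Phi y = Phi x) = Phi x" by (rule someI[of _ x]) simp
  thus ?thesis by (simp add: Gq_def cls_eq_iff)
qed

lemma center_qgr: "center qgr = Gq ` Cen"
proof (intro equalityI subsetI)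
  fix z assume "z \<in> center qgr"
  then obtain x where x: "z = cls x" and c: "\<And>y. cls x \<otimes>\<^bsub>qgr\<^esub> cls y = cls y \<otimes>\<^bsub>qgr\<^esub> cls x"
    unfolding center_def carrier_qgr by auto
  have "Phi x * Phi y = Phi y * Phi x" for y
    using c[of y] by (simp add: cls_mult cls_eq_iff rep.Phi_mult)
  hence "Phi x \<in> Cen" by (auto simp: Cen_def Al_def)
  thus "z \<in> Gq ` Cen" unfolding x Gq_Phi[symmetric] by (rule imageI)
next
  fix z assume "z \<in> Gq ` Cen"
  then obtain x where x: "Phi x \<in> Cen" "z = cls x" by (auto simp: Cen_def Al_def Gq_Phi)
  have "cls x \<otimes>\<^bsub>qgr\<^esub> cls y = cls y \<otimes>\<^bsub>qgr\<^esub> cls x" for y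
    using CenD[OF x(1), of "Phi y"] by (simp add: cls_mult cls_eq_iff rep.Phi_mult Al_def)
  thus "z \<in> center qgr" unfolding center_def carrier_qgr x(2) by auto
qed

text \<open>\<open>Ic k l\<close> collects the indices of the blocks in which the two Casimir eigenvalues have
  multiplicities \<open>k\<close> and \<open>l\<close>.\<close>

definition Ic :: "nat \<Rightarrow> nat \<Rightarrow> (nat \<times> nat) set" where
  "Ic k l = (if k = 1 \<and> l = 1 then {(p True, p False), (0, p False)}
    else if k = 2 \<and> l = 1 then {1..p True - 1} \<times> {p False}
    else if k = 1 \<and> l = 2 then {p True} \<times> {1..p False - 1}
    else if k = 2 \<and> l = 2 then index_I1 (p True) (p False) else {})"

definition II :: "(nat \<times> nat) set" where
  "II = {(p True, p False)} \<union> {(0, p False)} \<union> {1..p True - 1} \<times> {p False} \<union> {p True} \<times> {1..p False - 1} \<union> index_I1 (p True) (p False)"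

definition bty :: "nat \<times> nat \<Rightarrow> nat \<times> nat" where
  "bty i = (if i \<in> Ic 1 1 then (1, 1) else if i \<in> Ic 2 1 then (2, 1) else if i \<in> Ic 1 2 then (1, 2) else (2, 2))"

lemma Ic_simps:
  "Ic 1 1 = {(p True, p False), (0, p False)}" "Ic 2 1 = {1..p True - 1} \<times> {p False}"
  "Ic 1 2 = {p True} \<times> {1..p False - 1}" "Ic 2 2 = index_I1 (p True) (p False)"
  by (simp_all add: Ic_def)

lemma II_eq: "II = Ic 1 1 \<union> Ic 2 1 \<union> Ic 1 2 \<union> Ic 2 2"
  unfolding II_def Ic_simps by auto

lemma bty_eq: "i \<in> Ic 1 1 \<Longrightarrow> bty i = (1, 1)" "i \<in> Ic 2 1 \<Longrightarrow> bty i = (2, 1)"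
  "i \<in> Ic 1 2 \<Longrightarrow> bty i = (1, 2)" "i \<in> Ic 2 2 \<Longrightarrow> bty i = (2, 2)"
  using p_pos[of True] p_pos[of False] unfolding bty_def Ic_simps by (auto simp: index_I1_def)

lemma finite_Ic: "finite (Ic k l)"
proof -
  have "index_I1 (p True) (p False) \<subseteq> {1..p True - 1} \<times> {1..p False - 1}" by (auto simp: index_I1_def)
  hence "finite (index_I1 (p True) (p False))" by (rule finite_subset) simp
  thus ?thesis by (simp add: Ic_def)
qed

lemma card_Ic: "card (Ic 1 1) = 2" "card (Ic 2 1) = p True - 1" "card (Ic 1 2) = p False - 1"
  "2 * card (Ic 2 2) = (p True - 1) * (p False - 1)"
  using p_pos[of True] index_I1_card unfolding Ic_simps by (simp_all add: card_cartesian_product)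

lemma II_cases:
  assumes "i \<in> II"
  obtains k l where "k \<in> {1, 2}" "l \<in> {1, 2}" "i \<in> Ic k l" "bty i = (k, l)"
proof -
  from assms consider "i \<in> Ic 1 1" | "i \<in> Ic 2 1" | "i \<in> Ic 1 2" | "i \<in> Ic 2 2" unfolding II_eq by blast
  thus ?thesis
  proof cases
    case 1 show ?thesis by (rule that[of 1 1]) (use 1 bty_eq in simp_all)
  next
    case 2 show ?thesis by (rule that[of 2 1]) (use 2 bty_eq in simp_all)
  next
    case 3 show ?thesis by (rule that[of 1 2]) (use 3 bty_eq in simp_all)
  next
    case 4 show ?thesis by (rule that[of 2 2]) (use 4 bty_eq in simp_all)
  qed
qed

text \<open>The theorem asks for some block of the right shape at each index, so any bijection that
  respects the multiplicity types will do, and these exist by equality of the numbers.\<close>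

lemma ex_blockmap: "\<exists>f. \<forall>k\<in>{1, 2}. \<forall>l\<in>{1, 2}. bij_betw f (Ic k l) (ev_pairs k l)"
proof -
  have "card (Ic k l) = card (ev_pairs k l)" if "k \<in> {1, 2}" "l \<in> {1, 2}" for k l
    using that card_Ic card_ev_pairs_all by auto
  hence "\<forall>k\<in>{1, 2}. \<forall>l\<in>{1, 2}. \<exists>f. bij_betw f (Ic k l) (ev_pairs k l)"
    by (auto intro!: finite_same_card_bij finite_Ic finite_ev_pairs)
  then obtain F where F: "\<forall>k\<in>{1, 2}. \<forall>l\<in>{1, 2}. bij_betw (F k l) (Ic k l) (ev_pairs k l)" by metis
  define f where "f i = F (fst (bty i)) (snd (bty i)) i" for i
  have "bij_betw f (Ic k l) (ev_pairs k l)" if kl: "k \<in> {1, 2}" "l \<in> {1, 2}" for k l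
  proof -
    have "f i = F k l i" if "i \<in> Ic k l" for i using that kl bty_eq[of i] by (auto simp: f_def)
    thus ?thesis using F kl bij_betw_cong[of "Ic k l" f "F k l"] by blast
  qed
  thus ?thesis by blast
qed

definition bmap :: "nat \<times> nat \<Rightarrow> complex \<times> complex" where
  "bmap = (SOME f. \<forall>k\<in>{1, 2}. \<forall>l\<in>{1, 2}. bij_betw f (Ic k l) (ev_pairs k l))"

lemma bmap: "k \<in> {1, 2} \<Longrightarrow> l \<in> {1, 2} \<Longrightarrow> bij_betw bmap (Ic k l) (ev_pairs k l)"
  using someI_ex[OF ex_blockmap] unfolding bmap_def by blast

definition all_ev_pairs :: "(complex \<times> complex) set" where
  "all_ev_pairs = {(c, d). c \<in> cas_ev True \<and> d \<in> cas_ev False \<and> sect True c = sect False d}"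

lemma bmap_bij: "bij_betw bmap II all_ev_pairs"
proof (rule bij_betw_imageI)
  show "inj_on bmap II"
  proof (rule inj_onI)
    fix i j assume ij: "i \<in> II" "j \<in> II" "bmap i = bmap j"
    obtain k l where kl: "k \<in> {1, 2}" "l \<in> {1, 2}" "i \<in> Ic k l" using II_cases[OF ij(1)] .
    obtain k' l' where kl': "k' \<in> {1, 2}" "l' \<in> {1, 2}" "j \<in> Ic k' l'" using II_cases[OF ij(2)] .
    have "bmap i \<in> ev_pairs k l" by (rule bij_betw_apply[OF bmap[OF kl(1,2)] kl(3)])
    moreover have "bmap i \<in> ev_pairs k' l'"
      unfolding ij(3) by (rule bij_betw_apply[OF bmap[OF kl'(1,2)] kl'(3)])
    ultimately have "k = k'" "l = l'" by (auto simp: ev_pairs_def)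
    thus "i = j" using bmap[OF kl(1,2)] kl(3) kl'(3) ij(3) by (auto simp: bij_betw_def inj_on_def)
  qed
  have img: "bmap ` Ic k l = ev_pairs k l" if "k \<in> {1, 2}" "l \<in> {1, 2}" for k l using bmap[OF that] by (simp add: bij_betw_def)
  have "all_ev_pairs = ev_pairs 1 1 \<union> ev_pairs 2 1 \<union> ev_pairs 1 2 \<union> ev_pairs 2 2"
  proof (rule Set.set_eqI)
    fix x :: "complex \<times> complex"
    obtain c d where x: "x = (c, d)" by (cases x)
    show "x \<in> all_ev_pairs \<longleftrightarrow> x \<in> ev_pairs 1 1 \<union> ev_pairs 2 1 \<union> ev_pairs 1 2 \<union> ev_pairs 2 2"
      using card_fib[of c True] card_fib[of d False] unfolding x all_ev_pairs_def ev_pairs_def by blast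
  qed
  thus "bmap ` II = all_ev_pairs" unfolding II_eq image_Un using img by simp
qed

definition sA :: "nat \<times> nat \<Rightarrow> nat set" where "sA i = slots True (fst (bmap i))"
definition sB :: "nat \<times> nat \<Rightarrow> nat set" where "sB i = slots False (snd (bmap i))"
definition bb :: "(nat \<times> nat) \<times> nat \<times> nat \<Rightarrow> lop" where
  "bb w = cbasis ((fst (bmap (fst w)), fst (snd w)), (snd (bmap (fst w)), snd (snd w)))"

lemma s_Ic:
  assumes "k \<in> {1, 2}" "l \<in> {1, 2}" "i \<in> Ic k l"
  shows "sA i = (if k = 1 then {0} else {0, 1, 2})" "sB i = (if l = 1 then {0} else {0, 1, 2})"
proof -
  have "bmap i \<in> ev_pairs k l" using bmap[OF assms(1,2)] assms(3) by (auto simp: bij_betw_def)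
  thus "sA i = (if k = 1 then {0} else {0, 1, 2})" "sB i = (if l = 1 then {0} else {0, 1, 2})"
    by (auto simp: sA_def sB_def slots_def ev_pairs_def)
qed

definition tmap :: "(nat \<times> nat) \<times> nat \<times> nat \<Rightarrow> (complex \<times> nat) \<times> (complex \<times> nat)" where
  "tmap w = ((fst (bmap (fst w)), fst (snd w)), (snd (bmap (fst w)), snd (snd w)))"

lemma bb_tmap: "bb w = cbasis (tmap w)" by (simp add: bb_def tmap_def)

lemma tmap_bij: "bij_betw tmap (SIGMA i:II. sA i \<times> sB i) cbasis_index"
proof (rule bij_betw_imageI)
  have inj: "inj_on bmap II" and img: "bmap ` II = all_ev_pairs" using bmap_bij by (auto simp: bij_betw_def)
  show "inj_on tmap (SIGMA i:II. sA i \<times> sB i)"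
  proof (rule inj_onI)
    fix v w assume vw: "v \<in> (SIGMA i:II. sA i \<times> sB i)" "w \<in> (SIGMA i:II. sA i \<times> sB i)" "tmap v = tmap w"
    have "bmap (fst v) = bmap (fst w)" using vw(3) by (simp add: tmap_def prod_eq_iff)
    hence "fst v = fst w" using inj_onD[OF inj] vw(1,2) by auto
    thus "v = w" using vw(3) by (simp add: tmap_def prod_eq_iff)
  qed
  show "tmap ` (SIGMA i:II. sA i \<times> sB i) = cbasis_index"
  proof (intro equalityI subsetI)
    fix t assume "t \<in> tmap ` (SIGMA i:II. sA i \<times> sB i)"
    then obtain i m n where t: "t = tmap (i, m, n)" "i \<in> II" "m \<in> sA i" "n \<in> sB i" by auto
    have "bmap i \<in> all_ev_pairs" using img t by blast
    thus "t \<in> cbasis_index" using t by (auto simp: tmap_def cbasis_index_def half_index_def all_ev_pairs_def sA_def sB_def)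
  next
    fix t assume t: "t \<in> cbasis_index"
    obtain c m d n where tt: "t = ((c, m), (d, n))" by (metis surj_pair)
    have "(c, d) \<in> all_ev_pairs" "m \<in> slots True c" "n \<in> slots False d" using t by (auto simp: tt cbasis_index_def half_index_def all_ev_pairs_def)
    moreover from this(1) obtain i where i: "i \<in> II" "bmap i = (c, d)" using img by (metis imageE)
    ultimately have "(i, m, n) \<in> (SIGMA i:II. sA i \<times> sB i)" "t = tmap (i, m, n)"
      by (simp_all add: sA_def sB_def tmap_def tt)
    thus "t \<in> tmap ` (SIGMA i:II. sA i \<times> sB i)" by blast
  qed
qed

lemma tmap_cbasis_index: "i \<in> II \<Longrightarrow> m \<in> sA i \<Longrightarrow> n \<in> sB i \<Longrightarrow> tmap (i, m, n) \<in> cbasis_index"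
  using tmap_bij by (auto simp: bij_betw_def)

lemma block_algebra_center: "block_algebra scl (center_ring qgr) Gq Cen II sA sB bb"
proof unfold_locales
  have ops: "carrier (center_ring qgr) = center qgr" "monoid.mult (center_ring qgr) = monoid.mult qgr"
    "ring.add (center_ring qgr) = ring.add qgr" "monoid.one (center_ring qgr) = monoid.one qgr"
    "ring.zero (center_ring qgr) = ring.zero qgr" by (simp_all add: center_ring_def)
  have ex: "\<exists>a. x = Phi a" if "x \<in> Cen" for x using Cen_Al[OF that] by (auto simp: Al_def)
  show "carrier (center_ring qgr) = Gq ` Cen" by (simp add: ops center_qgr)
  show "inj_on Gq Cen"
  proof (rule inj_onI)
    fix x y assume "x \<in> Cen" "y \<in> Cen" "Gq x = Gq y"
    thus "x = y" using ex[of x] ex[of y] by (auto simp: Gq_Phi cls_eq_iff)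
  qed
  show "Gq x \<otimes>\<^bsub>center_ring qgr\<^esub> Gq y = Gq (x * y)" "Gq x \<oplus>\<^bsub>center_ring qgr\<^esub> Gq y = Gq (x + y)"
    if xy: "x \<in> Cen" "y \<in> Cen" for x y
  proof -
    obtain a where a: "x = Phi a" using ex[OF xy(1)] by blast
    obtain b where b: "y = Phi b" using ex[OF xy(2)] by blast
    show "Gq x \<otimes>\<^bsub>center_ring qgr\<^esub> Gq y = Gq (x * y)" "Gq x \<oplus>\<^bsub>center_ring qgr\<^esub> Gq y = Gq (x + y)"
      by (simp_all add: a b ops Gq_Phi cls_mult cls_add flip: rep.Phi_mult rep.Phi_add)
  qed
  show "\<one>\<^bsub>center_ring qgr\<^esub> = Gq 1" using Gq_Phi[of 1] by (simp add: ops cls_one)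
  show "\<zero>\<^bsub>center_ring qgr\<^esub> = Gq 0" using Gq_Phi[of 0] by (simp add: ops cls_zero)
  show "scl c \<in> Cen" for c by simp
  show "x + y \<in> Cen" "x * y \<in> Cen" if "x \<in> Cen" "y \<in> Cen" for x y using that by (simp_all add: Cen_add Cen_mult)
  show "x * y = y * x" if "x \<in> Cen" "y \<in> Cen" for x y using CenD[OF that(1) Cen_Al[OF that(2)]] .
  show "finite II" unfolding II_eq by (simp add: finite_Ic)
  show "finite (sA i)" "finite (sB i)" "0 \<in> sA i" "0 \<in> sB i" for i by (simp_all add: sA_def sB_def slots_def)
  show "bb (i, m, n) \<in> Cen" if "i \<in> II" "m \<in> sA i" "n \<in> sB i" for i m n
    unfolding bb_tmap by (intro cbasis_Cen tmap_cbasis_index that)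
  show "\<exists>c. z = (\<Sum>w\<in>(SIGMA i:II. sA i \<times> sB i). scl (c w) * bb w)" if z: "z \<in> Cen" for z
  proof -
    obtain C where "z = (\<Sum>t\<in>cbasis_index. scl (C t) * cbasis t)" using center_span[OF z] by blast
    also have "\<dots> = (\<Sum>w\<in>(SIGMA i:II. sA i \<times> sB i). scl (C (tmap w)) * cbasis (tmap w))"
      by (rule sum.reindex_bij_betw[OF tmap_bij, symmetric])
    finally have "z = (\<Sum>w\<in>(SIGMA i:II. sA i \<times> sB i). scl (C (tmap w)) * bb w)" by (simp only: bb_tmap)
    thus ?thesis by (rule exI[of _ "\<lambda>w. C (tmap w)"])
  qed
  show "c w = 0" if z: "(\<Sum>w\<in>(SIGMA i:II. sA i \<times> sB i). scl (c w) * bb w) = 0" and w: "w \<in> (SIGMA i:II. sA i \<times> sB i)" for c w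
  proof -
    let ?W = "(SIGMA i:II. sA i \<times> sB i)"
    define C where "C t = c (the_inv_into ?W tmap t)" for t
    have inv: "C (tmap w) = c w" if "w \<in> ?W" for w
      unfolding C_def using tmap_bij that by (subst the_inv_into_f_f) (auto simp: bij_betw_def)
    have "(\<Sum>t\<in>cbasis_index. scl (C t) * cbasis t) = (\<Sum>w\<in>?W. scl (C (tmap w)) * cbasis (tmap w))"
      by (rule sum.reindex_bij_betw[OF tmap_bij, symmetric])
    also have "\<dots> = (\<Sum>w\<in>?W. scl (c w) * bb w)" by (rule sum.cong[OF refl]) (simp add: inv bb_tmap)
    finally have "(\<Sum>t\<in>cbasis_index. scl (C t) * cbasis t) = 0" using z by simp
    moreover have "tmap w \<in> cbasis_index" using tmap_bij w by (auto simp: bij_betw_def)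
    ultimately have "C (tmap w) = 0" by (rule center_indep)
    thus ?thesis using inv[OF w] by simp
  qed
  show "bb (i, m, n) * bb (i', m', n') = (if i = i' \<and> (m = 0 \<or> m' = 0) \<and> (n = 0 \<or> n' = 0) then bb (i, m + m', n + n') else 0)"
    if i: "i \<in> II" "m \<in> sA i" "n \<in> sB i" and i': "i' \<in> II" "m' \<in> sA i'" "n' \<in> sB i'" for i m n i' m' n'
  proof -
    have "fst (bmap i) = fst (bmap i') \<and> snd (bmap i) = snd (bmap i') \<longleftrightarrow> bmap i = bmap i'"
      by (simp add: prod_eq_iff)
    also have "\<dots> \<longleftrightarrow> i = i'" by (rule inj_on_eq_iff[OF bij_betw_imp_inj_on[OF bmap_bij] i(1) i'(1)])
    finally have eq: "i = i' \<longleftrightarrow> fst (bmap i) = fst (bmap i') \<and> snd (bmap i) = snd (bmap i')" by (rule sym)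
    show ?thesis unfolding eq bb_def fst_conv snd_conv conj_assoc
      by (rule trans[OF cbasis_mult[OF tmap_cbasis_index[OF i, unfolded tmap_def fst_conv snd_conv] tmap_cbasis_index[OF i', unfolded tmap_def fst_conv snd_conv]]])
        (rule refl)
  qed
qed

text \<open>Two blocks of dimension 1, p_+ - 1 and p_- - 1 blocks of dimension 3, and (p_+ - 1)(p_-
  - 1)/2 of dimension 9. Doubling removes the half, and p_+ = a + 1, p_- = b + 1 removes the
  truncated subtractions.\<close>

lemma center_card: "card (SIGMA i:II. sA i \<times> sB i) = (3 * p True - 1) * (3 * p False - 1) div 2"
proof -
  let ?c = "\<lambda>i. card (sA i) * card (sB i)"
  have "card (SIGMA i:II. sA i \<times> sB i) = (\<Sum>i\<in>II. ?c i)"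
    by (subst card_SigmaI) (auto simp: II_eq finite_Ic sA_def sB_def card_cartesian_product)
  also have "\<dots> = (\<Sum>i\<in>Ic 1 1 \<union> Ic 2 1 \<union> Ic 1 2. ?c i) + (\<Sum>i\<in>Ic 2 2. ?c i)"
    unfolding II_eq by (rule sum.union_disjoint) (use bty_eq in \<open>fastforce simp: finite_Ic\<close>)+
  also have "(\<Sum>i\<in>Ic 1 1 \<union> Ic 2 1 \<union> Ic 1 2. ?c i) = (\<Sum>i\<in>Ic 1 1 \<union> Ic 2 1. ?c i) + (\<Sum>i\<in>Ic 1 2. ?c i)"
    by (rule sum.union_disjoint) (use bty_eq in \<open>fastforce simp: finite_Ic\<close>)+
  also have "(\<Sum>i\<in>Ic 1 1 \<union> Ic 2 1. ?c i) = (\<Sum>i\<in>Ic 1 1. ?c i) + (\<Sum>i\<in>Ic 2 1. ?c i)"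
    by (rule sum.union_disjoint) (use bty_eq in \<open>fastforce simp: finite_Ic\<close>)+
  also have "(\<Sum>i\<in>Ic 1 1. ?c i) = (\<Sum>i\<in>Ic 1 1. 1)" by (rule sum.cong[OF refl]) (simp add: s_Ic[of 1 1])
  also have "(\<Sum>i\<in>Ic 2 1. ?c i) = (\<Sum>i\<in>Ic 2 1. 3)" by (rule sum.cong[OF refl]) (simp add: s_Ic[of 2 1])
  also have "(\<Sum>i\<in>Ic 1 2. ?c i) = (\<Sum>i\<in>Ic 1 2. 3)" by (rule sum.cong[OF refl]) (simp add: s_Ic[of 1 2])
  also have "(\<Sum>i\<in>Ic 2 2. ?c i) = (\<Sum>i\<in>Ic 2 2. 9)" by (rule sum.cong[OF refl]) (simp add: s_Ic[of 2 2])
  finally have c: "card (SIGMA i:II. sA i \<times> sB i) = 2 + 3 * (p True - 1) + 3 * (p False - 1) + 9 * card (Ic 2 2)"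
    using card_Ic by simp
  obtain a where a: "p True = Suc a" using p_pos[of True] by (cases "p True") auto
  obtain b where b: "p False = Suc b" using p_pos[of False] by (cases "p False") auto
  have "2 * card (Ic 2 2) = a * b" using card_Ic(4) a b by simp
  hence "(3 * p True - 1) * (3 * p False - 1) = 2 * (2 + 3 * a + 3 * b + 9 * card (Ic 2 2))"
    by (simp add: a b algebra_simps)
  thus ?thesis unfolding c by (simp add: a b)
qed

end

theorem theorem2p4p1:
  fixes pp pm :: nat and Z :: "free_alg set ring" and F :: "free_alg set set"
  assumes "pp > 0" and "pm > 0" and "coprime pp pm"
    and Z: "Z = center_ring (qg pp pm)" and F: "F = qg_scalars pp pm"
  shows "ring.dimension Z ((3 * pp - 1) * (3 * pm - 1) div 2) F (carrier Z) \<and>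
    (\<exists>S e v_n v_e v_w v_ne v_sw v_nw v_se w_n w_e w_s w_w.
       algebra_direct_sum Z
         ({(pp, pm)} \<union> {(0, pm)} \<union> {1..pp - 1} \<times> {pm} \<union> {pp} \<times> {1..pm - 1} \<union> index_I1 pp pm) S \<and>
       block1 Z F (S (pp, pm)) (e (pp, pm)) \<and>
       block1 Z F (S (0, pm)) (e (0, pm)) \<and>
       (\<forall>r \<in> {1..pp - 1}.
          block3 Z F (S (r, pm)) (e (r, pm)) (v_n (r, pm)) (v_e (r, pm))) \<and>
       (\<forall>r' \<in> {1..pm - 1}.
          block3 Z F (S (pp, r')) (e (pp, r')) (v_n (pp, r')) (v_w (pp, r'))) \<and>
       (\<forall>i \<in> index_I1 pp pm.
          block9 Z F (S i) (e i) (v_ne i) (v_sw i) (v_nw i) (v_se i)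
            (w_n i) (w_e i) (w_s i) (w_w i)))"
proof -
  define p where "p s = (if s then pp else pm)" for s
  have P: "p True = pp" "p False = pm" by (simp_all add: p_def)
  interpret Q: qparam p
    by unfold_locales (use assms in \<open>auto simp: p_def\<close>)
  interpret B: block_algebra scl Z Q.Gq Q.Cen Q.II Q.sA Q.sB Q.bb
    using Q.block_algebra_center unfolding P Z .
  have FF: "F = B.FF"
    unfolding F B.FF_def qg_scalars_def image_image Q.rep.Phi_const[symmetric] Q.Gq_Phi
    by (simp add: Q.cls_def Q.I_def P)
  have dim: "ring.dimension Z ((3 * pp - 1) * (3 * pm - 1) div 2) F (carrier Z)"
    using B.dim_Z Q.center_card unfolding P FF by simp
  \<comment> \<open>The upward arrow occurs in both families of three-dimensional blocks: its
    nilpotent lies on the plus side for indices \<open>(r, pm)\<close> and on the minus side for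
    \<open>(pp, r')\<close>.\<close>
  define vn where "vn i = (if snd i = pm then B.gb i 1 0 else B.gb i 0 1)" for i
  have in_II: "i \<in> Q.Ic k l \<Longrightarrow> k \<in> {1, 2} \<Longrightarrow> l \<in> {1, 2} \<Longrightarrow> i \<in> Q.II" for i k l
    by (auto simp: Q.II_eq)
  note Ic = Q.Ic_simps[unfolded P]
  have ds: "algebra_direct_sum Z
      ({(pp, pm)} \<union> {(0, pm)} \<union> {1..pp - 1} \<times> {pm} \<union> {pp} \<times> {1..pm - 1} \<union> index_I1 pp pm) B.SS"
    using B.direct_sum unfolding Q.II_def P .
  have b1: "block1 Z F (B.SS i) (B.gb i 0 0)" if "i \<in> Q.Ic 1 1" for i
    unfolding FF by (rule B.is_block1) (use that in_II[OF that] Q.s_Ic[OF _ _ that] in simp_all)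
  have b21: "block3 Z F (B.SS i) (B.gb i 0 0) (B.gb i 1 0) (B.gb i 2 0)" if "i \<in> Q.Ic 2 1" for i
    unfolding FF by (rule B.is_block3A) (use that in_II[OF that] Q.s_Ic[OF _ _ that] in simp_all)
  have b12: "block3 Z F (B.SS i) (B.gb i 0 0) (B.gb i 0 1) (B.gb i 0 2)" if "i \<in> Q.Ic 1 2" for i
    unfolding FF by (rule B.is_block3B) (use that in_II[OF that] Q.s_Ic[OF _ _ that] in simp_all)
  have b22: "block9 Z F (B.SS i) (B.gb i 0 0) (B.gb i 1 0) (B.gb i 2 0) (B.gb i 0 1) (B.gb i 0 2)
      (B.gb i 1 1) (B.gb i 1 2) (B.gb i 2 2) (B.gb i 2 1)" if "i \<in> Q.Ic 2 2" for i
    unfolding FF by (rule B.is_block9) (use that in_II[OF that] Q.s_Ic[OF _ _ that] in simp_all)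
  have bA: "block3 Z F (B.SS (r, pm)) (B.gb (r, pm) 0 0) (vn (r, pm)) (B.gb (r, pm) 2 0)" if "r \<in> {1..pp - 1}" for r
    using b21[of "(r, pm)", unfolded Ic] that by (simp add: vn_def)
  have bB: "block3 Z F (B.SS (pp, r')) (B.gb (pp, r') 0 0) (vn (pp, r')) (B.gb (pp, r') 0 2)" if "r' \<in> {1..pm - 1}" for r'
    using b12[of "(pp, r')", unfolded Ic] that by (auto simp: vn_def)
  have bp: "block1 Z F (B.SS (pp, pm)) (B.gb (pp, pm) 0 0)" by (rule b1) (simp add: Ic(1) del: One_nat_def)
  have b0: "block1 Z F (B.SS (0, pm)) (B.gb (0, pm) 0 0)" by (rule b1) (simp add: Ic(1) del: One_nat_def)
  note bC = b22[unfolded Ic]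
  show ?thesis
    by (rule conjI[OF dim], rule exI[of _ B.SS], rule exI[of _ "\<lambda>i. B.gb i 0 0"], rule exI[of _ vn],
        rule exI[of _ "\<lambda>i. B.gb i 2 0"], rule exI[of _ "\<lambda>i. B.gb i 0 2"],
        rule exI[of _ "\<lambda>i. B.gb i 1 0"], rule exI[of _ "\<lambda>i. B.gb i 2 0"], rule exI[of _ "\<lambda>i. B.gb i 0 1"], rule exI[of _ "\<lambda>i. B.gb i 0 2"],
        rule exI[of _ "\<lambda>i. B.gb i 1 1"], rule exI[of _ "\<lambda>i. B.gb i 1 2"], rule exI[of _ "\<lambda>i. B.gb i 2 2"], rule exI[of _ "\<lambda>i. B.gb i 2 1"])
      (intro conjI ds bp b0 ballI bA bB bC)
qed

end
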